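(* Let $n\geq1$ be an integer and let $(\mathcal{C},\mathbb{E},\mathfrak{s})$ be an $n$-exangulated category. If each object in $\mathcal{C}$ has a semi-perfect endomorphism ring, then the idempotent completion $(\widetilde{\mathcal{C}},\mathbb{F},\mathfrak{t})$ (with $\mathbb{F}$ and $\mathfrak{t}$ as defined in the context) is a Krull-Schmidt $n$-exangulated category, i.e. it is an $n$-exangulated category whose underlying additive category $\widetilde{\mathcal{C}}$ is Krull-Schmidt.
   Context: **$n$-exangulated categories.** Let $\mathcal{C}$ be an additive category and $\mathbb{E}\colon\mathcal{C}^{\mathrm{op}}\times\mathcal{C}\to\mathsf{Ab}$ a biadditive functor. An $\mathbb{E}$-extension is an element $\delta\in\mathbb{E}(C,A)$. For $a\colon A\to B$ and $d\colon D\to C$ put $a_{\mathbb{E}}\delta=\mathbb{E}(C,a)(\delta)$ and $d^{\mathbb{E}}\delta=\mathbb{E}(d,A)(\delta)$. The zero of $\mathbb{E}(C,A)$ is ${}_A0_C$. A morphism of $\mathbb{E}$-extensions from $\delta\in\mathbb{E}(C,A)$ to $\rho\in\mathbb{E}(D,B)$ is a pair $(a\colon A\to B,\,c\colon C\to D)$ with $a_{\mathbb{E}}\delta=c^{\mathbb{E}}\rho$. $\mathsf{Ch}(\mathcal{C})^n$ is the category of complexes $X_\bullet\colon X_0\xrightarrow{d^X_0}X_1\to\cdots\xrightarrow{d^X_n}X_{n+1}$ concentrated in degrees $0,\dots,n+1$. An $\mathbb{E}$-attached complex $\langle X_\bullet,\delta\rangle$ consists of $X_\bullet\in\mathsf{Ch}(\mathcal{C})^n$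 and $\delta\in\mathbb{E}(X_{n+1},X_0)$ with $(d^X_0)_{\mathbb{E}}\delta=0$ and $(d^X_n)^{\mathbb{E}}\delta=0$. It is an $n$-exangle if for every $Y\in\mathcal{C}$ the sequences $\mathcal{C}(Y,X_0)\to\cdots\to\mathcal{C}(Y,X_{n+1})\to\mathbb{E}(Y,X_0)$ (last map $u\mapsto u^{\mathbb{E}}\delta$) and $\mathcal{C}(X_{n+1},Y)\to\cdots\to\mathcal{C}(X_0,Y)\to\mathbb{E}(X_{n+1},Y)$ (last map $u\mapsto u_{\mathbb{E}}\delta$) are exact. For $A,C\in\mathcal{C}$, $\mathsf{Ch}(\mathcal{C})^n_{(A,C)}$ has as objects the $X_\bullet\in\mathsf{Ch}(\mathcal{C})^n$ with $X_0=A$, $X_{n+1}=C$, and as morphisms the chain maps $f_\bullet$ with $f_0=\mathrm{id}_A$, $f_{n+1}=\mathrm{id}_C$; $\mathsf{K}(\mathcal{C})^n_{(A,C)}$ is its quotient by the usual chain homotopy relation, and $[X_\bullet]$ is the isomorphism class of $X_\bullet$ in $\mathsf{K}(\mathcal{C})^n_{(A,C)}$. An exact realisation $\mathfrak{s}$ of $\mathbb{E}$ assigns to each $\delta\in\mathbb{E}(C,A)$ a class $\mathfrak{s}(\delta)=[X_\bullet]$ in $\mathsf{K}(\mathcal{C})^n_{(A,C)}$ such that: (R0) for each morphism $(a,c)\colon\delta\to\rho$ with $\mathfrak{s}(\delta)=[X_\bullet]$, $\mathfrak{s}(\rho)=[Y_\bullet]$ there is a chain map $f_\bullet\colon X_\bullet\to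 Y_\bullet$ with $f_0=a$, $f_{n+1}=c$ (a lift of $(a,c)$); (R1) if $\mathfrak{s}(\delta)=[X_\bullet]$ then $\langle X_\bullet,\delta\rangle$ is an $n$-exangle; (R2) $\mathfrak{s}({}_A0_0)=[A\xrightarrow{\mathrm{id}}A\to0\to\cdots\to0]$ and $\mathfrak{s}({}_00_A)=[0\to\cdots\to0\to A\xrightarrow{\mathrm{id}}A]$. If $\mathfrak{s}(\delta)=[X_\bullet]$, then $d^X_0$ is called an $\mathfrak{s}$-inflation and $d^X_n$ an $\mathfrak{s}$-deflation. For a chain map $f_\bullet\colon X_\bullet\to Y_\bullet$ in $\mathsf{Ch}(\mathcal{C})^n$ with $X_0=Y_0$, $f_0=\mathrm{id}$, the mapping cone $M_f$ is the complex $X_1\to X_2\oplus Y_1\to\cdots\to X_{n+1}\oplus Y_n\to Y_{n+1}$ with differentials $\begin{pmatrix}-d^X_1\\ f_1\end{pmatrix}$, $\begin{pmatrix}-d^X_{i+1}&0\\ f_{i+1}&d^Y_i\end{pmatrix}$ ($1\le i\le n-1$), $\begin{pmatrix}f_{n+1}&d^Y_n\end{pmatrix}$. $(\mathcal{C},\mathbb{E},\mathfrak{s})$ is an $n$-exangulated category if $\mathfrak{s}$ is an exact realisation of $\mathbb{E}$ and: (EA1) $\mathfrak{s}$-inflations are closed under composition and $\mathfrak{s}$-deflations are closed under composition; (EA2) for $\delta\in\mathbb{E}(D,A)$, $c\colon C\to D$, $\mathfrak{s}(c^{\mathbb{E}}\delta)=[Y_\bullet]$, $\mathfrak{s}(\delta)=[X_\bullet]$,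 there is a lift $f_\bullet\colon Y_\bullet\to X_\bullet$ of $(\mathrm{id}_A,c)$ with $\mathfrak{s}((d^Y_0)_{\mathbb{E}}\delta)=[M_f]$; (EA2)$^{\mathrm{op}}$ the dual of (EA2). **Krull-Schmidt.** Krull-Schmidt categories can be characterised as the idempotent complete additive categories (all idempotents split) in which each object has a semi-perfect endomorphism ring. **Idempotent completion.** Objects of $\widetilde{\mathcal{C}}$ are pairs $(X,e)$ with $e\in\mathrm{End}_{\mathcal{C}}(X)$, $e^2=e$. Morphisms $(X,e)\to(Y,e')$ are triplets $(e',r,e)$ with $r\in\mathcal{C}(X,Y)$, $re=r=e'r$. Composition: $(e'',s,e')\circ(e',r,e)=(e'',sr,e)$; the identity of $(X,e)$ is $(e,e,e)$. $\mathbb{F}((Z,e'),(X,e))=\{(e,\delta,e')\mid\delta\in\mathbb{E}(Z,X),\ e_{\mathbb{E}}\delta=\delta=(e')^{\mathbb{E}}\delta\}$ with addition inherited from $\mathbb{E}(Z,X)$; for morphisms $\tilde a=(e_1,a,e)\colon(X,e)\to(X_1,e_1)$ and $\tilde c=(e',c,e_2)\colon(Z_2,e_2)\to(Z,e')$, $\mathbb{F}(\tilde c,\tilde a)(e,\delta,e')=(e_1,\mathbb{E}(c,a)(\delta),e_2)$. For $\tilde\delta=(e_0,\delta,e_{n+1})\in\mathbb{F}((X_{n+1},e_{n+1}),(X_0,e_0))$ choose $X_\bullet$ with $\mathfrak{s}(\delta)=[X_\bullet]$ and an idempotent chain map $e_\bullet\colon X_\bullet\to X_\bullet$ with the given end terms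 $e_0$ and $e_{n+1}$ (such exists), and set $\mathfrak{t}(\tilde\delta)=[(X_\bullet,e_\bullet)]$, where $(X_\bullet,e_\bullet)$ is the complex in $\widetilde{\mathcal{C}}$ with objects $(X_i,e_i)$ and differentials $(e_{i+1},e_{i+1}d^X_ie_i,e_i)$; this class is independent of the choices. *)

theory Defs
  imports "HOL-Algebra.QuotRing"
begin

section \<open>Semi-perfect rings\<close>

definition left_ideal :: "'a set \<Rightarrow> ('a, 'b) ring_scheme \<Rightarrow> bool" where
  "left_ideal I R \<longleftrightarrow>
     additive_subgroup I R \<and> (\<forall>r\<in>carrier R. \<forall>x\<in>I. r \<otimes>\<^bsub>R\<^esub> x \<in> I)"

definition maximal_left_ideal :: "'a set \<Rightarrow> ('a, 'b) ring_scheme \<Rightarrow> bool" where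
  "maximal_left_ideal M R \<longleftrightarrow>
     left_ideal M R \<and> M \<noteq> carrier R \<and>
     (\<forall>I. left_ideal I R \<longrightarrow> M \<subseteq> I \<longrightarrow> I = M \<or> I = carrier R)"

definition jacobson_radical :: "('a, 'b) ring_scheme \<Rightarrow> 'a set" where
  "jacobson_radical R = {x \<in> carrier R. \<forall>M. maximal_left_ideal M R \<longrightarrow> x \<in> M}"

text \<open>The regular left module is semisimple: every submodule is a direct summand.
  The zero ring is semisimple and hence semi-perfect; this is needed because the
  endomorphism ring of a zero object is the zero ring.\<close>

definition semisimple_ring :: "('a, 'b) ring_scheme \<Rightarrow> bool" where
  "semisimple_ring R \<longleftrightarrow>
     ring R \<and>
     (\<forall>I. left_ideal I R \<longrightarrow>
        (\<exists>J. left_ideal J R \<and> I \<inter> J = {\<zero>\<^bsub>R\<^esub>} \<and> I <+>\<^bsub>R\<^esub> J = carrier R))"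

definition idempotents_lift_modulo :: "('a, 'b) ring_scheme \<Rightarrow> 'a set \<Rightarrow> bool" where
  "idempotents_lift_modulo R J \<longleftrightarrow>
     (\<forall>x\<in>carrier R. (x \<otimes>\<^bsub>R\<^esub> x) \<ominus>\<^bsub>R\<^esub> x \<in> J \<longrightarrow>
        (\<exists>e\<in>carrier R. e \<otimes>\<^bsub>R\<^esub> e = e \<and> e \<ominus>\<^bsub>R\<^esub> x \<in> J))"

definition semiperfect_ring :: "('a, 'b) ring_scheme \<Rightarrow> bool" where
  "semiperfect_ring R \<longleftrightarrow>
     ring R \<and>
     semisimple_ring (R Quot jacobson_radical R) \<and>
     idempotents_lift_modulo R (jacobson_radical R)"


section \<open>Additive categories\<close>

text \<open>The abelian groups \<open>Hom C A B\<close> (and later the groups of extensions) are groups in the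
  multiplicative notation of the library: \<open>\<otimes>\<close>, \<open>\<one>\<close> and \<open>inv\<close> are addition, zero and negation.
  As usual, a morphism is supposed to determine its domain and codomain, so composition
  does not mention objects; \<open>g \<cdot> f\<close> is \<open>g\<close> after \<open>f\<close>.\<close>

record ('o, 'm) addcat =
  Ob :: "'o set"
  Hom :: "'o \<Rightarrow> 'o \<Rightarrow> 'm monoid"
  Cmp :: "'m \<Rightarrow> 'm \<Rightarrow> 'm"  (infixr "\<cdot>\<index>" 75)
  Idn :: "'o \<Rightarrow> 'm"

definition is_zero_object :: "('o, 'm) addcat \<Rightarrow> 'o \<Rightarrow> bool" where
  "is_zero_object C Z \<longleftrightarrow>
     Z \<in> Ob C \<and>
     (\<forall>A\<in>Ob C. (\<exists>!f. f \<in> carrier (Hom C A Z)) \<and> (\<exists>!f. f \<in> carrier (Hom C Z A)))"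

definition is_biproduct ::
  "('o, 'm) addcat \<Rightarrow> 'o \<Rightarrow> 'o \<Rightarrow> 'o \<Rightarrow> 'm \<Rightarrow> 'm \<Rightarrow> 'm \<Rightarrow> 'm \<Rightarrow> bool" where
  "is_biproduct C A B P i1 i2 p1 p2 \<longleftrightarrow>
     P \<in> Ob C \<and>
     i1 \<in> carrier (Hom C A P) \<and> i2 \<in> carrier (Hom C B P) \<and>
     p1 \<in> carrier (Hom C P A) \<and> p2 \<in> carrier (Hom C P B) \<and>
     p1 \<cdot>\<^bsub>C\<^esub> i1 = Idn C A \<and> p2 \<cdot>\<^bsub>C\<^esub> i2 = Idn C B \<and>
     p1 \<cdot>\<^bsub>C\<^esub> i2 = \<one>\<^bsub>Hom C B A\<^esub> \<and> p2 \<cdot>\<^bsub>C\<^esub> i1 = \<one>\<^bsub>Hom C A B\<^esub> \<and>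
     (i1 \<cdot>\<^bsub>C\<^esub> p1) \<otimes>\<^bsub>Hom C P P\<^esub> (i2 \<cdot>\<^bsub>C\<^esub> p2) = Idn C P"

locale additive_category =
  fixes C :: "('o, 'm) addcat"
  assumes Idn_in_Hom: "A \<in> Ob C \<Longrightarrow> Idn C A \<in> carrier (Hom C A A)"
    and Cmp_in_Hom: "\<lbrakk>A \<in> Ob C; B \<in> Ob C; D \<in> Ob C;
          f \<in> carrier (Hom C A B); g \<in> carrier (Hom C B D)\<rbrakk>
          \<Longrightarrow> g \<cdot>\<^bsub>C\<^esub> f \<in> carrier (Hom C A D)"
    and Idn_left: "\<lbrakk>A \<in> Ob C; B \<in> Ob C; f \<in> carrier (Hom C A B)\<rbrakk>
          \<Longrightarrow> Idn C B \<cdot>\<^bsub>C\<^esub> f = f"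
    and Idn_right: "\<lbrakk>A \<in> Ob C; B \<in> Ob C; f \<in> carrier (Hom C A B)\<rbrakk>
          \<Longrightarrow> f \<cdot>\<^bsub>C\<^esub> Idn C A = f"
    and Cmp_assoc: "\<lbrakk>A \<in> Ob C; B \<in> Ob C; D \<in> Ob C; F \<in> Ob C;
          f \<in> carrier (Hom C A B); g \<in> carrier (Hom C B D); h \<in> carrier (Hom C D F)\<rbrakk>
          \<Longrightarrow> (h \<cdot>\<^bsub>C\<^esub> g) \<cdot>\<^bsub>C\<^esub> f = h \<cdot>\<^bsub>C\<^esub> (g \<cdot>\<^bsub>C\<^esub> f)"
    and Hom_comm_group: "\<lbrakk>A \<in> Ob C; B \<in> Ob C\<rbrakk> \<Longrightarrow> comm_group (Hom C A B)"
    and Cmp_add_left: "\<lbrakk>A \<in> Ob C; B \<in> Ob C; D \<in> Ob C; f \<in> carrier (Hom C A B);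
          g \<in> carrier (Hom C B D); g' \<in> carrier (Hom C B D)\<rbrakk>
          \<Longrightarrow> (g \<otimes>\<^bsub>Hom C B D\<^esub> g') \<cdot>\<^bsub>C\<^esub> f
              = (g \<cdot>\<^bsub>C\<^esub> f) \<otimes>\<^bsub>Hom C A D\<^esub> (g' \<cdot>\<^bsub>C\<^esub> f)"
    and Cmp_add_right: "\<lbrakk>A \<in> Ob C; B \<in> Ob C; D \<in> Ob C; f \<in> carrier (Hom C A B);
          f' \<in> carrier (Hom C A B); g \<in> carrier (Hom C B D)\<rbrakk>
          \<Longrightarrow> g \<cdot>\<^bsub>C\<^esub> (f \<otimes>\<^bsub>Hom C A B\<^esub> f')
              = (g \<cdot>\<^bsub>C\<^esub> f) \<otimes>\<^bsub>Hom C A D\<^esub> (g \<cdot>\<^bsub>C\<^esub> f')"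
    and ex_zero_object: "\<exists>Z. is_zero_object C Z"
    and ex_biproduct: "\<lbrakk>A \<in> Ob C; B \<in> Ob C\<rbrakk>
          \<Longrightarrow> \<exists>P i1 i2 p1 p2. is_biproduct C A B P i1 i2 p1 p2"

definition End_ring :: "('o, 'm) addcat \<Rightarrow> 'o \<Rightarrow> 'm ring" where
  "End_ring C X =
     \<lparr>carrier = carrier (Hom C X X), mult = Cmp C, one = Idn C X,
      zero = \<one>\<^bsub>Hom C X X\<^esub>, add = mult (Hom C X X)\<rparr>"

definition idempotent_complete :: "('o, 'm) addcat \<Rightarrow> bool" where
  "idempotent_complete C \<longleftrightarrow>
     (\<forall>X\<in>Ob C. \<forall>e\<in>carrier (Hom C X X). e \<cdot>\<^bsub>C\<^esub> e = e \<longrightarrow>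
        (\<exists>Y\<in>Ob C. \<exists>p\<in>carrier (Hom C X Y). \<exists>i\<in>carrier (Hom C Y X).
           i \<cdot>\<^bsub>C\<^esub> p = e \<and> p \<cdot>\<^bsub>C\<^esub> i = Idn C Y))"

definition krull_schmidt :: "('o, 'm) addcat \<Rightarrow> bool" where
  "krull_schmidt C \<longleftrightarrow>
     additive_category C \<and> idempotent_complete C \<and>
     (\<forall>X\<in>Ob C. semiperfect_ring (End_ring C X))"


section \<open>Complexes in degrees 0 to n+1\<close>

text \<open>Only the objects in degrees \<open>\<le> n + 1\<close> and the differentials in degrees \<open>\<le> n\<close> matter;
  the remaining values are never inspected. Chain maps are likewise functions on \<open>nat\<close> whose
  values beyond \<open>n + 1\<close> are irrelevant.\<close>

record ('o, 'm) cpx =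
  Tm :: "nat \<Rightarrow> 'o"
  Df :: "nat \<Rightarrow> 'm"

definition Ch :: "nat \<Rightarrow> ('o, 'm) addcat \<Rightarrow> ('o, 'm) cpx set" where
  "Ch n C =
     {X. (\<forall>i\<le>n + 1. Tm X i \<in> Ob C) \<and>
         (\<forall>i\<le>n. Df X i \<in> carrier (Hom C (Tm X i) (Tm X (i + 1)))) \<and>
         (\<forall>i<n. Df X (i + 1) \<cdot>\<^bsub>C\<^esub> Df X i = \<one>\<^bsub>Hom C (Tm X i) (Tm X (i + 2))\<^esub>)}"

definition chain_map ::
  "nat \<Rightarrow> ('o, 'm) addcat \<Rightarrow> ('o, 'm) cpx \<Rightarrow> ('o, 'm) cpx \<Rightarrow> (nat \<Rightarrow> 'm) \<Rightarrow> bool" where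
  "chain_map n C X Y f \<longleftrightarrow>
     (\<forall>i\<le>n + 1. f i \<in> carrier (Hom C (Tm X i) (Tm Y i))) \<and>
     (\<forall>i\<le>n. Df Y i \<cdot>\<^bsub>C\<^esub> f i = f (i + 1) \<cdot>\<^bsub>C\<^esub> Df X i)"

text \<open>The homotopy has components \<open>h i : Tm X (i + 1) \<rightarrow> Tm Y i\<close>.\<close>

definition homotopic ::
  "nat \<Rightarrow> ('o, 'm) addcat \<Rightarrow> ('o, 'm) cpx \<Rightarrow> ('o, 'm) cpx \<Rightarrow> (nat \<Rightarrow> 'm) \<Rightarrow> (nat \<Rightarrow> 'm) \<Rightarrow> bool"
  where
  "homotopic n C X Y f g \<longleftrightarrow>
     (\<exists>h. (\<forall>i\<le>n. h i \<in> carrier (Hom C (Tm X (i + 1)) (Tm Y i))) \<and>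
        f 0 = g 0 \<otimes>\<^bsub>Hom C (Tm X 0) (Tm Y 0)\<^esub> (h 0 \<cdot>\<^bsub>C\<^esub> Df X 0) \<and>
        (\<forall>i<n. f (i + 1) = g (i + 1) \<otimes>\<^bsub>Hom C (Tm X (i + 1)) (Tm Y (i + 1))\<^esub>
           ((Df Y i \<cdot>\<^bsub>C\<^esub> h i) \<otimes>\<^bsub>Hom C (Tm X (i + 1)) (Tm Y (i + 1))\<^esub>
            (h (i + 1) \<cdot>\<^bsub>C\<^esub> Df X (i + 1)))) \<and>
        f (n + 1) = g (n + 1) \<otimes>\<^bsub>Hom C (Tm X (n + 1)) (Tm Y (n + 1))\<^esub> (Df Y n \<cdot>\<^bsub>C\<^esub> h n))"

definition chain_map_fixing_ends ::
  "nat \<Rightarrow> ('o, 'm) addcat \<Rightarrow> ('o, 'm) cpx \<Rightarrow> ('o, 'm) cpx \<Rightarrow> (nat \<Rightarrow> 'm) \<Rightarrow> bool" where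
  "chain_map_fixing_ends n C X Y f \<longleftrightarrow>
     chain_map n C X Y f \<and>
     Tm Y 0 = Tm X 0 \<and> f 0 = Idn C (Tm X 0) \<and>
     Tm Y (n + 1) = Tm X (n + 1) \<and> f (n + 1) = Idn C (Tm X (n + 1))"

text \<open>The isomorphism class of \<open>X\<close> in the homotopy category of complexes with the same end
  terms as \<open>X\<close> and morphisms that are the identity on the end terms.\<close>

definition iso_class :: "nat \<Rightarrow> ('o, 'm) addcat \<Rightarrow> ('o, 'm) cpx \<Rightarrow> ('o, 'm) cpx set" where
  "iso_class n C X =
     {Y \<in> Ch n C. \<exists>f g. chain_map_fixing_ends n C X Y f \<and> chain_map_fixing_ends n C Y X g \<and>
        homotopic n C X X (\<lambda>i. g i \<cdot>\<^bsub>C\<^esub> f i) (\<lambda>i. Idn C (Tm X i)) \<and>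
        homotopic n C Y Y (\<lambda>i. f i \<cdot>\<^bsub>C\<^esub> g i) (\<lambda>i. Idn C (Tm Y i))}"

text \<open>\<open>M\<close> is a mapping cone of \<open>f : X \<rightarrow> Y\<close> (where \<open>X\<close> and \<open>Y\<close> agree in degree 0 and \<open>f\<close> is the
  identity there), formed with some choice of the direct sums
  \<open>Tm M i = Tm X (i + 1) \<oplus> Tm Y i\<close>; the differentials are given by their matrix entries.\<close>

definition is_mapping_cone ::
  "nat \<Rightarrow> ('o, 'm) addcat \<Rightarrow> ('o, 'm) cpx \<Rightarrow> ('o, 'm) cpx \<Rightarrow> (nat \<Rightarrow> 'm) \<Rightarrow> ('o, 'm) cpx \<Rightarrow> bool"
  where
  "is_mapping_cone n C X Y f M \<longleftrightarrow>
     M \<in> Ch n C \<and> Tm M 0 = Tm X 1 \<and> Tm M (n + 1) = Tm Y (n + 1) \<and>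
     (\<exists>i1 i2 p1 p2.
        (\<forall>i\<in>{1..n}. is_biproduct C (Tm X (i + 1)) (Tm Y i) (Tm M i) (i1 i) (i2 i) (p1 i) (p2 i)) \<and>
        p1 1 \<cdot>\<^bsub>C\<^esub> Df M 0 = inv\<^bsub>Hom C (Tm X 1) (Tm X 2)\<^esub> (Df X 1) \<and>
        p2 1 \<cdot>\<^bsub>C\<^esub> Df M 0 = f 1 \<and>
        (\<forall>i\<in>{1..<n}.
           p1 (i + 1) \<cdot>\<^bsub>C\<^esub> Df M i \<cdot>\<^bsub>C\<^esub> i1 i
             = inv\<^bsub>Hom C (Tm X (i + 1)) (Tm X (i + 2))\<^esub> (Df X (i + 1)) \<and>
           p1 (i + 1) \<cdot>\<^bsub>C\<^esub> Df M i \<cdot>\<^bsub>C\<^esub> i2 i = \<one>\<^bsub>Hom C (Tm Y i) (Tm X (i + 2))\<^esub> \<and>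
           p2 (i + 1) \<cdot>\<^bsub>C\<^esub> Df M i \<cdot>\<^bsub>C\<^esub> i1 i = f (i + 1) \<and>
           p2 (i + 1) \<cdot>\<^bsub>C\<^esub> Df M i \<cdot>\<^bsub>C\<^esub> i2 i = Df Y i) \<and>
        Df M n \<cdot>\<^bsub>C\<^esub> i1 n = f (n + 1) \<and>
        Df M n \<cdot>\<^bsub>C\<^esub> i2 n = Df Y n)"

text \<open>The dual notion, for \<open>g : X \<rightarrow> Y\<close> where \<open>X\<close> and \<open>Y\<close> agree in degree \<open>n + 1\<close> and \<open>g\<close> is the
  identity there: the mapping cone of \<open>g\<close>, viewed as a chain map from \<open>Y\<close> to \<open>X\<close> in the opposite
  category with degree \<open>i\<close> renumbered as \<open>n + 1 - i\<close>. Here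
  \<open>Tm N 0 = Tm X 0\<close>, \<open>Tm N i = Tm Y (i - 1) \<oplus> Tm X i\<close> and \<open>Tm N (n + 1) = Tm Y n\<close>.\<close>

definition is_mapping_cocone ::
  "nat \<Rightarrow> ('o, 'm) addcat \<Rightarrow> ('o, 'm) cpx \<Rightarrow> ('o, 'm) cpx \<Rightarrow> (nat \<Rightarrow> 'm) \<Rightarrow> ('o, 'm) cpx \<Rightarrow> bool"
  where
  "is_mapping_cocone n C X Y g N \<longleftrightarrow>
     N \<in> Ch n C \<and> Tm N 0 = Tm X 0 \<and> Tm N (n + 1) = Tm Y n \<and>
     (\<exists>i1 i2 p1 p2.
        (\<forall>i\<in>{1..n}. is_biproduct C (Tm Y (i - 1)) (Tm X i) (Tm N i) (i1 i) (i2 i) (p1 i) (p2 i)) \<and>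
        p1 1 \<cdot>\<^bsub>C\<^esub> Df N 0 = g 0 \<and>
        p2 1 \<cdot>\<^bsub>C\<^esub> Df N 0 = Df X 0 \<and>
        (\<forall>i\<in>{1..<n}.
           p1 (i + 1) \<cdot>\<^bsub>C\<^esub> Df N i \<cdot>\<^bsub>C\<^esub> i1 i
             = inv\<^bsub>Hom C (Tm Y (i - 1)) (Tm Y i)\<^esub> (Df Y (i - 1)) \<and>
           p1 (i + 1) \<cdot>\<^bsub>C\<^esub> Df N i \<cdot>\<^bsub>C\<^esub> i2 i = g i \<and>
           p2 (i + 1) \<cdot>\<^bsub>C\<^esub> Df N i \<cdot>\<^bsub>C\<^esub> i1 i = \<one>\<^bsub>Hom C (Tm Y (i - 1)) (Tm X (i + 1))\<^esub> \<and>
           p2 (i + 1) \<cdot>\<^bsub>C\<^esub> Df N i \<cdot>\<^bsub>C\<^esub> i2 i = Df X i) \<and>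
        Df N n \<cdot>\<^bsub>C\<^esub> i1 n = inv\<^bsub>Hom C (Tm Y (n - 1)) (Tm Y n)\<^esub> (Df Y (n - 1)) \<and>
        Df N n \<cdot>\<^bsub>C\<^esub> i2 n = g n)"


section \<open>Extensions and exact realisations\<close>

text \<open>\<open>Ext E D A\<close> is contravariant in \<open>D\<close> and covariant in \<open>A\<close>. For \<open>c : D' \<rightarrow> D\<close> and
  \<open>a : A \<rightarrow> A'\<close>, \<open>Act E c a\<close> is the induced map from \<open>Ext E D A\<close> to \<open>Ext E D' A'\<close>.\<close>

record ('o, 'm, 'x) bifunctor =
  Ext :: "'o \<Rightarrow> 'o \<Rightarrow> 'x monoid"
  Act :: "'m \<Rightarrow> 'm \<Rightarrow> 'x \<Rightarrow> 'x"

locale biadditive_functor = additive_category C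
  for C :: "('o, 'm) addcat" +
  fixes E :: "('o, 'm, 'x) bifunctor"
  assumes Ext_comm_group: "\<lbrakk>D \<in> Ob C; A \<in> Ob C\<rbrakk> \<Longrightarrow> comm_group (Ext E D A)"
    and Act_hom: "\<lbrakk>D \<in> Ob C; D' \<in> Ob C; A \<in> Ob C; A' \<in> Ob C;
          c \<in> carrier (Hom C D' D); a \<in> carrier (Hom C A A')\<rbrakk>
          \<Longrightarrow> Act E c a \<in> hom (Ext E D A) (Ext E D' A')"
    and Act_Idn: "\<lbrakk>D \<in> Ob C; A \<in> Ob C; \<delta> \<in> carrier (Ext E D A)\<rbrakk>
          \<Longrightarrow> Act E (Idn C D) (Idn C A) \<delta> = \<delta>"
    and Act_Cmp: "\<lbrakk>D \<in> Ob C; D' \<in> Ob C; D'' \<in> Ob C; A \<in> Ob C; A' \<in> Ob C; A'' \<in> Ob C;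
          c \<in> carrier (Hom C D' D); c' \<in> carrier (Hom C D'' D');
          a \<in> carrier (Hom C A A'); a' \<in> carrier (Hom C A' A'');
          \<delta> \<in> carrier (Ext E D A)\<rbrakk>
          \<Longrightarrow> Act E (c \<cdot>\<^bsub>C\<^esub> c') (a' \<cdot>\<^bsub>C\<^esub> a) \<delta> = Act E c' a' (Act E c a \<delta>)"
    and Act_add_left: "\<lbrakk>D \<in> Ob C; D' \<in> Ob C; A \<in> Ob C; A' \<in> Ob C;
          c \<in> carrier (Hom C D' D); c' \<in> carrier (Hom C D' D); a \<in> carrier (Hom C A A');
          \<delta> \<in> carrier (Ext E D A)\<rbrakk>
          \<Longrightarrow> Act E (c \<otimes>\<^bsub>Hom C D' D\<^esub> c') a \<delta> = Act E c a \<delta> \<otimes>\<^bsub>Ext E D' A'\<^esub> Act E c' a \<delta>"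
    and Act_add_right: "\<lbrakk>D \<in> Ob C; D' \<in> Ob C; A \<in> Ob C; A' \<in> Ob C;
          c \<in> carrier (Hom C D' D); a \<in> carrier (Hom C A A'); a' \<in> carrier (Hom C A A');
          \<delta> \<in> carrier (Ext E D A)\<rbrakk>
          \<Longrightarrow> Act E c (a \<otimes>\<^bsub>Hom C A A'\<^esub> a') \<delta> = Act E c a \<delta> \<otimes>\<^bsub>Ext E D' A'\<^esub> Act E c a' \<delta>"

text \<open>\<open>push C E D a \<delta>\<close> is \<open>E(D,a)(\<delta>)\<close> and \<open>pull C E A d \<delta>\<close> is \<open>E(d,A)(\<delta>)\<close>.\<close>

definition push :: "('o, 'm) addcat \<Rightarrow> ('o, 'm, 'x) bifunctor \<Rightarrow> 'o \<Rightarrow> 'm \<Rightarrow> 'x \<Rightarrow> 'x" where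
  "push C E D a \<delta> = Act E (Idn C D) a \<delta>"

definition pull :: "('o, 'm) addcat \<Rightarrow> ('o, 'm, 'x) bifunctor \<Rightarrow> 'o \<Rightarrow> 'm \<Rightarrow> 'x \<Rightarrow> 'x" where
  "pull C E A d \<delta> = Act E d (Idn C A) \<delta>"

definition attached_complex ::
  "nat \<Rightarrow> ('o, 'm) addcat \<Rightarrow> ('o, 'm, 'x) bifunctor \<Rightarrow> ('o, 'm) cpx \<Rightarrow> 'x \<Rightarrow> bool" where
  "attached_complex n C E X \<delta> \<longleftrightarrow>
     X \<in> Ch n C \<and> \<delta> \<in> carrier (Ext E (Tm X (n + 1)) (Tm X 0)) \<and>
     push C E (Tm X (n + 1)) (Df X 0) \<delta> = \<one>\<^bsub>Ext E (Tm X (n + 1)) (Tm X 1)\<^esub> \<and>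
     pull C E (Tm X 0) (Df X n) \<delta> = \<one>\<^bsub>Ext E (Tm X n) (Tm X 0)\<^esub>"

definition n_exangle ::
  "nat \<Rightarrow> ('o, 'm) addcat \<Rightarrow> ('o, 'm, 'x) bifunctor \<Rightarrow> ('o, 'm) cpx \<Rightarrow> 'x \<Rightarrow> bool" where
  "n_exangle n C E X \<delta> \<longleftrightarrow>
     attached_complex n C E X \<delta> \<and>
     (\<forall>Y\<in>Ob C.
        (\<forall>i<n. (\<lambda>u. Df X i \<cdot>\<^bsub>C\<^esub> u) ` carrier (Hom C Y (Tm X i))
           = kernel (Hom C Y (Tm X (i + 1))) (Hom C Y (Tm X (i + 2)))
               (\<lambda>u. Df X (i + 1) \<cdot>\<^bsub>C\<^esub> u)) \<and>
        (\<lambda>u. Df X n \<cdot>\<^bsub>C\<^esub> u) ` carrier (Hom C Y (Tm X n))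
           = kernel (Hom C Y (Tm X (n + 1))) (Ext E Y (Tm X 0))
               (\<lambda>u. pull C E (Tm X 0) u \<delta>) \<and>
        (\<forall>i<n. (\<lambda>u. u \<cdot>\<^bsub>C\<^esub> Df X (i + 1)) ` carrier (Hom C (Tm X (i + 2)) Y)
           = kernel (Hom C (Tm X (i + 1)) Y) (Hom C (Tm X i) Y)
               (\<lambda>u. u \<cdot>\<^bsub>C\<^esub> Df X i)) \<and>
        (\<lambda>u. u \<cdot>\<^bsub>C\<^esub> Df X 0) ` carrier (Hom C (Tm X 1) Y)
           = kernel (Hom C (Tm X 0) Y) (Ext E (Tm X (n + 1)) Y)
               (\<lambda>u. push C E (Tm X (n + 1)) u \<delta>))"

text \<open>For \<open>\<delta>\<close> in \<open>Ext E D A\<close>, the class assigned to \<open>\<delta>\<close> is \<open>s D A \<delta>\<close>; the predicate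
  \<open>realises n C s D A \<delta> X\<close> says that this class is the class of the complex \<open>X\<close>.\<close>

type_synonym ('o, 'm, 'x) realisation = "'o \<Rightarrow> 'o \<Rightarrow> 'x \<Rightarrow> ('o, 'm) cpx set"

definition realises ::
  "nat \<Rightarrow> ('o, 'm) addcat \<Rightarrow> ('o, 'm, 'x) realisation \<Rightarrow> 'o \<Rightarrow> 'o \<Rightarrow> 'x \<Rightarrow> ('o, 'm) cpx \<Rightarrow> bool"
  where
  "realises n C s D A \<delta> X \<longleftrightarrow>
     X \<in> Ch n C \<and> Tm X 0 = A \<and> Tm X (n + 1) = D \<and> s D A \<delta> = iso_class n C X"

definition is_lift ::
  "nat \<Rightarrow> ('o, 'm) addcat \<Rightarrow> ('o, 'm) cpx \<Rightarrow> ('o, 'm) cpx \<Rightarrow> 'm \<Rightarrow> 'm \<Rightarrow> (nat \<Rightarrow> 'm) \<Rightarrow> bool"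
  where
  "is_lift n C X Y a c f \<longleftrightarrow> chain_map n C X Y f \<and> f 0 = a \<and> f (n + 1) = c"

text \<open>The complexes \<open>A = A \<rightarrow> Z \<rightarrow> \<dots> \<rightarrow> Z\<close> and \<open>Z \<rightarrow> \<dots> \<rightarrow> Z \<rightarrow> A = A\<close>, used with \<open>Z\<close> a zero object.\<close>

definition left_trivial_cpx :: "('o, 'm) addcat \<Rightarrow> 'o \<Rightarrow> 'o \<Rightarrow> ('o, 'm) cpx" where
  "left_trivial_cpx C A Z =
     \<lparr>Tm = (\<lambda>i. if i \<le> 1 then A else Z),
      Df = (\<lambda>i. if i = 0 then Idn C A
                 else if i = 1 then \<one>\<^bsub>Hom C A Z\<^esub> else \<one>\<^bsub>Hom C Z Z\<^esub>)\<rparr>"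

definition right_trivial_cpx :: "nat \<Rightarrow> ('o, 'm) addcat \<Rightarrow> 'o \<Rightarrow> 'o \<Rightarrow> ('o, 'm) cpx" where
  "right_trivial_cpx n C A Z =
     \<lparr>Tm = (\<lambda>i. if n \<le> i then A else Z),
      Df = (\<lambda>i. if i = n then Idn C A
                 else if i + 1 = n then \<one>\<^bsub>Hom C Z A\<^esub> else \<one>\<^bsub>Hom C Z Z\<^esub>)\<rparr>"

locale exact_realisation = biadditive_functor C E
  for C :: "('o, 'm) addcat" and E :: "('o, 'm, 'x) bifunctor" +
  fixes n :: nat and s :: "('o, 'm, 'x) realisation"
  assumes realisation: "\<lbrakk>D \<in> Ob C; A \<in> Ob C; \<delta> \<in> carrier (Ext E D A)\<rbrakk>
          \<Longrightarrow> \<exists>X. realises n C s D A \<delta> X"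
    and R0: "\<lbrakk>A \<in> Ob C; B \<in> Ob C; D \<in> Ob C; F \<in> Ob C;
          \<delta> \<in> carrier (Ext E D A); \<rho> \<in> carrier (Ext E F B);
          a \<in> carrier (Hom C A B); c \<in> carrier (Hom C D F);
          push C E D a \<delta> = pull C E B c \<rho>;
          realises n C s D A \<delta> X; realises n C s F B \<rho> Y\<rbrakk>
          \<Longrightarrow> \<exists>f. is_lift n C X Y a c f"
    and R1: "\<lbrakk>A \<in> Ob C; D \<in> Ob C; \<delta> \<in> carrier (Ext E D A); realises n C s D A \<delta> X\<rbrakk>
          \<Longrightarrow> n_exangle n C E X \<delta>"
    and R2_left: "\<lbrakk>A \<in> Ob C; is_zero_object C Z\<rbrakk>
          \<Longrightarrow> s Z A \<one>\<^bsub>Ext E Z A\<^esub> = iso_class n C (left_trivial_cpx C A Z)"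
    and R2_right: "\<lbrakk>A \<in> Ob C; is_zero_object C Z\<rbrakk>
          \<Longrightarrow> s A Z \<one>\<^bsub>Ext E A Z\<^esub> = iso_class n C (right_trivial_cpx n C A Z)"

definition is_inflation ::
  "nat \<Rightarrow> ('o, 'm) addcat \<Rightarrow> ('o, 'm, 'x) bifunctor \<Rightarrow> ('o, 'm, 'x) realisation
     \<Rightarrow> 'o \<Rightarrow> 'o \<Rightarrow> 'm \<Rightarrow> bool" where
  "is_inflation n C E s A B f \<longleftrightarrow>
     (\<exists>D\<in>Ob C. \<exists>\<delta>\<in>carrier (Ext E D A). \<exists>X. realises n C s D A \<delta> X \<and> Tm X 1 = B \<and> Df X 0 = f)"

definition is_deflation ::
  "nat \<Rightarrow> ('o, 'm) addcat \<Rightarrow> ('o, 'm, 'x) bifunctor \<Rightarrow> ('o, 'm, 'x) realisation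
     \<Rightarrow> 'o \<Rightarrow> 'o \<Rightarrow> 'm \<Rightarrow> bool" where
  "is_deflation n C E s B D f \<longleftrightarrow>
     (\<exists>A\<in>Ob C. \<exists>\<delta>\<in>carrier (Ext E D A). \<exists>X. realises n C s D A \<delta> X \<and> Tm X n = B \<and> Df X n = f)"


section \<open>n-exangulated categories\<close>

locale n_exangulated_category = exact_realisation C E n s
  for n :: nat and C :: "('o, 'm) addcat" and E :: "('o, 'm, 'x) bifunctor"
    and s :: "('o, 'm, 'x) realisation" +
  assumes EA1_inflation: "\<lbrakk>A \<in> Ob C; B \<in> Ob C; D \<in> Ob C;
          is_inflation n C E s A B f; is_inflation n C E s B D g\<rbrakk>
          \<Longrightarrow> is_inflation n C E s A D (g \<cdot>\<^bsub>C\<^esub> f)"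
    and EA1_deflation: "\<lbrakk>A \<in> Ob C; B \<in> Ob C; D \<in> Ob C;
          is_deflation n C E s A B f; is_deflation n C E s B D g\<rbrakk>
          \<Longrightarrow> is_deflation n C E s A D (g \<cdot>\<^bsub>C\<^esub> f)"
    and EA2: "\<lbrakk>A \<in> Ob C; D \<in> Ob C; D' \<in> Ob C;
          \<delta> \<in> carrier (Ext E D A); c \<in> carrier (Hom C D' D);
          realises n C s D' A (pull C E A c \<delta>) Y; realises n C s D A \<delta> X\<rbrakk>
          \<Longrightarrow> \<exists>f M. is_lift n C Y X (Idn C A) c f \<and> is_mapping_cone n C Y X f M \<and>
                realises n C s D (Tm Y 1) (push C E D (Df Y 0) \<delta>) M"
    and EA2_op: "\<lbrakk>A \<in> Ob C; A' \<in> Ob C; D \<in> Ob C;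
          \<delta> \<in> carrier (Ext E D A); a \<in> carrier (Hom C A A');
          realises n C s D A' (push C E D a \<delta>) Y; realises n C s D A \<delta> X\<rbrakk>
          \<Longrightarrow> \<exists>g N. is_lift n C X Y a (Idn C D) g \<and> is_mapping_cocone n C X Y g N \<and>
                realises n C s (Tm Y n) A (pull C E A (Df Y n) \<delta>) N"


section \<open>The idempotent completion\<close>

definition icompl :: "('o, 'm) addcat \<Rightarrow> ('o \<times> 'm, 'm \<times> 'm \<times> 'm) addcat" where
  "icompl C =
     \<lparr>Ob = {(X, e). X \<in> Ob C \<and> e \<in> carrier (Hom C X X) \<and> e \<cdot>\<^bsub>C\<^esub> e = e},
      Hom = (\<lambda>(X, e) (Y, e').
        \<lparr>carrier = {(e', r, e) | r. r \<in> carrier (Hom C X Y) \<and> r \<cdot>\<^bsub>C\<^esub> e = r \<and> e' \<cdot>\<^bsub>C\<^esub> r = r},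
         mult = (\<lambda>(_, r, _) (_, r', _). (e', r \<otimes>\<^bsub>Hom C X Y\<^esub> r', e)),
         one = (e', \<one>\<^bsub>Hom C X Y\<^esub>, e)\<rparr>),
      Cmp = (\<lambda>(e'', s, _) (_, r, e). (e'', s \<cdot>\<^bsub>C\<^esub> r, e)),
      Idn = (\<lambda>(X, e). (e, e, e))\<rparr>"

definition icompl_ext ::
  "('o, 'm) addcat \<Rightarrow> ('o, 'm, 'x) bifunctor \<Rightarrow> ('o \<times> 'm, 'm \<times> 'm \<times> 'm, 'm \<times> 'x \<times> 'm) bifunctor"
  where
  "icompl_ext C E =
     \<lparr>Ext = (\<lambda>(Z, e') (X, e).
        \<lparr>carrier = {(e, \<delta>, e') | \<delta>. \<delta> \<in> carrier (Ext E Z X) \<and>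
                      push C E Z e \<delta> = \<delta> \<and> pull C E X e' \<delta> = \<delta>},
         mult = (\<lambda>(_, \<delta>, _) (_, \<rho>, _). (e, \<delta> \<otimes>\<^bsub>Ext E Z X\<^esub> \<rho>, e')),
         one = (e, \<one>\<^bsub>Ext E Z X\<^esub>, e')\<rparr>),
      Act = (\<lambda>(_, c, e2) (e1, a, _) (_, \<delta>, _). (e1, Act E c a \<delta>, e2))\<rparr>"

definition icompl_cpx ::
  "('o, 'm) addcat \<Rightarrow> ('o, 'm) cpx \<Rightarrow> (nat \<Rightarrow> 'm) \<Rightarrow> ('o \<times> 'm, 'm \<times> 'm \<times> 'm) cpx" where
  "icompl_cpx C X e =
     \<lparr>Tm = (\<lambda>i. (Tm X i, e i)),
      Df = (\<lambda>i. (e (i + 1), e (i + 1) \<cdot>\<^bsub>C\<^esub> Df X i \<cdot>\<^bsub>C\<^esub> e i, e i))\<rparr>"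

definition idempotent_realiser ::
  "nat \<Rightarrow> ('o, 'm) addcat \<Rightarrow> ('o, 'm, 'x) realisation \<Rightarrow> 'o \<Rightarrow> 'o \<Rightarrow> 'm \<times> 'x \<times> 'm
     \<Rightarrow> ('o, 'm) cpx \<times> (nat \<Rightarrow> 'm) \<Rightarrow> bool" where
  "idempotent_realiser n C s D A = (\<lambda>(e0, \<delta>, e1) (X, e).
     realises n C s D A \<delta> X \<and> chain_map n C X X e \<and>
     (\<forall>i\<le>n + 1. e i \<cdot>\<^bsub>C\<^esub> e i = e i) \<and> e 0 = e0 \<and> e (n + 1) = e1)"

definition icompl_real ::
  "nat \<Rightarrow> ('o, 'm) addcat \<Rightarrow> ('o, 'm, 'x) realisation
     \<Rightarrow> ('o \<times> 'm, 'm \<times> 'm \<times> 'm, 'm \<times> 'x \<times> 'm) realisation" where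
  "icompl_real n C s = (\<lambda>(D, _) (A, _) \<delta>.
     iso_class n (icompl C)
       (case (SOME Xe. idempotent_realiser n C s D A \<delta> Xe) of (X, e) \<Rightarrow> icompl_cpx C X e))"

end

theory Submission
  imports Defs
begin

text \<open>Only two facts about an exact realisation are needed to compare realising complexes: exactness of
  the contravariant Hom sequences, and the existence of chain maps in both directions that are the
  identity on the end terms. Indeed, for such maps \<open>f\<close> and \<open>g\<close> the square of \<open>1 - g f\<close> is null homotopic
  relative to the ends, so that \<open>2 g - g f g\<close> is a homotopy inverse of \<open>f\<close>, and exactness passes along.

  In the idempotent completion, (EA2) is first proved for one pair of representatives and then
  transported along homotopies to all others. For the good lift \<open>f\<close> of \<open>C\<close> and idempotent chain maps \<open>e\<close>
  and \<open>r\<close> on its source and target, \<open>r f e + (1 - r) f (1 - e)\<close> is homotopic to \<open>f\<close>, hence again good, and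
  commutes with the idempotents; its cone therefore carries an idempotent, and packing the cone gives a
  cone in the completion.

  For (EA1), \<open>f : (A, a) \<rightarrow> (B, b)\<close> is an inflation of the completion if and only if there are an
  inflation \<open>x : A \<rightarrow> X\<close> of \<open>C\<close>, \<open>q : B \<rightarrow> X\<close> with \<open>q f = x a\<close>, and \<open>u : X \<rightarrow> A\<close> with \<open>u x = 1 - a\<close>. Adding \<open>B\<close>
  to \<open>X\<close> one can even arrange that \<open>B\<close> is a summand of \<open>X\<close>, that \<open>f\<close> is the component of \<open>x\<close> in \<open>B\<close>, and
  that \<open>x a\<close> is \<open>f\<close> followed by the inclusion of \<open>B\<close>; such data compose. The statements for deflations follow by passing to the opposite
  category.

  Endomorphism rings in the completion are corner rings \<open>e R e\<close> of endomorphism rings \<open>R\<close> in \<open>C\<close>; these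
  inherit semi-perfectness since the radical of \<open>e R e\<close> is its intersection with the radical of \<open>R\<close>.\<close>

section \<open>Calculations in additive categories\<close>

text \<open>The recurring obstacle is the last degree. Exactness of the contravariant Hom sequences
  builds a null homotopy from the left, degree by degree, but no exactness is left to make
  \<open>Df Y n ** k n\<close> vanish in degree n + 1. Homotopies relative to both ends are
  indispensable all the same: in degrees 0 and n + 1 a mapping cone has only one of its two
  summands, so a homotopy can enter a map of cones only in between. Squaring 1 - g f is one repair,
  since multiplying the homotopy by 1 - g f, which is zero in degree n + 1, kills the defect. For
  lifts that must commute with idempotents the repair comes from the extension: if an idempotent
  fixes it, the complement factors through an end differential.

  The same factorisation yields idempotent lifts and the map \<open>u\<close> in the criterion for
  inflations, which says that \<open>x\<close> splits off the part of \<open>A\<close> cut away by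
  a. Finally, (EA2) provides only some good lift. Every change of lift or of representative must be
  shown to preserve that the cone realises the pushed extension, which is why cones are compared by
  explicit maps.\<close>

context additive_category begin

abbreviation cmp_C (infixr "**" 75) where "g ** f \<equiv> g \<cdot>\<^bsub>C\<^esub> f"
abbreviation H where "H \<equiv> Hom C"
abbreviation add_C ("(_ +[_,_]/ _)" [70, 0, 0, 71] 70) where "f +[A,B] g \<equiv> f \<otimes>\<^bsub>Hom C A B\<^esub> g"
abbreviation neg_C ("(-[_,_]/ _)" [0, 0, 81] 80) where "-[A,B] f \<equiv> inv\<^bsub>Hom C A B\<^esub> f"
abbreviation zero_C ("0[_,_]") where "0[A,B] \<equiv> \<one>\<^bsub>Hom C A B\<^esub>"

text \<open>Carries the memberships of both objects, so that one typing fact discharges all side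
  conditions of the locale axioms.\<close>

definition arr :: "'o \<Rightarrow> 'o \<Rightarrow> 'm set"
  where "arr A B = {f. A \<in> Ob C \<and> B \<in> Ob C \<and> f \<in> carrier (H A B)}"

text \<open>The next two notions let the simplifier discharge the side conditions of associativity by
  walking along a composite from left to right, so that the objects in between are found by
  unification with the typing of a single factor.\<close>

definition into :: "'o \<Rightarrow> 'm set"
  where "into B = {f. \<exists>A. f \<in> arr A B}"
definition composable :: "'m \<Rightarrow> 'm \<Rightarrow> 'o \<Rightarrow> bool"
  where "composable g f D \<longleftrightarrow> (\<exists>A B. g \<in> arr B D \<and> f \<in> arr A B)"

lemma arrI: "A \<in> Ob C \<Longrightarrow> B \<in> Ob C \<Longrightarrow> f \<in> carrier (H A B) \<Longrightarrow> f \<in> arr A B"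
  by (simp add: arr_def)

lemma arrD:
  assumes "f \<in> arr A B"
  shows "A \<in> Ob C" "B \<in> Ob C" "f \<in> carrier (H A B)"
  using assms by (simp_all add: arr_def)

lemma comp_arr: "g \<in> arr B D \<Longrightarrow> f \<in> arr A B \<Longrightarrow> g ** f \<in> arr A D"
  unfolding arr_def using Cmp_in_Hom by auto

lemma Idn_arr: "A \<in> Ob C \<Longrightarrow> Idn C A \<in> arr A A"
  by (simp add: arr_def Idn_in_Hom)

lemma zero_arr: "A \<in> Ob C \<Longrightarrow> B \<in> Ob C \<Longrightarrow> 0[A,B] \<in> arr A B"
  using Hom_comm_group[THEN comm_group.axioms(2), THEN group.is_monoid] monoid.one_closed
  by (auto simp add: arr_def)

lemma add_arr: "f \<in> arr A B \<Longrightarrow> g \<in> arr A B \<Longrightarrow> f +[A,B] g \<in> arr A B"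
  using Hom_comm_group[THEN comm_group.axioms(2), THEN group.is_monoid] monoid.m_closed
  by (fastforce simp add: arr_def)

lemma neg_arr: "f \<in> arr A B \<Longrightarrow> -[A,B] f \<in> arr A B"
  using Hom_comm_group[THEN comm_group.axioms(2)] group.inv_closed
  by (fastforce simp add: arr_def)

lemma arr_comm_group: "f \<in> arr A B \<Longrightarrow> comm_group (H A B)"
  using Hom_comm_group by (auto simp: arr_def)

lemma intoI: "f \<in> arr A B \<Longrightarrow> f \<in> into B"
  unfolding into_def by auto

lemma comp_into: "g \<in> arr B D \<Longrightarrow> f \<in> into B \<Longrightarrow> g ** f \<in> into D"
  unfolding into_def using comp_arr by blast

lemmas typed_into = intoI[OF add_arr] intoI[OF neg_arr] intoI[OF zero_arr] intoI[OF Idn_arr]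

lemma composableI: "g \<in> arr B D \<Longrightarrow> f \<in> into B \<Longrightarrow> composable g f D"
  by (auto simp: into_def composable_def)

lemma composable_comp: "h \<in> arr D F \<Longrightarrow> composable g f D \<Longrightarrow> composable (h ** g) f F"
  unfolding composable_def using comp_arr by blast

lemmas typed_composable = composableI[OF add_arr] composableI[OF neg_arr] composableI[OF zero_arr]
  composableI[OF Idn_arr]

lemma comp_assoc: "h \<in> arr D F \<Longrightarrow> composable g f D \<Longrightarrow> (h ** g) ** f = h ** (g ** f)"
  unfolding arr_def composable_def using Cmp_assoc by auto

lemma comp_assoc_arr:
  "h \<in> arr D F \<Longrightarrow> g \<in> arr B D \<Longrightarrow> f \<in> arr A B \<Longrightarrow> (h ** g) ** f = h ** (g ** f)"
  unfolding arr_def using Cmp_assoc by auto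

lemma id_left: "f \<in> into B \<Longrightarrow> Idn C B ** f = f"
  using Idn_left by (auto simp: arr_def into_def)

lemma id_right: "f \<in> arr A B \<Longrightarrow> f ** Idn C A = f"
  using Idn_right by (auto simp: arr_def)

lemma distrib_left:
  "g \<in> arr B D \<Longrightarrow> x \<in> arr A B \<Longrightarrow> y \<in> arr A B \<Longrightarrow>
    g ** (x +[A,B] y) = (g ** x) +[A,D] (g ** y)"
  using Cmp_add_right by (auto simp: arr_def)

lemma distrib_right:
  "f \<in> arr A B \<Longrightarrow> x \<in> arr B D \<Longrightarrow> y \<in> arr B D \<Longrightarrow>
    (x +[B,D] y) ** f = (x ** f) +[A,D] (y ** f)"
  using Cmp_add_left by (auto simp: arr_def)

text \<open>In right-nested normal form a sum acts on the first factor of a longer composite. Only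
  that factor is absorbed, because the source of the rest need not be known at that point.\<close>

lemma distrib_right_comp:
  "f \<in> arr A B \<Longrightarrow> k \<in> into A \<Longrightarrow> x \<in> arr B D \<Longrightarrow> y \<in> arr B D \<Longrightarrow>
    (x +[B,D] y) ** (f ** k) = ((x ** f) +[A,D] (y ** f)) ** k"
  by (simp add: distrib_right[symmetric] into_def) (metis comp_assoc_arr add_arr)

lemma add_assoc:
  "x \<in> arr A B \<Longrightarrow> y \<in> arr A B \<Longrightarrow> z \<in> arr A B \<Longrightarrow>
    (x +[A,B] y) +[A,B] z = x +[A,B] (y +[A,B] z)"
  using arr_comm_group[of x A B] by (simp add: comm_group_def comm_monoid.m_ac arr_def)

lemma add_comm: "x \<in> arr A B \<Longrightarrow> y \<in> arr A B \<Longrightarrow> x +[A,B] y = y +[A,B] x"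
  using arr_comm_group[of x A B] by (simp add: comm_group_def comm_monoid.m_ac arr_def)

lemma add_lcomm:
  "x \<in> arr A B \<Longrightarrow> y \<in> arr A B \<Longrightarrow> z \<in> arr A B \<Longrightarrow>
    x +[A,B] (y +[A,B] z) = y +[A,B] (x +[A,B] z)"
  using arr_comm_group[of x A B] by (simp add: comm_group_def comm_monoid.m_ac arr_def)

lemma add_zero:
  "x \<in> arr A B \<Longrightarrow> 0[A,B] +[A,B] x = x"
  "x \<in> arr A B \<Longrightarrow> x +[A,B] 0[A,B] = x"
  using arr_comm_group[of x A B] by (simp_all add: comm_group_def group_def arr_def)

lemma add_neg:
  assumes "x \<in> arr A B"
  shows "x +[A,B] -[A,B] x = 0[A,B]" "-[A,B] x +[A,B] x = 0[A,B]"
    "-[A,B] (-[A,B] x) = x"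
  using arr_comm_group[OF assms] assms
  by (simp_all add: comm_group_def group.r_inv group.l_inv group.inv_inv arr_def)

lemma neg_zero: "A \<in> Ob C \<Longrightarrow> B \<in> Ob C \<Longrightarrow> -[A,B] 0[A,B] = 0[A,B]"
  using Hom_comm_group by (simp add: comm_group_def group.is_monoid monoid.inv_one)

lemma neg_add:
  "x \<in> arr A B \<Longrightarrow> y \<in> arr A B \<Longrightarrow>
    -[A,B] (x +[A,B] y) = -[A,B] x +[A,B] -[A,B] y"
  using arr_comm_group[of x A B] by (simp add: comm_group.inv_mult arr_def)

lemma add_neg_cancel:
  assumes "x \<in> arr A B" "y \<in> arr A B"
  shows "x +[A,B] (-[A,B] x +[A,B] y) = y" "-[A,B] x +[A,B] (x +[A,B] y) = y"
  using assms by (simp_all add: add_assoc[symmetric] neg_arr add_neg add_zero)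

text \<open>Sorting the summands may separate a term from its negative; these equations cancel the
  pair across up to two intermediate summands.\<close>

lemma add_neg_cancel_nested:
  assumes "x \<in> arr A B" "y \<in> arr A B" "z \<in> arr A B" "w \<in> arr A B"
  shows "x +[A,B] (y +[A,B] -[A,B] x) = y"
    "-[A,B] x +[A,B] (y +[A,B] x) = y"
    "x +[A,B] (y +[A,B] (-[A,B] x +[A,B] z)) = y +[A,B] z"
    "-[A,B] x +[A,B] (y +[A,B] (x +[A,B] z)) = y +[A,B] z"
    "x +[A,B] (y +[A,B] (z +[A,B] -[A,B] x)) = y +[A,B] z"
    "-[A,B] x +[A,B] (y +[A,B] (z +[A,B] x)) = y +[A,B] z"
    "x +[A,B] (y +[A,B] (z +[A,B] (-[A,B] x +[A,B] w))) = y +[A,B] (z +[A,B] w)"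
    "-[A,B] x +[A,B] (y +[A,B] (z +[A,B] (x +[A,B] w))) = y +[A,B] (z +[A,B] w)"
proof -
  let ?p = "\<lambda>x y. x +[A,B] y"
  have **: "?p x (?p y (-[A,B] x)) = y" "?p x (?p y (?p (-[A,B] x) w)) = ?p y w"
    if "x \<in> arr A B" "y \<in> arr A B" "w \<in> arr A B" for x y w
    using that by (simp_all add: add_lcomm[of x A B y] add_neg_cancel neg_arr add_arr add_neg add_zero)
  have *: "?p x (?p y (?p z (-[A,B] x))) = ?p y z" "?p x (?p y (?p z (?p (-[A,B] x) w))) = ?p y (?p z w)"
    if "x \<in> arr A B" "y \<in> arr A B" "z \<in> arr A B" "w \<in> arr A B" for x y z w
    using that **[of x "?p y z" w] by (simp_all add: add_assoc neg_arr add_arr)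
  show "?p x (?p y (-[A,B] x)) = y" "?p x (?p y (?p (-[A,B] x) z)) = ?p y z"
    "?p x (?p y (?p z (-[A,B] x))) = ?p y z" "?p x (?p y (?p z (?p (-[A,B] x) w))) = ?p y (?p z w)"
    by (rule **(1)[OF assms(1,2,2)] **(2)[OF assms(1-3)] *(1)[OF assms] *(2)[OF assms])+
  show "?p (-[A,B] x) (?p y x) = y" "?p (-[A,B] x) (?p y (?p x z)) = ?p y z"
    "?p (-[A,B] x) (?p y (?p z x)) = ?p y z" "?p (-[A,B] x) (?p y (?p z (?p x w))) = ?p y (?p z w)"
    using **(1)[OF neg_arr[OF assms(1)] assms(2,2)] **(2)[OF neg_arr[OF assms(1)] assms(2,3)]
      *[OF neg_arr[OF assms(1)] assms(2-4)] by (simp_all only: add_neg(3)[OF assms(1)])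
qed

lemma add_cancel:
  assumes "x \<in> arr A B" "y \<in> arr A B" "z \<in> arr A B"
  shows "x +[A,B] y = x +[A,B] z \<longleftrightarrow> y = z" "y +[A,B] x = z +[A,B] x \<longleftrightarrow> y = z"
proof -
  show "y +[A,B] x = z +[A,B] x \<longleftrightarrow> y = z"
    using arr_comm_group[OF assms(1)] assms by (simp add: comm_group_def group.right_cancel arr_def)
  then show "x +[A,B] y = x +[A,B] z \<longleftrightarrow> y = z"
    using assms by (simp add: add_comm)
qed

lemma add_eq_zero:
  assumes "x +[A,B] y = 0[A,B]" "x \<in> arr A B" "y \<in> arr A B"
  shows "y = -[A,B] x"
  using add_cancel(1)[of x A B y "-[A,B] x"] assms by (simp add: add_neg neg_arr)

lemma diff_eq_zero:
  "x \<in> arr A B \<Longrightarrow> y \<in> arr A B \<Longrightarrow> x +[A,B] -[A,B] y = 0[A,B] \<longleftrightarrow> x = y"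
  using add_cancel(2)[of "-[A,B] y" A B x y] by (simp add: add_neg neg_arr)

lemma zero_left: "f \<in> arr A B \<Longrightarrow> D \<in> Ob C \<Longrightarrow> 0[B,D] ** f = 0[A,D]"
  using distrib_right[of f A B "0[B,D]" D "0[B,D]"]
    add_cancel(1)[of "0[B,D] ** f" A D "0[B,D] ** f" "0[A,D]"]
  by (simp add: zero_arr add_zero arrD comp_arr[OF zero_arr])

lemma zero_right: "g \<in> arr A B \<Longrightarrow> D \<in> Ob C \<Longrightarrow> g ** 0[D,A] = 0[D,B]"
  using distrib_left[of g A B "0[D,A]" D "0[D,A]"]
    add_cancel(1)[of "g ** 0[D,A]" D B "g ** 0[D,A]" "0[D,B]"]
  by (simp add: zero_arr add_zero arrD comp_arr[OF _ zero_arr])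

lemma zero_left_comp:
  "f \<in> arr A B \<Longrightarrow> k \<in> into A \<Longrightarrow> D \<in> Ob C \<Longrightarrow> 0[B,D] ** (f ** k) = 0[A,D] ** k"
  by (auto simp add: into_def arrD zero_left zero_left[OF comp_arr])

lemma neg_left: "f \<in> arr A B \<Longrightarrow> x \<in> arr B D \<Longrightarrow> -[B,D] x ** f = -[A,D] (x ** f)"
  using distrib_right[of f A B x D "-[B,D] x"]
  by (intro add_eq_zero) (simp_all add: comp_arr comp_arr[OF neg_arr] neg_arr add_neg zero_left arrD)

lemma neg_right: "g \<in> arr B D \<Longrightarrow> x \<in> arr A B \<Longrightarrow> g ** -[A,B] x = -[A,D] (g ** x)"
  using distrib_left[of g B D x A "-[A,B] x"]
  by (intro add_eq_zero) (simp_all add: comp_arr comp_arr[OF _ neg_arr] neg_arr add_neg zero_right arrD)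

lemma neg_left_comp:
  "f \<in> arr A B \<Longrightarrow> k \<in> into A \<Longrightarrow> x \<in> arr B D \<Longrightarrow>
    -[B,D] x ** (f ** k) = -[A,D] (x ** f) ** k"
  by (simp add: neg_left[symmetric] into_def) (metis comp_assoc_arr neg_arr)

lemmas typing = comp_arr Idn_arr zero_arr add_arr neg_arr intoI comp_into typed_into
  composableI composable_comp typed_composable

lemmas cat_simps = typing comp_assoc id_left id_right id_right[OF add_arr] id_right[OF neg_arr]
  distrib_left distrib_right distrib_right_comp
  distrib_right[OF add_arr] distrib_right[OF neg_arr] distrib_right[OF zero_arr]
  zero_left zero_right zero_left_comp zero_left[OF add_arr] zero_left[OF neg_arr]
  zero_left[OF zero_arr] zero_right[OF add_arr] zero_right[OF neg_arr]
  neg_left neg_right neg_left_comp neg_left[OF add_arr] neg_left[OF neg_arr] neg_left[OF zero_arr]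
  neg_zero neg_add add_assoc add_zero add_neg add_neg_cancel

lemmas cat_ac = cat_simps add_comm add_lcomm add_neg_cancel_nested

text \<open>Composites are kept right-nested, so an equation for g f has to be prolonged before it
  can rewrite inside g f x.\<close>

lemma comp_eq_comp:
  assumes "g ** f = k" "g \<in> arr B D" "f \<in> arr A B" "x \<in> into A"
  shows "g ** (f ** x) = k ** x"
  using assms comp_assoc_arr[of g B D f A x] by (auto simp: into_def comp_assoc_arr)

lemma zero_object_arr:
  assumes "is_zero_object C Z"
  shows "f \<in> arr Z A \<Longrightarrow> f = 0[Z,A]" "f \<in> arr A Z \<Longrightarrow> f = 0[A,Z]"
proof -
  assume f: "f \<in> arr Z A"
  then have "0[Z,A] \<in> arr Z A" by (simp add: arrD zero_arr)
  with f assms show "f = 0[Z,A]" unfolding is_zero_object_def arr_def by auto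
next
  assume f: "f \<in> arr A Z"
  then have "0[A,Z] \<in> arr A Z" by (simp add: arrD zero_arr)
  with f assms show "f = 0[A,Z]" unfolding is_zero_object_def arr_def by auto
qed

lemma biproductD:
  assumes "is_biproduct C A B P i1 i2 p1 p2" "A \<in> Ob C" "B \<in> Ob C"
  shows "i1 \<in> arr A P" "i2 \<in> arr B P" "p1 \<in> arr P A" "p2 \<in> arr P B"
    "p1 ** i1 = Idn C A" "p2 ** i2 = Idn C B" "p1 ** i2 = 0[B,A]" "p2 ** i1 = 0[A,B]"
    "(i1 ** p1) +[P,P] (i2 ** p2) = Idn C P"
  using assms by (simp_all add: is_biproduct_def arr_def)

lemma biproduct_comp:
  assumes "is_biproduct C A B P i1 i2 p1 p2" "A \<in> Ob C" "B \<in> Ob C"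
  shows "x \<in> into A \<Longrightarrow> p1 ** (i1 ** x) = x" "x \<in> into B \<Longrightarrow> p2 ** (i2 ** x) = x"
    "x \<in> into B \<Longrightarrow> p1 ** (i2 ** x) = 0[B,A] ** x" "x \<in> into A \<Longrightarrow> p2 ** (i1 ** x) = 0[A,B] ** x"
  using biproductD[OF assms] assms(2,3)
  by (simp_all add: comp_eq_comp[of p1 i1 _ P A A] comp_eq_comp[of p2 i2 _ P B B]
      comp_eq_comp[of p1 i2 _ P A B] comp_eq_comp[of p2 i1 _ P B A] id_left)

lemma biproduct_into_eqI:
  assumes b: "is_biproduct C A B P i1 i2 p1 p2" "A \<in> Ob C" "B \<in> Ob C"
    and f: "f \<in> arr D P" "g \<in> arr D P"
    and eq: "p1 ** f = p1 ** g" "p2 ** f = p2 ** g"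
  shows "f = g"
proof -
  have *: "x = i1 ** (p1 ** x) +[D,P] i2 ** (p2 ** x)" if "x \<in> arr D P" for x
  proof -
    have "x = (i1 ** p1 +[P,P] i2 ** p2) ** x"
      using biproductD[OF b] that by (simp add: cat_simps)
    then show ?thesis using biproductD(1-4)[OF b] that by (simp add: cat_simps)
  qed
  show ?thesis using *[OF f(1)] *[OF f(2)] eq by simp
qed

lemma biproduct_outof_eqI:
  assumes b: "is_biproduct C A B P i1 i2 p1 p2" "A \<in> Ob C" "B \<in> Ob C"
    and f: "f \<in> arr P D" "g \<in> arr P D"
    and eq: "f ** i1 = g ** i1" "f ** i2 = g ** i2"
  shows "f = g"
proof -
  have *: "x = (x ** i1) ** p1 +[P,D] (x ** i2) ** p2" if "x \<in> arr P D" for x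
  proof -
    have "x = x ** (i1 ** p1 +[P,P] i2 ** p2)"
      using biproductD[OF b] that by (simp add: cat_simps)
    then show ?thesis using biproductD(1-4)[OF b] that by (simp add: cat_simps)
  qed
  show ?thesis using *[OF f(1)] *[OF f(2)] eq by simp
qed

end

section \<open>Complexes that are exact in the contravariant variable\<close>

context additive_category begin

lemma Ch_Ob: "X \<in> Ch n C \<Longrightarrow> i \<le> Suc n \<Longrightarrow> Tm X i \<in> Ob C"
  by (simp add: Ch_def)

lemma Ch_arr: "X \<in> Ch n C \<Longrightarrow> i \<le> n \<Longrightarrow> Df X i \<in> arr (Tm X i) (Tm X (Suc i))"
  by (simp add: Ch_def arr_def)

lemma Ch_zero:
  "X \<in> Ch n C \<Longrightarrow> i < n \<Longrightarrow> Df X (Suc i) ** Df X i = 0[Tm X i,Tm X (Suc (Suc i))]"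
  by (simp add: Ch_def)

lemma chain_map_arr:
  "chain_map n C X Y f \<Longrightarrow> X \<in> Ch n C \<Longrightarrow> Y \<in> Ch n C \<Longrightarrow> i \<le> Suc n \<Longrightarrow>
    f i \<in> arr (Tm X i) (Tm Y i)"
  by (simp add: chain_map_def arr_def Ch_Ob)

lemma chain_map_comm:
  "chain_map n C X Y f \<Longrightarrow> i \<le> n \<Longrightarrow> Df Y i ** f i = f (Suc i) ** Df X i"
  by (simp add: chain_map_def)

lemma chain_mapI:
  assumes "\<And>i. i \<le> Suc n \<Longrightarrow> f i \<in> arr (Tm X i) (Tm Y i)"
    and "\<And>i. i \<le> n \<Longrightarrow> Df Y i ** f i = f (Suc i) ** Df X i"
  shows "chain_map n C X Y f"
  using assms by (simp add: chain_map_def arr_def)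

lemma chain_map_Idn: "X \<in> Ch n C \<Longrightarrow> chain_map n C X X (\<lambda>i. Idn C (Tm X i))"
  by (rule chain_mapI) (simp_all add: Idn_arr Ch_Ob id_left[OF intoI[OF Ch_arr]] id_right[OF Ch_arr])

lemma chain_map_comp:
  assumes f: "chain_map n C X Y f" and g: "chain_map n C Y Z g"
    and Ch: "X \<in> Ch n C" "Y \<in> Ch n C" "Z \<in> Ch n C"
  shows "chain_map n C X Z (\<lambda>i. g i ** f i)"
proof (rule chain_mapI)
  fix i assume i: "i \<le> n"
  note t = chain_map_arr[OF f Ch(1,2), of i] chain_map_arr[OF g Ch(2,3), of i]
    chain_map_arr[OF f Ch(1,2), of "Suc i"] chain_map_arr[OF g Ch(2,3), of "Suc i"]
    Ch_arr[OF Ch(1) i] Ch_arr[OF Ch(2) i] Ch_arr[OF Ch(3) i]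
  have "Df Z i ** g i ** f i = (Df Z i ** g i) ** f i"
    using t i by (simp add: cat_simps)
  also have "\<dots> = g (Suc i) ** Df Y i ** f i"
    using t i by (simp add: chain_map_comm[OF g i] cat_simps)
  also have "\<dots> = (g (Suc i) ** f (Suc i)) ** Df X i"
    using t i by (simp add: chain_map_comm[OF f i] cat_simps)
  finally show "Df Z i ** g i ** f i = (g (Suc i) ** f (Suc i)) ** Df X i" .
qed (use chain_map_arr[OF f Ch(1,2)] chain_map_arr[OF g Ch(2,3)] in \<open>auto intro: comp_arr\<close>)

lemma chain_map_add:
  assumes f: "chain_map n C X Y f" and g: "chain_map n C X Y g"
    and Ch: "X \<in> Ch n C" "Y \<in> Ch n C"
  shows "chain_map n C X Y (\<lambda>i. f i +[Tm X i,Tm Y i] g i)"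
proof (rule chain_mapI)
  fix i assume i: "i \<le> n"
  show "Df Y i ** (f i +[Tm X i,Tm Y i] g i)
    = (f (Suc i) +[Tm X (Suc i),Tm Y (Suc i)] g (Suc i)) ** Df X i"
    using chain_map_arr[OF f Ch, of i] chain_map_arr[OF g Ch, of i] i
      chain_map_arr[OF f Ch, of "Suc i"] chain_map_arr[OF g Ch, of "Suc i"]
      Ch_arr[OF Ch(1) i] Ch_arr[OF Ch(2) i]
    by (simp add: chain_map_comm[OF g i] chain_map_comm[OF f i] cat_simps)
qed (use chain_map_arr[OF f Ch] chain_map_arr[OF g Ch] in \<open>auto intro: add_arr\<close>)

lemma chain_map_neg:
  assumes f: "chain_map n C X Y f" and Ch: "X \<in> Ch n C" "Y \<in> Ch n C"
  shows "chain_map n C X Y (\<lambda>i. -[Tm X i,Tm Y i] f i)"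
proof (rule chain_mapI)
  fix i assume i: "i \<le> n"
  show "Df Y i ** -[Tm X i,Tm Y i] f i = -[Tm X (Suc i),Tm Y (Suc i)] f (Suc i) ** Df X i"
    using chain_map_arr[OF f Ch, of i] chain_map_arr[OF f Ch, of "Suc i"] i
      Ch_arr[OF Ch(1) i] Ch_arr[OF Ch(2) i]
    by (simp add: chain_map_comm[OF f i] cat_simps)
qed (use chain_map_arr[OF f Ch] in \<open>auto intro: neg_arr\<close>)

lemma fixing_ends_comp:
  assumes f: "chain_map_fixing_ends n C X Y f" and g: "chain_map_fixing_ends n C Y Z g"
    and Ch: "X \<in> Ch n C" "Y \<in> Ch n C" "Z \<in> Ch n C"
  shows "chain_map_fixing_ends n C X Z (\<lambda>i. g i ** f i)"
  using chain_map_comp[OF _ _ Ch] f g Ch_Ob[OF Ch(1), of 0] Ch_Ob[OF Ch(1), of "Suc n"]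
  by (auto simp: chain_map_fixing_ends_def id_right[OF Idn_arr])

text \<open>Half of the exactness of an exangle, stated without the extension: the contravariant Hom
  sequences in the inner degrees. The construction of homotopies uses just this, and it can be
  checked for a complex such as a cone before the complex is known to realise anything.\<close>

definition cexact :: "nat \<Rightarrow> ('o, 'm) cpx \<Rightarrow> bool" where
  "cexact n X \<longleftrightarrow> X \<in> Ch n C \<and>
     (\<forall>i<n. \<forall>Y. \<forall>u\<in>arr (Tm X (Suc i)) Y. u ** Df X i = 0[Tm X i,Y] \<longrightarrow>
        (\<exists>v\<in>arr (Tm X (Suc (Suc i))) Y. u = v ** Df X (Suc i)))"

text \<open>No composite is asked to be homotopic to an identity; between exact complexes that is
  automatic.\<close>

definition linked :: "nat \<Rightarrow> ('o, 'm) cpx \<Rightarrow> ('o, 'm) cpx \<Rightarrow> bool" where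
  "linked n X Y \<longleftrightarrow>
     (\<exists>f. chain_map_fixing_ends n C X Y f) \<and> (\<exists>g. chain_map_fixing_ends n C Y X g)"

text \<open>The homotopy leaves both end components unchanged. Its last component may be nonzero,
  since it still contributes in degree n; only its composite with the last differential has to
  vanish.\<close>

definition rel_homotopy where
  "rel_homotopy n X Y f g k \<longleftrightarrow>
     (\<forall>i\<le>n. k i \<in> arr (Tm X (Suc i)) (Tm Y i)) \<and>
     k 0 = 0[Tm X (Suc 0),Tm Y 0] \<and> Df Y n ** k n = 0[Tm X (Suc n),Tm Y (Suc n)] \<and>
     f 0 = g 0 \<and> f (Suc n) = g (Suc n) \<and>
     (\<forall>i<n. f (Suc i) = g (Suc i) +[Tm X (Suc i),Tm Y (Suc i)]
        (Df Y i ** k i +[Tm X (Suc i),Tm Y (Suc i)] k (Suc i) ** Df X (Suc i)))"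

lemma cexact_Ch: "cexact n X \<Longrightarrow> X \<in> Ch n C"
  by (simp add: cexact_def)

lemma cexactE:
  assumes "cexact n X" "i < n" "u \<in> arr (Tm X (Suc i)) Y" "u ** Df X i = 0[Tm X i,Y]"
  obtains v where "v \<in> arr (Tm X (Suc (Suc i))) Y" "u = v ** Df X (Suc i)"
  using assms unfolding cexact_def by blast

lemma rel_homotopyD:
  assumes "rel_homotopy n X Y f g k"
  shows "\<And>i. i \<le> n \<Longrightarrow> k i \<in> arr (Tm X (Suc i)) (Tm Y i)"
    "k 0 = 0[Tm X (Suc 0),Tm Y 0]" "Df Y n ** k n = 0[Tm X (Suc n),Tm Y (Suc n)]"
    "f 0 = g 0" "f (Suc n) = g (Suc n)"
    "\<And>i. i < n \<Longrightarrow> f (Suc i) = g (Suc i) +[Tm X (Suc i),Tm Y (Suc i)]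
        (Df Y i ** k i +[Tm X (Suc i),Tm Y (Suc i)] k (Suc i) ** Df X (Suc i))"
  using assms unfolding rel_homotopy_def by blast+

text \<open>The homotopy terms in degrees 0 and n + 1 are zero by the two normalisations.\<close>

lemma rel_homotopy_homotopic:
  assumes "rel_homotopy n X Y f g k" "X \<in> Ch n C" "Y \<in> Ch n C" "chain_map n C X Y g"
  shows "homotopic n C X Y f g"
proof -
  note k = rel_homotopyD[OF assms(1)]
  have "g 0 \<in> arr (Tm X 0) (Tm Y 0)" "g (Suc n) \<in> arr (Tm X (Suc n)) (Tm Y (Suc n))"
    "Df X 0 \<in> arr (Tm X 0) (Tm X (Suc 0))" "Tm Y 0 \<in> Ob C"
    using chain_map_arr[OF assms(4,2,3)] Ch_arr[OF assms(2)] Ch_Ob[OF assms(3)] by simp_all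
  then have "f 0 = g 0 +[Tm X 0,Tm Y 0] k 0 ** Df X 0"
    "f (Suc n) = g (Suc n) +[Tm X (Suc n),Tm Y (Suc n)] Df Y n ** k n"
    using k(4,5) by (simp_all add: k(2,3) add_zero zero_left)
  then show ?thesis
    unfolding homotopic_def using k(1,6) by (intro exI[of _ k]) (simp add: arrD)
qed

text \<open>Each new component extends the remaining error over the next differential. Nothing is
  claimed in degree n + 1, where no further exactness is available; the callers supply their own
  repair.\<close>

lemma null_homotopy_exists:
  assumes ex: "cexact n X" and Y: "Y \<in> Ch n C" and t: "chain_map n C X Y t"
    and t0: "t 0 = 0[Tm X 0,Tm Y 0]"
  obtains k where "\<And>i. i \<le> n \<Longrightarrow> k i \<in> arr (Tm X (Suc i)) (Tm Y i)"
    "k 0 = 0[Tm X (Suc 0),Tm Y 0]"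
    "\<And>i. i < n \<Longrightarrow> t (Suc i) = Df Y i ** k i +[Tm X (Suc i),Tm Y (Suc i)] k (Suc i) ** Df X (Suc i)"
proof -
  note X = cexact_Ch[OF ex]
  let ?P = "\<lambda>m k. (\<forall>i\<le>m. k i \<in> arr (Tm X (Suc i)) (Tm Y i)) \<and>
    k 0 = 0[Tm X (Suc 0),Tm Y 0] \<and>
    (\<forall>i<m. t (Suc i) = Df Y i ** k i +[Tm X (Suc i),Tm Y (Suc i)] k (Suc i) ** Df X (Suc i))"
  have "\<exists>k. ?P m k" if "m \<le> n" for m
    using that
  proof (induction m)
    case 0
    show ?case
      by (rule exI[of _ "\<lambda>i. 0[Tm X (Suc 0),Tm Y 0]"]) (simp add: zero_arr Ch_Ob[OF X] Ch_Ob[OF Y])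
  next
    case (Suc m)
    then obtain k where k: "?P m k" by auto
    have m: "m < n" using Suc by simp
    \<comment> \<open>The error in degree m + 1. Once it is known to vanish on
      \<open>Df X m\<close>, exactness extends it over \<open>Df X (Suc m)\<close>.\<close>
    define u where "u = t (Suc m) +[Tm X (Suc m),Tm Y (Suc m)]
      -[Tm X (Suc m),Tm Y (Suc m)] (Df Y m ** k m)"
    have ty: "t m \<in> arr (Tm X m) (Tm Y m)" "t (Suc m) \<in> arr (Tm X (Suc m)) (Tm Y (Suc m))"
      "Df X m \<in> arr (Tm X m) (Tm X (Suc m))" "Df Y m \<in> arr (Tm Y m) (Tm Y (Suc m))"
      "Df X (Suc m) \<in> arr (Tm X (Suc m)) (Tm X (Suc (Suc m)))"
      using chain_map_arr[OF t X Y] Ch_arr[OF X] Ch_arr[OF Y] m by simp_all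
    have km: "k m \<in> arr (Tm X (Suc m)) (Tm Y m)" using k by simp
    have u: "u \<in> arr (Tm X (Suc m)) (Tm Y (Suc m))"
      unfolding u_def using ty km by (simp add: cat_simps)
    have "u ** Df X m = Df Y m ** t m +[Tm X m,Tm Y (Suc m)]
        -[Tm X m,Tm Y (Suc m)] (Df Y m ** k m ** Df X m)"
      unfolding u_def using ty km m by (simp add: cat_simps chain_map_comm[OF t, symmetric])
    also have "\<dots> = 0[Tm X m,Tm Y (Suc m)]"
    \<comment> \<open>For m = 0 both terms vanish separately, because \<open>t 0\<close> and
      \<open>k 0\<close> are zero. Otherwise they cancel by the relation one degree lower, as
      \<open>Df Y m ** Df Y l\<close> is zero.\<close>
    proof (cases m)
      case 0
      then show ?thesis
        using t0 k ty by (simp add: cat_simps Ch_Ob[OF X] Ch_Ob[OF Y])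
    next
      case (Suc l)
      have ty': "k l \<in> arr (Tm X (Suc l)) (Tm Y l)" "Df Y l \<in> arr (Tm Y l) (Tm Y (Suc l))"
        "Df X l \<in> arr (Tm X l) (Tm X (Suc l))" "Tm X (Suc l) \<in> Ob C" "Tm Y (Suc (Suc l)) \<in> Ob C"
        using k m Suc by (auto intro: Ch_arr X Y Ch_Ob)
      have "t m = Df Y l ** k l +[Tm X m,Tm Y m] k m ** Df X m"
        using k Suc by simp
      moreover have "Df Y m ** Df Y l ** k l = 0[Tm X m,Tm Y (Suc m)]"
        using comp_eq_comp[OF Ch_zero[OF Y, of l] _ ty'(2) intoI[OF ty'(1)]] ty ty' m Suc
        by (simp add: cat_simps)
      ultimately show ?thesis using ty ty' km Suc by (simp add: cat_simps)
    qed
    finally obtain v where v: "v \<in> arr (Tm X (Suc (Suc m))) (Tm Y (Suc m))" "u = v ** Df X (Suc m)"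
      using cexactE[OF ex m u] by blast
    have "t (Suc m) = Df Y m ** k m +[Tm X (Suc m),Tm Y (Suc m)] u"
      unfolding u_def using ty km by (simp add: cat_ac)
    then have "?P (Suc m) (k(Suc m := v))"
      using k v by (auto simp: le_Suc_eq less_Suc_eq)
    then show ?case by blast
  qed
  from this[of n] obtain k where "?P n k" by auto
  then show thesis by (intro that) auto
qed

end

section \<open>Homotopy equivalences between linked exact complexes\<close>

context additive_category begin

text \<open>This is 2 g - g f g, one Newton step towards an inverse of f: the new error is the
  square of the old error 1 - g f.\<close>

definition sharpen :: "('o, 'm) cpx \<Rightarrow> ('o, 'm) cpx \<Rightarrow> (nat \<Rightarrow> 'm) \<Rightarrow> (nat \<Rightarrow> 'm) \<Rightarrow> nat \<Rightarrow> 'm" where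
  "sharpen X Y f g i = g i +[Tm Y i,Tm X i]
     (Idn C (Tm X i) +[Tm X i,Tm X i] -[Tm X i,Tm X i] (g i ** f i)) ** g i"

lemma fixing_endsD:
  assumes "chain_map_fixing_ends n C X Y f"
  shows "chain_map n C X Y f" "Tm Y 0 = Tm X 0" "f 0 = Idn C (Tm X 0)"
    "Tm Y (Suc n) = Tm X (Suc n)" "f (Suc n) = Idn C (Tm X (Suc n))"
  using assms by (simp_all add: chain_map_fixing_ends_def)

text \<open>The error h = 1 - g f vanishes at both ends, because f and g are identities there. It is
  null homotopic up to degree n, and a second factor h takes care of degree n + 1.\<close>

lemma sharpen_homotopy_inverse:
  assumes ex: "cexact n X" and Y: "Y \<in> Ch n C"
    and f: "chain_map_fixing_ends n C X Y f" and g: "chain_map_fixing_ends n C Y X g"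
  shows "chain_map_fixing_ends n C Y X (sharpen X Y f g)"
    and "\<exists>k. rel_homotopy n X X (\<lambda>i. sharpen X Y f g i ** f i) (\<lambda>i. Idn C (Tm X i)) k"
proof -
  note X = cexact_Ch[OF ex]
  define h where "h i = Idn C (Tm X i) +[Tm X i,Tm X i] -[Tm X i,Tm X i] (g i ** f i)" for i
  note F = fixing_endsD[OF f] and G = fixing_endsD[OF g]
  have hc: "chain_map n C X X h"
    unfolding h_def[abs_def]
    by (rule chain_map_add[OF chain_map_Idn[OF X] chain_map_neg[OF chain_map_comp[OF F(1) G(1) X Y X] X X] X X])
  have ends: "h 0 = 0[Tm X 0,Tm X 0]" "h (Suc n) = 0[Tm X (Suc n),Tm X (Suc n)]"
    using Ch_Ob[OF X, of 0] Ch_Ob[OF X, of "Suc n"]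
    by (simp_all add: h_def F G(3,5) cat_simps id_right[OF Idn_arr])
  have s: "sharpen X Y f g i = g i +[Tm Y i,Tm X i] h i ** g i" for i
    by (simp add: sharpen_def h_def)
  have "chain_map n C Y X (sharpen X Y f g)"
    unfolding s[abs_def] by (rule chain_map_add[OF G(1) chain_map_comp[OF G(1) hc Y X X] Y X])
  then show "chain_map_fixing_ends n C Y X (sharpen X Y f g)"
    using Ch_Ob[OF X, of 0] Ch_Ob[OF X, of "Suc n"]
    by (simp add: chain_map_fixing_ends_def s G(3,5) F ends cat_simps zero_left[OF Idn_arr])
  obtain k where k: "\<And>i. i \<le> n \<Longrightarrow> k i \<in> arr (Tm X (Suc i)) (Tm X i)"
    "k 0 = 0[Tm X (Suc 0),Tm X 0]"
    "\<And>i. i < n \<Longrightarrow> h (Suc i) = Df X i ** k i +[Tm X (Suc i),Tm X (Suc i)] k (Suc i) ** Df X (Suc i)"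
    using null_homotopy_exists[OF ex X hc ends(1)] by blast
  \<comment> \<open>As \<open>h\<close> vanishes in degree n + 1, this factor kills the defect
    \<open>Df X n ** k n\<close> left by the construction from the left. The sign appears because
    the new composite is the identity minus the square of \<open>h\<close>.\<close>
  define \<kappa> where "\<kappa> i = -[Tm X (Suc i),Tm X i] (h i ** k i)" for i
  have d\<kappa>: "Df X i ** \<kappa> i = -[Tm X (Suc i),Tm X (Suc i)] (h (Suc i) ** Df X i ** k i)" if i: "i \<le> n" for i
  proof -
    have ty: "h i \<in> arr (Tm X i) (Tm X i)" "h (Suc i) \<in> arr (Tm X (Suc i)) (Tm X (Suc i))"
      "Df X i \<in> arr (Tm X i) (Tm X (Suc i))" "k i \<in> arr (Tm X (Suc i)) (Tm X i)"
      using i chain_map_arr[OF hc X X] Ch_arr[OF X] k(1) by simp_all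
    show ?thesis
      using ty comp_eq_comp[OF chain_map_comm[OF hc i] ty(3,1) intoI[OF ty(4)]]
      by (simp add: \<kappa>_def cat_simps)
  qed
  have "rel_homotopy n X X (\<lambda>i. sharpen X Y f g i ** f i) (\<lambda>i. Idn C (Tm X i)) \<kappa>"
    unfolding rel_homotopy_def
  proof (intro conjI allI impI)
    show "\<kappa> i \<in> arr (Tm X (Suc i)) (Tm X i)" if "i \<le> n" for i
      using that chain_map_arr[OF hc X X, of i] k(1)[of i] by (simp add: \<kappa>_def typing)
    show "\<kappa> 0 = 0[Tm X (Suc 0),Tm X 0]"
      using Ch_Ob[OF X, of 0] Ch_Ob[OF X, of 1] by (simp add: \<kappa>_def ends k cat_simps zero_left[OF zero_arr])
    show "Df X n ** \<kappa> n = 0[Tm X (Suc n),Tm X (Suc n)]"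
      using Ch_Ob[OF X, of "Suc n"] Ch_arr[OF X, of n] k(1)[of n] by (simp add: d\<kappa> ends cat_simps)
    show "sharpen X Y f g 0 ** f 0 = Idn C (Tm X 0)"
      "sharpen X Y f g (Suc n) ** f (Suc n) = Idn C (Tm X (Suc n))"
      using Ch_Ob[OF X, of 0] Ch_Ob[OF X, of "Suc n"]
      by (simp_all add: s G(3,5) F ends cat_simps zero_left[OF Idn_arr] id_right[OF Idn_arr])
    fix i assume i: "i < n"
    have ty: "h (Suc i) \<in> arr (Tm X (Suc i)) (Tm X (Suc i))"
      "f (Suc i) \<in> arr (Tm X (Suc i)) (Tm Y (Suc i))" "g (Suc i) \<in> arr (Tm Y (Suc i)) (Tm X (Suc i))"
      "Df X i \<in> arr (Tm X i) (Tm X (Suc i))" "k i \<in> arr (Tm X (Suc i)) (Tm X i)"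
      "Df X (Suc i) \<in> arr (Tm X (Suc i)) (Tm X (Suc (Suc i)))"
      "k (Suc i) \<in> arr (Tm X (Suc (Suc i))) (Tm X (Suc i))" "Tm X (Suc i) \<in> Ob C"
      using i chain_map_arr[OF hc X X] chain_map_arr[OF F(1) X Y] chain_map_arr[OF G(1) Y X]
        Ch_arr[OF X] k(1) Ch_Ob[OF X] by simp_all
    define m where "m = g (Suc i) ** f (Suc i)"
    have m: "m \<in> arr (Tm X (Suc i)) (Tm X (Suc i))" using ty by (simp add: m_def typing)
    have "\<kappa> (Suc i) ** Df X (Suc i) = -[Tm X (Suc i),Tm X (Suc i)] (h (Suc i) ** k (Suc i) ** Df X (Suc i))"
      using ty by (simp add: \<kappa>_def cat_simps)
    then have "Df X i ** \<kappa> i +[Tm X (Suc i),Tm X (Suc i)] \<kappa> (Suc i) ** Df X (Suc i)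
        = -[Tm X (Suc i),Tm X (Suc i)] (h (Suc i) ** h (Suc i))"
      using ty i arg_cong[OF k(3)[OF i], of "\<lambda>x. h (Suc i) ** x"] by (simp add: d\<kappa> cat_simps)
    \<comment> \<open>With m = g f this is the identity 1 - (1 - m)(1 - m) = m + (1 - m) m.\<close>
    also have "Idn C (Tm X (Suc i)) +[Tm X (Suc i),Tm X (Suc i)] \<dots> = m +[Tm X (Suc i),Tm X (Suc i)] h (Suc i) ** m"
      using ty m unfolding h_def m_def[symmetric] by (simp add: cat_ac)
    finally show "sharpen X Y f g (Suc i) ** f (Suc i) = Idn C (Tm X (Suc i)) +[Tm X (Suc i),Tm X (Suc i)]
        (Df X i ** \<kappa> i +[Tm X (Suc i),Tm X (Suc i)] \<kappa> (Suc i) ** Df X (Suc i))"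
      using ty by (simp add: s m_def cat_simps)
  qed
  then show "\<exists>k. rel_homotopy n X X (\<lambda>i. sharpen X Y f g i ** f i) (\<lambda>i. Idn C (Tm X i)) k" by blast
qed

lemma linked_iso_class:
  assumes X: "cexact n X" and Y: "cexact n Y" and l: "linked n X Y"
  shows "Y \<in> iso_class n C X"
proof -
  note XC = cexact_Ch[OF X] and YC = cexact_Ch[OF Y]
  obtain f g where f: "chain_map_fixing_ends n C X Y f" and g: "chain_map_fixing_ends n C Y X g"
    using l by (auto simp: linked_def)
  note F = fixing_endsD[OF f] and G = fixing_endsD[OF g]
  obtain k where k: "rel_homotopy n X X (\<lambda>i. sharpen X Y f g i ** f i) (\<lambda>i. Idn C (Tm X i)) k"
    using sharpen_homotopy_inverse(2)[OF X YC f g] by blast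
  obtain k' where k': "rel_homotopy n Y Y (\<lambda>i. sharpen Y X g f i ** g i) (\<lambda>i. Idn C (Tm Y i)) k'"
    using sharpen_homotopy_inverse(2)[OF Y XC g f] by blast
  \<comment> \<open>f (2 g - g f g) = (2 f - f g f) g, so one and the same sharpened map is a
    homotopy inverse on both sides.\<close>
  have "sharpen Y X g f i ** g i = f i ** sharpen X Y f g i" if "i \<le> Suc n" for i
    using that chain_map_arr[OF F(1) XC YC, of i] chain_map_arr[OF G(1) YC XC, of i]
      Ch_Ob[OF XC, of i] Ch_Ob[OF YC, of i]
    by (simp add: sharpen_def cat_simps)
  then have "rel_homotopy n Y Y (\<lambda>i. f i ** sharpen X Y f g i) (\<lambda>i. Idn C (Tm Y i)) k'"
    using k' by (simp add: rel_homotopy_def)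
  then show ?thesis
    using sharpen_homotopy_inverse(1)[OF X YC f g] f k rel_homotopy_homotopic chain_map_Idn XC YC
    unfolding iso_class_def by blast
qed

text \<open>A morphism on Y that is killed by the differential is pulled back along f, extended over
  the next differential of X, carried back along g and corrected by the homotopy.\<close>

lemma homotopy_retract_cexact:
  assumes ex: "cexact n X" and Y: "Y \<in> Ch n C"
    and f: "chain_map n C X Y f" and g: "chain_map n C Y X g"
    and h: "homotopic n C Y Y (\<lambda>i. f i ** g i) (\<lambda>i. Idn C (Tm Y i))"
  shows "cexact n Y"
  unfolding cexact_def
proof (intro conjI allI ballI impI)
  fix i W u
  assume i: "i < n" and u: "u \<in> arr (Tm Y (Suc i)) W" "u ** Df Y i = 0[Tm Y i,W]"
  note X = cexact_Ch[OF ex]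
  obtain h where h: "\<And>i. i \<le> n \<Longrightarrow> h i \<in> arr (Tm Y (Suc i)) (Tm Y i)"
    "\<And>i. i < n \<Longrightarrow> f (Suc i) ** g (Suc i) = Idn C (Tm Y (Suc i)) +[Tm Y (Suc i),Tm Y (Suc i)]
       (Df Y i ** h i +[Tm Y (Suc i),Tm Y (Suc i)] h (Suc i) ** Df Y (Suc i))"
    using h Ch_Ob[OF Y] unfolding homotopic_def arr_def by auto
  have ty: "f i \<in> arr (Tm X i) (Tm Y i)" "f (Suc i) \<in> arr (Tm X (Suc i)) (Tm Y (Suc i))"
    "g (Suc i) \<in> arr (Tm Y (Suc i)) (Tm X (Suc i))"
    "g (Suc (Suc i)) \<in> arr (Tm Y (Suc (Suc i))) (Tm X (Suc (Suc i)))"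
    "Df X i \<in> arr (Tm X i) (Tm X (Suc i))" "Df X (Suc i) \<in> arr (Tm X (Suc i)) (Tm X (Suc (Suc i)))"
    "Df Y i \<in> arr (Tm Y i) (Tm Y (Suc i))" "Df Y (Suc i) \<in> arr (Tm Y (Suc i)) (Tm Y (Suc (Suc i)))"
    "h i \<in> arr (Tm Y (Suc i)) (Tm Y i)" "h (Suc i) \<in> arr (Tm Y (Suc (Suc i))) (Tm Y (Suc i))"
    "W \<in> Ob C"
    using i h(1) chain_map_arr[OF f X Y] chain_map_arr[OF g Y X] Ch_arr[OF X] Ch_arr[OF Y] arrD[OF u(1)]
    by simp_all
  have "(u ** f (Suc i)) ** Df X i = (u ** Df Y i) ** f i"
    using ty u(1) i chain_map_comm[OF f, of i] by (simp add: cat_simps)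
  also have "\<dots> = 0[Tm X i,W]" using u ty by (simp add: cat_simps)
  finally obtain v where v: "v \<in> arr (Tm X (Suc (Suc i))) W" "u ** f (Suc i) = v ** Df X (Suc i)"
    using cexactE[OF ex i comp_arr[OF u(1) ty(2)]] by blast
  have "u ** f (Suc i) ** g (Suc i) = (u ** f (Suc i)) ** g (Suc i)"
    using ty u(1) by (simp add: cat_simps)
  also have "\<dots> = v ** g (Suc (Suc i)) ** Df Y (Suc i)"
    using ty v i chain_map_comm[OF g, of "Suc i"] by (simp add: v(2) cat_simps)
  finally have 1: "u ** f (Suc i) ** g (Suc i) = v ** g (Suc (Suc i)) ** Df Y (Suc i)" .
  have "u ** f (Suc i) ** g (Suc i) = u +[Tm Y (Suc i),W] ((u ** Df Y i) ** h i +[Tm Y (Suc i),W] u ** h (Suc i) ** Df Y (Suc i))"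
    using ty u(1) Ch_Ob[OF Y, of "Suc i"] i by (simp add: h(2) cat_simps)
  also have "\<dots> = u +[Tm Y (Suc i),W] u ** h (Suc i) ** Df Y (Suc i)"
    using ty u by (simp add: cat_simps)
  finally have 2: "v ** g (Suc (Suc i)) ** Df Y (Suc i) = u +[Tm Y (Suc i),W] u ** h (Suc i) ** Df Y (Suc i)"
    using 1 by simp
  \<comment> \<open>Of the two homotopy terms one has vanished with \<open>u ** Df Y i\<close>, and
    the other already factors through the next differential, so the relation can be solved for
    u.\<close>
  have "u = (v ** g (Suc (Suc i)) +[Tm Y (Suc (Suc i)),W] -[Tm Y (Suc (Suc i)),W] (u ** h (Suc i))) ** Df Y (Suc i)"
    using ty u(1) v(1) by (simp add: 2 cat_simps)
  then show "\<exists>v\<in>arr (Tm Y (Suc (Suc i))) W. u = v ** Df Y (Suc i)"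
    using ty u(1) v(1) by (intro bexI) (assumption | simp add: typing)+
qed (fact Y)

text \<open>Replaces homotopy equivalences by two conditions that can be checked separately:
  exactness, and the mere existence of maps both ways.\<close>

lemma iso_class_iff:
  assumes X: "cexact n X"
  shows "Y \<in> iso_class n C X \<longleftrightarrow> cexact n Y \<and> linked n X Y"
proof
  assume "Y \<in> iso_class n C X"
  then obtain f g where "Y \<in> Ch n C" "chain_map_fixing_ends n C X Y f" "chain_map_fixing_ends n C Y X g"
    "homotopic n C Y Y (\<lambda>i. f i ** g i) (\<lambda>i. Idn C (Tm Y i))"
    by (auto simp: iso_class_def)
  then show "cexact n Y \<and> linked n X Y"
    using homotopy_retract_cexact[OF X] fixing_endsD(1) unfolding linked_def by blast
qed (use linked_iso_class[OF X] in blast)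

lemma linked_refl: "X \<in> Ch n C \<Longrightarrow> linked n X X"
  using chain_map_Idn by (auto simp: linked_def chain_map_fixing_ends_def)

lemma linked_sym: "linked n X Y \<Longrightarrow> linked n Y X"
  by (auto simp: linked_def)

lemma linked_trans:
  "linked n X Y \<Longrightarrow> linked n Y Z \<Longrightarrow> X \<in> Ch n C \<Longrightarrow> Y \<in> Ch n C \<Longrightarrow> Z \<in> Ch n C \<Longrightarrow> linked n X Z"
  unfolding linked_def using fixing_ends_comp by meson

lemma iso_class_eq_iff:
  assumes "cexact n X" "cexact n Y"
  shows "iso_class n C X = iso_class n C Y \<longleftrightarrow> linked n X Y"
proof
  have "Y \<in> iso_class n C Y" using assms linked_refl cexact_Ch by (simp add: iso_class_iff)
  moreover assume "iso_class n C X = iso_class n C Y"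
  ultimately show "linked n X Y" using iso_class_iff[OF assms(1), of Y] by metis
next
  assume l: "linked n X Y"
  have "linked n X Z \<longleftrightarrow> linked n Y Z" if "cexact n Z" for Z
    using that l assms linked_trans[of n X Y Z] linked_trans[OF linked_sym, of n X Y Z] cexact_Ch by blast
  then show "iso_class n C X = iso_class n C Y" using assms by (auto simp: iso_class_iff)
qed

end

section \<open>Mapping cones\<close>

context additive_category begin

text \<open>A family of direct sums \<open>A i \<oplus> B i\<close> with differential \<open>(-\<alpha>, 0; \<phi>, \<beta>)\<close>. A mapping cone is of this
  form in all degrees \<open>0, \<dots>, n + 1\<close> if the missing summands in degrees \<open>0\<close> and \<open>n + 1\<close> are
  filled with a zero object, which makes the two ends instances of the general degree.\<close>

definition twisted_sum where
  "twisted_sum n A B \<alpha> \<beta> \<phi> M i1 i2 p1 p2 \<longleftrightarrow>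
     (\<forall>i\<le>Suc n. A i \<in> Ob C \<and> B i \<in> Ob C \<and>
        is_biproduct C (A i) (B i) (Tm M i) (i1 i) (i2 i) (p1 i) (p2 i)) \<and>
     (\<forall>i\<le>n. \<alpha> i \<in> arr (A i) (A (Suc i)) \<and> \<beta> i \<in> arr (B i) (B (Suc i)) \<and> \<phi> i \<in> arr (A i) (B (Suc i)) \<and>
        Df M i \<in> arr (Tm M i) (Tm M (Suc i)) \<and>
        p1 (Suc i) ** Df M i = -[Tm M i,A (Suc i)] (\<alpha> i ** p1 i) \<and>
        p2 (Suc i) ** Df M i = \<phi> i ** p1 i +[Tm M i,B (Suc i)] \<beta> i ** p2 i)"

lemma twisted_sumD:
  assumes "twisted_sum n A B \<alpha> \<beta> \<phi> M i1 i2 p1 p2"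
  shows "\<And>i. i \<le> Suc n \<Longrightarrow> A i \<in> Ob C" "\<And>i. i \<le> Suc n \<Longrightarrow> B i \<in> Ob C"
    "\<And>i. i \<le> Suc n \<Longrightarrow> is_biproduct C (A i) (B i) (Tm M i) (i1 i) (i2 i) (p1 i) (p2 i)"
    "\<And>i. i \<le> n \<Longrightarrow> \<alpha> i \<in> arr (A i) (A (Suc i))" "\<And>i. i \<le> n \<Longrightarrow> \<beta> i \<in> arr (B i) (B (Suc i))"
    "\<And>i. i \<le> n \<Longrightarrow> \<phi> i \<in> arr (A i) (B (Suc i))" "\<And>i. i \<le> n \<Longrightarrow> Df M i \<in> arr (Tm M i) (Tm M (Suc i))"
    "\<And>i. i \<le> n \<Longrightarrow> p1 (Suc i) ** Df M i = -[Tm M i,A (Suc i)] (\<alpha> i ** p1 i)"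
    "\<And>i. i \<le> n \<Longrightarrow> p2 (Suc i) ** Df M i = \<phi> i ** p1 i +[Tm M i,B (Suc i)] \<beta> i ** p2 i"
    "\<And>i. i \<le> Suc n \<Longrightarrow> i1 i \<in> arr (A i) (Tm M i)" "\<And>i. i \<le> Suc n \<Longrightarrow> i2 i \<in> arr (B i) (Tm M i)"
    "\<And>i. i \<le> Suc n \<Longrightarrow> p1 i \<in> arr (Tm M i) (A i)" "\<And>i. i \<le> Suc n \<Longrightarrow> p2 i \<in> arr (Tm M i) (B i)"
proof -
  show "\<And>i. i \<le> Suc n \<Longrightarrow> A i \<in> Ob C" "\<And>i. i \<le> Suc n \<Longrightarrow> B i \<in> Ob C"
    and *: "\<And>i. i \<le> Suc n \<Longrightarrow> is_biproduct C (A i) (B i) (Tm M i) (i1 i) (i2 i) (p1 i) (p2 i)"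
    using assms by (simp_all add: twisted_sum_def)
  then show "\<And>i. i \<le> Suc n \<Longrightarrow> i1 i \<in> arr (A i) (Tm M i)" "\<And>i. i \<le> Suc n \<Longrightarrow> i2 i \<in> arr (B i) (Tm M i)"
    "\<And>i. i \<le> Suc n \<Longrightarrow> p1 i \<in> arr (Tm M i) (A i)" "\<And>i. i \<le> Suc n \<Longrightarrow> p2 i \<in> arr (Tm M i) (B i)"
    using biproductD(1-4)[OF *] by simp_all
qed (use assms in \<open>simp_all add: twisted_sum_def\<close>)

text \<open>The sign on \<alpha> makes the mixed entry of the squared differential \<beta> \<phi> -
  \<phi> \<alpha>.\<close>

lemma twisted_sum_Ch:
  assumes tw: "twisted_sum n A B \<alpha> \<beta> \<phi> M i1 i2 p1 p2"
    and \<alpha>: "\<And>i. i < n \<Longrightarrow> \<alpha> (Suc i) ** \<alpha> i = 0[A i,A (Suc (Suc i))]"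
    and \<beta>: "\<And>i. i < n \<Longrightarrow> \<beta> (Suc i) ** \<beta> i = 0[B i,B (Suc (Suc i))]"
    and \<phi>: "\<And>i. i < n \<Longrightarrow> \<beta> (Suc i) ** \<phi> i = \<phi> (Suc i) ** \<alpha> i"
  shows "M \<in> Ch n C"
proof -
  note T = twisted_sumD[OF tw]
  have "Df M (Suc i) ** Df M i = 0[Tm M i,Tm M (Suc (Suc i))]" if i: "i < n" for i
  proof (rule biproduct_into_eqI[OF T(3)[of "Suc (Suc i)"] T(1)[of "Suc (Suc i)"] T(2)[of "Suc (Suc i)"]])
    have ty: "\<alpha> i \<in> arr (A i) (A (Suc i))" "\<alpha> (Suc i) \<in> arr (A (Suc i)) (A (Suc (Suc i)))"
      "\<beta> i \<in> arr (B i) (B (Suc i))" "\<beta> (Suc i) \<in> arr (B (Suc i)) (B (Suc (Suc i)))"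
      "\<phi> i \<in> arr (A i) (B (Suc i))" "\<phi> (Suc i) \<in> arr (A (Suc i)) (B (Suc (Suc i)))"
      "Df M i \<in> arr (Tm M i) (Tm M (Suc i))" "Df M (Suc i) \<in> arr (Tm M (Suc i)) (Tm M (Suc (Suc i)))"
      "p1 i \<in> arr (Tm M i) (A i)" "p2 i \<in> arr (Tm M i) (B i)"
      "p1 (Suc i) \<in> arr (Tm M (Suc i)) (A (Suc i))" "p2 (Suc i) \<in> arr (Tm M (Suc i)) (B (Suc i))"
      "p1 (Suc (Suc i)) \<in> arr (Tm M (Suc (Suc i))) (A (Suc (Suc i)))"
      "p2 (Suc (Suc i)) \<in> arr (Tm M (Suc (Suc i))) (B (Suc (Suc i)))"
      "Tm M i \<in> Ob C" "Tm M (Suc (Suc i)) \<in> Ob C" "A (Suc (Suc i)) \<in> Ob C" "B (Suc (Suc i)) \<in> Ob C"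
      using i T(4-7) T(12,13) arrD(1,2)[OF T(7)] T(1,2) by simp_all
    show "Df M (Suc i) ** Df M i \<in> arr (Tm M i) (Tm M (Suc (Suc i)))"
      "0[Tm M i,Tm M (Suc (Suc i))] \<in> arr (Tm M i) (Tm M (Suc (Suc i)))"
      using ty by (simp_all add: typing)
    have "p1 (Suc (Suc i)) ** Df M (Suc i) ** Df M i = (p1 (Suc (Suc i)) ** Df M (Suc i)) ** Df M i"
      using ty by (simp add: cat_simps)
    also have "\<dots> = -[Tm M i,A (Suc (Suc i))] (\<alpha> (Suc i) ** (p1 (Suc i) ** Df M i))"
      using ty i by (simp add: T(8) cat_simps)
    also have "\<dots> = (\<alpha> (Suc i) ** \<alpha> i) ** p1 i"
      using ty i unfolding T(8)[OF less_imp_le[OF i]] by (simp add: cat_simps)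
    finally show "p1 (Suc (Suc i)) ** Df M (Suc i) ** Df M i = p1 (Suc (Suc i)) ** 0[Tm M i,Tm M (Suc (Suc i))]"
      using ty by (simp add: \<alpha>[OF i] cat_simps)
    have "p2 (Suc (Suc i)) ** Df M (Suc i) ** Df M i = (p2 (Suc (Suc i)) ** Df M (Suc i)) ** Df M i"
      using ty by (simp add: cat_simps)
    also have "\<dots> = \<phi> (Suc i) ** (p1 (Suc i) ** Df M i) +[Tm M i,B (Suc (Suc i))] \<beta> (Suc i) ** (p2 (Suc i) ** Df M i)"
      using ty i by (simp add: T(9) cat_simps)
    also have "\<dots> = -[Tm M i,B (Suc (Suc i))] ((\<phi> (Suc i) ** \<alpha> i) ** p1 i) +[Tm M i,B (Suc (Suc i))]
        ((\<beta> (Suc i) ** \<phi> i) ** p1 i +[Tm M i,B (Suc (Suc i))] (\<beta> (Suc i) ** \<beta> i) ** p2 i)"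
      unfolding T(8)[OF less_imp_le[OF i]] T(9)[OF less_imp_le[OF i]] using ty by (simp add: cat_simps)
    finally show "p2 (Suc (Suc i)) ** Df M (Suc i) ** Df M i = p2 (Suc (Suc i)) ** 0[Tm M i,Tm M (Suc (Suc i))]"
      using ty unfolding \<phi>[OF i] \<beta>[OF i] by (simp add: cat_simps)
  qed (use i in auto)
  then show ?thesis
    using arrD[OF T(10)] arrD[OF T(7)] unfolding Ch_def by simp
qed

text \<open>The map has the matrix (a, 0; h, b). In the mixed entry, compatibility with the
  differentials says that \<open>h\<close> is a homotopy between b \<phi> and \<phi>' a; the sign on
  \<alpha> produces the sum in the homotopy relation.\<close>

lemma twisted_sum_map:
  assumes tw: "twisted_sum n A B \<alpha> \<beta> \<phi> M i1 i2 p1 p2"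
    and tw': "twisted_sum n A' B' \<alpha>' \<beta>' \<phi>' M' j1 j2 q1 q2"
    and a: "\<And>i. i \<le> Suc n \<Longrightarrow> a i \<in> arr (A i) (A' i)" "\<And>i. i \<le> n \<Longrightarrow> \<alpha>' i ** a i = a (Suc i) ** \<alpha> i"
    and b: "\<And>i. i \<le> Suc n \<Longrightarrow> b i \<in> arr (B i) (B' i)" "\<And>i. i \<le> n \<Longrightarrow> \<beta>' i ** b i = b (Suc i) ** \<beta> i"
    and h: "\<And>i. i \<le> Suc n \<Longrightarrow> h i \<in> arr (A i) (B' i)"
      "\<And>i. i \<le> n \<Longrightarrow> b (Suc i) ** \<phi> i = \<phi>' i ** a i +[A i,B' (Suc i)]
        (\<beta>' i ** h i +[A i,B' (Suc i)] h (Suc i) ** \<alpha> i)"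
    and q_def: "\<And>i. q i = j1 i ** a i ** p1 i +[Tm M i,Tm M' i]
      j2 i ** (h i ** p1 i +[Tm M i,B' i] b i ** p2 i)"
  shows "chain_map n C M M' q"
    and "\<And>i. i \<le> Suc n \<Longrightarrow> q1 i ** q i = a i ** p1 i"
    and "\<And>i. i \<le> Suc n \<Longrightarrow> q2 i ** q i = h i ** p1 i +[Tm M i,B' i] b i ** p2 i"
    and "\<And>i. i \<le> Suc n \<Longrightarrow> q i \<in> arr (Tm M i) (Tm M' i)"
proof -
  note T = twisted_sumD[OF tw] and T' = twisted_sumD[OF tw']
  have tq: "q i \<in> arr (Tm M i) (Tm M' i)"
    and q1: "q1 i ** q i = a i ** p1 i"
    and q2: "q2 i ** q i = h i ** p1 i +[Tm M i,B' i] b i ** p2 i" if i: "i \<le> Suc n" for i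
  proof -
    note ty = a(1)[OF i] b(1)[OF i] h(1)[OF i] T(12,13)[OF i] T'(10-13)[OF i] T'(1,2)[OF i]
    show "q i \<in> arr (Tm M i) (Tm M' i)"
      using ty by (simp add: q_def typing)
    show "q1 i ** q i = a i ** p1 i" "q2 i ** q i = h i ** p1 i +[Tm M i,B' i] b i ** p2 i"
      using ty biproductD(5-8)[OF T'(3)[OF i] T'(1)[OF i] T'(2)[OF i]] biproduct_comp[OF T'(3)[OF i] T'(1)[OF i] T'(2)[OF i]] arrD(1)[OF T(12)[OF i]]
      by (simp_all add: q_def cat_simps)
  qed
  show "chain_map n C M M' q"
  proof (rule chain_mapI[OF tq])
    fix i assume i: "i \<le> n"
    have ty: "\<alpha> i \<in> arr (A i) (A (Suc i))" "\<beta> i \<in> arr (B i) (B (Suc i))" "\<phi> i \<in> arr (A i) (B (Suc i))"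
      "\<alpha>' i \<in> arr (A' i) (A' (Suc i))" "\<beta>' i \<in> arr (B' i) (B' (Suc i))" "\<phi>' i \<in> arr (A' i) (B' (Suc i))"
      "Df M i \<in> arr (Tm M i) (Tm M (Suc i))" "Df M' i \<in> arr (Tm M' i) (Tm M' (Suc i))"
      "p1 i \<in> arr (Tm M i) (A i)" "p2 i \<in> arr (Tm M i) (B i)"
      "p1 (Suc i) \<in> arr (Tm M (Suc i)) (A (Suc i))" "p2 (Suc i) \<in> arr (Tm M (Suc i)) (B (Suc i))"
      "q1 i \<in> arr (Tm M' i) (A' i)" "q2 i \<in> arr (Tm M' i) (B' i)"
      "q1 (Suc i) \<in> arr (Tm M' (Suc i)) (A' (Suc i))" "q2 (Suc i) \<in> arr (Tm M' (Suc i)) (B' (Suc i))"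
      "q i \<in> arr (Tm M i) (Tm M' i)" "q (Suc i) \<in> arr (Tm M (Suc i)) (Tm M' (Suc i))"
      "a i \<in> arr (A i) (A' i)" "a (Suc i) \<in> arr (A (Suc i)) (A' (Suc i))"
      "b i \<in> arr (B i) (B' i)" "b (Suc i) \<in> arr (B (Suc i)) (B' (Suc i))"
      "h i \<in> arr (A i) (B' i)" "h (Suc i) \<in> arr (A (Suc i)) (B' (Suc i))"
      using i T(4-7,12,13) T'(4-7,12,13) tq a(1) b(1) h(1) by simp_all
    show "Df M' i ** q i = q (Suc i) ** Df M i"
    proof (rule biproduct_into_eqI[OF T'(3)[of "Suc i"] T'(1)[of "Suc i"] T'(2)[of "Suc i"]])
      show "Df M' i ** q i \<in> arr (Tm M i) (Tm M' (Suc i))" "q (Suc i) ** Df M i \<in> arr (Tm M i) (Tm M' (Suc i))"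
        using ty by (simp_all add: typing)
      have "q1 (Suc i) ** Df M' i ** q i = (q1 (Suc i) ** Df M' i) ** q i" using ty by (simp add: cat_simps)
      also have "\<dots> = -[Tm M i,A' (Suc i)] (\<alpha>' i ** (q1 i ** q i))"
        unfolding T'(8)[OF i] using ty by (simp add: cat_simps)
      also have "\<dots> = -[Tm M i,A' (Suc i)] ((\<alpha>' i ** a i) ** p1 i)"
        using i ty by (simp add: q1 cat_simps)
      also have "\<dots> = a (Suc i) ** (p1 (Suc i) ** Df M i)"
        unfolding T(8)[OF i] a(2)[OF i] using ty by (simp add: cat_simps)
      also have "\<dots> = (q1 (Suc i) ** q (Suc i)) ** Df M i"
        using i ty by (simp add: q1 cat_simps)
      finally show "q1 (Suc i) ** Df M' i ** q i = q1 (Suc i) ** q (Suc i) ** Df M i"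
        using ty by (simp add: cat_simps)
      have "q2 (Suc i) ** Df M' i ** q i = (q2 (Suc i) ** Df M' i) ** q i" using ty by (simp add: cat_simps)
      also have "\<dots> = \<phi>' i ** (q1 i ** q i) +[Tm M i,B' (Suc i)] \<beta>' i ** (q2 i ** q i)"
        unfolding T'(9)[OF i] using ty by (simp add: cat_simps)
      also have "\<dots> = \<phi>' i ** a i ** p1 i +[Tm M i,B' (Suc i)]
          (\<beta>' i ** h i ** p1 i +[Tm M i,B' (Suc i)] (\<beta>' i ** b i) ** p2 i)"
        using i ty by (simp add: q1 q2 cat_simps)
      also have "\<dots> = -[Tm M i,B' (Suc i)] (h (Suc i) ** \<alpha> i ** p1 i) +[Tm M i,B' (Suc i)]
          ((b (Suc i) ** \<phi> i) ** p1 i +[Tm M i,B' (Suc i)] b (Suc i) ** \<beta> i ** p2 i)"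
        unfolding h(2)[OF i] b(2)[OF i] using ty by (simp add: cat_ac)
      also have "\<dots> = h (Suc i) ** (p1 (Suc i) ** Df M i) +[Tm M i,B' (Suc i)] b (Suc i) ** (p2 (Suc i) ** Df M i)"
        unfolding T(8)[OF i] T(9)[OF i] using ty by (simp add: cat_simps)
      also have "\<dots> = (q2 (Suc i) ** q (Suc i)) ** Df M i"
        using i ty by (simp add: q2 cat_simps)
      finally show "q2 (Suc i) ** Df M' i ** q i = q2 (Suc i) ** q (Suc i) ** Df M i"
        using ty by (simp add: cat_simps)
    qed (use i in auto)
  qed
  show "\<And>i. i \<le> Suc n \<Longrightarrow> q1 i ** q i = a i ** p1 i" by (rule q1)
  show "\<And>i. i \<le> Suc n \<Longrightarrow> q2 i ** q i = h i ** p1 i +[Tm M i,B' i] b i ** p2 i" by (rule q2)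
  show "\<And>i. i \<le> Suc n \<Longrightarrow> q i \<in> arr (Tm M i) (Tm M' i)" by (rule tq)
qed

end

section \<open>Mapping cones padded by a zero object\<close>

context additive_category begin

text \<open>Both complexes share their degree 0 term and the chain map is the identity there, so
  this pair of summands would be contractible. The cone leaves it out and sees only degrees from 1
  on.\<close>

definition tail_ob :: "nat \<Rightarrow> 'o \<Rightarrow> ('o, 'm) cpx \<Rightarrow> nat \<Rightarrow> 'o"
  where "tail_ob n Z X i = (if i \<le> n then Tm X (Suc i) else Z)"
definition tail_df :: "nat \<Rightarrow> 'o \<Rightarrow> ('o, 'm) cpx \<Rightarrow> nat \<Rightarrow> 'm"
  where "tail_df n Z X i = (if i < n then Df X (Suc i) else 0[Tm X (Suc n),Z])"
definition head_ob :: "'o \<Rightarrow> ('o, 'm) cpx \<Rightarrow> nat \<Rightarrow> 'o"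
  where "head_ob Z Y i = (if i = 0 then Z else Tm Y i)"
definition head_df :: "'o \<Rightarrow> ('o, 'm) cpx \<Rightarrow> nat \<Rightarrow> 'm"
  where "head_df Z Y i = (if i = 0 then 0[Z,Tm Y (Suc 0)] else Df Y i)"

text \<open>At the ends the direct sum with the zero object is taken to be the other summand itself.
  Thus the end terms agree with those of \<open>is_mapping_cone\<close> on the nose, and maps of
  cones can be compared with identities there.\<close>

definition cone_sum where
  "cone_sum n Z X Y f M i1 i2 p1 p2 \<longleftrightarrow>
     twisted_sum n (tail_ob n Z X) (head_ob Z Y) (tail_df n Z X) (head_df Z Y) (\<lambda>i. f (Suc i)) M i1 i2 p1 p2 \<and>
     Tm M 0 = Tm X (Suc 0) \<and> Tm M (Suc n) = Tm Y (Suc n) \<and>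
     i1 0 = Idn C (Tm X (Suc 0)) \<and> p1 0 = Idn C (Tm X (Suc 0)) \<and>
     i2 (Suc n) = Idn C (Tm Y (Suc n)) \<and> p2 (Suc n) = Idn C (Tm Y (Suc n))"

lemma zero_object_Idn: "is_zero_object C Z \<Longrightarrow> Idn C Z = 0[Z,Z]"
  using zero_object_arr(1)[of Z "Idn C Z" Z] Idn_arr[of Z] by (auto simp: is_zero_object_def)

lemma zero_object_Ob: "is_zero_object C Z \<Longrightarrow> Z \<in> Ob C"
  by (simp add: is_zero_object_def)

lemma biproduct_zero_object:
  assumes "is_zero_object C Z" "A \<in> Ob C"
  shows "is_biproduct C A Z A (Idn C A) 0[Z,A] (Idn C A) 0[A,Z]"
    "is_biproduct C Z A A 0[Z,A] (Idn C A) 0[A,Z] (Idn C A)"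
  using assms zero_object_Ob[OF assms(1)]
  by (simp_all add: is_biproduct_def arrD(3)[OF Idn_arr] arrD(3)[OF zero_arr] zero_object_Idn cat_simps
      zero_left[OF Idn_arr] zero_right[OF Idn_arr] id_right[OF Idn_arr] id_right[OF zero_arr])

context
  fixes n :: nat and Z and X Y :: "('o, 'm) cpx" and f
  assumes Z: "is_zero_object C Z" and X: "X \<in> Ch n C" and Y: "Y \<in> Ch n C"
    and f: "chain_map n C X Y f"
begin

lemma tail_head_typing:
  "i \<le> Suc n \<Longrightarrow> tail_ob n Z X i \<in> Ob C" "i \<le> Suc n \<Longrightarrow> head_ob Z Y i \<in> Ob C"
  "i \<le> n \<Longrightarrow> tail_df n Z X i \<in> arr (tail_ob n Z X i) (tail_ob n Z X (Suc i))"
  "i \<le> n \<Longrightarrow> head_df Z Y i \<in> arr (head_ob Z Y i) (head_ob Z Y (Suc i))"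
  "i \<le> n \<Longrightarrow> f (Suc i) \<in> arr (tail_ob n Z X i) (head_ob Z Y (Suc i))"
  using zero_object_Ob[OF Z] Ch_Ob[OF X] Ch_Ob[OF Y] Ch_arr[OF X] Ch_arr[OF Y] chain_map_arr[OF f X Y]
  by (simp_all add: tail_ob_def head_ob_def tail_df_def head_df_def zero_arr)

lemma tail_head_rels:
  assumes i: "i < n"
  shows "tail_df n Z X (Suc i) ** tail_df n Z X i = 0[tail_ob n Z X i,tail_ob n Z X (Suc (Suc i))]"
    "head_df Z Y (Suc i) ** head_df Z Y i = 0[head_ob Z Y i,head_ob Z Y (Suc (Suc i))]"
    "head_df Z Y (Suc i) ** f (Suc i) = f (Suc (Suc i)) ** tail_df n Z X i"
proof -
  show "tail_df n Z X (Suc i) ** tail_df n Z X i = 0[tail_ob n Z X i,tail_ob n Z X (Suc (Suc i))]"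
  proof (cases "Suc i < n")
    case False
    then have "n = Suc i" using i by simp
    then show ?thesis
      using zero_left[OF Ch_arr[OF X, of "Suc i"] zero_object_Ob[OF Z]] by (simp add: tail_df_def tail_ob_def)
  qed (simp add: tail_df_def tail_ob_def Ch_zero[OF X])
  show "head_df Z Y (Suc i) ** head_df Z Y i = 0[head_ob Z Y i,head_ob Z Y (Suc (Suc i))]"
    using zero_right[OF Ch_arr[OF Y, of "Suc 0"] zero_object_Ob[OF Z]] i
    by (auto simp add: head_df_def head_ob_def Ch_zero[OF Y])
  show "head_df Z Y (Suc i) ** f (Suc i) = f (Suc (Suc i)) ** tail_df n Z X i"
    using chain_map_comm[OF f, of "Suc i"] i by (simp add: head_df_def tail_df_def)
qed

lemma cone_sum_exists: "\<exists>(M :: ('o, 'm) cpx) i1 i2 p1 p2. cone_sum n Z X Y f M i1 i2 p1 p2"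
proof -
  let ?A = "tail_ob n Z X" and ?B = "head_ob Z Y"
  \<comment> \<open>One choice for all degrees at once; the sums in degrees 0 and n + 1 are
    prescribed.\<close>
  have "\<forall>i. \<exists>b. i \<le> Suc n \<longrightarrow> (case b of (P, i1, i2, p1, p2) \<Rightarrow> is_biproduct C (?A i) (?B i) P i1 i2 p1 p2 \<and>
      (i = 0 \<longrightarrow> P = Tm X (Suc 0) \<and> i1 = Idn C (Tm X (Suc 0)) \<and> p1 = Idn C (Tm X (Suc 0))) \<and>
      (i = Suc n \<longrightarrow> P = Tm Y (Suc n) \<and> i2 = Idn C (Tm Y (Suc n)) \<and> p2 = Idn C (Tm Y (Suc n))))"
    (is "\<forall>i. \<exists>b. ?R i b")
  proof
    fix i
    consider "i = 0" | "i = Suc n" | "i \<noteq> 0" "i \<noteq> Suc n" "i \<le> Suc n" | "i > Suc n" by linarith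
    then show "\<exists>b. ?R i b"
    proof cases
      case 1
      then show ?thesis using biproduct_zero_object(1)[OF Z Ch_Ob[OF X, of "Suc 0"]]
        by (auto simp: tail_ob_def head_ob_def)
    next
      case 2
      then show ?thesis using biproduct_zero_object(2)[OF Z Ch_Ob[OF Y, of "Suc n"]]
        by (auto simp: tail_ob_def head_ob_def)
    next
      case 3
      then show ?thesis using ex_biproduct[OF tail_head_typing(1,2)[of i]] by auto
    qed auto
  qed
  from choice[OF this] obtain b where b: "\<And>i. ?R i (b i)" by blast
  define P where "P i = fst (b i)" for i
  define i1 where "i1 i = fst (snd (b i))" for i
  define i2 where "i2 i = fst (snd (snd (b i)))" for i
  define p1 where "p1 i = fst (snd (snd (snd (b i))))" for i
  define p2 where "p2 i = snd (snd (snd (snd (b i))))" for i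
  have bp: "is_biproduct C (?A i) (?B i) (P i) (i1 i) (i2 i) (p1 i) (p2 i)" if "i \<le> Suc n" for i
    using b[of i] that by (simp add: P_def i1_def i2_def p1_def p2_def split: prod.splits)
  have ends: "P 0 = Tm X (Suc 0)" "i1 0 = Idn C (Tm X (Suc 0))" "p1 0 = Idn C (Tm X (Suc 0))"
    "P (Suc n) = Tm Y (Suc n)" "i2 (Suc n) = Idn C (Tm Y (Suc n))" "p2 (Suc n) = Idn C (Tm Y (Suc n))"
    using b[of 0] b[of "Suc n"] by (simp_all add: P_def i1_def i2_def p1_def p2_def split: prod.splits)
  define D where "D i = i1 (Suc i) ** -[P i,?A (Suc i)] (tail_df n Z X i ** p1 i) +[P i,P (Suc i)]
    i2 (Suc i) ** (f (Suc i) ** p1 i +[P i,?B (Suc i)] head_df Z Y i ** p2 i)" for i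
  have D: "D i \<in> arr (P i) (P (Suc i))"
    "p1 (Suc i) ** D i = -[P i,?A (Suc i)] (tail_df n Z X i ** p1 i)"
    "p2 (Suc i) ** D i = f (Suc i) ** p1 i +[P i,?B (Suc i)] head_df Z Y i ** p2 i"
    if i: "i \<le> n" for i
  proof -
    have le: "i \<le> Suc n" "Suc i \<le> Suc n" using i by simp_all
    note B = biproductD[OF bp[OF le(1)] tail_head_typing(1,2)[OF le(1)]]
      and B' = bp[OF le(2)] tail_head_typing(1,2)[OF le(2)]
    note ty = tail_head_typing(3-5)[OF i] tail_head_typing(1,2)[OF le(2)] B(1-4) biproductD(1-4)[OF B'] arrD(2)[OF B(1)]
    show "D i \<in> arr (P i) (P (Suc i))" using ty by (simp add: D_def typing)
    show "p1 (Suc i) ** D i = -[P i,?A (Suc i)] (tail_df n Z X i ** p1 i)"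
      "p2 (Suc i) ** D i = f (Suc i) ** p1 i +[P i,?B (Suc i)] head_df Z Y i ** p2 i"
      using ty biproductD(5-8)[OF B'] biproduct_comp[OF B'] by (simp_all add: D_def cat_simps)
  qed
  have "cone_sum n Z X Y f \<lparr>Tm = P, Df = D\<rparr> i1 i2 p1 p2"
    using D bp ends tail_head_typing by (simp add: cone_sum_def twisted_sum_def)
  then show ?thesis by (intro exI)
qed

lemma is_mapping_cone_of_cone_sum:
  assumes c: "cone_sum n Z X Y f M i1 i2 p1 p2" and n: "1 \<le> n"
  shows "is_mapping_cone n C X Y f M"
proof -
  have tw: "twisted_sum n (tail_ob n Z X) (head_ob Z Y) (tail_df n Z X) (head_df Z Y) (\<lambda>i. f (Suc i)) M i1 i2 p1 p2"
    and ends: "Tm M 0 = Tm X (Suc 0)" "i1 0 = Idn C (Tm X (Suc 0))" "p1 0 = Idn C (Tm X (Suc 0))"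
    "Tm M (Suc n) = Tm Y (Suc n)" "i2 (Suc n) = Idn C (Tm Y (Suc n))" "p2 (Suc n) = Idn C (Tm Y (Suc n))"
    using c by (simp_all add: cone_sum_def)
  note T = twisted_sumD[OF tw]
  have comps: "p1 (Suc i) ** Df M i ** i1 i = -[tail_ob n Z X i,tail_ob n Z X (Suc i)] (tail_df n Z X i)"
    "p1 (Suc i) ** Df M i ** i2 i = 0[head_ob Z Y i,tail_ob n Z X (Suc i)]"
    "p2 (Suc i) ** Df M i ** i1 i = f (Suc i)" "p2 (Suc i) ** Df M i ** i2 i = head_df Z Y i"
    if i: "i \<le> n" for i
  proof -
    have le: "i \<le> Suc n" "Suc i \<le> Suc n" using i by simp_all
    note B = biproductD[OF T(3)[OF le(1)] T(1,2)[OF le(1)]]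
    note ty = B T(4-7)[OF i] T(1,2)[OF le(2)] T(1,2)[OF le(1)] T(12,13)[OF le(2)]
    show "p1 (Suc i) ** Df M i ** i1 i = -[tail_ob n Z X i,tail_ob n Z X (Suc i)] (tail_df n Z X i)"
      "p1 (Suc i) ** Df M i ** i2 i = 0[head_ob Z Y i,tail_ob n Z X (Suc i)]"
      using ty comp_eq_comp[OF T(8)[OF i] T(12)[OF le(2)] T(7)[OF i] intoI[OF B(1)]]
        comp_eq_comp[OF T(8)[OF i] T(12)[OF le(2)] T(7)[OF i] intoI[OF B(2)]]
      by (simp_all add: cat_simps)
    show "p2 (Suc i) ** Df M i ** i1 i = f (Suc i)" "p2 (Suc i) ** Df M i ** i2 i = head_df Z Y i"
      using ty comp_eq_comp[OF T(9)[OF i] T(13)[OF le(2)] T(7)[OF i] intoI[OF B(1)]]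
        comp_eq_comp[OF T(9)[OF i] T(13)[OF le(2)] T(7)[OF i] intoI[OF B(2)]]
      by (simp_all add: cat_simps)
  qed
  have M: "M \<in> Ch n C" by (rule twisted_sum_Ch[OF tw tail_head_rels])
  show ?thesis
    unfolding is_mapping_cone_def
  proof (intro conjI M, simp add: ends, simp add: ends, rule exI[of _ i1], rule exI[of _ i2],
      rule exI[of _ p1], rule exI[of _ p2], intro conjI)
    show "\<forall>i\<in>{1..n}. is_biproduct C (Tm X (i + 1)) (Tm Y i) (Tm M i) (i1 i) (i2 i) (p1 i) (p2 i)"
    proof
      fix i assume "i \<in> {1..n}"
      then show "is_biproduct C (Tm X (i + 1)) (Tm Y i) (Tm M i) (i1 i) (i2 i) (p1 i) (p2 i)"
        using T(3)[of i] by (simp add: tail_ob_def head_ob_def)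
    qed
    have "Df M 0 ** i1 0 = Df M 0" using T(7)[of 0] ends by (simp add: id_right)
    then show "p1 1 ** Df M 0 = -[Tm X 1,Tm X 2] (Df X 1)" "p2 1 ** Df M 0 = f 1"
      using comps(1,3)[of 0] n by (auto simp: tail_ob_def tail_df_def eval_nat_numeral split: if_splits)
    have "Df M n ** i1 n \<in> arr (Tm X (Suc n)) (Tm Y (Suc n))" "Df M n ** i2 n \<in> arr (Tm Y n) (Tm Y (Suc n))"
      using T(7)[of n] T(10,11)[of n] ends n by (auto simp: tail_ob_def head_ob_def intro: comp_arr)
    then show "Df M n ** i1 n = f (n + 1)" "Df M n ** i2 n = Df Y n"
      using comps(3,4)[of n] n ends by (auto simp: head_df_def id_left intoI)
    show "\<forall>i\<in>{1..<n}. p1 (i + 1) ** Df M i ** i1 i = -[Tm X (i + 1),Tm X (i + 2)] (Df X (i + 1)) \<and>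
           p1 (i + 1) ** Df M i ** i2 i = 0[Tm Y i,Tm X (i + 2)] \<and>
           p2 (i + 1) ** Df M i ** i1 i = f (i + 1) \<and> p2 (i + 1) ** Df M i ** i2 i = Df Y i"
      using comps by (simp add: tail_ob_def head_ob_def tail_df_def head_df_def)
  qed
qed

lemma cone_sum_of_is_mapping_cone:
  assumes c: "is_mapping_cone n C X Y f M" and n: "1 \<le> n"
  shows "\<exists>i1 i2 p1 p2. cone_sum n Z X Y f M i1 i2 p1 p2"
proof -
  obtain i1 i2 p1 p2 where M: "M \<in> Ch n C" "Tm M 0 = Tm X (Suc 0)" "Tm M (Suc n) = Tm Y (Suc n)"
    and bp': "\<forall>i\<in>{1..n}. is_biproduct C (Tm X (i + 1)) (Tm Y i) (Tm M i) (i1 i) (i2 i) (p1 i) (p2 i)"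
    and d0: "p1 (Suc 0) ** Df M 0 = -[Tm X (Suc 0),Tm X (Suc (Suc 0))] (Df X (Suc 0))"
      "p2 (Suc 0) ** Df M 0 = f (Suc 0)"
    and d': "\<forall>i\<in>{1..<n}. p1 (i + 1) ** Df M i ** i1 i = -[Tm X (i + 1),Tm X (i + 2)] (Df X (i + 1)) \<and>
           p1 (i + 1) ** Df M i ** i2 i = 0[Tm Y i,Tm X (i + 2)] \<and>
           p2 (i + 1) ** Df M i ** i1 i = f (i + 1) \<and> p2 (i + 1) ** Df M i ** i2 i = Df Y i"
    and dn: "Df M n ** i1 n = f (Suc n)" "Df M n ** i2 n = Df Y n"
    using c unfolding is_mapping_cone_def by (auto simp: eval_nat_numeral simp del: ball_simps)
  have bp: "is_biproduct C (Tm X (Suc i)) (Tm Y i) (Tm M i) (i1 i) (i2 i) (p1 i) (p2 i)" if "0 < i" "i \<le> n" for i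
    using bp' that by simp
  have d: "p1 (Suc i) ** Df M i ** i1 i = -[Tm X (Suc i),Tm X (Suc (Suc i))] (Df X (Suc i)) \<and>
           p1 (Suc i) ** Df M i ** i2 i = 0[Tm Y i,Tm X (Suc (Suc i))] \<and>
           p2 (Suc i) ** Df M i ** i1 i = f (Suc i) \<and> p2 (Suc i) ** Df M i ** i2 i = Df Y i"
    if "0 < i" "i < n" for i
    using d' that by simp
  define J1 where "J1 i = (if i = 0 then Idn C (Tm X (Suc 0)) else if i \<le> n then i1 i else 0[Z,Tm Y (Suc n)])" for i
  define J2 where "J2 i = (if i = 0 then 0[Z,Tm X (Suc 0)] else if i \<le> n then i2 i else Idn C (Tm Y (Suc n)))" for i
  define P1 where "P1 i = (if i = 0 then Idn C (Tm X (Suc 0)) else if i \<le> n then p1 i else 0[Tm Y (Suc n),Z])" for i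
  define P2 where "P2 i = (if i = 0 then 0[Tm X (Suc 0),Z] else if i \<le> n then p2 i else Idn C (Tm Y (Suc n)))" for i
  let ?A = "tail_ob n Z X" and ?B = "head_ob Z Y"
  have BP: "is_biproduct C (?A i) (?B i) (Tm M i) (J1 i) (J2 i) (P1 i) (P2 i)" if le: "i \<le> Suc n" for i
  proof -
    consider "i = 0" | "i = Suc n" | "0 < i" "i \<le> n" using le by linarith
    then show ?thesis
      using M(2,3) bp biproduct_zero_object(1)[OF Z Ch_Ob[OF X, of "Suc 0"]]
        biproduct_zero_object(2)[OF Z Ch_Ob[OF Y, of "Suc n"]]
      by cases (simp_all add: J1_def J2_def P1_def P2_def tail_ob_def head_ob_def)
  qed
  have Dm: "Df M i \<in> arr (Tm M i) (Tm M (Suc i))" if "i \<le> n" for i using that by (rule Ch_arr[OF M(1)])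
  have eqs: "P1 (Suc i) ** Df M i = -[Tm M i,?A (Suc i)] (tail_df n Z X i ** P1 i)"
    "P2 (Suc i) ** Df M i = f (Suc i) ** P1 i +[Tm M i,?B (Suc i)] head_df Z Y i ** P2 i"
    if i: "i \<le> n" for i
  proof -
    have le: "i \<le> Suc n" "Suc i \<le> Suc n" using i by simp_all
    note B = BP[OF le(1)] tail_head_typing(1,2)[OF le(1)]
      and B' = biproductD[OF BP[OF le(2)] tail_head_typing(1,2)[OF le(2)]]
    note ty = biproductD(1-4)[OF B] B'(3,4) Dm[OF i] tail_head_typing(3-5)[OF i]
      tail_head_typing(1,2)[OF le(1)] tail_head_typing(1,2)[OF le(2)]
    \<comment> \<open>Only the entries of the differential are given. The row equations follow by
      testing on both injections, the padded ends being separate cases.\<close>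
    have comps: "P1 (Suc i) ** Df M i ** J1 i = -[?A i,?A (Suc i)] (tail_df n Z X i) \<and>
      P1 (Suc i) ** Df M i ** J2 i = 0[?B i,?A (Suc i)] \<and>
      P2 (Suc i) ** Df M i ** J1 i = f (Suc i) \<and> P2 (Suc i) ** Df M i ** J2 i = head_df Z Y i"
    proof -
      consider "i = 0" | "i = n" "0 < i" | "0 < i" "i < n" using i by linarith
      then show ?thesis
      proof cases
        case 1
        have "p1 (Suc 0) ** 0[Z,Tm M (Suc 0)] = 0[Z,Tm X (Suc (Suc 0))]"
          "p2 (Suc 0) ** 0[Z,Tm M (Suc 0)] = 0[Z,Tm Y (Suc 0)]"
          using biproductD(3,4)[OF bp[of "Suc 0"]] Ch_Ob[OF X] Ch_Ob[OF Y] n zero_object_Ob[OF Z]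
          by (simp_all add: zero_right)
        then show ?thesis
          using 1 n d0 Dm[of 0] M(2) zero_object_Ob[OF Z]
          by (simp add: J1_def J2_def P1_def P2_def tail_ob_def head_ob_def tail_df_def head_df_def id_right zero_right)
      next
        case 2
        have "0[Tm Y (Suc n),Z] ** f (Suc n) = 0[Tm X (Suc n),Z]"
          "0[Tm Y (Suc n),Z] ** Df Y n = 0[Tm Y n,Z]"
          using chain_map_arr[OF f X Y, of "Suc n"] Ch_arr[OF Y, of n] zero_object_Ob[OF Z]
          by (simp_all add: zero_left)
        then show ?thesis
          using 2 n dn chain_map_arr[OF f X Y, of "Suc n"] Ch_arr[OF Y, of n] zero_object_Ob[OF Z] Ch_Ob[OF X, of "Suc n"]
          by (simp add: J1_def J2_def P1_def P2_def tail_ob_def head_ob_def tail_df_def head_df_def id_left intoI neg_zero)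
      next
        case 3
        then show ?thesis
          using d by (simp add: J1_def J2_def P1_def P2_def tail_ob_def head_ob_def tail_df_def head_df_def)
      qed
    qed
    show "P1 (Suc i) ** Df M i = -[Tm M i,?A (Suc i)] (tail_df n Z X i ** P1 i)"
      using ty comps biproductD(5-8)[OF B]
      by - (rule biproduct_outof_eqI[OF B, where D = "?A (Suc i)"], simp_all add: cat_simps)
    show "P2 (Suc i) ** Df M i = f (Suc i) ** P1 i +[Tm M i,?B (Suc i)] head_df Z Y i ** P2 i"
      using ty comps biproductD(5-8)[OF B]
      by - (rule biproduct_outof_eqI[OF B, where D = "?B (Suc i)"], simp_all add: cat_simps)
  qed
  have "twisted_sum n ?A ?B (tail_df n Z X) (head_df Z Y) (\<lambda>i. f (Suc i)) M J1 J2 P1 P2"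
    using BP Dm eqs tail_head_typing by (simp add: twisted_sum_def)
  then have "cone_sum n Z X Y f M J1 J2 P1 P2"
    using M n by (simp add: cone_sum_def J1_def J2_def P1_def P2_def)
  then show ?thesis by (intro exI)
qed

end
end

section \<open>Maps between cones and exactness of cones\<close>

context additive_category begin

text \<open>Because the homotopy is relative to the ends, it leaves no trace in the outer components
  of the induced map, which are \<open>a (Suc 0)\<close> and \<open>b (Suc n)\<close>.\<close>

lemma cone_sum_map:
  assumes Z: "is_zero_object C Z" and n: "1 \<le> n"
    and Ch: "X \<in> Ch n C" "Y \<in> Ch n C" "X' \<in> Ch n C" "Y' \<in> Ch n C"
    and f: "chain_map n C X Y f" and f': "chain_map n C X' Y' f'"
    and M: "cone_sum n Z X Y f M i1 i2 p1 p2" and M': "cone_sum n Z X' Y' f' M' j1 j2 q1 q2"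
    and a: "chain_map n C X X' a" and b: "chain_map n C Y Y' b"
    and k: "rel_homotopy n X Y' (\<lambda>i. b i ** f i) (\<lambda>i. f' i ** a i) k"
  obtains q where "chain_map n C M M' q" "q 0 = a (Suc 0)" "q (Suc n) = b (Suc n)"
    "\<And>i. 0 < i \<Longrightarrow> i \<le> n \<Longrightarrow> q i ** i1 i = j1 i ** a (Suc i) +[Tm X (Suc i),Tm M' i] j2 i ** k i"
    "\<And>i. 0 < i \<Longrightarrow> i \<le> n \<Longrightarrow> q i ** i2 i = j2 i ** b i"
    "\<And>i. 0 < i \<Longrightarrow> i \<le> n \<Longrightarrow> q i = j1 i ** a (Suc i) ** p1 i +[Tm M i,Tm M' i]
      j2 i ** (k i ** p1 i +[Tm M i,Tm Y' i] b i ** p2 i)"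
proof -
  let ?A = "tail_ob n Z X" and ?A' = "tail_ob n Z X'" and ?B = "head_ob Z Y" and ?B' = "head_ob Z Y'"
  define A where "A i = (if i \<le> n then a (Suc i) else 0[Z,Z])" for i
  define B where "B i = (if i = 0 then 0[Z,Z] else b i)" for i
  \<comment> \<open>In degrees 0 and n + 1 of the cones one summand is zero, so no homotopy
    component fits there. The relations still hold because \<open>k 0\<close> is zero and
    \<open>k n\<close> is killed by the last differential.\<close>
  define h where "h i = (if i = 0 then 0[Tm X (Suc 0),Z] else if i \<le> n then k i else 0[Z,Tm Y' (Suc n)])" for i
  have tw: "twisted_sum n ?A ?B (tail_df n Z X) (head_df Z Y) (\<lambda>i. f (Suc i)) M i1 i2 p1 p2"
    and e: "Tm M 0 = Tm X (Suc 0)" "Tm M (Suc n) = Tm Y (Suc n)" "i1 0 = Idn C (Tm X (Suc 0))"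
      "p1 0 = Idn C (Tm X (Suc 0))" "i2 (Suc n) = Idn C (Tm Y (Suc n))" "p2 (Suc n) = Idn C (Tm Y (Suc n))"
    and tw': "twisted_sum n ?A' ?B' (tail_df n Z X') (head_df Z Y') (\<lambda>i. f' (Suc i)) M' j1 j2 q1 q2"
    and e': "Tm M' 0 = Tm X' (Suc 0)" "Tm M' (Suc n) = Tm Y' (Suc n)" "j1 0 = Idn C (Tm X' (Suc 0))"
      "q1 0 = Idn C (Tm X' (Suc 0))" "j2 (Suc n) = Idn C (Tm Y' (Suc n))" "q2 (Suc n) = Idn C (Tm Y' (Suc n))"
    using M M' by (simp_all add: cone_sum_def)
  note T = twisted_sumD[OF tw] and T' = twisted_sumD[OF tw']
  note ZO = zero_object_Ob[OF Z] and K = rel_homotopyD[OF k]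
  note Ar = Ch_arr[OF Ch(1)] Ch_arr[OF Ch(2)] Ch_arr[OF Ch(3)] Ch_arr[OF Ch(4)]
  note Obs = Ch_Ob[OF Ch(1)] Ch_Ob[OF Ch(2)] Ch_Ob[OF Ch(3)] Ch_Ob[OF Ch(4)]
  note aa = chain_map_arr[OF a Ch(1,3)] and bb = chain_map_arr[OF b Ch(2,4)]
  have A1: "A i \<in> arr (?A i) (?A' i)" and B1: "B i \<in> arr (?B i) (?B' i)" and h1: "h i \<in> arr (?A i) (?B' i)"
    if "i \<le> Suc n" for i
    using that aa bb ZO K(1) Obs
    by (cases "i = Suc n"; auto simp: A_def B_def h_def tail_ob_def head_ob_def intro: zero_arr)+
  have A2: "tail_df n Z X' i ** A i = A (Suc i) ** tail_df n Z X i" if i: "i \<le> n" for i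
  proof (cases "i = n")
    case True
    then show ?thesis using aa[of "Suc n"] ZO Obs(1)[of "Suc n"]
      by (simp add: A_def tail_df_def zero_left zero_left[OF zero_arr])
  next
    case False
    then show ?thesis using i chain_map_comm[OF a, of "Suc i"] by (simp add: A_def tail_df_def)
  qed
  have B2: "head_df Z Y' i ** B i = B (Suc i) ** head_df Z Y i" if i: "i \<le> n" for i
  proof (cases "i = 0")
    case True
    then show ?thesis using bb[of "Suc 0"] ZO Obs(4)[of "Suc 0"]
      by (simp add: B_def head_df_def zero_right zero_left[OF zero_arr])
  next
    case False
    then show ?thesis using i chain_map_comm[OF b, of i] by (simp add: B_def head_df_def)
  qed
  have h2: "B (Suc i) ** f (Suc i) = f' (Suc i) ** A i +[?A i,?B' (Suc i)]
      (head_df Z Y' i ** h i +[?A i,?B' (Suc i)] h (Suc i) ** tail_df n Z X i)" if i: "i \<le> n" for i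
  proof -
    consider "i = 0" | "0 < i" "i < n" | "i = n" "0 < n" using i n by linarith
    then show ?thesis
    proof cases
      case 1
      have "0[Z,Tm Y' (Suc 0)] ** 0[Tm X (Suc 0),Z] = 0[Tm X (Suc 0),Tm Y' (Suc 0)]"
        "Df Y' 0 ** k 0 = 0[Tm X (Suc 0),Tm Y' (Suc 0)]"
        unfolding K(2) using ZO Obs Ar(4)[of 0] by (simp_all add: zero_left[OF zero_arr] zero_right)
      then show ?thesis using 1 n K(6)[of 0]
        by (simp add: A_def B_def h_def tail_ob_def head_ob_def head_df_def tail_df_def)
    next
      case 2
      then show ?thesis using K(6)[of i]
        by (simp add: A_def B_def h_def tail_ob_def head_ob_def head_df_def tail_df_def)
    next
      case 3
      have "f' (Suc n) ** a (Suc n) \<in> arr (Tm X (Suc n)) (Tm Y' (Suc n))"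
        using chain_map_arr[OF f' Ch(3,4), of "Suc n"] aa[of "Suc n"] by (simp add: comp_arr)
      then show ?thesis using 3 K(3,5) ZO Obs
        by (simp add: A_def B_def h_def tail_ob_def head_ob_def head_df_def tail_df_def add_zero zero_left[OF zero_arr] zero_arr)
    qed
  qed
  define q where "q i = j1 i ** A i ** p1 i +[Tm M i,Tm M' i]
      j2 i ** (h i ** p1 i +[Tm M i,?B' i] B i ** p2 i)" for i
  note tm = twisted_sum_map[OF tw tw' A1 A2 B1 B2 h1 h2 q_def]
  show thesis
  proof
    show "chain_map n C M M' q" by (rule tm(1))
    have "A 0 \<in> arr (Tm X (Suc 0)) (Tm X' (Suc 0))" using A1[of 0] by (simp add: tail_ob_def)
    moreover have "q 0 \<in> arr (Tm X (Suc 0)) (Tm X' (Suc 0))" using tm(4)[of 0] e e' by simp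
    ultimately show "q 0 = a (Suc 0)" using tm(2)[of 0] e e' by (simp add: id_left id_right intoI A_def)
    have "q (Suc n) \<in> arr (Tm Y (Suc n)) (Tm Y' (Suc n))" using tm(4)[of "Suc n"] e e' by simp
    moreover have "h (Suc n) ** p1 (Suc n) = 0[Tm Y (Suc n),Tm Y' (Suc n)]"
      using T(12)[of "Suc n"] Obs(4)[of "Suc n"] e by (simp add: h_def tail_ob_def zero_left)
    ultimately show "q (Suc n) = b (Suc n)" using tm(3)[of "Suc n"] e e' bb[of "Suc n"]
      by (simp add: id_left id_right intoI B_def head_ob_def add_zero)
    fix i assume i: "0 < i" "i \<le> n"
    have le: "i \<le> Suc n" using i by simp
    have ty: "i1 i \<in> arr (Tm X (Suc i)) (Tm M i)" "i2 i \<in> arr (Tm Y i) (Tm M i)"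
      "p1 i \<in> arr (Tm M i) (Tm X (Suc i))" "p2 i \<in> arr (Tm M i) (Tm Y i)"
      "j1 i \<in> arr (Tm X' (Suc i)) (Tm M' i)" "j2 i \<in> arr (Tm Y' i) (Tm M' i)"
      "a (Suc i) \<in> arr (Tm X (Suc i)) (Tm X' (Suc i))" "b i \<in> arr (Tm Y i) (Tm Y' i)"
      "k i \<in> arr (Tm X (Suc i)) (Tm Y' i)" "Tm Y i \<in> Ob C" "Tm X (Suc i) \<in> Ob C" "Tm Y' i \<in> Ob C"
      "Tm M' i \<in> Ob C"
      using T(10-13)[of i] T'(10,11)[of i] aa[of "Suc i"] bb[of i] K(1)[of i] i Obs
        arrD(2)[OF T'(10)[of i]]
      by (simp_all add: tail_ob_def head_ob_def)
    show "q i = j1 i ** a (Suc i) ** p1 i +[Tm M i,Tm M' i]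
      j2 i ** (k i ** p1 i +[Tm M i,Tm Y' i] b i ** p2 i)" (is "_ = ?q")
      using i by (simp add: q_def A_def h_def B_def head_ob_def)
    have "is_biproduct C (Tm X (Suc i)) (Tm Y i) (Tm M i) (i1 i) (i2 i) (p1 i) (p2 i)"
      using T(3)[OF le] i by (simp add: tail_ob_def head_ob_def)
    note bp = biproductD(5-8)[OF this ty(11,10)]
    show "q i ** i1 i = j1 i ** a (Suc i) +[Tm X (Suc i),Tm M' i] j2 i ** k i"
      "q i ** i2 i = j2 i ** b i"
      unfolding \<open>q i = ?q\<close> using ty bp by (simp_all add: cat_simps)
  qed
qed

text \<open>The components of u on the two summands are treated in turn: the one on Y extends over
  the differential of Y to some v, and then the one on X agrees with v f after composition with the
  differential of X.\<close>

lemma cone_sum_cexact_step: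
  assumes n: "1 \<le> n" and X: "cexact n X" and Y: "cexact n Y"
    and f: "chain_map n C X Y f" "Tm Y 0 = Tm X 0" "f 0 = Idn C (Tm X 0)"
    and M: "cone_sum n Z X Y f M i1 i2 p1 p2"
    and i: "i < n" and u: "u \<in> arr (Tm M (Suc i)) W" "u ** Df M i = 0[Tm M i,W]"
  obtains v where "v \<in> arr (Tm Y (Suc (Suc i))) W" "u ** i2 (Suc i) = v ** Df Y (Suc i)"
    "(u ** i1 (Suc i)) ** Df X (Suc i) = (v ** f (Suc (Suc i))) ** Df X (Suc i)"
proof -
  have tw: "twisted_sum n (tail_ob n Z X) (head_ob Z Y) (tail_df n Z X) (head_df Z Y) (\<lambda>i. f (Suc i)) M i1 i2 p1 p2"
    using M by (simp add: cone_sum_def)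
  note T = twisted_sumD[OF tw]
  note XC = cexact_Ch[OF X] and YC = cexact_Ch[OF Y]
  have le: "i \<le> n" "i \<le> Suc n" "Suc i \<le> Suc n" using i by simp_all
  have S: "tail_ob n Z X i = Tm X (Suc i)" "tail_ob n Z X (Suc i) = Tm X (Suc (Suc i))"
    "tail_df n Z X i = Df X (Suc i)" "head_ob Z Y (Suc i) = Tm Y (Suc i)"
    using i by (simp_all add: tail_ob_def tail_df_def head_ob_def)
  note B = T(3)[OF le(2)] T(1,2)[OF le(2)]
  note ty = T(7)[OF le(1)] T(10-13)[OF le(2)] T(10-13)[OF le(3)] T(4-6)[OF le(1)] T(1,2)[OF le(2)] T(1,2)[OF le(3)]
  have D1: "Df M i ** i1 i = -[Tm X (Suc i),Tm M (Suc i)] (i1 (Suc i) ** Df X (Suc i)) +[Tm X (Suc i),Tm M (Suc i)] i2 (Suc i) ** f (Suc i)"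
    and D2: "Df M i ** i2 i = i2 (Suc i) ** head_df Z Y i"
  proof -
    note B' = T(3)[OF le(3)] T(1,2)[OF le(3)]
    note bp = biproductD(5-8)[OF B] biproductD(5-8)[OF B'] biproduct_comp[OF B']
    show "Df M i ** i1 i = -[Tm X (Suc i),Tm M (Suc i)] (i1 (Suc i) ** Df X (Suc i)) +[Tm X (Suc i),Tm M (Suc i)] i2 (Suc i) ** f (Suc i)"
      using ty bp comp_eq_comp[OF T(8)[OF le(1)] T(12)[OF le(3)] T(7)[OF le(1)] intoI[OF T(10)[OF le(2)]]]
        comp_eq_comp[OF T(9)[OF le(1)] T(13)[OF le(3)] T(7)[OF le(1)] intoI[OF T(10)[OF le(2)]]]
      unfolding S[symmetric]
      by - (rule biproduct_into_eqI[OF B', where D = "tail_ob n Z X i"], simp_all add: cat_simps)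
    show "Df M i ** i2 i = i2 (Suc i) ** head_df Z Y i"
      using ty bp comp_eq_comp[OF T(8)[OF le(1)] T(12)[OF le(3)] T(7)[OF le(1)] intoI[OF T(11)[OF le(2)]]]
        comp_eq_comp[OF T(9)[OF le(1)] T(13)[OF le(3)] T(7)[OF le(1)] intoI[OF T(11)[OF le(2)]]]
      by - (rule biproduct_into_eqI[OF B', where D = "head_ob Z Y i"], simp_all add: cat_simps)
  qed
  note ty' = ty[unfolded S] arrD(2)[OF u(1)]
  have W: "W \<in> Ob C" by (rule arrD[OF u(1)])
  have "0[Tm X (Suc i),W] = (u ** Df M i) ** i1 i"
    using u ty' by (simp add: cat_simps)
  also have "\<dots> = u ** (Df M i ** i1 i)" using u(1) ty' by (simp add: cat_simps)
  also have "\<dots> = -[Tm X (Suc i),W] (u ** i1 (Suc i) ** Df X (Suc i)) +[Tm X (Suc i),W] u ** i2 (Suc i) ** f (Suc i)"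
    unfolding D1 using u(1) ty' by (simp add: cat_simps)
  finally have "u ** i2 (Suc i) ** f (Suc i) +[Tm X (Suc i),W] -[Tm X (Suc i),W] (u ** i1 (Suc i) ** Df X (Suc i)) = 0[Tm X (Suc i),W]"
    using u(1) ty' by (simp add: cat_ac)
  then have E1: "u ** i2 (Suc i) ** f (Suc i) = u ** i1 (Suc i) ** Df X (Suc i)"
    using u(1) ty' by (subst (asm) diff_eq_zero) (simp_all add: typing)
  have E2: "(u ** i2 (Suc i)) ** Df Y i = 0[Tm Y i,W]"
  proof (cases "i = 0")
    case True
    have ty0: "Df X 0 \<in> arr (Tm X 0) (Tm X (Suc 0))" "Df Y 0 \<in> arr (Tm X 0) (Tm Y (Suc 0))"
      "Df X (Suc 0) \<in> arr (Tm X (Suc 0)) (Tm X (Suc (Suc 0)))" "f (Suc 0) \<in> arr (Tm X (Suc 0)) (Tm Y (Suc 0))"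
      using Ch_arr[OF XC] Ch_arr[OF YC, of 0] f(2) n chain_map_arr[OF f(1) XC YC, of "Suc 0"] by simp_all
    \<comment> \<open>Degree 0 of Y is not part of the cone. As f is the identity there, the first
      differential of Y factors through that of X, whose next composite is zero.\<close>
    have "Df Y 0 = f (Suc 0) ** Df X 0"
      using chain_map_comm[OF f(1), of 0] f(3) ty0 by (simp add: id_right)
    then have "(u ** i2 (Suc 0)) ** Df Y 0 = (u ** i2 (Suc 0) ** f (Suc 0)) ** Df X 0"
      using ty0 u(1) ty' True by (simp add: cat_simps)
    also have "\<dots> = (u ** i1 (Suc 0)) ** (Df X (Suc 0) ** Df X 0)"
      using E1 ty0 u(1) ty' True by (simp add: cat_simps)
    also have "\<dots> = 0[Tm X 0,W]"
      using Ch_zero[OF XC, of 0] n u(1) ty' True Ch_Ob[OF XC, of 0] by (simp add: cat_simps)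
    finally show ?thesis using True f(2) by simp
  next
    case False
    have "0[Tm Y i,W] = (u ** Df M i) ** i2 i"
      using u ty' False by (simp add: cat_simps head_ob_def)
    also have "\<dots> = u ** (Df M i ** i2 i)" using u(1) ty' by (simp add: cat_simps)
    also have "\<dots> = (u ** i2 (Suc i)) ** Df Y i"
      unfolding D2 using u(1) ty' False by (simp add: cat_simps head_ob_def head_df_def)
    finally show ?thesis by simp
  qed
  have u2: "u ** i2 (Suc i) \<in> arr (Tm Y (Suc i)) W" using u(1) ty' by (simp add: typing)
  obtain v where v: "v \<in> arr (Tm Y (Suc (Suc i))) W" "u ** i2 (Suc i) = v ** Df Y (Suc i)"
    using cexactE[OF Y i u2 E2] by blast
  have ty2: "f (Suc (Suc i)) \<in> arr (Tm X (Suc (Suc i))) (Tm Y (Suc (Suc i)))"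
    "Df Y (Suc i) \<in> arr (Tm Y (Suc i)) (Tm Y (Suc (Suc i)))"
    using i chain_map_arr[OF f(1) XC YC, of "Suc (Suc i)"] Ch_arr[OF YC, of "Suc i"] by simp_all
  have "(u ** i1 (Suc i)) ** Df X (Suc i) = (u ** i2 (Suc i)) ** f (Suc i)"
    using E1 u(1) ty' by (simp add: cat_simps)
  also have "\<dots> = v ** (Df Y (Suc i) ** f (Suc i))"
    unfolding v(2) using v(1) ty2 ty' by (simp add: cat_simps)
  also have "\<dots> = (v ** f (Suc (Suc i))) ** Df X (Suc i)"
    unfolding chain_map_comm[OF f(1), of "Suc i", OF Suc_leI[OF i]] using v(1) ty2 ty' by (simp add: cat_simps)
  finally show thesis using that v by blast
qed

text \<open>Below degree n, exactness of X' and Y' suffices. In degree n the complex X' offers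
  nothing after its last differential; there the exactness of the other cone M is used, through a
  map q that is the identity in degree n + 1 and triangular in degree n.\<close>

lemma cone_sum_cexact:
  assumes Z: "is_zero_object C Z" and n: "1 \<le> n"
    and Ch: "X \<in> Ch n C" "Y \<in> Ch n C"
    and M: "cone_sum n Z X Y f M i1 i2 p1 p2" and M': "cone_sum n Z X' Y' f' M' j1 j2 q1 q2"
    and MC: "M' \<in> Ch n C"
    and f: "chain_map n C X Y f"
    and f': "chain_map n C X' Y' f'" "Tm Y' 0 = Tm X' 0" "f' 0 = Idn C (Tm X' 0)"
    and ex: "cexact n M" "cexact n X'" "cexact n Y'"
    and a: "chain_map_fixing_ends n C X X' a" and b: "chain_map_fixing_ends n C Y Y' b"
    and b': "chain_map_fixing_ends n C Y' Y b'"
    and q: "chain_map n C M M' q" "q (Suc n) = Idn C (Tm Y (Suc n))"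
    and k: "k n \<in> arr (Tm X (Suc n)) (Tm Y' n)"
    and qi: "q n ** i1 n = j1 n ** a (Suc n) +[Tm X (Suc n),Tm M' n] j2 n ** k n"
      "q n ** i2 n = j2 n ** b n"
  shows "cexact n M'"
  unfolding cexact_def
proof (intro conjI allI ballI impI MC)
  fix i W u
  assume i: "i < n" and u: "u \<in> arr (Tm M' (Suc i)) W" "u ** Df M' i = 0[Tm M' i,W]"
  have tw: "twisted_sum n (tail_ob n Z X') (head_ob Z Y') (tail_df n Z X') (head_df Z Y') (\<lambda>i. f' (Suc i)) M' j1 j2 q1 q2"
    using M' by (simp add: cone_sum_def)
  note T = twisted_sumD[OF tw]
  note XC = cexact_Ch[OF ex(2)] and YC = cexact_Ch[OF ex(3)] and W = arrD(2)[OF u(1)]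
  have le: "i \<le> n" "Suc i \<le> n" "Suc i \<le> Suc n" "Suc (Suc i) \<le> Suc n" using i by simp_all
  have bp: "is_biproduct C (Tm X' (Suc (Suc i))) (Tm Y' (Suc i)) (Tm M' (Suc i)) (j1 (Suc i)) (j2 (Suc i)) (q1 (Suc i)) (q2 (Suc i))"
    "Tm X' (Suc (Suc i)) \<in> Ob C" "Tm Y' (Suc i) \<in> Ob C"
    using T(3)[OF le(3)] i Ch_Ob[OF XC] Ch_Ob[OF YC] by (simp_all add: tail_ob_def head_ob_def)
  note J = biproductD[OF bp]
  have ty: "f' (Suc (Suc i)) \<in> arr (Tm X' (Suc (Suc i))) (Tm Y' (Suc (Suc i)))"
    "Df Y' (Suc i) \<in> arr (Tm Y' (Suc i)) (Tm Y' (Suc (Suc i)))"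
    "Df X' (Suc i) \<in> arr (Tm X' (Suc i)) (Tm X' (Suc (Suc i)))"
    "Df M' (Suc i) \<in> arr (Tm M' (Suc i)) (Tm M' (Suc (Suc i)))"
    using i chain_map_arr[OF f'(1) XC YC, of "Suc (Suc i)"] Ch_arr[OF YC, of "Suc i"] Ch_arr[OF XC, of "Suc i"]
      T(7)[of "Suc i"] by simp_all
  show "\<exists>v\<in>arr (Tm M' (Suc (Suc i))) W. u = v ** Df M' (Suc i)"
  proof (cases "Suc i < n")
    case True
    obtain v where v: "v \<in> arr (Tm Y' (Suc (Suc i))) W" "u ** j2 (Suc i) = v ** Df Y' (Suc i)"
      "(u ** j1 (Suc i)) ** Df X' (Suc i) = (v ** f' (Suc (Suc i))) ** Df X' (Suc i)"
      by (rule cone_sum_cexact_step[OF n ex(2,3) f' M' i u])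
    define y where "y = u ** j1 (Suc i) +[Tm X' (Suc (Suc i)),W] -[Tm X' (Suc (Suc i)),W] (v ** f' (Suc (Suc i)))"
    have y: "y \<in> arr (Tm X' (Suc (Suc i))) W" using u(1) v(1) J ty by (simp add: y_def typing)
    have "y ** Df X' (Suc i) = (u ** j1 (Suc i)) ** Df X' (Suc i) +[Tm X' (Suc i),W] -[Tm X' (Suc i),W] ((v ** f' (Suc (Suc i))) ** Df X' (Suc i))"
      using u(1) v(1) J(1-4) ty by (simp add: y_def cat_simps)
    also have "\<dots> = 0[Tm X' (Suc i),W]"
      unfolding v(3) using v(1) ty by (simp add: cat_simps)
    finally obtain w where w: "w \<in> arr (Tm X' (Suc (Suc (Suc i)))) W" "y = w ** Df X' (Suc (Suc i))"
      using cexactE[OF ex(2) True y] by blast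
    have ty': "q1 (Suc (Suc i)) \<in> arr (Tm M' (Suc (Suc i))) (Tm X' (Suc (Suc (Suc i))))"
      "q2 (Suc (Suc i)) \<in> arr (Tm M' (Suc (Suc i))) (Tm Y' (Suc (Suc i)))"
      "Df X' (Suc (Suc i)) \<in> arr (Tm X' (Suc (Suc i))) (Tm X' (Suc (Suc (Suc i))))"
      using T(12,13)[OF le(4)] Ch_arr[OF XC, of "Suc (Suc i)"] True by (simp_all add: tail_ob_def head_ob_def)
    \<comment> \<open>The sign of w compensates the sign in the first row of the differential of the
      cone.\<close>
    let ?x = "-[Tm M' (Suc (Suc i)),W] (w ** q1 (Suc (Suc i))) +[Tm M' (Suc (Suc i)),W] v ** q2 (Suc (Suc i))"
    have eqs: "q1 (Suc (Suc i)) ** Df M' (Suc i) = -[Tm M' (Suc i),Tm X' (Suc (Suc (Suc i)))] (Df X' (Suc (Suc i)) ** q1 (Suc i))"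
      "q2 (Suc (Suc i)) ** Df M' (Suc i) = f' (Suc (Suc i)) ** q1 (Suc i) +[Tm M' (Suc i),Tm Y' (Suc (Suc i))] Df Y' (Suc i) ** q2 (Suc i)"
      using T(8,9)[OF le(2)] True by (simp_all add: tail_ob_def head_ob_def tail_df_def head_df_def)
    have "?x ** Df M' (Suc i) = -[Tm M' (Suc i),W] (w ** (q1 (Suc (Suc i)) ** Df M' (Suc i))) +[Tm M' (Suc i),W]
        v ** (q2 (Suc (Suc i)) ** Df M' (Suc i))"
      using ty ty' v(1) w(1) by (simp add: cat_simps)
    also have "\<dots> = (w ** Df X' (Suc (Suc i)) +[Tm X' (Suc (Suc i)),W] v ** f' (Suc (Suc i))) ** q1 (Suc i) +[Tm M' (Suc i),W]
        (v ** Df Y' (Suc i)) ** q2 (Suc i)"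
      unfolding eqs using ty ty' v(1) w(1) J(1-4) by (simp add: cat_simps)
    also have "w ** Df X' (Suc (Suc i)) +[Tm X' (Suc (Suc i)),W] v ** f' (Suc (Suc i)) = u ** j1 (Suc i)"
      unfolding w(2)[symmetric] y_def using u(1) v(1) J(1-4) ty by (simp add: cat_simps)
    also have "(u ** j1 (Suc i)) ** q1 (Suc i) +[Tm M' (Suc i),W] (v ** Df Y' (Suc i)) ** q2 (Suc i)
        = u ** (j1 (Suc i) ** q1 (Suc i) +[Tm M' (Suc i),Tm M' (Suc i)] j2 (Suc i) ** q2 (Suc i))"
      unfolding v(2)[symmetric] using u(1) J(1-4) by (simp add: cat_simps)
    also have "\<dots> = u" unfolding J(9) using u(1) by (simp add: id_right)
    finally have "u = ?x ** Df M' (Suc i)" by simp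
    then show ?thesis using v(1) w(1) ty' by (intro bexI) (assumption | simp add: typing)+
  next
    case False
    then have n': "n = Suc i" using i by simp
    note MM = cexact_Ch[OF ex(1)]
    have ends: "Tm M (Suc n) = Tm Y (Suc n)" "Tm M' (Suc n) = Tm Y' (Suc n)"
      using M M' by (simp_all add: cone_sum_def)
    note A = fixing_endsD[OF a] and B = fixing_endsD[OF b] and B' = fixing_endsD[OF b']
    have tw0: "twisted_sum n (tail_ob n Z X) (head_ob Z Y) (tail_df n Z X) (head_df Z Y) (\<lambda>i. f (Suc i)) M i1 i2 p1 p2"
      using M by (simp add: cone_sum_def)
    have DM: "Df M (Suc i) \<in> arr (Tm M (Suc i)) (Tm Y (Suc (Suc i)))"
      using Ch_arr[OF MM, of "Suc i"] n' ends by simp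
    have tq: "q (Suc i) \<in> arr (Tm M (Suc i)) (Tm M' (Suc i))" "q i \<in> arr (Tm M i) (Tm M' i)"
      "Df M i \<in> arr (Tm M i) (Tm M (Suc i))" "Df M' i \<in> arr (Tm M' i) (Tm M' (Suc i))"
      "Df M (Suc i) \<in> arr (Tm M (Suc i)) (Tm M' (Suc (Suc i)))"
      "i1 (Suc i) \<in> arr (Tm X' (Suc (Suc i))) (Tm M (Suc i))" "i2 (Suc i) \<in> arr (Tm Y (Suc i)) (Tm M (Suc i))"
      "b (Suc i) \<in> arr (Tm Y (Suc i)) (Tm Y' (Suc i))" "b' (Suc i) \<in> arr (Tm Y' (Suc i)) (Tm Y (Suc i))"
      "k (Suc i) \<in> arr (Tm X' (Suc (Suc i))) (Tm Y' (Suc i))" "Df Y (Suc i) \<in> arr (Tm Y (Suc i)) (Tm Y' (Suc (Suc i)))"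
      using chain_map_arr[OF q(1) MM MC] Ch_arr[OF MM] Ch_arr[OF MC] DM twisted_sumD(10,11)[OF tw0, of n] n' ends
        chain_map_arr[OF B(1) Ch(2) YC] chain_map_arr[OF B'(1) YC Ch(2)] k A(4) B(4) Ch_arr[OF Ch(2), of n]
      by (simp_all add: tail_ob_def head_ob_def)
    have "(u ** q (Suc i)) ** Df M i = (u ** Df M' i) ** q i"
      using chain_map_comm[OF q(1), of i] n' u(1) tq by (simp add: cat_simps)
    also have "\<dots> = 0[Tm M i,W]" unfolding u(2) using tq W by (simp add: zero_left)
    finally obtain x where x: "x \<in> arr (Tm M (Suc (Suc i))) W" "u ** q (Suc i) = x ** Df M (Suc i)"
      using cexactE[OF ex(1) i comp_arr[OF u(1) tq(1)]] by blast
    have x': "x \<in> arr (Tm M' (Suc (Suc i))) W" using x(1) ends B(4) n' by simp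
    have Dq: "Df M' (Suc i) ** q (Suc i) = Df M (Suc i)"
      using chain_map_comm[OF q(1), of "Suc i"] n' q(2) tq(5) ends B(4) by (simp add: id_left intoI)
    \<comment> \<open>Exactness of M yields x on the common last term. Subtracting x composed with
      the last differential of M' leaves a morphism that becomes zero after q; it is then shown to
      vanish on one summand after the other.\<close>
    define u' where "u' = u +[Tm M' (Suc i),W] -[Tm M' (Suc i),W] (x ** Df M' (Suc i))"
    have u': "u' \<in> arr (Tm M' (Suc i)) W" using u(1) x' ty by (simp add: u'_def typing)
    have "u' ** Df M' i = u ** Df M' i +[Tm M' i,W] -[Tm M' i,W] (x ** (Df M' (Suc i) ** Df M' i))"
      using u(1) x' ty tq by (simp add: u'_def cat_simps)
    also have "\<dots> = 0[Tm M' i,W]"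
      unfolding u(2) Ch_zero[OF MC i] using x' W arrD(1)[OF tq(4)] by (simp add: cat_simps)
    finally obtain v where v: "v \<in> arr (Tm Y' (Suc (Suc i))) W" "u' ** j2 (Suc i) = v ** Df Y' (Suc i)"
      using cone_sum_cexact_step[OF n ex(2,3) f' M' i u'] by blast
    have "u' ** q (Suc i) = u ** q (Suc i) +[Tm M (Suc i),W] -[Tm M (Suc i),W] (x ** (Df M' (Suc i) ** q (Suc i)))"
      using u(1) x' ty tq by (simp add: u'_def cat_simps)
    also have "\<dots> = 0[Tm M (Suc i),W]"
      unfolding x(2) Dq using x' tq by (simp add: cat_simps)
    finally have u'q: "u' ** q (Suc i) = 0[Tm M (Suc i),W]" .
    have "(u' ** q (Suc i)) ** i2 (Suc i) = (u' ** j2 (Suc i)) ** b (Suc i)"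
      using qi(2) n' u' tq J by (simp add: cat_simps)
    also have "\<dots> = v ** (Df Y' (Suc i) ** b (Suc i))" unfolding v(2) using v(1) ty tq by (simp add: cat_simps)
    also have "\<dots> = v ** Df Y (Suc i)"
      using chain_map_comm[OF B(1), of "Suc i"] n' B(5) tq B(4) by (simp add: id_left intoI)
    finally have vd: "v ** Df Y (Suc i) = 0[Tm Y (Suc i),W]"
      unfolding u'q using tq W by (simp add: zero_left)
    \<comment> \<open>The map b' back to Y carries the vanishing of v on the differential of Y over
      to the differential of Y'.\<close>
    have "Df Y' (Suc i) = Df Y (Suc i) ** b' (Suc i)"
      using chain_map_comm[OF B'(1), of "Suc i"] n' B'(5) ty by (simp add: id_left intoI)
    then have "u' ** j2 (Suc i) = (v ** Df Y (Suc i)) ** b' (Suc i)"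
      unfolding v(2) using v(1) tq by (simp add: cat_simps)
    then have u2: "u' ** j2 (Suc i) = 0[Tm Y' (Suc i),W]"
      unfolding vd using tq W by (simp add: zero_left)
    have "(u' ** q (Suc i)) ** i1 (Suc i) = u' ** j1 (Suc i) +[Tm X' (Suc (Suc i)),W] (u' ** j2 (Suc i)) ** k (Suc i)"
      using qi(1) n' u' tq J A(4,5) by (simp add: cat_simps)
    also have "\<dots> = u' ** j1 (Suc i)" unfolding u2 using u' J tq W by (simp add: cat_simps)
    finally have u1: "u' ** j1 (Suc i) = 0[Tm X' (Suc (Suc i)),W]"
      unfolding u'q using tq W by (simp add: zero_left)
    have "u' = 0[Tm M' (Suc i),W]"
      using u' u1 u2 J(1,2) W arrD(1)[OF u'] by - (rule biproduct_outof_eqI[OF bp, where D = W], simp_all add: zero_arr zero_left)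
    then have "u = x ** Df M' (Suc i)"
      unfolding u'_def using u(1) x' ty by (subst (asm) diff_eq_zero) (simp_all add: typing)
    then show ?thesis using x' by blast
  qed
qed

text \<open>Exactness of M' is delivered as an implication, so that the same lemma also provides the
  map in the opposite direction, where exactness is not at stake.\<close>

lemma cone_transfer:
  assumes n: "1 \<le> n"
    and Ch: "X \<in> Ch n C" "Y \<in> Ch n C" "X' \<in> Ch n C" "Y' \<in> Ch n C"
    and f: "chain_map n C X Y f" and f': "chain_map n C X' Y' f'"
    and M: "is_mapping_cone n C X Y f M" and M': "is_mapping_cone n C X' Y' f' M'"
    and a: "chain_map_fixing_ends n C X X' a" and b: "chain_map_fixing_ends n C Y Y' b"
    and b': "chain_map_fixing_ends n C Y' Y b'"
    and k: "rel_homotopy n X Y' (\<lambda>i. b i ** f i) (\<lambda>i. f' i ** a i) k"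
  obtains q where "chain_map n C M M' q" "q 0 = a (Suc 0)" "q (Suc n) = Idn C (Tm Y (Suc n))"
    "cexact n M \<Longrightarrow> cexact n X' \<Longrightarrow> cexact n Y' \<Longrightarrow> Tm Y' 0 = Tm X' 0 \<Longrightarrow> f' 0 = Idn C (Tm X' 0) \<Longrightarrow> cexact n M'"
proof -
  obtain Z where Z: "is_zero_object C Z" using ex_zero_object by blast
  obtain i1 i2 p1 p2 where c: "cone_sum n Z X Y f M i1 i2 p1 p2"
    using cone_sum_of_is_mapping_cone[OF Z Ch(1,2) f M n] by blast
  obtain j1 j2 q1 q2 where c': "cone_sum n Z X' Y' f' M' j1 j2 q1 q2"
    using cone_sum_of_is_mapping_cone[OF Z Ch(3,4) f' M' n] by blast
  have MC: "M' \<in> Ch n C" using M' by (simp add: is_mapping_cone_def)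
  show thesis
  proof (rule cone_sum_map[OF Z n Ch f f' c c' fixing_endsD(1)[OF a] fixing_endsD(1)[OF b] k])
    fix q
    assume q: "chain_map n C M M' q" "q 0 = a (Suc 0)" "q (Suc n) = b (Suc n)"
      "\<And>i. 0 < i \<Longrightarrow> i \<le> n \<Longrightarrow> q i ** i1 i = j1 i ** a (Suc i) +[Tm X (Suc i),Tm M' i] j2 i ** k i"
      "\<And>i. 0 < i \<Longrightarrow> i \<le> n \<Longrightarrow> q i ** i2 i = j2 i ** b i"
    have qn: "q (Suc n) = Idn C (Tm Y (Suc n))" using q(3) fixing_endsD(5)[OF b] by simp
    have "cexact n M'"
      if "cexact n M" "cexact n X'" "cexact n Y'" "Tm Y' 0 = Tm X' 0" "f' 0 = Idn C (Tm X' 0)"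
      using n by (intro cone_sum_cexact[where k = k and q = q, OF Z n Ch(1,2) c c' MC f f' that(4,5,1-3) a b b' q(1) qn
        rel_homotopyD(1)[OF k order_refl] q(4)[of n] q(5)[of n]]) simp_all
    then show thesis by (rule that[OF q(1,2) qn])
  qed
qed

lemma mapping_cone_exists:
  assumes "1 \<le> n" "X \<in> Ch n C" "Y \<in> Ch n C" "chain_map n C X Y f"
  obtains M where "is_mapping_cone n C X Y f M"
proof -
  obtain Z where Z: "is_zero_object C Z" using ex_zero_object by blast
  obtain M :: "('o, 'm) cpx" and i1 i2 p1 p2 where "cone_sum n Z X Y f M i1 i2 p1 p2"
    using cone_sum_exists[OF Z assms(2-4)] by (elim exE)
  then show thesis
    by (rule that[OF is_mapping_cone_of_cone_sum[OF Z assms(2-4) _ assms(1)]])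
qed

end

section \<open>Extensions and exangles\<close>

context biadditive_functor begin

text \<open>The analogue of \<open>arr\<close> for extensions.\<close>

definition ext :: "'o \<Rightarrow> 'o \<Rightarrow> 'x set"
  where "ext D A = {\<delta>. D \<in> Ob C \<and> A \<in> Ob C \<and> \<delta> \<in> carrier (Ext E D A)}"

lemma extI: "D \<in> Ob C \<Longrightarrow> A \<in> Ob C \<Longrightarrow> \<delta> \<in> carrier (Ext E D A) \<Longrightarrow> \<delta> \<in> ext D A"
  by (simp add: ext_def)

lemma extD:
  assumes "\<delta> \<in> ext D A"
  shows "D \<in> Ob C" "A \<in> Ob C" "\<delta> \<in> carrier (Ext E D A)"
  using assms by (simp_all add: ext_def)

lemma Act_ext:
  "c \<in> arr D' D \<Longrightarrow> a \<in> arr A A' \<Longrightarrow> \<delta> \<in> ext D A \<Longrightarrow> Act E c a \<delta> \<in> ext D' A'"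
  using Act_hom[of D D' A A' c a] by (auto simp: arr_def ext_def hom_def)

lemma push_ext: "a \<in> arr A A' \<Longrightarrow> \<delta> \<in> ext D A \<Longrightarrow> push C E D a \<delta> \<in> ext D A'"
  by (simp add: push_def Act_ext[OF Idn_arr] extD)

lemma pull_ext: "c \<in> arr D' D \<Longrightarrow> \<delta> \<in> ext D A \<Longrightarrow> pull C E A c \<delta> \<in> ext D' A"
  by (simp add: pull_def Act_ext[OF _ Idn_arr] extD)

lemma Act_Act:
  "c \<in> arr D' D \<Longrightarrow> c' \<in> arr D'' D' \<Longrightarrow> a \<in> arr A A' \<Longrightarrow> a' \<in> arr A' A'' \<Longrightarrow> \<delta> \<in> ext D A \<Longrightarrow>
    Act E c' a' (Act E c a \<delta>) = Act E (c ** c') (a' ** a) \<delta>"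
  using Act_Cmp[of D D' D'' A A' A'' c c' a a' \<delta>] by (auto simp: arr_def ext_def)

lemma push_Idn: "\<delta> \<in> ext D A \<Longrightarrow> push C E D (Idn C A) \<delta> = \<delta>"
  by (simp add: push_def ext_def Act_Idn)

lemma pull_Idn: "\<delta> \<in> ext D A \<Longrightarrow> pull C E A (Idn C D) \<delta> = \<delta>"
  by (simp add: pull_def ext_def Act_Idn)

lemma push_comp:
  "b \<in> arr B B' \<Longrightarrow> a \<in> arr A B \<Longrightarrow> \<delta> \<in> ext D A \<Longrightarrow>
    push C E D (b ** a) \<delta> = push C E D b (push C E D a \<delta>)"
  unfolding push_def by (subst Act_Act[OF Idn_arr Idn_arr]) (auto simp: extD id_right[OF Idn_arr])

lemma pull_comp:
  "c \<in> arr D' D \<Longrightarrow> c' \<in> arr D'' D' \<Longrightarrow> \<delta> \<in> ext D A \<Longrightarrow>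
    pull C E A (c ** c') \<delta> = pull C E A c' (pull C E A c \<delta>)"
  unfolding pull_def by (subst Act_Act[OF _ _ Idn_arr Idn_arr]) (auto simp: extD id_right[OF Idn_arr])

lemma push_pull:
  assumes "c \<in> arr D' D" "a \<in> arr A A'" "\<delta> \<in> ext D A"
  shows "push C E D' a (pull C E A c \<delta>) = Act E c a \<delta>" "pull C E A' c (push C E D a \<delta>) = Act E c a \<delta>"
  using Act_Act[OF assms(1) Idn_arr Idn_arr assms(2,3)] Act_Act[OF Idn_arr assms(1,2) Idn_arr assms(3)]
    assms extD[OF assms(3)] arrD[OF assms(1)] arrD[OF assms(2)]
  by (simp_all add: push_def pull_def id_right id_left intoI)

lemma Ext_group: "D \<in> Ob C \<Longrightarrow> A \<in> Ob C \<Longrightarrow> group (Ext E D A)"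
  using Ext_comm_group comm_group_def by blast

lemma zero_ext: "D \<in> Ob C \<Longrightarrow> A \<in> Ob C \<Longrightarrow> \<one>\<^bsub>Ext E D A\<^esub> \<in> ext D A"
  by (simp add: ext_def Ext_group group.is_monoid monoid.one_closed)

lemma Act_of_zero:
  assumes "c \<in> arr D' D" "a \<in> arr A A'"
  shows "Act E c a \<one>\<^bsub>Ext E D A\<^esub> = \<one>\<^bsub>Ext E D' A'\<^esub>"
  using assms Act_hom[of D D' A A' c a] Ext_group hom_one[of "Act E c a" "Ext E D A" "Ext E D' A'"]
  by (auto simp: arr_def)

lemma push_of_zero: "a \<in> arr A A' \<Longrightarrow> D \<in> Ob C \<Longrightarrow> push C E D a \<one>\<^bsub>Ext E D A\<^esub> = \<one>\<^bsub>Ext E D A'\<^esub>"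
  by (simp add: push_def Act_of_zero[OF Idn_arr])

lemma pull_of_zero: "c \<in> arr D' D \<Longrightarrow> A \<in> Ob C \<Longrightarrow> pull C E A c \<one>\<^bsub>Ext E D A\<^esub> = \<one>\<^bsub>Ext E D' A\<^esub>"
  by (simp add: pull_def Act_of_zero[OF _ Idn_arr])

lemma push_add:
  "a \<in> arr A A' \<Longrightarrow> b \<in> arr A A' \<Longrightarrow> \<delta> \<in> ext D A \<Longrightarrow>
    push C E D (a +[A,A'] b) \<delta> = push C E D a \<delta> \<otimes>\<^bsub>Ext E D A'\<^esub> push C E D b \<delta>"
  using Act_add_right[of D D A A' "Idn C D" a b \<delta>] by (auto simp: push_def arr_def ext_def Idn_in_Hom)

lemma pull_add:
  "c \<in> arr D' D \<Longrightarrow> d \<in> arr D' D \<Longrightarrow> \<delta> \<in> ext D A \<Longrightarrow>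
    pull C E A (c +[D',D] d) \<delta> = pull C E A c \<delta> \<otimes>\<^bsub>Ext E D' A\<^esub> pull C E A d \<delta>"
  using Act_add_left[of D D' A A c d "Idn C A" \<delta>] by (auto simp: pull_def arr_def ext_def Idn_in_Hom)

lemma ext_cancel:
  assumes "x \<otimes>\<^bsub>Ext E D A\<^esub> y = x" "x \<in> ext D A" "y \<in> ext D A"
  shows "y = \<one>\<^bsub>Ext E D A\<^esub>"
  using assms Ext_group[of D A] group.l_cancel_one[of "Ext E D A" x y] by (simp add: ext_def)

lemma push_zero:
  assumes "A' \<in> Ob C" "\<delta> \<in> ext D A"
  shows "push C E D 0[A,A'] \<delta> = \<one>\<^bsub>Ext E D A'\<^esub>"
proof -
  note z = zero_arr[OF extD(2)[OF assms(2)] assms(1)]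
  show ?thesis
    using push_add[OF z z assms(2)] by (intro ext_cancel[where x = "push C E D 0[A,A'] \<delta>"])
      (simp_all add: add_zero[OF z] push_ext[OF z assms(2)])
qed

lemma ext_add_zero:
  assumes "\<delta> \<in> ext D A"
  shows "\<delta> \<otimes>\<^bsub>Ext E D A\<^esub> \<one>\<^bsub>Ext E D A\<^esub> = \<delta>" "\<one>\<^bsub>Ext E D A\<^esub> \<otimes>\<^bsub>Ext E D A\<^esub> \<delta> = \<delta>"
  using assms Ext_group[of D A] by (simp_all add: ext_def group.is_monoid)

text \<open>By additivity the two pushed extensions add up to \<delta>. So an extension fixed by a
  is one annihilated by the complement b, and exactness then makes b factor through an end
  differential.\<close>

lemma push_complement_zero:
  assumes "a +[A,A] b = Idn C A" "a \<in> arr A A" "b \<in> arr A A" "\<delta> \<in> ext D A"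
  shows "push C E D a \<delta> = \<delta> \<longleftrightarrow> push C E D b \<delta> = \<one>\<^bsub>Ext E D A\<^esub>"
proof -
  have *: "push C E D a \<delta> \<otimes>\<^bsub>Ext E D A\<^esub> push C E D b \<delta> = \<delta>"
    using push_add[OF assms(2,3,4)] push_Idn[OF assms(4)] assms(1) by simp
  show ?thesis
    using ext_cancel[OF _ assms(4) push_ext[OF assms(3,4)]] * ext_add_zero(1)[OF push_ext[OF assms(2,4)]] by auto
qed

lemma pull_complement_zero:
  assumes "a +[D,D] b = Idn C D" "a \<in> arr D D" "b \<in> arr D D" "\<delta> \<in> ext D A"
  shows "pull C E A a \<delta> = \<delta> \<longleftrightarrow> pull C E A b \<delta> = \<one>\<^bsub>Ext E D A\<^esub>"
proof -
  have *: "pull C E A a \<delta> \<otimes>\<^bsub>Ext E D A\<^esub> pull C E A b \<delta> = \<delta>"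
    using pull_add[OF assms(2,3,4)] pull_Idn[OF assms(4)] assms(1) by simp
  show ?thesis
    using ext_cancel[OF _ assms(4) pull_ext[OF assms(3,4)]] * ext_add_zero(1)[OF pull_ext[OF assms(2,4)]] by auto
qed

lemma image_eq_kernel:
  assumes "\<And>v. v \<in> carrier G \<Longrightarrow> f v \<in> kernel G' G'' h"
  shows "f ` carrier G = kernel G' G'' h \<longleftrightarrow> (\<forall>u\<in>carrier G'. h u = \<one>\<^bsub>G''\<^esub> \<longrightarrow> (\<exists>v\<in>carrier G. u = f v))"
  using assms unfolding kernel_def by blast

text \<open>Images are contained in kernels for every attached complex. What remains are
  factorisation properties, in which the membership of the test object is absorbed by the
  typing.\<close>

lemma n_exangle_iff:
  "n_exangle n C E X \<delta> \<longleftrightarrow>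
     cexact n X \<and> \<delta> \<in> ext (Tm X (Suc n)) (Tm X 0) \<and>
     push C E (Tm X (Suc n)) (Df X 0) \<delta> = \<one>\<^bsub>Ext E (Tm X (Suc n)) (Tm X (Suc 0))\<^esub> \<and>
     pull C E (Tm X 0) (Df X n) \<delta> = \<one>\<^bsub>Ext E (Tm X n) (Tm X 0)\<^esub> \<and>
     (\<forall>i<n. \<forall>Y. \<forall>u\<in>arr Y (Tm X (Suc i)). Df X (Suc i) ** u = 0[Y,Tm X (Suc (Suc i))] \<longrightarrow>
        (\<exists>v\<in>arr Y (Tm X i). u = Df X i ** v)) \<and>
     (\<forall>Y. \<forall>u\<in>arr Y (Tm X (Suc n)). pull C E (Tm X 0) u \<delta> = \<one>\<^bsub>Ext E Y (Tm X 0)\<^esub> \<longrightarrow>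
        (\<exists>v\<in>arr Y (Tm X n). u = Df X n ** v)) \<and>
     (\<forall>Y. \<forall>u\<in>arr (Tm X 0) Y. push C E (Tm X (Suc n)) u \<delta> = \<one>\<^bsub>Ext E (Tm X (Suc n)) Y\<^esub> \<longrightarrow>
        (\<exists>v\<in>arr (Tm X (Suc 0)) Y. u = v ** Df X 0))" (is "_ \<longleftrightarrow> ?R")
proof (cases "attached_complex n C E X \<delta>")
  case True
  then have X: "X \<in> Ch n C" and \<delta>: "\<delta> \<in> ext (Tm X (Suc n)) (Tm X 0)"
    and p: "push C E (Tm X (Suc n)) (Df X 0) \<delta> = \<one>\<^bsub>Ext E (Tm X (Suc n)) (Tm X (Suc 0))\<^esub>"
      "pull C E (Tm X 0) (Df X n) \<delta> = \<one>\<^bsub>Ext E (Tm X n) (Tm X 0)\<^esub>"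
    by (auto simp: attached_complex_def ext_def intro: Ch_Ob)
  have Obs: "Tm X i \<in> Ob C" if "i \<le> Suc n" for i using that by (rule Ch_Ob[OF X])
  have 1: "(\<lambda>u. Df X i ** u) ` carrier (H Y (Tm X i)) = kernel (H Y (Tm X (i + 1))) (H Y (Tm X (i + 2))) (\<lambda>u. Df X (i + 1) ** u)
      \<longleftrightarrow> (\<forall>u\<in>arr Y (Tm X (Suc i)). Df X (Suc i) ** u = 0[Y,Tm X (Suc (Suc i))] \<longrightarrow> (\<exists>v\<in>arr Y (Tm X i). u = Df X i ** v))"
    if i: "i < n" and Y: "Y \<in> Ob C" for i Y
  proof (subst image_eq_kernel)
    fix v assume "v \<in> carrier (H Y (Tm X i))"
    then have v: "v \<in> arr Y (Tm X i)" using Y i Obs by (simp add: arr_def)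
    have d: "Df X i \<in> arr (Tm X i) (Tm X (Suc i))" "Df X (Suc i) \<in> arr (Tm X (Suc i)) (Tm X (Suc (Suc i)))"
      using i Ch_arr[OF X] by simp_all
    have "Df X (Suc i) ** Df X i ** v = 0[Y,Tm X (Suc (Suc i))]"
      using comp_eq_comp[OF Ch_zero[OF X i] d(2,1) intoI[OF v]] v d(2) by (simp add: zero_left arrD)
    then show "Df X i ** v \<in> kernel (H Y (Tm X (i + 1))) (H Y (Tm X (i + 2))) (\<lambda>u. Df X (i + 1) ** u)"
      using comp_arr[OF d(1) v] by (simp add: kernel_def arrD)
  qed (use i Y Obs in \<open>simp add: arr_def\<close>)
  have 2: "(\<lambda>u. Df X n ** u) ` carrier (H Y (Tm X n)) = kernel (H Y (Tm X (n + 1))) (Ext E Y (Tm X 0)) (\<lambda>u. pull C E (Tm X 0) u \<delta>)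
      \<longleftrightarrow> (\<forall>u\<in>arr Y (Tm X (Suc n)). pull C E (Tm X 0) u \<delta> = \<one>\<^bsub>Ext E Y (Tm X 0)\<^esub> \<longrightarrow> (\<exists>v\<in>arr Y (Tm X n). u = Df X n ** v))"
    if Y: "Y \<in> Ob C" for Y
  proof (subst image_eq_kernel)
    fix v assume "v \<in> carrier (H Y (Tm X n))"
    then have v: "v \<in> arr Y (Tm X n)" using Y Obs by (simp add: arr_def)
    have d: "Df X n \<in> arr (Tm X n) (Tm X (Suc n))" using Ch_arr[OF X] by simp
    show "Df X n ** v \<in> kernel (H Y (Tm X (n + 1))) (Ext E Y (Tm X 0)) (\<lambda>u. pull C E (Tm X 0) u \<delta>)"
      using comp_arr[OF d v] pull_comp[OF d v \<delta>] p(2) pull_of_zero[OF v Obs[of 0]] by (simp add: kernel_def arrD)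
  qed (use Y Obs in \<open>simp add: arr_def\<close>)
  have 3: "(\<lambda>u. u ** Df X (i + 1)) ` carrier (H (Tm X (i + 2)) Y) = kernel (H (Tm X (i + 1)) Y) (H (Tm X i) Y) (\<lambda>u. u ** Df X i)
      \<longleftrightarrow> (\<forall>u\<in>arr (Tm X (Suc i)) Y. u ** Df X i = 0[Tm X i,Y] \<longrightarrow> (\<exists>v\<in>arr (Tm X (Suc (Suc i))) Y. u = v ** Df X (Suc i)))"
    if i: "i < n" and Y: "Y \<in> Ob C" for i Y
  proof (subst image_eq_kernel)
    fix v assume "v \<in> carrier (H (Tm X (i + 2)) Y)"
    then have v: "v \<in> arr (Tm X (Suc (Suc i))) Y" using Y i Obs by (simp add: arr_def)
    have d: "Df X i \<in> arr (Tm X i) (Tm X (Suc i))" "Df X (Suc i) \<in> arr (Tm X (Suc i)) (Tm X (Suc (Suc i)))"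
      using i Ch_arr[OF X] by simp_all
    have "(v ** Df X (Suc i)) ** Df X i = 0[Tm X i,Y]"
      using v d Ch_zero[OF X i] zero_right[OF v, of "Tm X i"] by (simp add: cat_simps arrD)
    then show "v ** Df X (i + 1) \<in> kernel (H (Tm X (i + 1)) Y) (H (Tm X i) Y) (\<lambda>u. u ** Df X i)"
      using comp_arr[OF v d(2)] by (simp add: kernel_def arrD)
  qed (use i Y Obs in \<open>simp add: arr_def\<close>)
  have 4: "(\<lambda>u. u ** Df X 0) ` carrier (H (Tm X 1) Y) = kernel (H (Tm X 0) Y) (Ext E (Tm X (n + 1)) Y) (\<lambda>u. push C E (Tm X (n + 1)) u \<delta>)
      \<longleftrightarrow> (\<forall>u\<in>arr (Tm X 0) Y. push C E (Tm X (Suc n)) u \<delta> = \<one>\<^bsub>Ext E (Tm X (Suc n)) Y\<^esub> \<longrightarrow> (\<exists>v\<in>arr (Tm X (Suc 0)) Y. u = v ** Df X 0))"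
    if Y: "Y \<in> Ob C" for Y
  proof (subst image_eq_kernel)
    fix v assume "v \<in> carrier (H (Tm X 1) Y)"
    then have v: "v \<in> arr (Tm X (Suc 0)) Y" using Y Obs by (simp add: arr_def)
    have d: "Df X 0 \<in> arr (Tm X 0) (Tm X (Suc 0))" using Ch_arr[OF X] by simp
    show "v ** Df X 0 \<in> kernel (H (Tm X 0) Y) (Ext E (Tm X (n + 1)) Y) (\<lambda>u. push C E (Tm X (n + 1)) u \<delta>)"
      using comp_arr[OF v d] push_comp[OF v d \<delta>] p(1) push_of_zero[OF v Obs[of "Suc n"]] by (simp add: kernel_def arrD)
  qed (use Y Obs in \<open>simp add: arr_def\<close>)
  have all_Y: "(\<forall>Y\<in>Ob C. \<forall>u\<in>arr Y A. P Y u) \<longleftrightarrow> (\<forall>Y. \<forall>u\<in>arr Y A. P Y u)"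
    "(\<forall>Y\<in>Ob C. \<forall>u\<in>arr A Y. P Y u) \<longleftrightarrow> (\<forall>Y. \<forall>u\<in>arr A Y. P Y u)" for A P
    using arrD(1,2) by blast+
  have "n_exangle n C E X \<delta> \<longleftrightarrow> (\<forall>Y\<in>Ob C.
     (\<forall>i<n. \<forall>u\<in>arr Y (Tm X (Suc i)). Df X (Suc i) ** u = 0[Y,Tm X (Suc (Suc i))] \<longrightarrow> (\<exists>v\<in>arr Y (Tm X i). u = Df X i ** v)) \<and>
     (\<forall>u\<in>arr Y (Tm X (Suc n)). pull C E (Tm X 0) u \<delta> = \<one>\<^bsub>Ext E Y (Tm X 0)\<^esub> \<longrightarrow> (\<exists>v\<in>arr Y (Tm X n). u = Df X n ** v)) \<and>
     (\<forall>i<n. \<forall>u\<in>arr (Tm X (Suc i)) Y. u ** Df X i = 0[Tm X i,Y] \<longrightarrow> (\<exists>v\<in>arr (Tm X (Suc (Suc i))) Y. u = v ** Df X (Suc i))) \<and>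
     (\<forall>u\<in>arr (Tm X 0) Y. push C E (Tm X (Suc n)) u \<delta> = \<one>\<^bsub>Ext E (Tm X (Suc n)) Y\<^esub> \<longrightarrow> (\<exists>v\<in>arr (Tm X (Suc 0)) Y. u = v ** Df X 0)))"
    using True 1 2 3 4 unfolding n_exangle_def by simp
  also have "\<dots> \<longleftrightarrow> (\<forall>i<n. \<forall>Y\<in>Ob C. \<forall>u\<in>arr Y (Tm X (Suc i)). Df X (Suc i) ** u = 0[Y,Tm X (Suc (Suc i))] \<longrightarrow> (\<exists>v\<in>arr Y (Tm X i). u = Df X i ** v)) \<and>
     (\<forall>Y\<in>Ob C. \<forall>u\<in>arr Y (Tm X (Suc n)). pull C E (Tm X 0) u \<delta> = \<one>\<^bsub>Ext E Y (Tm X 0)\<^esub> \<longrightarrow> (\<exists>v\<in>arr Y (Tm X n). u = Df X n ** v)) \<and>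
     (\<forall>i<n. \<forall>Y\<in>Ob C. \<forall>u\<in>arr (Tm X (Suc i)) Y. u ** Df X i = 0[Tm X i,Y] \<longrightarrow> (\<exists>v\<in>arr (Tm X (Suc (Suc i))) Y. u = v ** Df X (Suc i))) \<and>
     (\<forall>Y\<in>Ob C. \<forall>u\<in>arr (Tm X 0) Y. push C E (Tm X (Suc n)) u \<delta> = \<one>\<^bsub>Ext E (Tm X (Suc n)) Y\<^esub> \<longrightarrow> (\<exists>v\<in>arr (Tm X (Suc 0)) Y. u = v ** Df X 0))"
    by blast
  also have "\<dots> \<longleftrightarrow> ?R"
    unfolding all_Y cexact_def using X \<delta> p by (simp add: conj_ac)
  finally show ?thesis .
next
  case False
  then show ?thesis
    by (auto simp: n_exangle_def attached_complex_def cexact_def ext_def)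
qed

lemma n_exangleD:
  assumes "n_exangle n C E X \<delta>"
  shows "cexact n X" "\<delta> \<in> ext (Tm X (Suc n)) (Tm X 0)"
    "push C E (Tm X (Suc n)) (Df X 0) \<delta> = \<one>\<^bsub>Ext E (Tm X (Suc n)) (Tm X (Suc 0))\<^esub>"
    "pull C E (Tm X 0) (Df X n) \<delta> = \<one>\<^bsub>Ext E (Tm X n) (Tm X 0)\<^esub>"
    "\<And>i Y u. i < n \<Longrightarrow> u \<in> arr Y (Tm X (Suc i)) \<Longrightarrow> Df X (Suc i) ** u = 0[Y,Tm X (Suc (Suc i))] \<Longrightarrow>
        \<exists>v\<in>arr Y (Tm X i). u = Df X i ** v"
    "\<And>Y u. u \<in> arr Y (Tm X (Suc n)) \<Longrightarrow> pull C E (Tm X 0) u \<delta> = \<one>\<^bsub>Ext E Y (Tm X 0)\<^esub> \<Longrightarrow>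
        \<exists>v\<in>arr Y (Tm X n). u = Df X n ** v"
    "\<And>Y u. u \<in> arr (Tm X 0) Y \<Longrightarrow> push C E (Tm X (Suc n)) u \<delta> = \<one>\<^bsub>Ext E (Tm X (Suc n)) Y\<^esub> \<Longrightarrow>
        \<exists>v\<in>arr (Tm X (Suc 0)) Y. u = v ** Df X 0"
  using assms by (simp_all add: n_exangle_iff)

end

section \<open>Relative homotopies under composition\<close>

context additive_category begin

lemma rel_homotopy_cong:
  assumes "rel_homotopy n X Y f g k" "\<And>i. i \<le> Suc n \<Longrightarrow> f i = f' i" "\<And>i. i \<le> Suc n \<Longrightarrow> g i = g' i"
  shows "rel_homotopy n X Y f' g' k"
  using assms(1) assms(2,3)[symmetric] unfolding rel_homotopy_def by simp

text \<open>Here p is precomposed and the homotopy runs from g to g p, hence the sign; the companion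
  lemma postcomposes p and runs from p g to g. These are the two orientations that the comparison of
  lifts in \<open>EA2_transport\<close> asks for.\<close>

lemma rel_homotopy_comp_left:
  assumes k: "rel_homotopy n X X p (\<lambda>i. Idn C (Tm X i)) k" and g: "chain_map n C X Y g"
    and Ch: "X \<in> Ch n C" "Y \<in> Ch n C"
  shows "rel_homotopy n X Y g (\<lambda>i. g i ** p i) (\<lambda>i. -[Tm X (Suc i),Tm Y i] (g i ** k i))"
proof -
  note K = rel_homotopyD[OF k] and Obs = Ch_Ob[OF Ch(1)] Ch_Ob[OF Ch(2)]
  note ga = chain_map_arr[OF g Ch]
  have comm: "Df Y i ** g i ** x = g (Suc i) ** Df X i ** x" if "i \<le> n" "x \<in> into (Tm X i)" for i x
    using that comp_eq_comp[OF chain_map_comm[OF g that(1)] Ch_arr[OF Ch(2)] ga] ga[of "Suc i"]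
      Ch_arr[OF Ch(1), of i] by (simp add: cat_simps)
  show ?thesis
    unfolding rel_homotopy_def
  proof (intro conjI allI impI)
    show "-[Tm X (Suc i),Tm Y i] (g i ** k i) \<in> arr (Tm X (Suc i)) (Tm Y i)" if "i \<le> n" for i
      using that K(1)[of i] ga[of i] by (simp add: typing)
    show "-[Tm X (Suc 0),Tm Y 0] (g 0 ** k 0) = 0[Tm X (Suc 0),Tm Y 0]"
      unfolding K(2) using ga[of 0] Obs by (simp add: zero_right neg_zero)
    have "g (Suc n) ** Df X n ** k n = 0[Tm X (Suc n),Tm Y (Suc n)]"
      unfolding K(3) using ga[of "Suc n"] Obs by (simp add: zero_right)
    then show "Df Y n ** -[Tm X (Suc n),Tm Y n] (g n ** k n) = 0[Tm X (Suc n),Tm Y (Suc n)]"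
      using ga[of n] K(1)[of n] Ch_arr[OF Ch(2), of n] comm[of n "k n"] Obs by (simp add: cat_simps)
    show "g 0 = g 0 ** p 0" "g (Suc n) = g (Suc n) ** p (Suc n)"
      unfolding K(4,5) using ga[of 0] ga[of "Suc n"] by (simp_all add: id_right)
    fix i assume i: "i < n"
    have ty: "g i \<in> arr (Tm X i) (Tm Y i)" "g (Suc i) \<in> arr (Tm X (Suc i)) (Tm Y (Suc i))"
      "k i \<in> arr (Tm X (Suc i)) (Tm X i)" "k (Suc i) \<in> arr (Tm X (Suc (Suc i))) (Tm X (Suc i))"
      "Df X i \<in> arr (Tm X i) (Tm X (Suc i))" "Df X (Suc i) \<in> arr (Tm X (Suc i)) (Tm X (Suc (Suc i)))"
      "Df Y i \<in> arr (Tm Y i) (Tm Y (Suc i))" "Tm X (Suc i) \<in> Ob C"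
      using i ga K(1) Ch_arr[OF Ch(1)] Ch_arr[OF Ch(2)] Obs by simp_all
    show "g (Suc i) = g (Suc i) ** p (Suc i) +[Tm X (Suc i),Tm Y (Suc i)]
      (Df Y i ** -[Tm X (Suc i),Tm Y i] (g i ** k i) +[Tm X (Suc i),Tm Y (Suc i)]
       -[Tm X (Suc (Suc i)),Tm Y (Suc i)] (g (Suc i) ** k (Suc i)) ** Df X (Suc i))"
      unfolding K(6)[OF i] using ty i comm[of i "k i"] by (simp add: cat_ac)
  qed
qed

lemma rel_homotopy_comp_right:
  assumes k: "rel_homotopy n Y Y p (\<lambda>i. Idn C (Tm Y i)) k" and g: "chain_map n C X Y g"
    and Ch: "X \<in> Ch n C" "Y \<in> Ch n C"
  shows "rel_homotopy n X Y (\<lambda>i. p i ** g i) g (\<lambda>i. k i ** g (Suc i))"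
proof -
  note K = rel_homotopyD[OF k] and Obs = Ch_Ob[OF Ch(1)] Ch_Ob[OF Ch(2)]
  note ga = chain_map_arr[OF g Ch]
  show ?thesis
    unfolding rel_homotopy_def
  proof (intro conjI allI impI)
    show "k i ** g (Suc i) \<in> arr (Tm X (Suc i)) (Tm Y i)" if "i \<le> n" for i
      using that K(1)[of i] ga[of "Suc i"] by (simp add: typing)
    show "k 0 ** g (Suc 0) = 0[Tm X (Suc 0),Tm Y 0]"
      unfolding K(2) using ga[of "Suc 0"] Obs by (simp add: zero_left)
    have "Df Y n ** k n ** g (Suc n) = (Df Y n ** k n) ** g (Suc n)"
      using ga[of "Suc n"] K(1)[of n] Ch_arr[OF Ch(2), of n] by (simp add: cat_simps)
    then show "Df Y n ** k n ** g (Suc n) = 0[Tm X (Suc n),Tm Y (Suc n)]"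
      unfolding K(3) using ga[of "Suc n"] Obs by (simp add: zero_left)
    show "p 0 ** g 0 = g 0" "p (Suc n) ** g (Suc n) = g (Suc n)"
      unfolding K(4,5) using ga[of 0] ga[of "Suc n"] by (simp_all add: id_left intoI)
    fix i assume i: "i < n"
    have ty: "g (Suc i) \<in> arr (Tm X (Suc i)) (Tm Y (Suc i))"
      "g (Suc (Suc i)) \<in> arr (Tm X (Suc (Suc i))) (Tm Y (Suc (Suc i)))"
      "k i \<in> arr (Tm Y (Suc i)) (Tm Y i)" "k (Suc i) \<in> arr (Tm Y (Suc (Suc i))) (Tm Y (Suc i))"
      "Df Y i \<in> arr (Tm Y i) (Tm Y (Suc i))" "Df Y (Suc i) \<in> arr (Tm Y (Suc i)) (Tm Y (Suc (Suc i)))"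
      "Df X (Suc i) \<in> arr (Tm X (Suc i)) (Tm X (Suc (Suc i)))" "Tm Y (Suc i) \<in> Ob C"
      using i ga K(1) Ch_arr[OF Ch(1)] Ch_arr[OF Ch(2)] Obs by simp_all
    show "p (Suc i) ** g (Suc i) = g (Suc i) +[Tm X (Suc i),Tm Y (Suc i)]
      (Df Y i ** k i ** g (Suc i) +[Tm X (Suc i),Tm Y (Suc i)]
       (k (Suc i) ** g (Suc (Suc i))) ** Df X (Suc i))"
      unfolding K(6)[OF i] using ty i chain_map_comm[OF g, of "Suc i"] by (simp add: cat_simps)
  qed
qed

text \<open>The correction is the null homotopic chain map with the single component h. It lives in
  degrees 0 and 1 and so avoids degree n + 1, because n is positive.\<close>

lemma chain_map_adjust_start:
  assumes q: "chain_map n C X Y q" and h: "h \<in> arr (Tm X (Suc 0)) (Tm Y 0)"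
    and Ch: "X \<in> Ch n C" "Y \<in> Ch n C" and n: "1 \<le> n"
  obtains r where "chain_map n C X Y r" "r 0 = q 0 +[Tm X 0,Tm Y 0] h ** Df X 0" "r (Suc n) = q (Suc n)"
proof -
  define e where "e i = (if i = 0 then h ** Df X 0 else if i = Suc 0 then Df Y 0 ** h else 0[Tm X i,Tm Y i])" for i
  note Obs = Ch_Ob[OF Ch(1)] Ch_Ob[OF Ch(2)] and Ar = Ch_arr[OF Ch(1)] Ch_arr[OF Ch(2)]
  have "chain_map n C X Y e"
  proof (rule chain_mapI)
    show "e i \<in> arr (Tm X i) (Tm Y i)" if "i \<le> Suc n" for i
      using that h Obs[of i] Ar[of 0] by (auto simp: e_def intro: comp_arr zero_arr)
    fix i assume i: "i \<le> n"
    consider "i = 0" | "i = Suc 0" | "2 \<le> i" by linarith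
    then show "Df Y i ** e i = e (Suc i) ** Df X i"
    proof cases
      case 1
      then show ?thesis using h Ar[of 0] by (simp add: e_def cat_simps)
    next
      case 2
      have "Df Y (Suc 0) ** Df Y 0 ** h = 0[Tm X (Suc 0),Tm Y (Suc (Suc 0))]"
        using comp_eq_comp[OF Ch_zero[OF Ch(2), of 0] Ar(2) Ar(2) intoI[OF h]] n h Obs(2)[of "Suc (Suc 0)"]
        by (simp add: zero_left)
      then show ?thesis using 2 n Ar(1)[of "Suc 0"] Obs(2)[of "Suc (Suc 0)"] by (simp add: e_def zero_left)
    next
      case 3
      then show ?thesis using i Ar[of i] Obs[of i] Obs[of "Suc i"] by (simp add: e_def zero_left zero_right)
    qed
  qed
  note c = chain_map_add[OF q this Ch]
  have "q (Suc n) +[Tm X (Suc n),Tm Y (Suc n)] e (Suc n) = q (Suc n)"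
    using n chain_map_arr[OF q Ch, of "Suc n"] by (simp add: e_def add_zero)
  then show thesis by (intro that[OF c]) (simp_all add: e_def)
qed

end

section \<open>Realising complexes and the transport of good lifts\<close>

context exact_realisation begin

lemma realises_Ch: "realises n C s D A \<delta> X \<Longrightarrow> X \<in> Ch n C"
  by (simp add: realises_def)

lemma realises_ends: "realises n C s D A \<delta> X \<Longrightarrow> Tm X 0 = A" "realises n C s D A \<delta> X \<Longrightarrow> Tm X (Suc n) = D"
  by (simp_all add: realises_def)

lemma realises_n_exangle: "realises n C s D A \<delta> X \<Longrightarrow> \<delta> \<in> ext D A \<Longrightarrow> n_exangle n C E X \<delta>"
  using R1[of A D \<delta> X] by (auto simp: ext_def)

lemma realises_cexact: "realises n C s D A \<delta> X \<Longrightarrow> \<delta> \<in> ext D A \<Longrightarrow> cexact n X"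
  using realises_n_exangle n_exangleD(1) by blast

lemma realises_exists:
  assumes "\<delta> \<in> ext D A" obtains X where "realises n C s D A \<delta> X"
  using assms realisation[of D A \<delta>] by (auto simp: ext_def)

lemma realises_linked:
  assumes "realises n C s D A \<delta> X" "realises n C s D A \<delta> Y" "\<delta> \<in> ext D A"
  shows "linked n X Y"
proof -
  have "s D A \<delta> = iso_class n C X" "s D A \<delta> = iso_class n C Y"
    using assms(1,2) by (simp_all only: realises_def)
  then have "iso_class n C X = iso_class n C Y" by (rule trans[OF sym])
  then show ?thesis
    using iso_class_eq_iff[OF realises_cexact[OF assms(1,3)] realises_cexact[OF assms(2,3)]] by simp
qed

lemma realises_of_linked:
  assumes X: "realises n C s D A \<delta> X" and \<delta>: "\<delta> \<in> ext D A" and Y: "cexact n Y" and l: "linked n X Y"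
  shows "realises n C s D A \<delta> Y"
proof -
  obtain f where f: "chain_map_fixing_ends n C X Y f" using l by (auto simp: linked_def)
  show ?thesis
    using iso_class_eq_iff[OF realises_cexact[OF X \<delta>] Y] l X cexact_Ch[OF Y] fixing_endsD(2,4)[OF f]
    by (simp add: realises_def)
qed

lemma lift_exists:
  assumes "realises n C s D A \<delta> X" "realises n C s F B \<rho> Y" "\<delta> \<in> ext D A" "\<rho> \<in> ext F B"
    "a \<in> arr A B" "c \<in> arr D F" "push C E D a \<delta> = pull C E B c \<rho>"
  obtains f where "chain_map n C X Y f" "f 0 = a" "f (Suc n) = c"
proof -
  have "\<exists>f. is_lift n C X Y a c f"
    using assms R0[of A B D F \<delta> \<rho> a c X Y] by (simp add: arr_def ext_def)
  then show thesis using that by (auto simp: is_lift_def)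
qed

text \<open>In degree 0 the two maps have to be the identity only up to a morphism that factors
  through the first differential. For q the factorisation comes from exactness of T, since 1 -
  \<open>q 0\<close> kills \<epsilon>. For r it is supplied as h, because M is not yet known to be
  an exangle.\<close>

lemma realises_of_maps:
  assumes n: "1 \<le> n" and \<epsilon>: "\<epsilon> \<in> ext D A" and T: "realises n C s D A \<epsilon> T"
    and M: "cexact n M" "Tm M 0 = A" "Tm M (Suc n) = D"
    and q: "chain_map n C T M q" "q (Suc n) = Idn C D" "push C E D (q 0) \<epsilon> = \<epsilon>"
    and r: "chain_map n C M T r" "r (Suc n) = Idn C D"
    and h: "h \<in> arr (Tm M (Suc 0)) A" "r 0 +[A,A] h ** Df M 0 = Idn C A"
  shows "realises n C s D A \<epsilon> M"
proof -
  note TC = realises_Ch[OF T] and MC = cexact_Ch[OF M(1)] and e = realises_ends[OF T]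
  note ex = n_exangleD[OF realises_n_exangle[OF T \<epsilon>]]
  have q0: "q 0 \<in> arr A A" using chain_map_arr[OF q(1) TC MC, of 0] e M by simp
  have A: "A \<in> Ob C" by (rule extD[OF \<epsilon>])
  define b where "b = Idn C A +[A,A] -[A,A] (q 0)"
  have b: "b \<in> arr A A" "q 0 +[A,A] b = Idn C A"
    using q0 A by (simp_all add: b_def cat_ac)
  have "push C E D b \<epsilon> = \<one>\<^bsub>Ext E D A\<^esub>"
    using push_complement_zero[OF b(2) q0 b(1) \<epsilon>] q(3) by simp
  then obtain v where v: "v \<in> arr (Tm T (Suc 0)) A" "b = v ** Df T 0"
    using ex(7)[of b A] b(1) e by auto
  obtain q' where q': "chain_map n C T M q'" "q' 0 = Idn C A" "q' (Suc n) = Idn C D"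
    using chain_map_adjust_start[OF q(1) _ TC MC n, of v] v b(2) q(2) e M(2) by auto
  obtain r' where r': "chain_map n C M T r'" "r' 0 = Idn C A" "r' (Suc n) = Idn C D"
    using chain_map_adjust_start[OF r(1) _ MC TC n, of h] h r(2) e M(2) by auto
  have "linked n T M"
    using q' r' e M by (auto simp: linked_def chain_map_fixing_ends_def)
  then show ?thesis by (rule realises_of_linked[OF T \<epsilon> M(1)])
qed

text \<open>M' is compared with an arbitrary realising complex T by passing through M. In degree 0
  both resulting maps are \<open>a (Suc 0) ** a' (Suc 0)\<close>. This need not be the identity, but
  it fixes the extension and differs from the identity by a morphism through the first differential
  of M', as \<open>realises_of_maps\<close> requires.\<close>

lemma cone_transport:
  assumes n: "1 \<le> n" and \<delta>: "\<delta> \<in> ext D A" and c: "c \<in> arr D' D"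
    and X: "realises n C s D' A (pull C E A c \<delta>) X" and X': "realises n C s D' A (pull C E A c \<delta>) X'"
    and Y: "realises n C s D A \<delta> Y" and Y': "realises n C s D A \<delta> Y'"
    and f: "is_lift n C X Y (Idn C A) c f" and M: "is_mapping_cone n C X Y f M"
    and real: "realises n C s D (Tm X (Suc 0)) (push C E D (Df X 0) \<delta>) M"
    and f': "is_lift n C X' Y' (Idn C A) c f'" and M': "is_mapping_cone n C X' Y' f' M'"
    and a: "chain_map_fixing_ends n C X X' a" and a': "chain_map_fixing_ends n C X' X a'"
    and b: "chain_map_fixing_ends n C Y Y' b" and b': "chain_map_fixing_ends n C Y' Y b'"
    and k: "rel_homotopy n X Y' (\<lambda>i. b i ** f i) (\<lambda>i. f' i ** a i) k"
    and k': "rel_homotopy n X' Y (\<lambda>i. b' i ** f' i) (\<lambda>i. f i ** a' i) k'"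
  shows "realises n C s D (Tm X' (Suc 0)) (push C E D (Df X' 0) \<delta>) M'"
proof -
  note \<delta>' = pull_ext[OF c \<delta>]
  note XC = realises_Ch[OF X] and XC' = realises_Ch[OF X'] and YC = realises_Ch[OF Y] and YC' = realises_Ch[OF Y']
  note eX = realises_ends[OF X] and eX' = realises_ends[OF X'] and eY = realises_ends[OF Y] and eY' = realises_ends[OF Y']
  have fc: "chain_map n C X Y f" and fc': "chain_map n C X' Y' f'" "f' 0 = Idn C A"
    using f f' by (simp_all add: is_lift_def)
  have MC: "M \<in> Ch n C" "M' \<in> Ch n C" and eM: "Tm M' 0 = Tm X' (Suc 0)" "Tm M' (Suc n) = D"
    using M M' eY' by (simp_all add: is_mapping_cone_def)
  have dX: "Df X 0 \<in> arr A (Tm X (Suc 0))" and dX': "Df X' 0 \<in> arr A (Tm X' (Suc 0))"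
    "Df X' (Suc 0) \<in> arr (Tm X' (Suc 0)) (Tm X' (Suc (Suc 0)))"
    using Ch_arr[OF XC, of 0] Ch_arr[OF XC', of 0] Ch_arr[OF XC', of "Suc 0"] n eX eX' by simp_all
  note \<epsilon> = push_ext[OF dX \<delta>] and \<epsilon>' = push_ext[OF dX'(1) \<delta>]
  obtain q where q: "chain_map n C M M' q" "q 0 = a (Suc 0)" "q (Suc n) = Idn C D"
    "cexact n M \<Longrightarrow> cexact n X' \<Longrightarrow> cexact n Y' \<Longrightarrow> Tm Y' 0 = Tm X' 0 \<Longrightarrow> f' 0 = Idn C (Tm X' 0) \<Longrightarrow> cexact n M'"
    using cone_transfer[OF n XC YC XC' YC' fc fc'(1) M M' a b b' k] eY by metis
  obtain q' where q': "chain_map n C M' M q'" "q' 0 = a' (Suc 0)" "q' (Suc n) = Idn C D"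
    using cone_transfer[OF n XC' YC' XC YC fc'(1) fc M' M a' b' b k'] eY' by metis
  have M'ex: "cexact n M'"
    using q(4) realises_cexact[OF real \<epsilon>] realises_cexact[OF X' \<delta>'] realises_cexact[OF Y' \<delta>] eX' eY' fc' by simp
  note A = fixing_endsD[OF a] and A' = fixing_endsD[OF a']
  have ty: "a (Suc 0) \<in> arr (Tm X (Suc 0)) (Tm X' (Suc 0))" "a' (Suc 0) \<in> arr (Tm X' (Suc 0)) (Tm X (Suc 0))"
    using chain_map_arr[OF A(1) XC XC', of "Suc 0"] chain_map_arr[OF A'(1) XC' XC, of "Suc 0"] by simp_all
  have ad: "a (Suc 0) ** Df X 0 = Df X' 0" "a' (Suc 0) ** Df X' 0 = Df X 0"
    using chain_map_comm[OF A(1), of 0] chain_map_comm[OF A'(1), of 0] A(3) A'(3) eX eX' dX dX'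
    by (simp_all add: id_right)
  have push1: "push C E D (a (Suc 0)) (push C E D (Df X 0) \<delta>) = push C E D (Df X' 0) \<delta>"
    and push2: "push C E D (a' (Suc 0)) (push C E D (Df X' 0) \<delta>) = push C E D (Df X 0) \<delta>"
    using push_comp[OF ty(1) dX \<delta>] push_comp[OF ty(2) dX'(1) \<delta>] ad by simp_all
  note D = extD(1)[OF \<delta>]
  obtain T where T: "realises n C s D (Tm X' (Suc 0)) (push C E D (Df X' 0) \<delta>) T"
    by (rule realises_exists[OF \<epsilon>'])
  obtain r where r: "chain_map n C M T r" "r 0 = a (Suc 0)" "r (Suc n) = Idn C D"
    using lift_exists[OF real T \<epsilon> \<epsilon>' ty(1) Idn_arr[OF D]] pull_Idn[OF \<epsilon>'] push1 by metis
  obtain r' where r': "chain_map n C T M r'" "r' 0 = a' (Suc 0)" "r' (Suc n) = Idn C D"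
    using lift_exists[OF T real \<epsilon>' \<epsilon> ty(2) Idn_arr[OF D]] pull_Idn[OF \<epsilon>] push2 by metis
  note TC = realises_Ch[OF T]
  \<comment> \<open>Of M' only the first row of its first differential matters. It is the negative
    of a differential of X', so a morphism that factors through the latter also factors through the
    former.\<close>
  from M'[unfolded is_mapping_cone_def] obtain i1 i2 and p1' p2 :: "nat \<Rightarrow> 'm" where
    "\<forall>i\<in>{1..n}. is_biproduct C (Tm X' (i + 1)) (Tm Y' i) (Tm M' i) (i1 i) (i2 i) (p1' i) (p2 i)"
    and "p1' 1 ** Df M' 0 = -[Tm X' 1,Tm X' 2] (Df X' 1)"
    by (elim conjE exE)
  then obtain p1 where "is_biproduct C (Tm X' (Suc (Suc 0))) (Tm Y' (Suc 0)) (Tm M' (Suc 0)) (i1 1) (i2 1) p1 (p2 1)"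
    and p1: "p1 ** Df M' 0 = -[Tm X' (Suc 0),Tm X' (Suc (Suc 0))] (Df X' (Suc 0))"
    using n by (auto simp: eval_nat_numeral dest: bspec[of _ _ 1])
  then have tp1: "p1 \<in> arr (Tm M' (Suc 0)) (Tm X' (Suc (Suc 0)))"
    using biproductD(3) Ch_Ob[OF XC', of "Suc (Suc 0)"] Ch_Ob[OF YC', of "Suc 0"] n by simp
  \<comment> \<open>The difference between the identity and a a' in degree 1. It vanishes on
    \<open>Df X' 0\<close>, hence factors through \<open>Df X' (Suc 0)\<close> and thus through the
    first differential of M'.\<close>
  define g where "g = Idn C (Tm X' (Suc 0)) +[Tm X' (Suc 0),Tm X' (Suc 0)]
    -[Tm X' (Suc 0),Tm X' (Suc 0)] (a (Suc 0) ** a' (Suc 0))"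
  have X1: "Tm X' (Suc 0) \<in> Ob C" using Ch_Ob[OF XC', of "Suc 0"] by simp
  have g: "g \<in> arr (Tm X' (Suc 0)) (Tm X' (Suc 0))" using ty X1 by (simp add: g_def typing)
  have "g ** Df X' 0 = 0[A,Tm X' (Suc 0)]"
    using ty X1 dX dX' ad by (simp add: g_def cat_simps)
  then obtain w where w: "w \<in> arr (Tm X' (Suc (Suc 0))) (Tm X' (Suc 0))" "g = w ** Df X' (Suc 0)"
    using cexactE[OF realises_cexact[OF X' \<delta>'], of 0 g] n g eX' by auto
  have Df0: "Df M' 0 \<in> arr (Tm X' (Suc 0)) (Tm M' (Suc 0))" using Ch_arr[OF MC(2), of 0] eM by simp
  let ?h = "-[Tm X' (Suc (Suc 0)),Tm X' (Suc 0)] w ** p1"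
  have "?h ** Df M' 0 = g"
    unfolding w(2) using w(1) tp1 Df0 p1 dX' by (simp add: cat_simps)
  then have h: "a (Suc 0) ** a' (Suc 0) +[Tm X' (Suc 0),Tm X' (Suc 0)] ?h ** Df M' 0 = Idn C (Tm X' (Suc 0))"
    using ty X1 by (simp add: g_def cat_ac)
  show ?thesis
  proof (rule realises_of_maps[OF n \<epsilon>' T M'ex eM chain_map_comp[OF r'(1) q(1) TC MC] _ _
        chain_map_comp[OF q'(1) r(1) MC(2,1) TC]])
    show "q (Suc n) ** r' (Suc n) = Idn C D" "r (Suc n) ** q' (Suc n) = Idn C D"
      using D by (simp_all add: q q' r r' id_right[OF Idn_arr])
    show "push C E D (q 0 ** r' 0) (push C E D (Df X' 0) \<delta>) = push C E D (Df X' 0) \<delta>"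
      using push_comp[OF ty \<epsilon>'] push1 push2 by (simp add: q r')
    show "?h \<in> arr (Tm M' (Suc 0)) (Tm X' (Suc 0))" using w(1) tp1 by (simp add: cat_simps)
    show "r 0 ** q' 0 +[Tm X' (Suc 0),Tm X' (Suc 0)] ?h ** Df M' 0 = Idn C (Tm X' (Suc 0))"
      using h by (simp add: q' r)
  qed
qed

lemma EA2_transport:
  assumes n: "1 \<le> n" and \<delta>: "\<delta> \<in> ext D A" and c: "c \<in> arr D' D"
    and X: "realises n C s D' A (pull C E A c \<delta>) X" and X': "realises n C s D' A (pull C E A c \<delta>) X'"
    and Y: "realises n C s D A \<delta> Y" and Y': "realises n C s D A \<delta> Y'"
    and f: "is_lift n C X Y (Idn C A) c f" and M: "is_mapping_cone n C X Y f M"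
    and real: "realises n C s D (Tm X (Suc 0)) (push C E D (Df X 0) \<delta>) M"
  shows "\<exists>f' M'. is_lift n C X' Y' (Idn C A) c f' \<and> is_mapping_cone n C X' Y' f' M' \<and>
    realises n C s D (Tm X' (Suc 0)) (push C E D (Df X' 0) \<delta>) M'"
proof -
  note \<delta>' = pull_ext[OF c \<delta>]
  note XC = realises_Ch[OF X] and XC' = realises_Ch[OF X'] and YC = realises_Ch[OF Y] and YC' = realises_Ch[OF Y']
  note eX = realises_ends[OF X] and eX' = realises_ends[OF X'] and eY = realises_ends[OF Y] and eY' = realises_ends[OF Y']
  have fc: "chain_map n C X Y f" "f 0 = Idn C A" "f (Suc n) = c" using f by (simp_all add: is_lift_def)
  obtain a a0 where a: "chain_map_fixing_ends n C X X' a" and a0: "chain_map_fixing_ends n C X' X a0"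
    using realises_linked[OF X X' \<delta>'] by (auto simp: linked_def)
  obtain b b0 where b: "chain_map_fixing_ends n C Y Y' b" and b0: "chain_map_fixing_ends n C Y' Y b0"
    using realises_linked[OF Y Y' \<delta>] by (auto simp: linked_def)
  \<comment> \<open>For arbitrary linking maps \<open>a0\<close> and \<open>b0\<close> the
    composites with a and b need not be visibly homotopic to identities. The sharpened ones are, on
    the side needed for the lift b f a'.\<close>
  let ?a' = "sharpen X X' a a0" and ?b' = "sharpen Y Y' b b0"
  note a' = sharpen_homotopy_inverse(1)[OF realises_cexact[OF X \<delta>'] XC' a a0]
  note b' = sharpen_homotopy_inverse(1)[OF realises_cexact[OF Y \<delta>] YC' b b0]
  obtain k where k: "rel_homotopy n X X (\<lambda>i. ?a' i ** a i) (\<lambda>i. Idn C (Tm X i)) k"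
    using sharpen_homotopy_inverse(2)[OF realises_cexact[OF X \<delta>'] XC' a a0] by blast
  obtain l where l: "rel_homotopy n Y Y (\<lambda>i. ?b' i ** b i) (\<lambda>i. Idn C (Tm Y i)) l"
    using sharpen_homotopy_inverse(2)[OF realises_cexact[OF Y \<delta>] YC' b b0] by blast
  note A = fixing_endsD[OF a] and A' = fixing_endsD[OF a'] and B = fixing_endsD[OF b] and B' = fixing_endsD[OF b']
  let ?f' = "\<lambda>i. b i ** (f i ** ?a' i)"
  note fa' = chain_map_comp[OF A'(1) fc(1) XC' XC YC] and bf = chain_map_comp[OF fc(1) B(1) XC YC YC']
  have fc': "chain_map n C X' Y' ?f'" by (rule chain_map_comp[OF fa' B(1) XC' YC YC'])
  have lift': "is_lift n C X' Y' (Idn C A) c ?f'"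
    using fc' fc B A' eX eX' eY eY' extD[OF \<delta>] c
    by (simp add: is_lift_def id_left id_right[OF Idn_arr] id_right intoI)
  obtain M' where M': "is_mapping_cone n C X' Y' ?f' M'"
    by (rule mapping_cone_exists[OF n XC' YC' fc'])
  have ty: "a i \<in> arr (Tm X i) (Tm X' i)" "?a' i \<in> arr (Tm X' i) (Tm X i)" "b i \<in> arr (Tm Y i) (Tm Y' i)"
    "?b' i \<in> arr (Tm Y' i) (Tm Y i)" "f i \<in> arr (Tm X i) (Tm Y i)" if "i \<le> Suc n" for i
    using that chain_map_arr[OF A(1) XC XC'] chain_map_arr[OF A'(1) XC' XC] chain_map_arr[OF B(1) YC YC']
      chain_map_arr[OF B'(1) YC' YC] chain_map_arr[OF fc(1) XC YC] by simp_all
  note rk = rel_homotopy_comp_left[OF k bf XC YC']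
  have K: "rel_homotopy n X Y' (\<lambda>i. b i ** f i) (\<lambda>i. ?f' i ** a i)
      (\<lambda>i. -[Tm X (Suc i),Tm Y' i] ((b i ** f i) ** k i))"
  proof (rule rel_homotopy_cong[OF rk])
    fix i assume "i \<le> Suc n"
    note ty[OF this]
    then show "(b i ** f i) ** ?a' i ** a i = ?f' i ** a i" by (simp add: cat_simps)
  qed simp
  note rl = rel_homotopy_comp_right[OF l fa' XC' YC]
  have L: "rel_homotopy n X' Y (\<lambda>i. ?b' i ** ?f' i) (\<lambda>i. f i ** ?a' i) (\<lambda>i. l i ** (f (Suc i) ** ?a' (Suc i)))"
  proof (rule rel_homotopy_cong[OF rl])
    fix i assume "i \<le> Suc n"
    note ty[OF this]
    then show "(?b' i ** b i) ** f i ** ?a' i = ?b' i ** ?f' i" by (simp add: cat_simps)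
  qed simp
  show ?thesis
    using cone_transport[OF n \<delta> c X X' Y Y' f M real lift' M' a a' b b' K L] lift' M' by blast
qed

end

section \<open>Idempotent chain maps and commuting lifts\<close>

context additive_category begin

lemma complement_idempotent:
  assumes e: "e \<in> arr A A" "e ** e = e"
    and c_def: "c = Idn C A +[A,A] -[A,A] e"
  shows "c \<in> arr A A" "e +[A,A] c = Idn C A" "c ** c = c" "e ** c = 0[A,A]" "c ** e = 0[A,A]"
proof -
  have A: "A \<in> Ob C" by (rule arrD[OF e(1)])
  show "c \<in> arr A A" "e +[A,A] c = Idn C A" using e A by (simp_all add: c_def cat_ac)
  show "c ** c = c" "e ** c = 0[A,A]" "c ** e = 0[A,A]"
    using e A by (simp_all add: c_def cat_simps)
qed

text \<open>The relation y x = 0 is one-sided, so the order of the factors matters: (1 - y)(1 - x) =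
  (1 - x) - y, and 1 - y annihilates y.\<close>

lemma product_of_complements_idempotent:
  assumes x: "x \<in> arr A A" "x ** x = x" and y: "y \<in> arr A A" "y ** y = y" and yx: "y ** x = 0[A,A]"
    and p_def: "p = Idn C A +[A,A] -[A,A] x" and q_def: "q = Idn C A +[A,A] -[A,A] y"
  shows "(p ** q) ** (p ** q) = p ** q"
proof -
  note p = complement_idempotent[OF x p_def] and q = complement_idempotent[OF y q_def]
  have A: "A \<in> Ob C" by (rule arrD[OF x(1)])
  have "q ** p = p +[A,A] -[A,A] y"
    using x y yx A by (simp add: p_def q_def cat_simps)
  then have "p ** (q ** p) ** q = p ** (p +[A,A] -[A,A] y) ** q" by simp
  also have "\<dots> = (p ** p) ** q +[A,A] -[A,A] (p ** (y ** q))"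
    using p(1) q(1) y(1) by (simp add: cat_simps)
  also have "\<dots> = p ** q"
    unfolding p(3) q(4) using p(1) q(1) A by (simp add: cat_simps zero_right)
  finally show ?thesis using p(1) q(1) by (simp add: cat_simps)
qed

lemma null_homotopy_add:
  assumes k: "rel_homotopy n X Y t (\<lambda>i. 0[Tm X i,Tm Y i]) k"
    and l: "rel_homotopy n X Y u (\<lambda>i. 0[Tm X i,Tm Y i]) l"
    and Ch: "X \<in> Ch n C" "Y \<in> Ch n C"
  shows "rel_homotopy n X Y (\<lambda>i. t i +[Tm X i,Tm Y i] u i) (\<lambda>i. 0[Tm X i,Tm Y i])
    (\<lambda>i. k i +[Tm X (Suc i),Tm Y i] l i)"
proof -
  note K = rel_homotopyD[OF k] and L = rel_homotopyD[OF l] and Obs = Ch_Ob[OF Ch(1)] Ch_Ob[OF Ch(2)]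
  show ?thesis
    unfolding rel_homotopy_def
  proof (intro conjI allI impI)
    show "k i +[Tm X (Suc i),Tm Y i] l i \<in> arr (Tm X (Suc i)) (Tm Y i)" if "i \<le> n" for i
      using that K(1)[of i] L(1)[of i] by (simp add: typing)
    show "k 0 +[Tm X (Suc 0),Tm Y 0] l 0 = 0[Tm X (Suc 0),Tm Y 0]"
      unfolding K(2) L(2) using Obs by (simp add: add_zero zero_arr)
    show "Df Y n ** (k n +[Tm X (Suc n),Tm Y n] l n) = 0[Tm X (Suc n),Tm Y (Suc n)]"
      using K(1)[of n] L(1)[of n] Ch_arr[OF Ch(2), of n] Obs by (simp add: distrib_left K(3) L(3) add_zero zero_arr)
    show "t 0 +[Tm X 0,Tm Y 0] u 0 = 0[Tm X 0,Tm Y 0]"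
      "t (Suc n) +[Tm X (Suc n),Tm Y (Suc n)] u (Suc n) = 0[Tm X (Suc n),Tm Y (Suc n)]"
      unfolding K(4,5) L(4,5) using Obs by (simp_all add: add_zero zero_arr)
    fix i assume i: "i < n"
    have "k i \<in> arr (Tm X (Suc i)) (Tm Y i)" "k (Suc i) \<in> arr (Tm X (Suc (Suc i))) (Tm Y (Suc i))"
      "l i \<in> arr (Tm X (Suc i)) (Tm Y i)" "l (Suc i) \<in> arr (Tm X (Suc (Suc i))) (Tm Y (Suc i))"
      "Df Y i \<in> arr (Tm Y i) (Tm Y (Suc i))" "Df X (Suc i) \<in> arr (Tm X (Suc i)) (Tm X (Suc (Suc i)))"
      "Tm X (Suc i) \<in> Ob C" "Tm Y (Suc i) \<in> Ob C"
      using i K(1) L(1) Ch_arr[OF Ch(1)] Ch_arr[OF Ch(2)] Obs by simp_all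
    then show "t (Suc i) +[Tm X (Suc i),Tm Y (Suc i)] u (Suc i) = 0[Tm X (Suc i),Tm Y (Suc i)]
        +[Tm X (Suc i),Tm Y (Suc i)] (Df Y i ** (k i +[Tm X (Suc i),Tm Y i] l i)
          +[Tm X (Suc i),Tm Y (Suc i)] (k (Suc i) +[Tm X (Suc (Suc i)),Tm Y (Suc i)] l (Suc i)) ** Df X (Suc i))"
      unfolding K(6)[OF i] L(6)[OF i] by (simp add: cat_ac)
  qed
qed

lemma null_homotopy_neg:
  assumes k: "rel_homotopy n X Y t (\<lambda>i. 0[Tm X i,Tm Y i]) k"
    and Ch: "X \<in> Ch n C" "Y \<in> Ch n C"
  shows "rel_homotopy n X Y (\<lambda>i. -[Tm X i,Tm Y i] t i) (\<lambda>i. 0[Tm X i,Tm Y i])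
    (\<lambda>i. -[Tm X (Suc i),Tm Y i] k i)"
proof -
  note K = rel_homotopyD[OF k] and Obs = Ch_Ob[OF Ch(1)] Ch_Ob[OF Ch(2)]
  show ?thesis
    unfolding rel_homotopy_def
  proof (intro conjI allI impI)
    show "-[Tm X (Suc i),Tm Y i] k i \<in> arr (Tm X (Suc i)) (Tm Y i)" if "i \<le> n" for i
      using that K(1)[of i] by (simp add: typing)
    show "-[Tm X (Suc 0),Tm Y 0] k 0 = 0[Tm X (Suc 0),Tm Y 0]"
      unfolding K(2) using Obs by (simp add: neg_zero)
    show "Df Y n ** -[Tm X (Suc n),Tm Y n] k n = 0[Tm X (Suc n),Tm Y (Suc n)]"
      using K(1)[of n] Ch_arr[OF Ch(2), of n] Obs by (simp add: neg_right K(3) neg_zero)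
    show "-[Tm X 0,Tm Y 0] t 0 = 0[Tm X 0,Tm Y 0]"
      "-[Tm X (Suc n),Tm Y (Suc n)] t (Suc n) = 0[Tm X (Suc n),Tm Y (Suc n)]"
      unfolding K(4,5) using Obs by (simp_all add: neg_zero)
    fix i assume i: "i < n"
    have "k i \<in> arr (Tm X (Suc i)) (Tm Y i)" "k (Suc i) \<in> arr (Tm X (Suc (Suc i))) (Tm Y (Suc i))"
      "Df Y i \<in> arr (Tm Y i) (Tm Y (Suc i))" "Df X (Suc i) \<in> arr (Tm X (Suc i)) (Tm X (Suc (Suc i)))"
      "Tm X (Suc i) \<in> Ob C" "Tm Y (Suc i) \<in> Ob C"
      using i K(1) Ch_arr[OF Ch(1)] Ch_arr[OF Ch(2)] Obs by simp_all
    then show "-[Tm X (Suc i),Tm Y (Suc i)] t (Suc i) = 0[Tm X (Suc i),Tm Y (Suc i)]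
        +[Tm X (Suc i),Tm Y (Suc i)] (Df Y i ** -[Tm X (Suc i),Tm Y i] k i
          +[Tm X (Suc i),Tm Y (Suc i)] -[Tm X (Suc (Suc i)),Tm Y (Suc i)] k (Suc i) ** Df X (Suc i))"
      unfolding K(6)[OF i] by (simp add: cat_ac)
  qed
qed

lemma rel_homotopy_of_null:
  assumes k: "rel_homotopy n X Y t (\<lambda>i. 0[Tm X i,Tm Y i]) k"
    and g: "chain_map n C X Y g" and f: "\<And>i. i \<le> Suc n \<Longrightarrow> f i = g i +[Tm X i,Tm Y i] t i"
    and Ch: "X \<in> Ch n C" "Y \<in> Ch n C"
  shows "rel_homotopy n X Y f g k"
proof -
  note K = rel_homotopyD[OF k] and ga = chain_map_arr[OF g Ch]
  have "f (Suc i) = g (Suc i) +[Tm X (Suc i),Tm Y (Suc i)]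
      (Df Y i ** k i +[Tm X (Suc i),Tm Y (Suc i)] k (Suc i) ** Df X (Suc i))" if i: "i < n" for i
  proof -
    have "k i \<in> arr (Tm X (Suc i)) (Tm Y i)" "k (Suc i) \<in> arr (Tm X (Suc (Suc i))) (Tm Y (Suc i))"
      "Df Y i \<in> arr (Tm Y i) (Tm Y (Suc i))" "Df X (Suc i) \<in> arr (Tm X (Suc i)) (Tm X (Suc (Suc i)))"
      using i K(1) Ch_arr[OF Ch(1)] Ch_arr[OF Ch(2)] by simp_all
    then show ?thesis using i f[of "Suc i"] K(6)[OF i] by (simp add: cat_simps)
  qed
  then show ?thesis
    using K(1-5) f[of 0] f[of "Suc n"] ga[of 0] ga[of "Suc n"] by (simp add: rel_homotopy_def add_zero)
qed

text \<open>A homotopy built from the left need not vanish after composition with the last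
  differential. This is repaired if one of the two idempotents through which \<open>t\<close> factors
  is split off in degree \<open>n + 1\<close> by the last differential.\<close>

lemma null_homotopic_cut:
  assumes n: "1 \<le> n" and ex: "cexact n X" and Y: "Y \<in> Ch n C"
    and t: "chain_map n C X Y t" "t 0 = 0[Tm X 0,Tm Y 0]" "t (Suc n) = 0[Tm X (Suc n),Tm Y (Suc n)]"
    and r: "chain_map n C Y Y r" and e: "chain_map n C X X e"
    and cut: "\<And>i. i \<le> Suc n \<Longrightarrow> t i = r i ** t i ** e i"
    and split: "(\<exists>v\<in>arr (Tm X (Suc n)) (Tm X n). e (Suc n) = Df X n ** v) \<or>
      (\<exists>v\<in>arr (Tm Y (Suc n)) (Tm Y n). r (Suc n) = Df Y n ** v)"
  shows "\<exists>k. rel_homotopy n X Y t (\<lambda>i. 0[Tm X i,Tm Y i]) k"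
proof -
  note X = cexact_Ch[OF ex]
  note Obs = Ch_Ob[OF X] Ch_Ob[OF Y] and ra = chain_map_arr[OF r Y Y] and ea = chain_map_arr[OF e X X]
  obtain k where k: "\<And>i. i \<le> n \<Longrightarrow> k i \<in> arr (Tm X (Suc i)) (Tm Y i)"
    "k 0 = 0[Tm X (Suc 0),Tm Y 0]"
    "\<And>i. i < n \<Longrightarrow> t (Suc i) = Df Y i ** k i +[Tm X (Suc i),Tm Y (Suc i)] k (Suc i) ** Df X (Suc i)"
    using null_homotopy_exists[OF ex Y t(1,2)] by blast
  \<comment> \<open>Since t = r t e, multiplying the homotopy by the chain maps r and e gives
    another homotopy for t.\<close>
  define K where "K i = r i ** k i ** e (Suc i)" for i
  have K1: "K i \<in> arr (Tm X (Suc i)) (Tm Y i)" if "i \<le> n" for i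
    using that k(1)[of i] ra[of i] ea[of "Suc i"] by (simp add: K_def typing)
  have K0: "K 0 = 0[Tm X (Suc 0),Tm Y 0]"
    unfolding K_def k(2) using ra[of 0] ea[of "Suc 0"] Obs by (simp add: zero_left zero_right)
  have dK: "Df Y i ** K i = r (Suc i) ** (Df Y i ** k i) ** e (Suc i)" if i: "i \<le> n" for i
  proof -
    have ty: "r i \<in> arr (Tm Y i) (Tm Y i)" "r (Suc i) \<in> arr (Tm Y (Suc i)) (Tm Y (Suc i))"
      "k i \<in> arr (Tm X (Suc i)) (Tm Y i)" "e (Suc i) \<in> arr (Tm X (Suc i)) (Tm X (Suc i))"
      "Df Y i \<in> arr (Tm Y i) (Tm Y (Suc i))"
      using i k(1) ra ea Ch_arr[OF Y] by simp_all
    have "Df Y i ** K i = (Df Y i ** r i) ** k i ** e (Suc i)" using ty by (simp add: K_def cat_simps)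
    also have "\<dots> = r (Suc i) ** (Df Y i ** k i) ** e (Suc i)"
      unfolding chain_map_comm[OF r i] using ty by (simp add: cat_simps)
    finally show ?thesis .
  qed
  have Kd: "K (Suc i) ** Df X (Suc i) = r (Suc i) ** (k (Suc i) ** Df X (Suc i)) ** e (Suc i)" if i: "i < n" for i
  proof -
    have ty: "r (Suc i) \<in> arr (Tm Y (Suc i)) (Tm Y (Suc i))" "e (Suc i) \<in> arr (Tm X (Suc i)) (Tm X (Suc i))"
      "k (Suc i) \<in> arr (Tm X (Suc (Suc i))) (Tm Y (Suc i))"
      "e (Suc (Suc i)) \<in> arr (Tm X (Suc (Suc i))) (Tm X (Suc (Suc i)))"
      "Df X (Suc i) \<in> arr (Tm X (Suc i)) (Tm X (Suc (Suc i)))"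
      using i k(1) ra ea Ch_arr[OF X] by simp_all
    have "K (Suc i) ** Df X (Suc i) = r (Suc i) ** k (Suc i) ** (e (Suc (Suc i)) ** Df X (Suc i))"
      using ty by (simp add: K_def cat_simps)
    also have "\<dots> = r (Suc i) ** (k (Suc i) ** Df X (Suc i)) ** e (Suc i)"
      unfolding chain_map_comm[OF e, of "Suc i", OF Suc_leI[OF i], symmetric] using ty by (simp add: cat_simps)
    finally show ?thesis .
  qed
  have tK: "t (Suc i) = Df Y i ** K i +[Tm X (Suc i),Tm Y (Suc i)] K (Suc i) ** Df X (Suc i)" if i: "i < n" for i
  proof -
    have ty: "r (Suc i) \<in> arr (Tm Y (Suc i)) (Tm Y (Suc i))" "e (Suc i) \<in> arr (Tm X (Suc i)) (Tm X (Suc i))"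
      "Df Y i ** k i \<in> arr (Tm X (Suc i)) (Tm Y (Suc i))" "k (Suc i) ** Df X (Suc i) \<in> arr (Tm X (Suc i)) (Tm Y (Suc i))"
      using i k(1) ra ea comp_arr[OF Ch_arr[OF Y] k(1), of i] comp_arr[OF k(1) Ch_arr[OF X], of "Suc i"] by simp_all
    have "t (Suc i) = r (Suc i) ** (Df Y i ** k i +[Tm X (Suc i),Tm Y (Suc i)] k (Suc i) ** Df X (Suc i)) ** e (Suc i)"
      using cut[of "Suc i"] i k(3)[OF i] by simp
    also have "\<dots> = Df Y i ** K i +[Tm X (Suc i),Tm Y (Suc i)] K (Suc i) ** Df X (Suc i)"
      unfolding dK[OF less_imp_le[OF i]] Kd[OF i] distrib_right[OF ty(2,3,4)]
        distrib_left[OF ty(1) comp_arr[OF ty(3,2)] comp_arr[OF ty(4,2)]] ..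
    finally show ?thesis .
  qed
  \<comment> \<open>The obstruction in degree n + 1. It vanishes on the last differential of X,
    because t is zero in degree n + 1.\<close>
  define w where "w = Df Y n ** k n"
  have tn: "Df Y n \<in> arr (Tm Y n) (Tm Y (Suc n))" "Df X n \<in> arr (Tm X n) (Tm X (Suc n))"
    "k n \<in> arr (Tm X (Suc n)) (Tm Y n)" "e (Suc n) \<in> arr (Tm X (Suc n)) (Tm X (Suc n))" "e n \<in> arr (Tm X n) (Tm X n)"
    "r (Suc n) \<in> arr (Tm Y (Suc n)) (Tm Y (Suc n))" "r n \<in> arr (Tm Y n) (Tm Y n)" "K n \<in> arr (Tm X (Suc n)) (Tm Y n)"
    using k(1) ra ea K1 Ch_arr[OF Y] Ch_arr[OF X] by simp_all
  have w: "w \<in> arr (Tm X (Suc n)) (Tm Y (Suc n))" using tn by (simp add: w_def typing)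
  have wd: "w ** Df X n = 0[Tm X n,Tm Y (Suc n)]"
  proof -
    obtain m where m: "n = Suc m" using n by (cases n) auto
    have tm: "Df Y m \<in> arr (Tm Y m) (Tm Y n)" "k m \<in> arr (Tm X n) (Tm Y m)" "t n \<in> arr (Tm X n) (Tm Y n)"
      using m Ch_arr[OF Y, of m] k(1)[of m] chain_map_arr[OF t(1) X Y, of n] by simp_all
    have "Df Y n ** Df Y m ** k m = 0[Tm X n,Tm Y (Suc n)]"
      using comp_eq_comp[OF Ch_zero[OF Y, of m] _ tm(1)[unfolded m] intoI[OF tm(2)]] tn(1) tm Obs(2)[of "Suc n"] m
      by (simp add: zero_left)
    moreover have "Df Y n ** t n = 0[Tm X n,Tm Y (Suc n)]"
      using chain_map_comm[OF t(1), of n] t(3) tn(2) Obs(2)[of "Suc n"] by (simp add: zero_left)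
    moreover have "t n = Df Y m ** k m +[Tm X n,Tm Y n] k n ** Df X n" using k(3)[of m] m by simp
    ultimately show ?thesis using tn tm by (simp add: w_def cat_simps)
  qed
  have dKn: "Df Y n ** K n = r (Suc n) ** w ** e (Suc n)" using dK[of n] by (simp add: w_def)
  show ?thesis
    using split
  proof
    assume "\<exists>v\<in>arr (Tm X (Suc n)) (Tm X n). e (Suc n) = Df X n ** v"
    then obtain v where v: "v \<in> arr (Tm X (Suc n)) (Tm X n)" "e (Suc n) = Df X n ** v" by blast
    have "w ** e (Suc n) = 0[Tm X (Suc n),Tm Y (Suc n)]"
      unfolding v(2) using comp_eq_comp[OF wd w tn(2) intoI[OF v(1)]] v(1) arrD(2)[OF w] by (simp add: zero_left)
    then have "Df Y n ** K n = 0[Tm X (Suc n),Tm Y (Suc n)]"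
      unfolding dKn using tn(6) arrD(1)[OF w] by (simp add: zero_right)
    then have "rel_homotopy n X Y t (\<lambda>i. 0[Tm X i,Tm Y i]) K"
      using K1 K0 t tK n Obs comp_arr[OF Ch_arr[OF Y] K1] comp_arr[OF K1 Ch_arr[OF X]]
      by (simp add: rel_homotopy_def add_zero add_arr)
    then show ?thesis by blast
  next
    assume "\<exists>v\<in>arr (Tm Y (Suc n)) (Tm Y n). r (Suc n) = Df Y n ** v"
    then obtain v where v: "v \<in> arr (Tm Y (Suc n)) (Tm Y n)" "r (Suc n) = Df Y n ** v" by blast
    \<comment> \<open>z has the same composite with the last differential of Y as
      \<open>K n\<close>, and it vanishes on the last differential of X. Subtracting it removes the
      obstruction without disturbing degree n.\<close>
    define z where "z = v ** w ** e (Suc n)"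
    have z: "z \<in> arr (Tm X (Suc n)) (Tm Y n)" using v(1) w tn by (simp add: z_def typing)
    have "z ** Df X n = v ** w ** (e (Suc n) ** Df X n)" using v(1) w tn by (simp add: z_def cat_simps)
    also have "\<dots> = v ** (w ** Df X n) ** e n"
      unfolding chain_map_comm[OF e order_refl, symmetric] using v(1) w tn by (simp add: cat_simps)
    also have "\<dots> = 0[Tm X n,Tm Y n]"
      unfolding wd using v(1) tn Obs(2)[of "Suc n"] Obs(1)[of n] by (simp add: cat_simps)
    finally have zd: "z ** Df X n = 0[Tm X n,Tm Y n]" .
    have dz: "Df Y n ** z = Df Y n ** K n" unfolding dKn v(2) z_def using v(1) w tn by (simp add: cat_simps)
    define L where "L = K(n := K n +[Tm X (Suc n),Tm Y n] -[Tm X (Suc n),Tm Y n] z)"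
    have L1: "L i \<in> arr (Tm X (Suc i)) (Tm Y i)" if "i \<le> n" for i
      using that K1 z by (simp add: L_def typing)
    have Li: "L i = K i" if "i < n" for i using that by (simp add: L_def)
    have Ld: "L (Suc i) ** Df X (Suc i) = K (Suc i) ** Df X (Suc i)" if "i < n" for i
    proof (cases "Suc i = n")
      case True
      have "(K n +[Tm X (Suc n),Tm Y n] -[Tm X (Suc n),Tm Y n] z) ** Df X n = K n ** Df X n"
        using tn z zd Obs(2)[of n] Obs(1)[of n] by (simp add: cat_simps)
      then show ?thesis using True by (simp add: L_def)
    qed (simp add: L_def)
    have "Df Y n ** L n = 0[Tm X (Suc n),Tm Y (Suc n)]"
      using tn z dz by (simp add: L_def cat_simps)
    then have "rel_homotopy n X Y t (\<lambda>i. 0[Tm X i,Tm Y i]) L"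
      using L1 K0 Li[of 0] t tK n Obs Ld Li comp_arr[OF Ch_arr[OF Y] K1] comp_arr[OF K1 Ch_arr[OF X]]
      by (simp add: rel_homotopy_def add_zero add_arr)
    then show ?thesis by blast
  qed
qed

end

section \<open>Idempotent lifts and lifts commuting with idempotents\<close>

context exact_realisation begin

text \<open>1 - a kills \<delta>, so exactness at degree 0 makes it factor through the first
  differential.\<close>

lemma push_split:
  assumes X: "n_exangle n C E X \<delta>"
    and a: "a \<in> arr (Tm X 0) (Tm X 0)" "push C E (Tm X (Suc n)) a \<delta> = \<delta>"
    and b: "b = Idn C (Tm X 0) +[Tm X 0,Tm X 0] -[Tm X 0,Tm X 0] a"
  obtains u where "u \<in> arr (Tm X (Suc 0)) (Tm X 0)" "b = u ** Df X 0"
proof -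
  have b': "b \<in> arr (Tm X 0) (Tm X 0)" "a +[Tm X 0,Tm X 0] b = Idn C (Tm X 0)"
    using a(1) arrD(1)[OF a(1)] by (simp_all add: b cat_ac)
  note ex = n_exangleD[OF X]
  have "push C E (Tm X (Suc n)) b \<delta> = \<one>\<^bsub>Ext E (Tm X (Suc n)) (Tm X 0)\<^esub>"
    using push_complement_zero[OF b'(2) a(1) b'(1) ex(2)] a(2) by simp
  then show thesis using ex(7)[OF b'(1)] that by blast
qed

lemma pull_split:
  assumes X: "n_exangle n C E X \<delta>"
    and a: "a \<in> arr (Tm X (Suc n)) (Tm X (Suc n))" "pull C E (Tm X 0) a \<delta> = \<delta>"
    and b: "b = Idn C (Tm X (Suc n)) +[Tm X (Suc n),Tm X (Suc n)] -[Tm X (Suc n),Tm X (Suc n)] a"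
  obtains v where "v \<in> arr (Tm X (Suc n)) (Tm X n)" "b = Df X n ** v"
proof -
  have b': "b \<in> arr (Tm X (Suc n)) (Tm X (Suc n))" "a +[Tm X (Suc n),Tm X (Suc n)] b = Idn C (Tm X (Suc n))"
    using a(1) arrD(1)[OF a(1)] by (simp_all add: b cat_ac)
  note ex = n_exangleD[OF X]
  have "pull C E (Tm X 0) b \<delta> = \<one>\<^bsub>Ext E (Tm X (Suc n)) (Tm X 0)\<^esub>"
    using pull_complement_zero[OF b'(2) a(1) b'(1) ex(2)] a(2) by simp
  then show thesis using ex(6)[OF b'(1)] that by blast
qed

text \<open>If \<open>1 - a = u d\<^sub>0\<close> and \<open>1 - d = d\<^sub>n v\<close>, then \<open>(1 - a, d\<^sub>0 u, 0, \<dots>)\<close> and \<open>(\<dots>, 0, v d\<^sub>n, 1 - d)\<close> are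
  idempotent chain maps (for normalised \<open>u\<close> and \<open>v\<close>), and the product of their complements is a lift
  of \<open>(a, d)\<close>.\<close>

lemma idempotent_lift:
  assumes n: "1 \<le> n" and X: "n_exangle n C E X \<delta>"
    and a: "a \<in> arr (Tm X 0) (Tm X 0)" "a ** a = a" "push C E (Tm X (Suc n)) a \<delta> = \<delta>"
    and d: "d \<in> arr (Tm X (Suc n)) (Tm X (Suc n))" "d ** d = d" "pull C E (Tm X 0) d \<delta> = \<delta>"
  obtains e where "chain_map n C X X e" "\<And>i. i \<le> Suc n \<Longrightarrow> e i ** e i = e i" "e 0 = a" "e (Suc n) = d"
proof -
  note XC = cexact_Ch[OF n_exangleD(1)[OF X]]
  note Obs = Ch_Ob[OF XC] and Ar = Ch_arr[OF XC]
  define a' where "a' = Idn C (Tm X 0) +[Tm X 0,Tm X 0] -[Tm X 0,Tm X 0] a"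
  define d' where "d' = Idn C (Tm X (Suc n)) +[Tm X (Suc n),Tm X (Suc n)] -[Tm X (Suc n),Tm X (Suc n)] d"
  note A = complement_idempotent[OF a(1,2) a'_def] and D = complement_idempotent[OF d(1,2) d'_def]
  obtain u0 where u0: "u0 \<in> arr (Tm X (Suc 0)) (Tm X 0)" "a' = u0 ** Df X 0"
    by (rule push_split[OF X a(1,3) a'_def])
  obtain v0 where v0: "v0 \<in> arr (Tm X (Suc n)) (Tm X n)" "d' = Df X n ** v0"
    by (rule pull_split[OF X d(1,3) d'_def])
  \<comment> \<open>Cutting \<open>u0\<close> by a' keeps the composite with \<open>Df X 0\<close>
    equal to a' and adds a' u = u; this makes \<open>Df X 0 ** u\<close> idempotent. The same is
    done for v on the other side.\<close>
  define u where "u = a' ** u0"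
  define v where "v = v0 ** d'"
  have d0: "Df X 0 \<in> arr (Tm X 0) (Tm X (Suc 0))" and dn: "Df X n \<in> arr (Tm X n) (Tm X (Suc n))" using Ar by simp_all
  have u: "u \<in> arr (Tm X (Suc 0)) (Tm X 0)" using A(1) u0(1) by (simp add: u_def typing)
  have v: "v \<in> arr (Tm X (Suc n)) (Tm X n)" using D(1) v0(1) by (simp add: v_def typing)
  have ud: "u ** Df X 0 = a'"
    unfolding u_def comp_assoc_arr[OF A(1) u0(1) d0] u0(2)[symmetric] by (rule A(3))
  have dv: "Df X n ** v = d'" unfolding v_def using D(3) v0(2) comp_assoc_arr[OF dn v0(1) D(1)] by simp
  have a'u: "a' ** u = u" unfolding u_def using comp_assoc_arr[OF A(1) A(1) u0(1)] A(3) by simp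
  have vd': "v ** d' = v" unfolding v_def using comp_assoc_arr[OF v0(1) D(1) D(1)] D(3) by simp
  let ?x = "Df X 0 ** u" and ?y = "v ** Df X n"
  define x where "x = ?x"
  define y where "y = ?y"
  have x: "x \<in> arr (Tm X (Suc 0)) (Tm X (Suc 0))" using u d0 by (simp add: x_def typing)
  have y: "y \<in> arr (Tm X n) (Tm X n)" using v dn by (simp add: y_def typing)
  have xx: "x ** x = x"
    using u d0 comp_eq_comp[OF ud u d0 intoI[OF u]] a'u by (simp add: x_def cat_simps)
  have yy: "y ** y = y"
    using v dn comp_eq_comp[OF dv dn v intoI[OF dn]] comp_eq_comp[OF vd' v D(1) intoI[OF dn]] by (simp add: y_def cat_simps)
  define p where "p i = (if i = 0 then a else if i = Suc 0 then Idn C (Tm X (Suc 0)) +[Tm X (Suc 0),Tm X (Suc 0)]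
      -[Tm X (Suc 0),Tm X (Suc 0)] x else Idn C (Tm X i))" for i
  define q where "q i = (if i = Suc n then d else if i = n then Idn C (Tm X n) +[Tm X n,Tm X n]
      -[Tm X n,Tm X n] y else Idn C (Tm X i))" for i
  have pa: "p i \<in> arr (Tm X i) (Tm X i)" if "i \<le> Suc n" for i
    using that a(1) x Obs by (auto simp: p_def typing)
  have qa: "q i \<in> arr (Tm X i) (Tm X i)" if "i \<le> Suc n" for i
    using that d(1) y Obs by (auto simp: q_def typing)
  have a_eq: "a = Idn C (Tm X 0) +[Tm X 0,Tm X 0] -[Tm X 0,Tm X 0] a'"
    using a(1) Obs[of 0] by (simp add: a'_def cat_ac)
  have d_eq: "d = Idn C (Tm X (Suc n)) +[Tm X (Suc n),Tm X (Suc n)] -[Tm X (Suc n),Tm X (Suc n)] d'"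
    using d(1) Obs[of "Suc n"] by (simp add: d'_def cat_ac)
  have pc: "chain_map n C X X p"
  proof (rule chain_mapI[OF pa])
    fix i assume i: "i \<le> n"
    consider "i = 0" | "i = Suc 0" | "2 \<le> i" by linarith
    then show "Df X i ** p i = p (Suc i) ** Df X i"
    proof cases
      case 1
      have "Df X 0 ** a = Df X 0 +[Tm X 0,Tm X (Suc 0)] -[Tm X 0,Tm X (Suc 0)] (Df X 0 ** a')"
        using d0 A(1) Obs[of 0] by (subst a_eq) (simp add: cat_simps)
      also have "\<dots> = p (Suc 0) ** Df X 0"
        using d0 u Obs[of "Suc 0"] by (simp add: p_def x_def ud[symmetric] cat_simps)
      finally show ?thesis using 1 by (simp add: p_def)
    next
      case 2
      have "Df X (Suc 0) ** x = 0[Tm X (Suc 0),Tm X (Suc (Suc 0))]"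
        using comp_eq_comp[OF Ch_zero[OF XC, of 0] Ar d0 intoI[OF u]] n u Obs[of "Suc (Suc 0)"] by (simp add: x_def zero_left)
      then show ?thesis using 2 n x Ar[of "Suc 0"] Obs[of "Suc 0"] Obs[of "Suc (Suc 0)"] by (simp add: p_def cat_simps)
    next
      case 3
      then show ?thesis using i Ar[OF i] by (simp add: p_def id_left id_right intoI)
    qed
  qed
  have qc: "chain_map n C X X q"
  proof (rule chain_mapI[OF qa])
    fix i assume i: "i \<le> n"
    consider "i = n" | "Suc i = n" | "Suc i < n" using i by linarith
    then show "Df X i ** q i = q (Suc i) ** Df X i"
    proof cases
      case 1
      have "d ** Df X n = Df X n +[Tm X n,Tm X (Suc n)] -[Tm X n,Tm X (Suc n)] (d' ** Df X n)"
        using dn D(1) Obs[of "Suc n"] by (subst d_eq) (simp add: cat_simps)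
      also have "\<dots> = Df X n ** q n"
        using dn v Obs[of n] by (simp add: q_def y_def dv[symmetric] cat_simps)
      finally show ?thesis using 1 by (simp add: q_def)
    next
      case 2
      have di: "Df X i \<in> arr (Tm X i) (Tm X n)" using 2 Ar[of i] by simp
      have "y ** Df X i = 0[Tm X i,Tm X n]"
        using 2 v dn di Ch_zero[OF XC, of i] zero_right[OF v, of "Tm X i"] Obs[of i] by (auto simp add: y_def cat_simps)
      then show ?thesis using 2 di y Obs[of n] arrD(1)[OF di] by (simp add: q_def cat_simps)
    next
      case 3
      then show ?thesis using i Ar[OF i] by (simp add: q_def id_left id_right intoI)
    qed
  qed
  have idem: "(p i ** q i) ** (p i ** q i) = p i ** q i" if i: "i \<le> Suc n" for i
  proof -
    have pp: "p i ** p i = p i"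
      using i a(2) complement_idempotent(3)[OF x xx refl] Obs by (auto simp: p_def id_right[OF Idn_arr])
    have qq: "q i ** q i = q i"
      using i d(2) complement_idempotent(3)[OF y yy refl] Obs by (auto simp: q_def id_right[OF Idn_arr])
    \<comment> \<open>Both factors can differ from the identity only in degree 1 of a complex with n
      = 1. There y x = 0, because consecutive differentials compose to zero.\<close>
    consider "i \<noteq> Suc n" "i \<noteq> n" | "i \<noteq> 0" "i \<noteq> Suc 0" | "i = Suc 0" "n = Suc 0"
      using i n by linarith
    then show ?thesis
    proof cases
      case 1
      then have "q i = Idn C (Tm X i)" by (simp add: q_def)
      then show ?thesis using pa[OF i] pp by (simp add: id_right)
    next
      case 2
      then have "p i = Idn C (Tm X i)" by (simp add: p_def)
      then show ?thesis using qa[OF i] qq by (simp add: id_left intoI)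
    next
      case 3
      have "Df X (Suc 0) ** x = 0[Tm X (Suc 0),Tm X (Suc (Suc 0))]"
        using comp_eq_comp[OF Ch_zero[OF XC, of 0] Ar d0 intoI[OF u]] n u Obs[of "Suc (Suc 0)"] by (simp add: x_def zero_left)
      then have "y ** x = 0[Tm X (Suc 0),Tm X (Suc 0)]"
        using 3 v dn x zero_right[OF v, of "Tm X (Suc 0)"] Obs[of "Suc 0"] by (simp add: y_def cat_simps)
      then show ?thesis
        using product_of_complements_idempotent[OF x xx, of y "p 1" "q 1"] y yy 3 by (simp add: p_def q_def)
    qed
  qed
  show thesis
  proof (rule that[OF chain_map_comp[OF qc pc XC XC XC] idem])
    show "p 0 ** q 0 = a" using n a(1) by (simp add: p_def q_def id_right)
    show "p (Suc n) ** q (Suc n) = d" using n d(1) by (simp add: p_def q_def id_left intoI)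
  qed
qed

text \<open>Only the term in degree 1 is exchanged. As n is positive this is not an end term, so the
  extension stays the same.\<close>

lemma inflation_comp_iso:
  assumes n: "1 \<le> n" and f: "is_inflation n C E s A B f"
    and g: "g \<in> arr B B'" "h \<in> arr B' B" "h ** g = Idn C B" "g ** h = Idn C B'"
  shows "is_inflation n C E s A B' (g ** f)"
proof -
  obtain D \<delta> X where D: "D \<in> Ob C" "\<delta> \<in> carrier (Ext E D A)" and X: "realises n C s D A \<delta> X"
    and X1: "Tm X (Suc 0) = B" "Df X 0 = f"
    using f by (auto simp: is_inflation_def)
  note XC = realises_Ch[OF X] and e = realises_ends[OF X]
  have \<delta>: "\<delta> \<in> ext D A" using D Ch_Ob[OF XC, of 0] e by (simp add: ext_def)
  define Y where "Y = \<lparr>Tm = (Tm X)(Suc 0 := B'), Df = (Df X)(0 := g ** Df X 0, Suc 0 := Df X (Suc 0) ** h)\<rparr>"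
  define p where "p i = (if i = Suc 0 then g else Idn C (Tm X i))" for i
  define q where "q i = (if i = Suc 0 then h else Idn C (Tm X i))" for i
  have d: "Df X 0 \<in> arr (Tm X 0) B" "Df X (Suc 0) \<in> arr B (Tm X (Suc (Suc 0)))"
    using Ch_arr[OF XC, of 0] Ch_arr[OF XC, of "Suc 0"] n X1 by simp_all
  have Ya: "Df Y i \<in> arr (Tm Y i) (Tm Y (Suc i))" if "i \<le> n" for i
    using that Ch_arr[OF XC, of i] d g n by (auto simp: Y_def typing)
  have h1: "h ** g ** Df X 0 = Df X 0"
    using comp_eq_comp[OF g(3,2,1) intoI[OF d(1)]] d(1) by (simp add: id_left intoI)
  have Yz: "Df Y (Suc i) ** Df Y i = 0[Tm Y i,Tm Y (Suc (Suc i))]" if i: "i < n" for i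
  proof -
    consider "i = 0" | "i = Suc 0" | "2 \<le> i" by linarith
    then show ?thesis
    proof cases
      case 1
      then show ?thesis using Ch_zero[OF XC i] d g h1 by (simp add: Y_def cat_simps)
    next
      case 2
      have "Df X (Suc (Suc 0)) ** Df X (Suc 0) ** h = 0[B',Tm X (Suc (Suc (Suc 0)))]"
        using 2 i comp_eq_comp[OF Ch_zero[OF XC, of "Suc 0"] Ch_arr[OF XC] Ch_arr[OF XC], of h] g(2) X1 Ch_Ob[OF XC, of "Suc (Suc (Suc 0))"]
        by (simp add: intoI zero_left)
      then show ?thesis using 2 by (simp add: Y_def)
    next
      case 3
      then show ?thesis using Ch_zero[OF XC i] by (simp add: Y_def)
    qed
  qed
  have YC: "Y \<in> Ch n C"
    using Ya[THEN arrD(3)] Yz Ch_Ob[OF XC] arrD(2)[OF g(1)] by (simp add: Ch_def Y_def)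
  have pc: "chain_map n C X Y p"
  proof (rule chain_mapI)
    show "p i \<in> arr (Tm X i) (Tm Y i)" if "i \<le> Suc n" for i
      using that g X1 Ch_Ob[OF XC, of i] by (simp add: p_def Y_def Idn_arr)
    fix i assume i: "i \<le> n"
    consider "i = 0" | "i = Suc 0" | "2 \<le> i" by linarith
    then show "Df Y i ** p i = p (Suc i) ** Df X i"
    proof cases
      case 1 then show ?thesis using d g comp_arr[OF g(1) d(1)] by (simp add: p_def Y_def id_right)
    next
      case 2 then show ?thesis using d g by (simp add: p_def Y_def cat_simps)
    next
      case 3 then show ?thesis using Ch_arr[OF XC i] by (simp add: p_def Y_def id_right id_left intoI)
    qed
  qed
  have qc: "chain_map n C Y X q"
  proof (rule chain_mapI)
    show "q i \<in> arr (Tm Y i) (Tm X i)" if "i \<le> Suc n" for i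
      using that g X1 Ch_Ob[OF XC, of i] by (simp add: q_def Y_def Idn_arr)
    fix i assume i: "i \<le> n"
    consider "i = 0" | "i = Suc 0" | "2 \<le> i" by linarith
    then show "Df X i ** q i = q (Suc i) ** Df Y i"
    proof cases
      case 1 then show ?thesis using d g h1 by (simp add: q_def Y_def id_right)
    next
      case 2 then show ?thesis using d g by (simp add: q_def Y_def cat_simps)
    next
      case 3 then show ?thesis using Ch_arr[OF XC i] by (simp add: q_def Y_def id_right id_left intoI)
    qed
  qed
  \<comment> \<open>p and q are strictly inverse to each other, so the zero homotopy does.\<close>
  have "rel_homotopy n Y Y (\<lambda>i. p i ** q i) (\<lambda>i. Idn C (Tm Y i)) (\<lambda>i. 0[Tm Y (Suc i),Tm Y i])"
  proof -
    have "p i ** q i = Idn C (Tm Y i)" if "i \<le> Suc n" for i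
      using that g Ch_Ob[OF XC, of i] by (simp add: p_def q_def Y_def id_right[OF Idn_arr])
    moreover have "Df Y i ** 0[Tm Y (Suc i),Tm Y i] = 0[Tm Y (Suc i),Tm Y (Suc i)]" if "i \<le> n" for i
      using zero_right[OF Ya[OF that]] Ch_Ob[OF YC] that by simp
    moreover have "0[Tm Y (Suc i),Tm Y i] ** Df Y i = 0[Tm Y i,Tm Y i]" if "i \<le> n" for i
      using zero_left[OF Ya[OF that]] Ch_Ob[OF YC] that by simp
    ultimately show ?thesis
      using Ch_Ob[OF YC] by (simp add: rel_homotopy_def zero_arr add_zero Idn_arr)
  qed
  then have ex: "cexact n Y"
    using homotopy_retract_cexact[OF realises_cexact[OF X \<delta>] YC pc qc] rel_homotopy_homotopic[OF _ YC YC chain_map_Idn[OF YC]]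
    by blast
  have "linked n X Y"
    unfolding linked_def chain_map_fixing_ends_def using pc qc n
    by (intro conjI exI[of _ p] exI[of _ q]) (simp_all add: p_def q_def Y_def)
  then have "realises n C s D A \<delta> Y" by (rule realises_of_linked[OF X \<delta> ex])
  then show ?thesis
    unfolding is_inflation_def using D X1
    by (intro bexI[of _ D] bexI[of _ \<delta>] exI[of _ Y] conjI) (simp_all add: Y_def)
qed

text \<open>f differs from its commuting part by r f (1 - e) + (1 - r) f e. Both summands vanish in
  degrees 0 and n + 1, and each contains a complementary idempotent that factors through the last
  differential in degree n + 1: 1 - e because d' fixes the pulled extension, 1 - r because d fixes
  \<delta>. This is the situation of \<open>null_homotopic_cut\<close>.\<close>

lemma commuting_lift:
  assumes n: "1 \<le> n" and \<delta>: "\<delta> \<in> ext D A" and c: "c \<in> arr D' D"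
    and X: "realises n C s D' A (pull C E A c \<delta>) X" and Y: "realises n C s D A \<delta> Y"
    and f: "is_lift n C X Y (Idn C A) c f" and M: "is_mapping_cone n C X Y f M"
    and real: "realises n C s D (Tm X (Suc 0)) (push C E D (Df X 0) \<delta>) M"
    and e: "chain_map n C X X e" "\<And>i. i \<le> Suc n \<Longrightarrow> e i ** e i = e i" "e 0 = a" "e (Suc n) = d'"
    and r: "chain_map n C Y Y r" "\<And>i. i \<le> Suc n \<Longrightarrow> r i ** r i = r i" "r 0 = a" "r (Suc n) = d"
    and cd: "c ** d' = c" "d ** c = c" and d\<delta>: "pull C E A d \<delta> = \<delta>"
  shows "\<exists>f' M'. is_lift n C X Y (Idn C A) c f' \<and> is_mapping_cone n C X Y f' M' \<and>
    realises n C s D (Tm X (Suc 0)) (push C E D (Df X 0) \<delta>) M' \<and>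
    (\<forall>i\<le>Suc n. f' i ** e i = r i ** f' i)"
proof -
  note \<delta>' = pull_ext[OF c \<delta>]
  note XC = realises_Ch[OF X] and YC = realises_Ch[OF Y]
  note eX = realises_ends[OF X] and eY = realises_ends[OF Y]
  note ObX = Ch_Ob[OF XC] and ObY = Ch_Ob[OF YC]
  note ea = chain_map_arr[OF e(1) XC XC] and ra = chain_map_arr[OF r(1) YC YC]
  have fc: "chain_map n C X Y f" "f 0 = Idn C A" "f (Suc n) = c" using f by (simp_all add: is_lift_def)
  note fa = chain_map_arr[OF fc(1) XC YC]
  define e' where "e' i = Idn C (Tm X i) +[Tm X i,Tm X i] -[Tm X i,Tm X i] e i" for i
  define r' where "r' i = Idn C (Tm Y i) +[Tm Y i,Tm Y i] -[Tm Y i,Tm Y i] r i" for i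
  note E' = complement_idempotent[OF ea e(2) e'_def] and R' = complement_idempotent[OF ra r(2) r'_def]
  have e'c: "chain_map n C X X e'" unfolding e'_def[abs_def]
    by (rule chain_map_add[OF chain_map_Idn[OF XC] chain_map_neg[OF e(1) XC XC] XC XC])
  have r'c: "chain_map n C Y Y r'" unfolding r'_def[abs_def]
    by (rule chain_map_add[OF chain_map_Idn[OF YC] chain_map_neg[OF r(1) YC YC] YC YC])
  let ?f = "\<lambda>i. (r i ** f i ** e i) +[Tm X i,Tm Y i] (r' i ** f i ** e' i)"
  let ?s = "\<lambda>i. r i ** f i ** e' i" and ?t = "\<lambda>i. r' i ** f i ** e i"
  have cm: "chain_map n C X Y (\<lambda>i. x i ** f i ** y i)" if "chain_map n C Y Y x" "chain_map n C X X y" for x y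
    by (rule chain_map_comp[OF chain_map_comp[OF that(2) fc(1) XC XC YC] that(1) XC YC YC])
  have f'c: "chain_map n C X Y ?f"
    by (rule chain_map_add[OF cm[OF r(1) e(1)] cm[OF r'c e'c] XC YC])
  have A: "A \<in> Ob C" and D: "D \<in> Ob C" "D' \<in> Ob C" using extD[OF \<delta>] arrD[OF c] by simp_all
  have a: "a \<in> arr A A" and d: "d \<in> arr D D" and d': "d' \<in> arr D' D'"
    using ea[of 0] ra[of "Suc n"] ea[of "Suc n"] e r eX eY by simp_all
  have aa: "a ** a = a" using e(2)[of 0] e(3) by simp
  have e'0: "e' 0 = Idn C A +[A,A] -[A,A] a" "e' (Suc n) = Idn C D' +[D',D'] -[D',D'] d'"
    "r' 0 = Idn C A +[A,A] -[A,A] a" "r' (Suc n) = Idn C D +[D,D] -[D,D] d"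
    using e r eX eY by (simp_all add: e'_def r'_def)
  note A' = complement_idempotent[OF a aa e'0(1)]
  \<comment> \<open>Here c being a morphism from d' to d in the completion makes both mixed terms
    vanish in degree n + 1.\<close>
  have ce': "c ** e' (Suc n) = 0[D',D]" and r'c0: "r' (Suc n) ** c = 0[D',D]"
    using c cd d d' D by (simp_all add: e'0 cat_simps)
  have lift': "is_lift n C X Y (Idn C A) c ?f"
  proof -
    have "?f 0 = Idn C A"
      using A'(1,2,3) a aa A eX eY e'0(1,3) by (simp add: fc e r id_left intoI)
    moreover have "?f (Suc n) = c"
      using ce' c cd D eX eY d d' R'(1)[of "Suc n"]
      by (simp add: fc e r zero_right add_zero)
    ultimately show ?thesis using f'c by (simp add: is_lift_def)
  qed
  obtain v where v: "v \<in> arr (Tm X (Suc n)) (Tm X n)" "e' (Suc n) = Df X n ** v"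
  proof (rule pull_split[OF realises_n_exangle[OF X \<delta>']])
    show "e (Suc n) \<in> arr (Tm X (Suc n)) (Tm X (Suc n))" by (rule ea) simp
    show "pull C E (Tm X 0) (e (Suc n)) (pull C E A c \<delta>) = pull C E A c \<delta>"
      using pull_comp[OF c d' \<delta>] cd(1) e(4) eX by simp
  qed (auto simp: e'_def)
  obtain w where w: "w \<in> arr (Tm Y (Suc n)) (Tm Y n)" "r' (Suc n) = Df Y n ** w"
  proof (rule pull_split[OF realises_n_exangle[OF Y \<delta>]])
    show "r (Suc n) \<in> arr (Tm Y (Suc n)) (Tm Y (Suc n))" by (rule ra) simp
    show "pull C E (Tm Y 0) (r (Suc n)) \<delta> = \<delta>"
      using d\<delta> r(4) eY by simp
  qed (auto simp: r'_def)
  note cX = realises_cexact[OF X \<delta>']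
  obtain k where k: "rel_homotopy n X Y ?s (\<lambda>i. 0[Tm X i,Tm Y i]) k"
  proof -
    have "?s 0 = 0[Tm X 0,Tm Y 0]"
      using A'(1,4) a A eX eY by (simp add: fc e r id_left intoI)
    moreover have "?s (Suc n) = 0[Tm X (Suc n),Tm Y (Suc n)]"
      using ce' d D eX eY by (simp add: fc r zero_right)
    moreover have "?s i = r i ** ?s i ** e' i" if i: "i \<le> Suc n" for i
      using ra[OF i] fa[OF i] E'(1)[OF i i] comp_eq_comp[OF r(2)[OF i] ra[OF i] ra[OF i]] E'(3)[OF i i]
      by (simp add: cat_simps)
    ultimately show thesis
      using null_homotopic_cut[OF n cX YC cm[OF r(1) e'c] _ _ r(1) e'c] v that by blast
  qed
  obtain l where l: "rel_homotopy n X Y ?t (\<lambda>i. 0[Tm X i,Tm Y i]) l"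
  proof -
    have "?t 0 = 0[Tm X 0,Tm Y 0]"
      using A'(1,5) a A eX eY e'0 by (simp add: fc e r id_left intoI)
    moreover have "?t (Suc n) = 0[Tm X (Suc n),Tm Y (Suc n)]"
      using r'c0 cd d' D eX eY by (simp add: fc e)
    moreover have "?t i = r' i ** ?t i ** e i" if i: "i \<le> Suc n" for i
      using ea[OF i] fa[OF i] R'(1)[OF i i] comp_eq_comp[OF R'(3)[OF i i] R'(1)[OF i i] R'(1)[OF i i]] e(2)[OF i]
      by (simp add: cat_simps)
    ultimately show thesis
      using null_homotopic_cut[OF n cX YC cm[OF r'c e(1)] _ _ r'c e(1)] w that by blast
  qed
  note kl = null_homotopy_add[OF k l XC YC]
  have sum: "f i = ?f i +[Tm X i,Tm Y i] (?s i +[Tm X i,Tm Y i] ?t i)" if i: "i \<le> Suc n" for i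
  proof -
    note ty = ra[OF i] fa[OF i] ea[OF i] R'(1)[OF i i] E'(1)[OF i i]
    have "f i = (r i +[Tm Y i,Tm Y i] r' i) ** f i ** (e i +[Tm X i,Tm X i] e' i)"
      unfolding R'(2)[OF i i] E'(2)[OF i i] using fa[OF i] by (simp add: id_left id_right intoI)
    then show ?thesis using ty by (simp add: cat_ac)
  qed
  have h: "rel_homotopy n X Y f ?f (\<lambda>i. k i +[Tm X (Suc i),Tm Y i] l i)"
    by (rule rel_homotopy_of_null[OF kl f'c sum XC YC])
  have h': "rel_homotopy n X Y ?f f (\<lambda>i. -[Tm X (Suc i),Tm Y i] (k i +[Tm X (Suc i),Tm Y i] l i))"
  proof (rule rel_homotopy_of_null[OF null_homotopy_neg[OF kl XC YC] fc(1) _ XC YC])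
    fix i assume i: "i \<le> Suc n"
    have "?f i \<in> arr (Tm X i) (Tm Y i)" "?s i +[Tm X i,Tm Y i] ?t i \<in> arr (Tm X i) (Tm Y i)"
      using ra[OF i] fa[OF i] ea[OF i] R'(1)[OF i i] E'(1)[OF i i] by (simp_all add: typing)
    then have "?f i = (?f i +[Tm X i,Tm Y i] (?s i +[Tm X i,Tm Y i] ?t i)) +[Tm X i,Tm Y i]
        -[Tm X i,Tm Y i] (?s i +[Tm X i,Tm Y i] ?t i)"
      by (simp only: add_assoc neg_arr add_neg add_zero)
    then show "?f i = f i +[Tm X i,Tm Y i] -[Tm X i,Tm Y i] (?s i +[Tm X i,Tm Y i] ?t i)"
      by (simp only: sum[OF i, symmetric])
  qed
  obtain M' where M': "is_mapping_cone n C X Y ?f M'"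
    by (rule mapping_cone_exists[OF n XC YC f'c])
  have I: "chain_map_fixing_ends n C W W (\<lambda>i. Idn C (Tm W i))" if "W \<in> Ch n C" for W
    using chain_map_Idn[OF that] by (simp add: chain_map_fixing_ends_def)
  have I1: "rel_homotopy n X Y (\<lambda>i. Idn C (Tm Y i) ** g i) (\<lambda>i. g' i ** Idn C (Tm X i)) k"
    if "rel_homotopy n X Y g g' k" "chain_map n C X Y g" "chain_map n C X Y g'" for g g' k
    by (rule rel_homotopy_cong[OF that(1)])
      (simp_all add: id_left[OF intoI[OF chain_map_arr[OF that(2) XC YC]]] id_right[OF chain_map_arr[OF that(3) XC YC]])
  have "realises n C s D (Tm X (Suc 0)) (push C E D (Df X 0) \<delta>) M'"
    by (rule cone_transport[OF n \<delta> c X X Y Y f M real lift' M' I[OF XC] I[OF XC] I[OF YC] I[OF YC]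
      I1[OF h fc(1) f'c] I1[OF h' f'c fc(1)]])
  moreover have "?f i ** e i = r i ** ?f i" if i: "i \<le> Suc n" for i
  proof -
    note ty = ra[OF i] fa[OF i] ea[OF i] R'(1)[OF i i] E'(1)[OF i i]
    have "?f i ** e i = r i ** f i ** e i"
      using ty e(2)[OF i] E'(5)[OF i i] zero_right[OF ty(2) arrD(1)[OF ty(3)]] zero_right[OF ty(4) arrD(1)[OF ty(3)]]
      by (simp add: cat_simps)
    moreover have "r i ** ?f i = r i ** f i ** e i"
      using ty comp_eq_comp[OF r(2)[OF i] ty(1,1)] comp_eq_comp[OF R'(4)[OF i i] ty(1,4)] arrD(1)[OF ty(1)]
      by (simp add: cat_simps)
    ultimately show ?thesis by simp
  qed
  ultimately show ?thesis
    using lift' M' by (intro exI[of _ ?f] exI[of _ M'] conjI allI impI)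
qed

end

section \<open>Duality\<close>

definition op_cat :: "('o, 'm) addcat \<Rightarrow> ('o, 'm) addcat" where
  "op_cat C = \<lparr>Ob = Ob C, Hom = (\<lambda>A B. Hom C B A), Cmp = (\<lambda>g f. f \<cdot>\<^bsub>C\<^esub> g), Idn = Idn C\<rparr>"

definition op_bifunctor :: "('o, 'm, 'x) bifunctor \<Rightarrow> ('o, 'm, 'x) bifunctor" where
  "op_bifunctor E = \<lparr>Ext = (\<lambda>D A. Ext E A D), Act = (\<lambda>c a. Act E a c)\<rparr>"

definition rev_cpx :: "nat \<Rightarrow> ('o, 'm) cpx \<Rightarrow> ('o, 'm) cpx" where
  "rev_cpx n X = \<lparr>Tm = (\<lambda>i. Tm X (Suc n - i)), Df = (\<lambda>i. Df X (n - i))\<rparr>"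

text \<open>A preimage rather than an image under reversal: reversing twice returns a complex only
  up to its irrelevant values beyond degree n + 1, so the image of a class would be too
  small.\<close>

definition op_realisation ::
  "nat \<Rightarrow> ('o, 'm) addcat \<Rightarrow> ('o, 'm, 'x) realisation \<Rightarrow> ('o, 'm, 'x) realisation" where
  "op_realisation n C s = (\<lambda>D A \<delta>. {W \<in> Ch n (op_cat C). rev_cpx n W \<in> s A D \<delta>})"

lemma op_cat_simps [simp]:
  "Ob (op_cat C) = Ob C" "Hom (op_cat C) A B = Hom C B A" "g \<cdot>\<^bsub>op_cat C\<^esub> f = f \<cdot>\<^bsub>C\<^esub> g" "Idn (op_cat C) = Idn C"
  by (simp_all add: op_cat_def)

lemma op_bifunctor_simps [simp]:
  "Ext (op_bifunctor E) D A = Ext E A D" "Act (op_bifunctor E) c a = Act E a c"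
  by (simp_all add: op_bifunctor_def)

lemma rev_cpx_simps [simp]:
  "Tm (rev_cpx n X) i = Tm X (Suc n - i)" "Df (rev_cpx n X) i = Df X (n - i)"
  by (simp_all add: rev_cpx_def)

lemma push_pull_op [simp]:
  "push (op_cat C) (op_bifunctor E) D a \<delta> = pull C E D a \<delta>"
  "pull (op_cat C) (op_bifunctor E) A c \<delta> = push C E A c \<delta>"
  by (simp_all add: push_def pull_def)

lemma is_zero_object_op [simp]: "is_zero_object (op_cat C) Z \<longleftrightarrow> is_zero_object C Z"
  by (auto simp: is_zero_object_def)

lemma is_biproduct_op [simp]:
  "is_biproduct (op_cat C) A B P i1 i2 p1 p2 \<longleftrightarrow> is_biproduct C A B P p1 p2 i1 i2"
  by (auto simp: is_biproduct_def)

lemma all_le_rev: "(\<forall>i\<le>n. P i) \<longleftrightarrow> (\<forall>i\<le>n. P (n - i))" for n :: nat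
  by (metis diff_diff_cancel diff_le_self)

text \<open>Differentials are reversed by i to n - i, but pairs of consecutive differentials by i to
  n - 1 - i.\<close>

lemma all_less_rev: "(\<forall>i<n. P i) \<longleftrightarrow> (\<forall>i<n. P (n - Suc i))" for n :: nat
  by (metis Suc_diff_Suc Suc_diff_le diff_Suc_Suc diff_diff_cancel diff_less_Suc less_imp_le_nat not_less_eq)

lemma Ch_op: "W \<in> Ch n (op_cat C) \<longleftrightarrow> rev_cpx n W \<in> Ch n C"
proof -
  have 1: "(\<forall>i\<le>n + 1. Tm W i \<in> Ob C) \<longleftrightarrow> (\<forall>i\<le>n + 1. Tm (rev_cpx n W) i \<in> Ob C)"
    by (subst all_le_rev) simp
  have 2: "(\<forall>i\<le>n. Df W i \<in> carrier (Hom C (Tm W (i + 1)) (Tm W i))) \<longleftrightarrow>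
      (\<forall>i\<le>n. Df (rev_cpx n W) i \<in> carrier (Hom C (Tm (rev_cpx n W) i) (Tm (rev_cpx n W) (i + 1))))"
    by (subst all_le_rev) (simp add: Suc_diff_le)
  have 3: "(\<forall>i<n. Df W i \<cdot>\<^bsub>C\<^esub> Df W (i + 1) = \<one>\<^bsub>Hom C (Tm W (i + 2)) (Tm W i)\<^esub>) \<longleftrightarrow>
      (\<forall>i<n. Df (rev_cpx n W) (i + 1) \<cdot>\<^bsub>C\<^esub> Df (rev_cpx n W) i = \<one>\<^bsub>Hom C (Tm (rev_cpx n W) i) (Tm (rev_cpx n W) (i + 2))\<^esub>)"
  proof (subst all_less_rev, intro all_cong)
    fix i assume "i < n"
    then have "n - Suc i + 1 = n - i" "n - Suc i + 2 = Suc n - i" "Suc n - (i + 2) = n - Suc i" by simp_all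
    then show "Df W (n - Suc i) \<cdot>\<^bsub>C\<^esub> Df W (n - Suc i + 1) = \<one>\<^bsub>Hom C (Tm W (n - Suc i + 2)) (Tm W (n - Suc i))\<^esub> \<longleftrightarrow>
      Df (rev_cpx n W) (i + 1) \<cdot>\<^bsub>C\<^esub> Df (rev_cpx n W) i = \<one>\<^bsub>Hom C (Tm (rev_cpx n W) i) (Tm (rev_cpx n W) (i + 2))\<^esub>"
      by simp
  qed
  show ?thesis
    unfolding Ch_def mem_Collect_eq op_cat_simps 1 2 3 ..
qed

lemma chain_map_op:
  "chain_map n (op_cat C) X Y f \<longleftrightarrow> chain_map n C (rev_cpx n Y) (rev_cpx n X) (\<lambda>i. f (Suc n - i))"
proof -
  have 1: "(\<forall>i\<le>n + 1. f i \<in> carrier (Hom C (Tm Y i) (Tm X i))) \<longleftrightarrow>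
      (\<forall>i\<le>n + 1. f (Suc n - i) \<in> carrier (Hom C (Tm (rev_cpx n Y) i) (Tm (rev_cpx n X) i)))"
    by (subst all_le_rev) simp
  have 2: "(\<forall>i\<le>n. f i \<cdot>\<^bsub>C\<^esub> Df Y i = Df X i \<cdot>\<^bsub>C\<^esub> f (i + 1)) \<longleftrightarrow>
      (\<forall>i\<le>n. Df (rev_cpx n X) i \<cdot>\<^bsub>C\<^esub> f (Suc n - i) = f (Suc n - (i + 1)) \<cdot>\<^bsub>C\<^esub> Df (rev_cpx n Y) i)"
    by (subst all_le_rev) (auto simp: Suc_diff_le)
  show ?thesis unfolding chain_map_def op_cat_simps 1 2 ..
qed

lemma chain_map_cong:
  assumes "\<And>i. i \<le> Suc n \<Longrightarrow> f i = g i"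
  shows "chain_map n C X Y f \<longleftrightarrow> chain_map n C X Y g"
  using assms by (simp add: chain_map_def)

lemma chain_map_of_op:
  assumes "chain_map n C (rev_cpx n Y) (rev_cpx n X) f"
  shows "chain_map n (op_cat C) X Y (\<lambda>i. f (Suc n - i))"
  unfolding chain_map_op by (rule chain_map_cong[THEN iffD1, OF _ assms]) simp

lemma fixing_ends_op:
  "chain_map_fixing_ends n (op_cat C) X Y f \<longleftrightarrow>
    chain_map_fixing_ends n C (rev_cpx n Y) (rev_cpx n X) (\<lambda>i. f (Suc n - i))"
  unfolding chain_map_fixing_ends_def chain_map_op by auto

lemma fixing_ends_of_op:
  assumes "chain_map_fixing_ends n C (rev_cpx n Y) (rev_cpx n X) f"
  shows "chain_map_fixing_ends n (op_cat C) X Y (\<lambda>i. f (Suc n - i))"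
  using assms chain_map_of_op[of n C Y X f] unfolding chain_map_fixing_ends_def by simp

lemma n_exangle_op:
  "n_exangle n (op_cat C) (op_bifunctor E) W \<delta> \<longleftrightarrow> n_exangle n C E (rev_cpx n W) \<delta>"
proof -
  have 1: "attached_complex n (op_cat C) (op_bifunctor E) W \<delta> \<longleftrightarrow> attached_complex n C E (rev_cpx n W) \<delta>"
    by (auto simp: attached_complex_def Ch_op)
  have 2: "(\<forall>i<n. (\<lambda>u. Df W i \<cdot>\<^bsub>op_cat C\<^esub> u) ` carrier (Hom (op_cat C) Y (Tm W i))
           = kernel (Hom (op_cat C) Y (Tm W (i + 1))) (Hom (op_cat C) Y (Tm W (i + 2))) (\<lambda>u. Df W (i + 1) \<cdot>\<^bsub>op_cat C\<^esub> u)) \<longleftrightarrow>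
    (\<forall>i<n. (\<lambda>u. u \<cdot>\<^bsub>C\<^esub> Df (rev_cpx n W) (i + 1)) ` carrier (Hom C (Tm (rev_cpx n W) (i + 2)) Y)
           = kernel (Hom C (Tm (rev_cpx n W) (i + 1)) Y) (Hom C (Tm (rev_cpx n W) i) Y) (\<lambda>u. u \<cdot>\<^bsub>C\<^esub> Df (rev_cpx n W) i))" for Y
  proof (subst all_less_rev, intro all_cong)
    fix i assume "i < n"
    then have e: "n - Suc i + 1 = n - i" "n - Suc i + 2 = Suc n - i" "Suc n - (i + 2) = n - Suc i" "Suc n - (i + 1) = n - i" by simp_all
    show "((\<lambda>u. Df W (n - Suc i) \<cdot>\<^bsub>op_cat C\<^esub> u) ` carrier (Hom (op_cat C) Y (Tm W (n - Suc i)))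
           = kernel (Hom (op_cat C) Y (Tm W (n - Suc i + 1))) (Hom (op_cat C) Y (Tm W (n - Suc i + 2))) (\<lambda>u. Df W (n - Suc i + 1) \<cdot>\<^bsub>op_cat C\<^esub> u)) \<longleftrightarrow>
     ((\<lambda>u. u \<cdot>\<^bsub>C\<^esub> Df (rev_cpx n W) (i + 1)) ` carrier (Hom C (Tm (rev_cpx n W) (i + 2)) Y)
           = kernel (Hom C (Tm (rev_cpx n W) (i + 1)) Y) (Hom C (Tm (rev_cpx n W) i) Y) (\<lambda>u. u \<cdot>\<^bsub>C\<^esub> Df (rev_cpx n W) i))"
      unfolding op_cat_simps rev_cpx_simps e by simp
  qed
  have 3: "(\<forall>i<n. (\<lambda>u. u \<cdot>\<^bsub>op_cat C\<^esub> Df W (i + 1)) ` carrier (Hom (op_cat C) (Tm W (i + 2)) Y)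
           = kernel (Hom (op_cat C) (Tm W (i + 1)) Y) (Hom (op_cat C) (Tm W i) Y) (\<lambda>u. u \<cdot>\<^bsub>op_cat C\<^esub> Df W i)) \<longleftrightarrow>
    (\<forall>i<n. (\<lambda>u. Df (rev_cpx n W) i \<cdot>\<^bsub>C\<^esub> u) ` carrier (Hom C Y (Tm (rev_cpx n W) i))
           = kernel (Hom C Y (Tm (rev_cpx n W) (i + 1))) (Hom C Y (Tm (rev_cpx n W) (i + 2))) (\<lambda>u. Df (rev_cpx n W) (i + 1) \<cdot>\<^bsub>C\<^esub> u))" for Y
  proof (subst all_less_rev, intro all_cong)
    fix i assume "i < n"
    then have e: "n - Suc i + 1 = n - i" "n - Suc i + 2 = Suc n - i" "Suc n - (i + 2) = n - Suc i" "Suc n - (i + 1) = n - i" by simp_all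
    show "((\<lambda>u. u \<cdot>\<^bsub>op_cat C\<^esub> Df W (n - Suc i + 1)) ` carrier (Hom (op_cat C) (Tm W (n - Suc i + 2)) Y)
           = kernel (Hom (op_cat C) (Tm W (n - Suc i + 1)) Y) (Hom (op_cat C) (Tm W (n - Suc i)) Y) (\<lambda>u. u \<cdot>\<^bsub>op_cat C\<^esub> Df W (n - Suc i))) \<longleftrightarrow>
     ((\<lambda>u. Df (rev_cpx n W) i \<cdot>\<^bsub>C\<^esub> u) ` carrier (Hom C Y (Tm (rev_cpx n W) i))
           = kernel (Hom C Y (Tm (rev_cpx n W) (i + 1))) (Hom C Y (Tm (rev_cpx n W) (i + 2))) (\<lambda>u. Df (rev_cpx n W) (i + 1) \<cdot>\<^bsub>C\<^esub> u))"
      unfolding op_cat_simps rev_cpx_simps e by simp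
  qed
  show ?thesis
    unfolding n_exangle_def 1 2 3 by (simp add: conj_ac)
qed

text \<open>Equality in the degrees that matter; reversal is an involution up to this
  relation.\<close>

definition cpx_agree :: "nat \<Rightarrow> ('o, 'm) cpx \<Rightarrow> ('o, 'm) cpx \<Rightarrow> bool" where
  "cpx_agree n X Y \<longleftrightarrow> (\<forall>i\<le>Suc n. Tm X i = Tm Y i) \<and> (\<forall>i\<le>n. Df X i = Df Y i)"

lemma cpx_agree_rev_rev: "cpx_agree n X (rev_cpx n (rev_cpx n X))"
  by (simp add: cpx_agree_def)

lemma (in additive_category) op_additive: "additive_category (op_cat C)"
proof (rule additive_category.intro)
  show "\<exists>P i1 i2 p1 p2. is_biproduct (op_cat C) A B P i1 i2 p1 p2" if "A \<in> Ob (op_cat C)" "B \<in> Ob (op_cat C)" for A B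
    using ex_biproduct[of A B] that unfolding is_biproduct_op op_cat_simps by blast
qed (simp_all add: Idn_in_Hom Cmp_in_Hom Idn_left Idn_right Cmp_assoc Hom_comm_group Cmp_add_left Cmp_add_right
  ex_zero_object)

context additive_category begin

lemma cpx_agree_Ch: "cpx_agree n X Y \<Longrightarrow> X \<in> Ch n C \<Longrightarrow> Y \<in> Ch n C"
  by (simp add: cpx_agree_def Ch_def)

lemma cpx_agree_linked:
  assumes "cpx_agree n X Y" "X \<in> Ch n C"
  shows "linked n X Y"
proof -
  note Y = cpx_agree_Ch[OF assms]
  have "chain_map n C X Y (\<lambda>i. Idn C (Tm X i))" "chain_map n C Y X (\<lambda>i. Idn C (Tm X i))"
    using chain_map_Idn[OF assms(2)] chain_map_Idn[OF Y] assms(1) by (simp_all add: chain_map_def cpx_agree_def)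
  then show ?thesis
    using assms(1) unfolding linked_def chain_map_fixing_ends_def cpx_agree_def by auto
qed

lemma cpx_agree_cexact: "cpx_agree n X Y \<Longrightarrow> cexact n X \<Longrightarrow> cexact n Y"
  using cpx_agree_Ch[of n X Y] unfolding cexact_def cpx_agree_def by simp

lemma iso_class_refl: "X \<in> Ch n C \<Longrightarrow> X \<in> iso_class n C X"
proof -
  assume X: "X \<in> Ch n C"
  note Obs = Ch_Ob[OF X]
  have z: "Df X i ** 0[Tm X (Suc i),Tm X i] = 0[Tm X (Suc i),Tm X (Suc i)]"
    "0[Tm X (Suc i),Tm X i] ** Df X i = 0[Tm X i,Tm X i]" if "i \<le> n" for i
    using zero_right[OF Ch_arr[OF X that]] zero_left[OF Ch_arr[OF X that]] Obs that by simp_all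
  have "rel_homotopy n X X (\<lambda>i. Idn C (Tm X i) ** Idn C (Tm X i)) (\<lambda>i. Idn C (Tm X i)) (\<lambda>i. 0[Tm X (Suc i),Tm X i])"
    using Obs z by (simp add: rel_homotopy_def zero_arr add_zero Idn_arr id_right[OF Idn_arr])
  then show ?thesis
    using X chain_map_Idn[OF X] rel_homotopy_homotopic[OF _ X X chain_map_Idn[OF X]]
    unfolding iso_class_def chain_map_fixing_ends_def by blast
qed

lemma linked_op_iff:
  "additive_category.linked (op_cat C) n X Y \<longleftrightarrow> linked n (rev_cpx n X) (rev_cpx n Y)"
proof -
  interpret O: additive_category "op_cat C" by (rule op_additive)
  show ?thesis
    unfolding O.linked_def linked_def using fixing_ends_op[of n C] fixing_ends_of_op[of n C] by blast
qed

lemma left_trivial_Ch: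
  assumes "is_zero_object C Z" "A \<in> Ob C"
  shows "left_trivial_cpx C A Z \<in> Ch n C"
  using assms zero_object_Ob[OF assms(1)] zero_right[of "0[A,Z]" A Z A]
  by (auto simp: Ch_def left_trivial_cpx_def arrD(3)[OF Idn_arr] arrD(3)[OF zero_arr] id_right[OF zero_arr]
      zero_left[OF zero_arr] eval_nat_numeral)

lemma right_trivial_Ch:
  assumes "is_zero_object C Z" "A \<in> Ob C" "1 \<le> n"
  shows "right_trivial_cpx n C A Z \<in> Ch n C"
  using assms zero_object_Ob[OF assms(1)]
  by (auto simp: Ch_def right_trivial_cpx_def arrD(3)[OF Idn_arr] arrD(3)[OF zero_arr] id_left[OF intoI[OF zero_arr]]
      zero_left[OF zero_arr] eval_nat_numeral)

end

section \<open>Exangles and realisations in the opposite category\<close>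

context biadditive_functor begin

lemma op_biadditive: "biadditive_functor (op_cat C) (op_bifunctor E)"
  by (intro biadditive_functor.intro biadditive_functor_axioms.intro op_additive)
    (simp_all add: Ext_comm_group Act_hom Act_Idn Act_Cmp Act_add_left Act_add_right)

text \<open>\<open>cexact\<close> changes sides under reversal, whereas exangles are self-dual;
  describing the class by exangles makes it comparable with classes in the opposite category. The
  covariant half of exactness is carried over by the homotopy from f g to the identity, dually to
  \<open>homotopy_retract_cexact\<close>.\<close>

lemma n_exangle_iso_class_iff:
  assumes X: "n_exangle n C E X \<delta>"
  shows "Y \<in> iso_class n C X \<longleftrightarrow> n_exangle n C E Y \<delta> \<and> linked n X Y"
proof
  assume "n_exangle n C E Y \<delta> \<and> linked n X Y"
  then show "Y \<in> iso_class n C X"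
    using linked_iso_class[OF n_exangleD(1)[OF X]] n_exangleD(1) by blast
next
  assume "Y \<in> iso_class n C X"
  then obtain f g where Y: "Y \<in> Ch n C" and f: "chain_map_fixing_ends n C X Y f" and g: "chain_map_fixing_ends n C Y X g"
    and h: "homotopic n C Y Y (\<lambda>i. f i ** g i) (\<lambda>i. Idn C (Tm Y i))"
    by (auto simp: iso_class_def)
  note F = fixing_endsD[OF f] and G = fixing_endsD[OF g]
  note D = n_exangleD[OF X]
  note XC = cexact_Ch[OF D(1)] and \<delta> = D(2)
  note fa = chain_map_arr[OF F(1) XC Y] and ga = chain_map_arr[OF G(1) Y XC]
  have cY: "cexact n Y" by (rule homotopy_retract_cexact[OF D(1) Y F(1) G(1) h])
  have l: "linked n X Y" using f g by (auto simp: linked_def)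
  have d: "Df X 0 \<in> arr (Tm X 0) (Tm X (Suc 0))" "Df Y 0 \<in> arr (Tm X 0) (Tm Y (Suc 0))"
    "Df X n \<in> arr (Tm X n) (Tm X (Suc n))" "Df Y n \<in> arr (Tm Y n) (Tm X (Suc n))"
    using Ch_arr[OF XC, of 0] Ch_arr[OF Y, of 0] Ch_arr[OF XC, of n] Ch_arr[OF Y, of n] F(2,4) by simp_all
  have f1: "Df Y 0 = f (Suc 0) ** Df X 0" using chain_map_comm[OF F(1), of 0] F(3) d by (simp add: id_right)
  have g1: "Df X 0 = g (Suc 0) ** Df Y 0" using chain_map_comm[OF G(1), of 0] G(3) F(2) d by (simp add: id_right)
  have fn: "Df X n = Df Y n ** f n" using chain_map_comm[OF F(1), of n] F(5) d by (simp add: id_left intoI)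
  have gn: "Df Y n = Df X n ** g n" using chain_map_comm[OF G(1), of n] G(5) F(4) d by (simp add: id_left intoI)
  have fg0: "f (Suc 0) \<in> arr (Tm X (Suc 0)) (Tm Y (Suc 0))" "g (Suc 0) \<in> arr (Tm Y (Suc 0)) (Tm X (Suc 0))"
    "f n \<in> arr (Tm X n) (Tm Y n)" "g n \<in> arr (Tm Y n) (Tm X n)"
    using fa ga by simp_all
  have "n_exangle n C E Y \<delta>"
    unfolding n_exangle_iff
  proof (intro conjI allI ballI impI cY)
    show "\<delta> \<in> ext (Tm Y (Suc n)) (Tm Y 0)" using \<delta> F(2,4) by simp
    show "push C E (Tm Y (Suc n)) (Df Y 0) \<delta> = \<one>\<^bsub>Ext E (Tm Y (Suc n)) (Tm Y (Suc 0))\<^esub>"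
      unfolding F(4) f1 push_comp[OF fg0(1) d(1) \<delta>] D(3) by (rule push_of_zero[OF fg0(1) extD(1)[OF \<delta>]])
    show "pull C E (Tm Y 0) (Df Y n) \<delta> = \<one>\<^bsub>Ext E (Tm Y n) (Tm Y 0)\<^esub>"
      unfolding F(2) gn pull_comp[OF d(3) fg0(4) \<delta>] D(4) by (rule pull_of_zero[OF fg0(4) extD(2)[OF \<delta>]])
  next
    fix W u assume u: "u \<in> arr W (Tm Y (Suc n))" "pull C E (Tm Y 0) u \<delta> = \<one>\<^bsub>Ext E W (Tm Y 0)\<^esub>"
    then obtain v where v: "v \<in> arr W (Tm X n)" "u = Df X n ** v" using D(6)[of u W] F(2,4) by auto
    then have "u = Df Y n ** f n ** v" using fn comp_assoc_arr[OF d(4) fg0(3) v(1)] by simp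
    then show "\<exists>v\<in>arr W (Tm Y n). u = Df Y n ** v" using comp_arr[OF fg0(3) v(1)] by blast
  next
    fix W u assume u: "u \<in> arr (Tm Y 0) W" "push C E (Tm Y (Suc n)) u \<delta> = \<one>\<^bsub>Ext E (Tm Y (Suc n)) W\<^esub>"
    then obtain v where v: "v \<in> arr (Tm X (Suc 0)) W" "u = v ** Df X 0" using D(7)[of u W] F(2,4) by auto
    then have "u = (v ** g (Suc 0)) ** Df Y 0" using g1 comp_assoc_arr[OF v(1) fg0(2) d(2)] by simp
    then show "\<exists>v\<in>arr (Tm Y (Suc 0)) W. u = v ** Df Y 0" using comp_arr[OF v(1) fg0(2)] by blast
  next
    fix i W u
    assume i: "i < n" and u: "u \<in> arr W (Tm Y (Suc i))" "Df Y (Suc i) ** u = 0[W,Tm Y (Suc (Suc i))]"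
    obtain h where h: "\<And>i. i \<le> n \<Longrightarrow> h i \<in> arr (Tm Y (Suc i)) (Tm Y i)"
      "\<And>i. i < n \<Longrightarrow> f (Suc i) ** g (Suc i) = Idn C (Tm Y (Suc i)) +[Tm Y (Suc i),Tm Y (Suc i)]
         (Df Y i ** h i +[Tm Y (Suc i),Tm Y (Suc i)] h (Suc i) ** Df Y (Suc i))"
      using h Ch_Ob[OF Y] unfolding homotopic_def arr_def by auto
    have ty: "f i \<in> arr (Tm X i) (Tm Y i)" "f (Suc i) \<in> arr (Tm X (Suc i)) (Tm Y (Suc i))"
      "g (Suc i) \<in> arr (Tm Y (Suc i)) (Tm X (Suc i))"
      "g (Suc (Suc i)) \<in> arr (Tm Y (Suc (Suc i))) (Tm X (Suc (Suc i)))"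
      "Df X i \<in> arr (Tm X i) (Tm X (Suc i))" "Df X (Suc i) \<in> arr (Tm X (Suc i)) (Tm X (Suc (Suc i)))"
      "Df Y i \<in> arr (Tm Y i) (Tm Y (Suc i))" "Df Y (Suc i) \<in> arr (Tm Y (Suc i)) (Tm Y (Suc (Suc i)))"
      "h i \<in> arr (Tm Y (Suc i)) (Tm Y i)" "h (Suc i) \<in> arr (Tm Y (Suc (Suc i))) (Tm Y (Suc i))"
      "W \<in> Ob C" "Tm Y (Suc i) \<in> Ob C"
      using i h(1) fa ga Ch_arr[OF XC] Ch_arr[OF Y] arrD[OF u(1)] by simp_all
    have "Df X (Suc i) ** g (Suc i) ** u = (Df X (Suc i) ** g (Suc i)) ** u" using ty u(1) by (simp add: cat_simps)
    also have "\<dots> = g (Suc (Suc i)) ** (Df Y (Suc i) ** u)"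
      unfolding chain_map_comm[OF G(1), of "Suc i", OF Suc_leI[OF i]] using ty u(1) by (simp add: cat_simps)
    also have "\<dots> = 0[W,Tm X (Suc (Suc i))]" unfolding u(2) using ty by (simp add: zero_right)
    finally obtain v where v: "v \<in> arr W (Tm X i)" "g (Suc i) ** u = Df X i ** v"
      using D(5)[OF i comp_arr[OF ty(3) u(1)]] by blast
    have "f (Suc i) ** Df X i ** v = (f (Suc i) ** g (Suc i)) ** u"
      unfolding v(2)[symmetric] using ty u(1) by (simp add: cat_simps)
    also have "\<dots> = u +[W,Tm Y (Suc i)] (Df Y i ** h i ** u +[W,Tm Y (Suc i)] h (Suc i) ** (Df Y (Suc i) ** u))"
      unfolding h(2)[OF i] using ty u(1) by (simp add: cat_simps)
    also have "\<dots> = u +[W,Tm Y (Suc i)] Df Y i ** h i ** u"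
      unfolding u(2) using ty u(1) by (simp add: cat_simps)
    finally have e: "f (Suc i) ** Df X i ** v = u +[W,Tm Y (Suc i)] Df Y i ** h i ** u" .
    have "Df Y i ** f i ** v = (Df Y i ** f i) ** v" using ty v(1) by (simp add: cat_simps)
    also have "\<dots> = f (Suc i) ** Df X i ** v"
      unfolding chain_map_comm[OF F(1) less_imp_le[OF i]] using ty v(1) by (simp add: cat_simps)
    finally have "u = Df Y i ** (f i ** v +[W,Tm Y i] -[W,Tm Y i] (h i ** u))"
      using e ty u(1) v(1) by (simp add: cat_simps)
    then show "\<exists>v\<in>arr W (Tm Y i). u = Df Y i ** v"
      using ty u(1) v(1) by (intro bexI) (assumption | simp add: typing)+
  qed
  then show "n_exangle n C E Y \<delta> \<and> linked n X Y" using l by blast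
qed

end

context exact_realisation begin

lemma realises_of_agree:
  assumes "realises n C s D A \<delta> X" "\<delta> \<in> ext D A" "cpx_agree n X Y"
  shows "realises n C s D A \<delta> Y"
  using assms by (intro realises_of_linked[OF assms(1,2)] cpx_agree_cexact[OF assms(3)] cpx_agree_linked[OF assms(3)]
      realises_cexact[OF assms(1,2)] realises_Ch[OF assms(1)])

lemma realises_rev_rev:
  "realises n C s D A \<delta> X \<Longrightarrow> \<delta> \<in> ext D A \<Longrightarrow> realises n C s D A \<delta> (rev_cpx n (rev_cpx n X))"
  by (rule realises_of_agree[OF _ _ cpx_agree_rev_rev])

text \<open>The classes on both sides are cut out by being an exangle and being linked, and both
  conditions are invariant under reversal.\<close>

lemma realises_op:
  assumes \<delta>: "\<delta> \<in> ext A D"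
  shows "realises n (op_cat C) (op_realisation n C s) D A \<delta> W \<longleftrightarrow> realises n C s A D \<delta> (rev_cpx n W)"
    (is "?O \<longleftrightarrow> ?R")
proof -
  interpret O: biadditive_functor "op_cat C" "op_bifunctor E" by (rule op_biadditive)
  have iso: "iso_class n (op_cat C) W = {V \<in> Ch n (op_cat C). rev_cpx n V \<in> iso_class n C (rev_cpx n W)}"
    if X: "n_exangle n C E (rev_cpx n W) \<delta>" for W
  proof -
    have "V \<in> iso_class n (op_cat C) W \<longleftrightarrow> rev_cpx n V \<in> iso_class n C (rev_cpx n W)" for V
      using O.n_exangle_iso_class_iff[of n W \<delta> V] n_exangle_iso_class_iff[OF X, of "rev_cpx n V"] X
      by (simp add: n_exangle_op linked_op_iff)
    moreover have "V \<in> Ch n (op_cat C)" if "V \<in> iso_class n (op_cat C) W" for V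
      using that by (simp add: iso_class_def)
    ultimately show ?thesis by blast
  qed
  show ?thesis
  proof
    assume R: ?R
    note X = realises_n_exangle[OF R \<delta>]
    show ?O
      using R iso[OF X] by (simp add: realises_def op_realisation_def Ch_op)
  next
    assume Op: ?O
    then have W: "W \<in> Ch n (op_cat C)" and sW: "op_realisation n C s D A \<delta> = iso_class n (op_cat C) W"
      and e: "Tm W 0 = A" "Tm W (Suc n) = D"
      by (simp_all add: realises_def)
    \<comment> \<open>Equality of the reversed classes does not immediately give that
      \<open>s A D \<delta>\<close> is the class of \<open>rev_cpx n W\<close>. But W lies in its
      own class, so its reversal lies in \<open>s A D \<delta>\<close> and is linked to any
      realising complex.\<close>
    have "W \<in> op_realisation n C s D A \<delta>" unfolding sW by (rule O.iso_class_refl[OF W])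
    then have mem: "rev_cpx n W \<in> s A D \<delta>" by (simp add: op_realisation_def)
    obtain X where X: "realises n C s A D \<delta> X" by (rule realises_exists[OF \<delta>])
    have "rev_cpx n W \<in> iso_class n C X" using mem X by (simp add: realises_def)
    then have "cexact n (rev_cpx n W)" "linked n X (rev_cpx n W)"
      using iso_class_iff[OF realises_cexact[OF X \<delta>]] by simp_all
    then show ?R by (rule realises_of_linked[OF X \<delta>])
  qed
qed

text \<open>(R2) for the left trivial complexes of the opposite category is (R2) for the right
  trivial ones of C and vice versa, up to values outside the relevant degrees.\<close>

lemma op_exact_realisation:
  assumes n: "1 \<le> n"
  shows "exact_realisation (op_cat C) (op_bifunctor E) n (op_realisation n C s)"
proof (intro exact_realisation.intro exact_realisation_axioms.intro op_biadditive)
  fix D A \<delta> assume "D \<in> Ob (op_cat C)" "A \<in> Ob (op_cat C)" "\<delta> \<in> carrier (Ext (op_bifunctor E) D A)"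
  then have \<delta>: "\<delta> \<in> ext A D" by (simp add: ext_def)
  obtain X where X: "realises n C s A D \<delta> X" by (rule realises_exists[OF \<delta>])
  show "\<exists>X. realises n (op_cat C) (op_realisation n C s) D A \<delta> X"
    using realises_rev_rev[OF X \<delta>] realises_op[OF \<delta>] by blast
next
  fix A B D F \<delta> \<rho> a c X Y
  assume asm: "A \<in> Ob (op_cat C)" "B \<in> Ob (op_cat C)" "D \<in> Ob (op_cat C)" "F \<in> Ob (op_cat C)"
    "\<delta> \<in> carrier (Ext (op_bifunctor E) D A)" "\<rho> \<in> carrier (Ext (op_bifunctor E) F B)"
    "a \<in> carrier (Hom (op_cat C) A B)" "c \<in> carrier (Hom (op_cat C) D F)"
    and eq: "push (op_cat C) (op_bifunctor E) D a \<delta> = pull (op_cat C) (op_bifunctor E) B c \<rho>"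
    and X: "realises n (op_cat C) (op_realisation n C s) D A \<delta> X" and Y: "realises n (op_cat C) (op_realisation n C s) F B \<rho> Y"
  have \<delta>: "\<delta> \<in> ext A D" and \<rho>: "\<rho> \<in> ext B F" using asm by (simp_all add: ext_def)
  have "c \<in> arr F D" "a \<in> arr B A" using asm by (simp_all add: arr_def)
  then obtain f where f: "chain_map n C (rev_cpx n Y) (rev_cpx n X) f" "f 0 = c" "f (Suc n) = a"
    using lift_exists[OF Y[unfolded realises_op[OF \<rho>]] X[unfolded realises_op[OF \<delta>]] \<rho> \<delta>, of c a] eq by auto
  then show "\<exists>f. is_lift n (op_cat C) X Y a c f"
    using chain_map_of_op[OF f(1)] by (auto simp: is_lift_def)
next
  fix A D \<delta> X
  assume "A \<in> Ob (op_cat C)" "D \<in> Ob (op_cat C)" "\<delta> \<in> carrier (Ext (op_bifunctor E) D A)"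
    and X: "realises n (op_cat C) (op_realisation n C s) D A \<delta> X"
  then have \<delta>: "\<delta> \<in> ext A D" by (simp add: ext_def)
  show "n_exangle n (op_cat C) (op_bifunctor E) X \<delta>"
    unfolding n_exangle_op by (rule realises_n_exangle[OF X[unfolded realises_op[OF \<delta>]] \<delta>])
next
  fix A Z assume A: "A \<in> Ob (op_cat C)" and Z: "is_zero_object (op_cat C) Z"
  then have AZ: "A \<in> Ob C" "is_zero_object C Z" "Z \<in> Ob C" by (simp_all add: zero_object_Ob)
  have \<delta>: "\<one>\<^bsub>Ext E A Z\<^esub> \<in> ext A Z" using AZ by (simp add: zero_ext)
  have "realises n C s A Z \<one>\<^bsub>Ext E A Z\<^esub> (right_trivial_cpx n C A Z)"
    using R2_right[OF AZ(1,2)] right_trivial_Ch[OF AZ(2,1) n] n by (simp add: realises_def right_trivial_cpx_def)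
  moreover have "cpx_agree n (right_trivial_cpx n C A Z) (rev_cpx n (left_trivial_cpx (op_cat C) A Z))"
    using n by (auto simp: cpx_agree_def right_trivial_cpx_def left_trivial_cpx_def)
  ultimately have "realises n C s A Z \<one>\<^bsub>Ext E A Z\<^esub> (rev_cpx n (left_trivial_cpx (op_cat C) A Z))"
    by (rule realises_of_agree[OF _ \<delta>])
  then show "op_realisation n C s Z A \<one>\<^bsub>Ext (op_bifunctor E) Z A\<^esub> = iso_class n (op_cat C) (left_trivial_cpx (op_cat C) A Z)"
    using realises_op[OF \<delta>, THEN iffD2] unfolding realises_def op_bifunctor_simps by blast
next
  fix A Z assume A: "A \<in> Ob (op_cat C)" and Z: "is_zero_object (op_cat C) Z"
  then have AZ: "A \<in> Ob C" "is_zero_object C Z" "Z \<in> Ob C" by (simp_all add: zero_object_Ob)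
  have \<delta>: "\<one>\<^bsub>Ext E Z A\<^esub> \<in> ext Z A" using AZ by (simp add: zero_ext)
  have "realises n C s Z A \<one>\<^bsub>Ext E Z A\<^esub> (left_trivial_cpx C A Z)"
    using R2_left[OF AZ(1,2)] left_trivial_Ch[OF AZ(2,1)] n by (simp add: realises_def left_trivial_cpx_def)
  moreover have "cpx_agree n (left_trivial_cpx C A Z) (rev_cpx n (right_trivial_cpx n (op_cat C) A Z))"
    using n by (auto simp: cpx_agree_def right_trivial_cpx_def left_trivial_cpx_def)
  ultimately have "realises n C s Z A \<one>\<^bsub>Ext E Z A\<^esub> (rev_cpx n (right_trivial_cpx n (op_cat C) A Z))"
    by (rule realises_of_agree[OF _ \<delta>])
  then show "op_realisation n C s A Z \<one>\<^bsub>Ext (op_bifunctor E) A Z\<^esub> = iso_class n (op_cat C) (right_trivial_cpx n (op_cat C) A Z)"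
    using realises_op[OF \<delta>, THEN iffD2] unfolding realises_def op_bifunctor_simps by blast
qed

lemma is_inflation_op:
  assumes n: "1 \<le> n"
  shows "is_inflation n (op_cat C) (op_bifunctor E) (op_realisation n C s) A B f \<longleftrightarrow> A \<in> Ob C \<and> is_deflation n C E s B A f"
proof
  assume "is_inflation n (op_cat C) (op_bifunctor E) (op_realisation n C s) A B f"
  then obtain D \<delta> X where D: "D \<in> Ob C" "\<delta> \<in> carrier (Ext E A D)"
    and X: "realises n (op_cat C) (op_realisation n C s) D A \<delta> X" and X1: "Tm X 1 = B" "Df X 0 = f"
    by (auto simp: is_inflation_def)
  have A: "A \<in> Ob C" using X by (auto simp: realises_def Ch_def)
  have R: "realises n C s A D \<delta> (rev_cpx n X)" using X realises_op D A by (simp add: ext_def)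
  show "A \<in> Ob C \<and> is_deflation n C E s B A f"
    unfolding is_deflation_def using A D X1 R
    by (intro conjI bexI[of _ D] bexI[of _ \<delta>] exI[of _ "rev_cpx n X"]) simp_all
next
  assume "A \<in> Ob C \<and> is_deflation n C E s B A f"
  then obtain D \<delta> X where D: "D \<in> Ob C" "\<delta> \<in> carrier (Ext E A D)" "A \<in> Ob C"
    and X: "realises n C s A D \<delta> X" and X1: "Tm X n = B" "Df X n = f"
    by (auto simp: is_deflation_def)
  have \<delta>: "\<delta> \<in> ext A D" using D by (simp add: ext_def)
  have R: "realises n (op_cat C) (op_realisation n C s) D A \<delta> (rev_cpx n X)"
    unfolding realises_op[OF \<delta>] by (rule realises_rev_rev[OF X \<delta>])
  show "is_inflation n (op_cat C) (op_bifunctor E) (op_realisation n C s) A B f"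
    unfolding is_inflation_def using D X1 R n
    by (intro bexI[of _ D] bexI[of _ \<delta>] exI[of _ "rev_cpx n X"] conjI) simp_all
qed

end

section \<open>Cones and cocones under reversal\<close>

context additive_category begin

text \<open>Passing to the opposite category exchanges injections and projections, and degree i
  becomes n + 1 - i. The inner matrix entries have to be reassociated as well, which is where the
  typing of injections and projections enters.\<close>

lemma mapping_cone_op_of_cocone:
  assumes c: "is_mapping_cocone n C (rev_cpx n X) (rev_cpx n Y) g N" and n: "1 \<le> n"
    and Ch: "rev_cpx n X \<in> Ch n C" "rev_cpx n Y \<in> Ch n C"
  shows "is_mapping_cone n (op_cat C) Y X (\<lambda>i. g (Suc n - i)) (rev_cpx n N)"
proof -
  from c[unfolded is_mapping_cocone_def] obtain i1 i2 p1 p2 where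
    N: "N \<in> Ch n C" "Tm N 0 = Tm (rev_cpx n X) 0" "Tm N (n + 1) = Tm (rev_cpx n Y) n"
    and b: "\<forall>i\<in>{1..n}. is_biproduct C (Tm (rev_cpx n Y) (i - 1)) (Tm (rev_cpx n X) i) (Tm N i) (i1 i) (i2 i) (p1 i) (p2 i)"
    and d0: "p1 1 ** Df N 0 = g 0" "p2 1 ** Df N 0 = Df (rev_cpx n X) 0"
    and d: "\<forall>i\<in>{1..<n}.
           p1 (i + 1) ** Df N i ** i1 i = -[Tm (rev_cpx n Y) (i - 1),Tm (rev_cpx n Y) i] (Df (rev_cpx n Y) (i - 1)) \<and>
           p1 (i + 1) ** Df N i ** i2 i = g i \<and>
           p2 (i + 1) ** Df N i ** i1 i = 0[Tm (rev_cpx n Y) (i - 1),Tm (rev_cpx n X) (i + 1)] \<and>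
           p2 (i + 1) ** Df N i ** i2 i = Df (rev_cpx n X) i"
    and dn: "Df N n ** i1 n = -[Tm (rev_cpx n Y) (n - 1),Tm (rev_cpx n Y) n] (Df (rev_cpx n Y) (n - 1))"
      "Df N n ** i2 n = g n"
    by (elim conjE exE)
  interpret O: additive_category "op_cat C" by (rule op_additive)
  have NC: "rev_cpx n N \<in> Ch n (op_cat C)"
    unfolding Ch_op by (rule cpx_agree_Ch[OF cpx_agree_rev_rev N(1)])
  have ends: "Tm (rev_cpx n N) 0 = Tm Y 1" "Tm (rev_cpx n N) (n + 1) = Tm X (n + 1)" using N by simp_all
  show ?thesis
    unfolding is_mapping_cone_def
  proof (intro conjI NC ends, rule exI[of _ "\<lambda>i. p1 (Suc n - i)"],
      rule exI[of _ "\<lambda>i. p2 (Suc n - i)"], rule exI[of _ "\<lambda>i. i1 (Suc n - i)"], rule exI[of _ "\<lambda>i. i2 (Suc n - i)"], intro conjI)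
    show "\<forall>i\<in>{1..n}. is_biproduct (op_cat C) (Tm Y (i + 1)) (Tm X i) (Tm (rev_cpx n N) i)
        (p1 (Suc n - i)) (p2 (Suc n - i)) (i1 (Suc n - i)) (i2 (Suc n - i))"
    proof
      fix i assume i: "i \<in> {1..n}"
      then have "Suc n - i \<in> {1..n}" "Suc n - (Suc n - i - 1) = i + 1" "Suc n - (Suc n - i) = i" by auto
      then show "is_biproduct (op_cat C) (Tm Y (i + 1)) (Tm X i) (Tm (rev_cpx n N) i)
        (p1 (Suc n - i)) (p2 (Suc n - i)) (i1 (Suc n - i)) (i2 (Suc n - i))"
        using b by (metis is_biproduct_op rev_cpx_simps(1))
    qed
    have e: "Suc n - (n - 1) = 2" "n - (n - 1) = 1" "Suc n - n = 1" using n by simp_all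
    show "i1 (Suc n - 1) \<cdot>\<^bsub>op_cat C\<^esub> Df (rev_cpx n N) 0 = inv\<^bsub>Hom (op_cat C) (Tm Y 1) (Tm Y 2)\<^esub> (Df Y 1)"
      "i2 (Suc n - 1) \<cdot>\<^bsub>op_cat C\<^esub> Df (rev_cpx n N) 0 = g (Suc n - 1)"
      using dn e by simp_all
    show "Df (rev_cpx n N) n \<cdot>\<^bsub>op_cat C\<^esub> p1 (Suc n - n) = g (Suc n - (n + 1))"
      "Df (rev_cpx n N) n \<cdot>\<^bsub>op_cat C\<^esub> p2 (Suc n - n) = Df X n"
      using d0 e by simp_all
    show "\<forall>i\<in>{1..<n}. i1 (Suc n - (i + 1)) \<cdot>\<^bsub>op_cat C\<^esub> Df (rev_cpx n N) i \<cdot>\<^bsub>op_cat C\<^esub> p1 (Suc n - i)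
         = inv\<^bsub>Hom (op_cat C) (Tm Y (i + 1)) (Tm Y (i + 2))\<^esub> (Df Y (i + 1)) \<and>
       i1 (Suc n - (i + 1)) \<cdot>\<^bsub>op_cat C\<^esub> Df (rev_cpx n N) i \<cdot>\<^bsub>op_cat C\<^esub> p2 (Suc n - i) = \<one>\<^bsub>Hom (op_cat C) (Tm X i) (Tm Y (i + 2))\<^esub> \<and>
       i2 (Suc n - (i + 1)) \<cdot>\<^bsub>op_cat C\<^esub> Df (rev_cpx n N) i \<cdot>\<^bsub>op_cat C\<^esub> p1 (Suc n - i) = g (Suc n - (i + 1)) \<and>
       i2 (Suc n - (i + 1)) \<cdot>\<^bsub>op_cat C\<^esub> Df (rev_cpx n N) i \<cdot>\<^bsub>op_cat C\<^esub> p2 (Suc n - i) = Df X i"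
    proof
      fix i assume i: "i \<in> {1..<n}"
      \<comment> \<open>Differential i of the reversed cocone is differential n - i of N, which ends
        in degree n + 1 - i.\<close>
      define j where "j = n - i"
      have j: "j \<in> {1..<n}" "j \<in> {1..n}" "Suc j \<in> {1..n}" "Suc n - (i + 1) = j" "Suc n - i = j + 1" "Suc n - (j - 1) = i + 2" "Suc n - j = i + 1"
        "n - (j - 1) = i + 1" "Suc n - (j + 1) = i" "n - j = i" "n - i = j"
        using i by (auto simp: j_def)
      have "j - 1 \<le> Suc n" using j(1) by auto
      then have obs: "Tm (rev_cpx n Y) (j - 1) \<in> Ob C" "Tm (rev_cpx n X) j \<in> Ob C" "Tm (rev_cpx n Y) (Suc j - 1) \<in> Ob C" "Tm (rev_cpx n X) (Suc j) \<in> Ob C"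
        using Ch_Ob[OF Ch(2), of "j - 1"] Ch_Ob[OF Ch(1), of j] Ch_Ob[OF Ch(2), of j] Ch_Ob[OF Ch(1), of "Suc j"] j(1) diff_le_self[of j 1]
        by (simp_all del: rev_cpx_simps diff_le_self)
      note B = biproductD(1,2)[OF b[rule_format, OF j(2)] obs(1,2)] biproductD(3,4)[OF b[rule_format, OF j(3)] obs(3,4)]
      have Dj: "Df N j \<in> arr (Tm N j) (Tm N (Suc j))" using Ch_arr[OF N(1), of j] j(1) by simp
      have as: "(p ** Df N j) ** i = p ** Df N j ** i" if "p \<in> arr (Tm N (Suc j)) P" "i \<in> arr I (Tm N j)" for p i P I
        using comp_assoc_arr[OF that(1) Dj that(2)] .
      show "i1 (Suc n - (i + 1)) \<cdot>\<^bsub>op_cat C\<^esub> Df (rev_cpx n N) i \<cdot>\<^bsub>op_cat C\<^esub> p1 (Suc n - i)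
         = inv\<^bsub>Hom (op_cat C) (Tm Y (i + 1)) (Tm Y (i + 2))\<^esub> (Df Y (i + 1)) \<and>
       i1 (Suc n - (i + 1)) \<cdot>\<^bsub>op_cat C\<^esub> Df (rev_cpx n N) i \<cdot>\<^bsub>op_cat C\<^esub> p2 (Suc n - i) = \<one>\<^bsub>Hom (op_cat C) (Tm X i) (Tm Y (i + 2))\<^esub> \<and>
       i2 (Suc n - (i + 1)) \<cdot>\<^bsub>op_cat C\<^esub> Df (rev_cpx n N) i \<cdot>\<^bsub>op_cat C\<^esub> p1 (Suc n - i) = g (Suc n - (i + 1)) \<and>
       i2 (Suc n - (i + 1)) \<cdot>\<^bsub>op_cat C\<^esub> Df (rev_cpx n N) i \<cdot>\<^bsub>op_cat C\<^esub> p2 (Suc n - i) = Df X i"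
        unfolding op_cat_simps rev_cpx_simps j(4,5,11)
        using bspec[OF d j(1)] as[OF B(3) B(1)] as[OF B(3) B(2)] as[OF B(4) B(1)] as[OF B(4) B(2)]
        unfolding rev_cpx_simps j(6-10) by simp
    qed
  qed
qed

lemma mapping_cocone_of_cone_op:
  assumes c: "is_mapping_cone n (op_cat C) (rev_cpx n Y) (rev_cpx n X) f M" and n: "1 \<le> n"
    and Ch: "X \<in> Ch n C" "Y \<in> Ch n C"
  shows "is_mapping_cocone n C X Y (\<lambda>i. f (Suc n - i)) (rev_cpx n M)"
proof -
  interpret O: additive_category "op_cat C" by (rule op_additive)
  from c[unfolded is_mapping_cone_def] obtain i1 i2 p1 p2 where
    M: "M \<in> Ch n (op_cat C)" "Tm M 0 = Tm (rev_cpx n Y) 1" "Tm M (n + 1) = Tm (rev_cpx n X) (n + 1)"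
    and b: "\<forall>i\<in>{1..n}. is_biproduct (op_cat C) (Tm (rev_cpx n Y) (i + 1)) (Tm (rev_cpx n X) i) (Tm M i) (i1 i) (i2 i) (p1 i) (p2 i)"
    and d0: "p1 1 \<cdot>\<^bsub>op_cat C\<^esub> Df M 0 = inv\<^bsub>Hom (op_cat C) (Tm (rev_cpx n Y) 1) (Tm (rev_cpx n Y) 2)\<^esub> (Df (rev_cpx n Y) 1)"
      "p2 1 \<cdot>\<^bsub>op_cat C\<^esub> Df M 0 = f 1"
    and d: "\<forall>i\<in>{1..<n}.
           p1 (i + 1) \<cdot>\<^bsub>op_cat C\<^esub> Df M i \<cdot>\<^bsub>op_cat C\<^esub> i1 i
             = inv\<^bsub>Hom (op_cat C) (Tm (rev_cpx n Y) (i + 1)) (Tm (rev_cpx n Y) (i + 2))\<^esub> (Df (rev_cpx n Y) (i + 1)) \<and>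
           p1 (i + 1) \<cdot>\<^bsub>op_cat C\<^esub> Df M i \<cdot>\<^bsub>op_cat C\<^esub> i2 i = \<one>\<^bsub>Hom (op_cat C) (Tm (rev_cpx n X) i) (Tm (rev_cpx n Y) (i + 2))\<^esub> \<and>
           p2 (i + 1) \<cdot>\<^bsub>op_cat C\<^esub> Df M i \<cdot>\<^bsub>op_cat C\<^esub> i1 i = f (i + 1) \<and>
           p2 (i + 1) \<cdot>\<^bsub>op_cat C\<^esub> Df M i \<cdot>\<^bsub>op_cat C\<^esub> i2 i = Df (rev_cpx n X) i"
    and dn: "Df M n \<cdot>\<^bsub>op_cat C\<^esub> i1 n = f (n + 1)" "Df M n \<cdot>\<^bsub>op_cat C\<^esub> i2 n = Df (rev_cpx n X) n"
    by (elim conjE exE)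
  have MC: "rev_cpx n M \<in> Ch n C" using M(1) by (simp add: Ch_op)
  have ends: "Tm (rev_cpx n M) 0 = Tm X 0" "Tm (rev_cpx n M) (n + 1) = Tm Y n" using M by simp_all
  show ?thesis
    unfolding is_mapping_cocone_def
  proof (intro conjI MC ends, rule exI[of _ "\<lambda>i. p1 (Suc n - i)"],
      rule exI[of _ "\<lambda>i. p2 (Suc n - i)"], rule exI[of _ "\<lambda>i. i1 (Suc n - i)"], rule exI[of _ "\<lambda>i. i2 (Suc n - i)"], intro conjI)
    show "\<forall>i\<in>{1..n}. is_biproduct C (Tm Y (i - 1)) (Tm X i) (Tm (rev_cpx n M) i)
        (p1 (Suc n - i)) (p2 (Suc n - i)) (i1 (Suc n - i)) (i2 (Suc n - i))"
    proof
      fix i assume i: "i \<in> {1..n}"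
      then have "Suc n - i \<in> {1..n}" "Suc n - (Suc n - i + 1) = i - 1" "Suc n - (Suc n - i) = i" by auto
      then show "is_biproduct C (Tm Y (i - 1)) (Tm X i) (Tm (rev_cpx n M) i)
        (p1 (Suc n - i)) (p2 (Suc n - i)) (i1 (Suc n - i)) (i2 (Suc n - i))"
        using b by (metis is_biproduct_op rev_cpx_simps(1))
    qed
    have e: "Suc n - 2 = n - 1" "Suc n - 1 = n" "Suc n - n = 1" "n - n = 0" using n by simp_all
    show "i1 (Suc n - 1) ** Df (rev_cpx n M) 0 = f (Suc n - 0)" "i2 (Suc n - 1) ** Df (rev_cpx n M) 0 = Df X 0"
      using dn e by simp_all
    show "Df (rev_cpx n M) n ** p1 (Suc n - n) = -[Tm Y (n - 1),Tm Y n] (Df Y (n - 1))"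
      "Df (rev_cpx n M) n ** p2 (Suc n - n) = f (Suc n - n)"
      using d0 e by simp_all
    show "\<forall>i\<in>{1..<n}. i1 (Suc n - (i + 1)) ** Df (rev_cpx n M) i ** p1 (Suc n - i) = -[Tm Y (i - 1),Tm Y i] (Df Y (i - 1)) \<and>
       i1 (Suc n - (i + 1)) ** Df (rev_cpx n M) i ** p2 (Suc n - i) = f (Suc n - i) \<and>
       i2 (Suc n - (i + 1)) ** Df (rev_cpx n M) i ** p1 (Suc n - i) = 0[Tm Y (i - 1),Tm X (i + 1)] \<and>
       i2 (Suc n - (i + 1)) ** Df (rev_cpx n M) i ** p2 (Suc n - i) = Df X i"
    proof
      fix i assume i: "i \<in> {1..<n}"
      define j where "j = n - i"
      have j: "j \<in> {1..<n}" "j \<in> {1..n}" "Suc j \<in> {1..n}" "Suc n - (i + 1) = j" "Suc n - i = j + 1" "Suc n - (j + 2) = i - 1" "Suc n - j = i + 1"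
        "n - (j + 1) = i - 1" "Suc n - (j + 1) = i" "n - j = i" "n - i = j"
        using i by (auto simp: j_def)
      have le: "j + 1 \<le> Suc n" "j \<le> Suc n" "Suc j + 1 \<le> Suc n" "Suc j \<le> Suc n" using j(1) by simp_all
      have obs: "Tm (rev_cpx n Y) (j + 1) \<in> Ob (op_cat C)" "Tm (rev_cpx n X) j \<in> Ob (op_cat C)"
        "Tm (rev_cpx n Y) (Suc j + 1) \<in> Ob (op_cat C)" "Tm (rev_cpx n X) (Suc j) \<in> Ob (op_cat C)"
        using Ch_Ob[OF Ch(1)] Ch_Ob[OF Ch(2)] by simp_all
      note B = O.biproductD(1,2)[OF b[rule_format, OF j(2)] obs(1,2)] O.biproductD(3,4)[OF b[rule_format, OF j(3)] obs(3,4)]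
      have Dj: "Df M j \<in> O.arr (Tm M j) (Tm M (Suc j))" using O.Ch_arr[OF M(1), of j] j(1) by simp
      have as: "i ** Df M j ** p = (i ** Df M j) ** p" if "p \<in> O.arr (Tm M (Suc j)) P" "i \<in> O.arr I (Tm M j)" for p i P I
        using O.comp_assoc_arr[OF that(1) Dj that(2)] by simp
      show "i1 (Suc n - (i + 1)) ** Df (rev_cpx n M) i ** p1 (Suc n - i) = -[Tm Y (i - 1),Tm Y i] (Df Y (i - 1)) \<and>
       i1 (Suc n - (i + 1)) ** Df (rev_cpx n M) i ** p2 (Suc n - i) = f (Suc n - i) \<and>
       i2 (Suc n - (i + 1)) ** Df (rev_cpx n M) i ** p1 (Suc n - i) = 0[Tm Y (i - 1),Tm X (i + 1)] \<and>
       i2 (Suc n - (i + 1)) ** Df (rev_cpx n M) i ** p2 (Suc n - i) = Df X i"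
        unfolding rev_cpx_simps j(4,5,11)
        using bspec[OF d j(1)] as[OF B(3) B(1)] as[OF B(3) B(2)] as[OF B(4) B(1)] as[OF B(4) B(2)]
        unfolding rev_cpx_simps op_cat_simps j(6-10) by simp
    qed
  qed
qed

end

section \<open>Packing complexes into the idempotent completion\<close>

text \<open>\<open>K\<close> is the idempotent completion of \<open>C\<close> up to the packing functions \<open>mk\<close> and \<open>mx\<close> for morphisms
  and extensions. The locale is used for \<open>C\<close> and for the opposite category of \<open>C\<close>; in the latter
  case \<open>K\<close> is the opposite category of the idempotent completion of \<open>C\<close>, whose morphisms are packed
  in the opposite order.\<close>

locale karoubi_additive = biadditive_functor C E + K: biadditive_functor K F
  for C :: "('o, 'm) addcat" and E :: "('o, 'm, 'x) bifunctor"
    and K :: "('o \<times> 'm, 'k) addcat" and F :: "('o \<times> 'm, 'k, 'y) bifunctor" +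
  fixes mk :: "'m \<Rightarrow> 'm \<Rightarrow> 'm \<Rightarrow> 'k" and mx :: "'m \<Rightarrow> 'x \<Rightarrow> 'm \<Rightarrow> 'y"
  assumes Ob_K: "Ob K = {(A, a). a \<in> arr A A \<and> a ** a = a}"
    and Hom_K: "(A, a) \<in> Ob K \<Longrightarrow> (B, b) \<in> Ob K \<Longrightarrow>
      carrier (Hom K (A, a) (B, b)) = {mk b r a |r. r \<in> arr A B \<and> r ** a = r \<and> b ** r = r}"
    and mk_inj: "mk b r a = mk b q a \<longleftrightarrow> r = q"
    and mk_comp: "mk b' q b \<cdot>\<^bsub>K\<^esub> mk b r a = mk b' (q ** r) a"
    and mk_Idn: "Idn K (A, a) = mk a a a"
    and mk_add: "mk b r a \<otimes>\<^bsub>Hom K (A, a) (B, b)\<^esub> mk b q a = mk b (r +[A,B] q) a"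
    and mk_zero: "\<one>\<^bsub>Hom K (A, a) (B, b)\<^esub> = mk b 0[A,B] a"
    and Ext_K: "(Z, z) \<in> Ob K \<Longrightarrow> (A, a) \<in> Ob K \<Longrightarrow>
      carrier (Ext F (Z, z) (A, a)) = {mx a \<delta> z |\<delta>. \<delta> \<in> ext Z A \<and> push C E Z a \<delta> = \<delta> \<and> pull C E A z \<delta> = \<delta>}"
    and mx_Act: "Act F (mk z c z') (mk a' b a) (mx a \<delta> z) = mx a' (Act E c b \<delta>) z'"
    and mx_inj: "mx a \<delta> z = mx a \<rho> z \<longleftrightarrow> \<delta> = \<rho>"
    and mx_zero: "\<one>\<^bsub>Ext F (Z, z) (A, a)\<^esub> = mx a \<one>\<^bsub>Ext E Z A\<^esub> z"
begin

definition pack :: "('o, 'm) cpx \<Rightarrow> (nat \<Rightarrow> 'm) \<Rightarrow> ('o \<times> 'm, 'k) cpx" where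
  "pack X e = \<lparr>Tm = \<lambda>i. (Tm X i, e i), Df = \<lambda>i. mk (e (Suc i)) (e (Suc i) ** Df X i ** e i) (e i)\<rparr>"

lemma pack_simps [simp]:
  "Tm (pack X e) i = (Tm X i, e i)" "Df (pack X e) i = mk (e (Suc i)) (e (Suc i) ** Df X i ** e i) (e i)"
  by (simp_all add: pack_def)

lemma K_ObD: "(X, e) \<in> Ob K \<Longrightarrow> e \<in> arr X X" "(X, e) \<in> Ob K \<Longrightarrow> e ** e = e"
  by (simp_all add: Ob_K)

lemma K_ObI: "e \<in> arr X X \<Longrightarrow> e ** e = e \<Longrightarrow> (X, e) \<in> Ob K"
  by (simp add: Ob_K)

lemma mk_arr:
  "\<lbrakk>(X, e) \<in> Ob K; (Y, e') \<in> Ob K; r \<in> arr X Y; r ** e = r; e' ** r = r\<rbrakk> \<Longrightarrow> mk e' r e \<in> K.arr (X, e) (Y, e')"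
  by (auto simp: K.arr_def Hom_K)

lemma mk_arr_cut:
  assumes "(X, e) \<in> Ob K" "(Y, e') \<in> Ob K" "r \<in> arr X Y"
  shows "mk e' (e' ** r ** e) e \<in> K.arr (X, e) (Y, e')"
proof (rule mk_arr[OF assms(1,2)])
  note t = K_ObD[OF assms(1)] K_ObD[OF assms(2)] assms(3)
  show "e' ** r ** e \<in> arr X Y" "(e' ** r ** e) ** e = e' ** r ** e"
    using t by (simp_all add: cat_simps)
  show "e' ** e' ** r ** e = e' ** r ** e"
    using comp_eq_comp[OF t(4) t(3,3), of "r ** e"] t by (simp add: cat_simps)
qed

lemma K_arrE:
  assumes "f \<in> K.arr (X, e) (Y, e')"
  obtains r where "f = mk e' r e" "r \<in> arr X Y" "r ** e = r" "e' ** r = r" "(X, e) \<in> Ob K" "(Y, e') \<in> Ob K"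
proof -
  have o: "(X, e) \<in> Ob K" "(Y, e') \<in> Ob K" "f \<in> carrier (Hom K (X, e) (Y, e'))"
    using assms by (simp_all add: K.arr_def)
  from o(3) show thesis unfolding Hom_K[OF o(1,2)] using that o(1,2) by blast
qed

text \<open>The locale describes addition and zero in the completion; negation is recovered from
  them.\<close>

lemma mk_neg:
  assumes "(X, e) \<in> Ob K" "(Y, e') \<in> Ob K" "r \<in> arr X Y" "r ** e = r" "e' ** r = r"
  shows "inv\<^bsub>Hom K (X, e) (Y, e')\<^esub> mk e' r e = mk e' (-[X,Y] r) e"
proof (rule K.add_eq_zero[symmetric])
  note t = K_ObD[OF assms(1)] K_ObD[OF assms(2)] assms(3-5)
  show "mk e' r e \<in> K.arr (X, e) (Y, e')" using assms by (rule mk_arr)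
  show "mk e' (-[X,Y] r) e \<in> K.arr (X, e) (Y, e')"
    using t by (intro mk_arr assms) (simp_all add: cat_simps)
  show "mk e' r e \<otimes>\<^bsub>Hom K (X, e) (Y, e')\<^esub> mk e' (-[X,Y] r) e = \<one>\<^bsub>Hom K (X, e) (Y, e')\<^esub>"
    using t by (simp add: mk_add mk_zero cat_simps)
qed

lemma K_extE:
  assumes "\<rho> \<in> K.ext (Z, z) (A, a)"
  obtains \<delta> where "\<rho> = mx a \<delta> z" "\<delta> \<in> ext Z A" "push C E Z a \<delta> = \<delta>" "pull C E A z \<delta> = \<delta>"
    "(Z, z) \<in> Ob K" "(A, a) \<in> Ob K"
proof -
  have o: "(Z, z) \<in> Ob K" "(A, a) \<in> Ob K" "\<rho> \<in> carrier (Ext F (Z, z) (A, a))"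
    using assms by (simp_all add: K.ext_def)
  from o(3) show thesis unfolding Ext_K[OF o(1,2)] using that o(1,2) by blast
qed

lemma mx_ext:
  "\<lbrakk>\<delta> \<in> ext Z A; push C E Z a \<delta> = \<delta>; pull C E A z \<delta> = \<delta>; (Z, z) \<in> Ob K; (A, a) \<in> Ob K\<rbrakk>
    \<Longrightarrow> mx a \<delta> z \<in> K.ext (Z, z) (A, a)"
  by (auto simp: K.ext_def Ext_K)

lemma K_zero_object:
  assumes Z: "is_zero_object C Z"
  shows "is_zero_object K (Z, Idn C Z)"
proof -
  note ZO = zero_object_Ob[OF Z]
  have oZ: "(Z, Idn C Z) \<in> Ob K" using ZO by (simp add: K_ObI Idn_arr id_left[OF intoI[OF Idn_arr]])
  have "\<exists>!f. f \<in> carrier (Hom K P (Z, Idn C Z))" "\<exists>!f. f \<in> carrier (Hom K (Z, Idn C Z) P)" if P: "P \<in> Ob K" for P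
  proof -
    obtain A a where Aa: "P = (A, a)" by (cases P)
    note oA = P[unfolded Aa]
    have "f = \<one>\<^bsub>Hom K (A, a) (Z, Idn C Z)\<^esub>" if f: "f \<in> carrier (Hom K (A, a) (Z, Idn C Z))" for f
      using K_arrE[OF K.arrI[OF oA oZ f]] zero_object_arr(2)[OF Z] unfolding mk_zero by metis
    moreover have "f = \<one>\<^bsub>Hom K (Z, Idn C Z) (A, a)\<^esub>" if f: "f \<in> carrier (Hom K (Z, Idn C Z) (A, a))" for f
      using K_arrE[OF K.arrI[OF oZ oA f]] zero_object_arr(1)[OF Z] unfolding mk_zero by metis
    ultimately show "\<exists>!f. f \<in> carrier (Hom K P (Z, Idn C Z))" "\<exists>!f. f \<in> carrier (Hom K (Z, Idn C Z) P)"
      unfolding Aa using K.arrD(3)[OF K.zero_arr[OF oA oZ]] K.arrD(3)[OF K.zero_arr[OF oZ oA]] by blast+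
  qed
  then show ?thesis unfolding is_zero_object_def using oZ by blast
qed

text \<open>For morphisms that commute with the idempotents one cut suffices, so the packed morphism
  e' g e may be written as g e.\<close>

lemma cut_eq:
  assumes "g ** e = e' ** g" "e' ** e' = e'" "g \<in> arr A B" "e' \<in> arr B B"
  shows "e' ** g ** e = g ** e"
  unfolding assms(1) using comp_eq_comp[OF assms(2,4,4) intoI[OF assms(3)]] by simp

context
  fixes n :: nat and X :: "('o, 'm) cpx" and e :: "nat \<Rightarrow> 'm"
  assumes X: "X \<in> Ch n C" and e: "chain_map n C X X e" and ee: "\<And>i. i \<le> Suc n \<Longrightarrow> e i ** e i = e i"
begin

lemma pack_Ob: "i \<le> Suc n \<Longrightarrow> (Tm X i, e i) \<in> Ob K"
  using chain_map_arr[OF e X X] ee by (simp add: K_ObI)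

lemma pack_Df: "i \<le> n \<Longrightarrow> Df (pack X e) i = mk (e (Suc i)) (Df X i ** e i) (e i)"
  using cut_eq[OF chain_map_comm[OF e] ee[of "Suc i"] Ch_arr[OF X] chain_map_arr[OF e X X, of "Suc i"]] by simp

lemma pack_Ch: "pack X e \<in> Ch n K"
proof -
  have "Df (pack X e) i \<in> carrier (Hom K (Tm (pack X e) i) (Tm (pack X e) (Suc i)))" if i: "i \<le> n" for i
    using K.arrD(3)[OF mk_arr_cut[OF pack_Ob[of i] pack_Ob[of "Suc i"] Ch_arr[OF X i]]] i by simp
  moreover have "Df (pack X e) (Suc i) \<cdot>\<^bsub>K\<^esub> Df (pack X e) i = \<one>\<^bsub>Hom K (Tm (pack X e) i) (Tm (pack X e) (Suc (Suc i)))\<^esub>" if i: "i < n" for i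
  proof -
    have ty: "Df X i \<in> arr (Tm X i) (Tm X (Suc i))" "Df X (Suc i) \<in> arr (Tm X (Suc i)) (Tm X (Suc (Suc i)))"
      "e i \<in> arr (Tm X i) (Tm X i)" "e (Suc i) \<in> arr (Tm X (Suc i)) (Tm X (Suc i))" "Tm X (Suc (Suc i)) \<in> Ob C"
      using i Ch_arr[OF X] chain_map_arr[OF e X X] Ch_Ob[OF X] by simp_all
    have "(Df X (Suc i) ** e (Suc i)) ** Df X i ** e i = Df X (Suc i) ** (Df X i ** e i) ** e i"
      using ty chain_map_comm[OF e, of i] comp_eq_comp[OF chain_map_comm[OF e, of i, symmetric] ty(4,1) intoI[OF ty(3)]] i
      by (simp add: cat_simps)
    also have "\<dots> = 0[Tm X i,Tm X (Suc (Suc i))]"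
      using comp_eq_comp[OF Ch_zero[OF X i] ty(2,1) intoI[OF ty(3)]] ty i ee[of i] by (simp add: cat_simps)
    finally show ?thesis using i by (simp add: pack_Df mk_comp mk_zero del: pack_simps(2))
  qed
  ultimately show ?thesis using pack_Ob by (simp add: Ch_def del: pack_simps(2))
qed

end

lemma pack_chain_map:
  assumes Ch: "X \<in> Ch n C" "Y \<in> Ch n C" and f: "chain_map n C X Y f"
    and e: "chain_map n C X X e" "\<And>i. i \<le> Suc n \<Longrightarrow> e i ** e i = e i"
    and r: "chain_map n C Y Y r" "\<And>i. i \<le> Suc n \<Longrightarrow> r i ** r i = r i"
    and fe: "\<And>i. i \<le> Suc n \<Longrightarrow> f i ** e i = r i ** f i"
  shows "chain_map n K (pack X e) (pack Y r) (\<lambda>i. mk (r i) (f i ** e i) (e i))"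
proof (rule K.chain_mapI)
  fix i assume i: "i \<le> Suc n"
  show "mk (r i) (f i ** e i) (e i) \<in> K.arr (Tm (pack X e) i) (Tm (pack Y r) i)"
    using mk_arr_cut[OF pack_Ob[OF Ch(1) e i] pack_Ob[OF Ch(2) r i] chain_map_arr[OF f Ch i]]
      cut_eq[OF fe[OF i] r(2)[OF i] chain_map_arr[OF f Ch i] chain_map_arr[OF r(1) Ch(2,2) i]] by simp
next
  fix i assume i: "i \<le> n"
  have ty: "Df X i \<in> arr (Tm X i) (Tm X (Suc i))" "Df Y i \<in> arr (Tm Y i) (Tm Y (Suc i))" "e i \<in> arr (Tm X i) (Tm X i)"
    "e (Suc i) \<in> arr (Tm X (Suc i)) (Tm X (Suc i))" "r i \<in> arr (Tm Y i) (Tm Y i)" "f i \<in> arr (Tm X i) (Tm Y i)"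
    "f (Suc i) \<in> arr (Tm X (Suc i)) (Tm Y (Suc i))"
    using i Ch_arr[OF Ch(1)] Ch_arr[OF Ch(2)] chain_map_arr[OF e(1) Ch(1,1)] chain_map_arr[OF r(1) Ch(2,2)] chain_map_arr[OF f Ch] by simp_all
  have "(Df Y i ** r i) ** f i ** e i = Df Y i ** f i ** e i"
    using ty comp_eq_comp[OF fe[of i, symmetric] ty(5,6) intoI[OF ty(3)]] e(2)[of i] i by (simp add: cat_simps)
  also have "\<dots> = f (Suc i) ** Df X i ** e i"
    using comp_eq_comp[OF chain_map_comm[OF f i] ty(2,6) intoI[OF ty(3)]] ty by (simp add: cat_simps)
  also have "\<dots> = (f (Suc i) ** e (Suc i)) ** Df X i ** e i"
    using ty comp_eq_comp[OF chain_map_comm[OF e(1) i, symmetric] ty(4,1) intoI[OF ty(3)]] e(2)[of i] i by (simp add: cat_simps)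
  finally show "Df (pack Y r) i \<cdot>\<^bsub>K\<^esub> mk (r i) (f i ** e i) (e i) = mk (r (Suc i)) (f (Suc i) ** e (Suc i)) (e (Suc i)) \<cdot>\<^bsub>K\<^esub> Df (pack X e) i"
    using i by (simp add: pack_Df[OF Ch(1) e] pack_Df[OF Ch(2) r] mk_comp del: pack_simps(2))
qed

text \<open>An arbitrary chain map is first cut to r f e, which commutes with the
  idempotents.\<close>

lemma pack_lift:
  assumes Ch: "X \<in> Ch n C" "Y \<in> Ch n C" and f: "chain_map n C X Y f"
    and e: "chain_map n C X X e" "\<And>i. i \<le> Suc n \<Longrightarrow> e i ** e i = e i"
    and r: "chain_map n C Y Y r" "\<And>i. i \<le> Suc n \<Longrightarrow> r i ** r i = r i"
  shows "chain_map n K (pack X e) (pack Y r) (\<lambda>i. mk (r i) (r i ** f i ** e i) (e i))"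
proof -
  have f': "chain_map n C X Y (\<lambda>i. r i ** f i ** e i)"
    by (rule chain_map_comp[OF chain_map_comp[OF e(1) f Ch(1,1,2)] r(1) Ch(1,2,2)])
  have cut: "(r i ** f i ** e i) ** e i = r i ** f i ** e i" "r i ** r i ** f i ** e i = r i ** f i ** e i" if i: "i \<le> Suc n" for i
    using chain_map_arr[OF e(1) Ch(1,1) i] chain_map_arr[OF f Ch i] chain_map_arr[OF r(1) Ch(2,2) i] e(2)[OF i]
      comp_eq_comp[OF r(2)[OF i], of "Tm Y i" "Tm Y i" "Tm Y i" "f i ** e i"]
    by (simp_all add: cat_simps)
  then have comm: "\<And>i. i \<le> Suc n \<Longrightarrow> (r i ** f i ** e i) ** e i = r i ** r i ** f i ** e i" by simp
  show ?thesis
    using pack_chain_map[OF Ch f' e r comm] cut(1)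
      chain_map_cong[of n "\<lambda>i. mk (r i) ((r i ** f i ** e i) ** e i) (e i)" "\<lambda>i. mk (r i) (r i ** f i ** e i) (e i)" K] by simp
qed

text \<open>The idempotent on the sum is the diagonal one, i1 a p1 + i2 b p2. It is compatible with
  the differential because \<alpha>, \<beta> and \<phi> all commute with the idempotents, so its
  off-diagonal homotopy entry can be zero.\<close>

lemma pack_twisted_sum:
  assumes tw: "twisted_sum n A B \<alpha> \<beta> \<phi> M i1 i2 p1 p2"
    and a: "\<And>i. i \<le> Suc n \<Longrightarrow> a i \<in> arr (A i) (A i)" "\<And>i. i \<le> Suc n \<Longrightarrow> a i ** a i = a i"
    and b: "\<And>i. i \<le> Suc n \<Longrightarrow> b i \<in> arr (B i) (B i)" "\<And>i. i \<le> Suc n \<Longrightarrow> b i ** b i = b i"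
    and comm: "\<And>i. i \<le> n \<Longrightarrow> \<alpha> i ** a i = a (Suc i) ** \<alpha> i" "\<And>i. i \<le> n \<Longrightarrow> \<beta> i ** b i = b (Suc i) ** \<beta> i"
      "\<And>i. i \<le> n \<Longrightarrow> \<phi> i ** a i = b (Suc i) ** \<phi> i"
  obtains q where "chain_map n C M M q" "\<And>i. i \<le> Suc n \<Longrightarrow> q i ** q i = q i"
    "\<And>i. i \<le> Suc n \<Longrightarrow> q i = i1 i ** a i ** p1 i +[Tm M i,Tm M i] i2 i ** b i ** p2 i"
    "K.twisted_sum n (\<lambda>i. (A i, a i)) (\<lambda>i. (B i, b i)) (\<lambda>i. mk (a (Suc i)) (\<alpha> i ** a i) (a i))
      (\<lambda>i. mk (b (Suc i)) (\<beta> i ** b i) (b i)) (\<lambda>i. mk (b (Suc i)) (\<phi> i ** a i) (a i)) (pack M q)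
      (\<lambda>i. mk (q i) (i1 i ** a i) (a i)) (\<lambda>i. mk (q i) (i2 i ** b i) (b i))
      (\<lambda>i. mk (a i) (a i ** p1 i) (q i)) (\<lambda>i. mk (b i) (b i ** p2 i) (q i))"
proof -
  note T = twisted_sumD[OF tw]
  \<comment> \<open>Written with a zero homotopy entry in order to match
    \<open>twisted_sum_map\<close>.\<close>
  define q where "q i = i1 i ** a i ** p1 i +[Tm M i,Tm M i]
    i2 i ** (0[A i,B i] ** p1 i +[Tm M i,B i] b i ** p2 i)" for i
  have h2: "b (Suc i) ** \<phi> i = \<phi> i ** a i +[A i,B (Suc i)]
        (\<beta> i ** 0[A i,B i] +[A i,B (Suc i)] 0[A (Suc i),B (Suc i)] ** \<alpha> i)" if i: "i \<le> n" for i
    using T(1)[of i] T(2)[of i] T(2)[of "Suc i"] T(4,5,6)[OF i] a(1)[of i] b(1)[of "Suc i"] comm(3)[OF i] i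
    by (simp add: cat_simps add_zero(2)[OF comp_arr])
  note qq = twisted_sum_map[OF tw tw a(1) comm(1) b(1) comm(2) zero_arr[OF T(1,2)] h2 q_def]
  have q: "q i \<in> arr (Tm M i) (Tm M i)" "p1 i ** q i = a i ** p1 i" "p2 i ** q i = b i ** p2 i"
    and q': "q i = i1 i ** a i ** p1 i +[Tm M i,Tm M i] i2 i ** b i ** p2 i" if i: "i \<le> Suc n" for i
  proof -
    have z: "0[A i,B i] ** p1 i +[Tm M i,B i] b i ** p2 i = b i ** p2 i"
      using T(2,12,13)[OF i] b(1)[OF i] by (simp add: cat_simps)
    show "q i = i1 i ** a i ** p1 i +[Tm M i,Tm M i] i2 i ** b i ** p2 i"
      unfolding q_def z by simp
    show "q i \<in> arr (Tm M i) (Tm M i)" "p1 i ** q i = a i ** p1 i" "p2 i ** q i = b i ** p2 i"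
      using qq(2-4)[of i] i z by simp_all
  qed
  have qi: "q i ** i1 i ** a i = i1 i ** a i" "q i ** i2 i ** b i = i2 i ** b i" "q i ** q i = q i"
    if i: "i \<le> Suc n" for i
  proof -
    note bp = biproductD[OF T(3)[OF i] T(1)[OF i] T(2)[OF i]] and bc = biproduct_comp[OF T(3)[OF i] T(1)[OF i] T(2)[OF i]]
    note ty = bp(1-4) a(1)[OF i] b(1)[OF i] T(1,2)[OF i] a(2)[OF i] b(2)[OF i]
    note aa = comp_eq_comp[OF a(2)[OF i] a(1)[OF i] a(1)[OF i]] and bb = comp_eq_comp[OF b(2)[OF i] b(1)[OF i] b(1)[OF i]]
    show 1: "q i ** i1 i ** a i = i1 i ** a i" "q i ** i2 i ** b i = i2 i ** b i"
      unfolding q'[OF i] using ty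
      by (simp_all add: cat_simps bc aa bb zero_left[OF a(1)[OF i]] zero_left[OF b(1)[OF i]])
    have "q i ** q i = (q i ** i1 i ** a i) ** p1 i +[Tm M i,Tm M i] (q i ** i2 i ** b i) ** p2 i"
      using ty q(1)[OF i] by (subst (2) q'[OF i]) (simp add: cat_simps)
    then show "q i ** q i = q i" unfolding 1 using ty by (simp add: q'[OF i] cat_simps)
  qed
  have qc: "chain_map n C M M q" using qq(1) by simp
  show thesis
  proof (rule that[OF qc qi(3) q'])
    show "K.twisted_sum n (\<lambda>i. (A i, a i)) (\<lambda>i. (B i, b i)) (\<lambda>i. mk (a (Suc i)) (\<alpha> i ** a i) (a i))
      (\<lambda>i. mk (b (Suc i)) (\<beta> i ** b i) (b i)) (\<lambda>i. mk (b (Suc i)) (\<phi> i ** a i) (a i)) (pack M q)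
      (\<lambda>i. mk (q i) (i1 i ** a i) (a i)) (\<lambda>i. mk (q i) (i2 i ** b i) (b i))
      (\<lambda>i. mk (a i) (a i ** p1 i) (q i)) (\<lambda>i. mk (b i) (b i ** p2 i) (q i))"
      unfolding K.twisted_sum_def
    proof (intro conjI allI impI)
      fix i assume i: "i \<le> Suc n"
      note bp = biproductD[OF T(3)[OF i] T(1)[OF i] T(2)[OF i]] and bc = biproduct_comp[OF T(3)[OF i] T(1)[OF i] T(2)[OF i]]
      note ty = bp(1-4) a(1)[OF i] b(1)[OF i] T(1,2)[OF i] a(2)[OF i] b(2)[OF i] q(1)[OF i]
      note aa = comp_eq_comp[OF a(2)[OF i] a(1)[OF i] a(1)[OF i]] and bb = comp_eq_comp[OF b(2)[OF i] b(1)[OF i] b(1)[OF i]]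
      show oA: "(A i, a i) \<in> Ob K" and oB: "(B i, b i) \<in> Ob K" using ty by (simp_all add: K_ObI)
      have oM: "(Tm M i, q i) \<in> Ob K" using q(1)[OF i] qi(3)[OF i] by (rule K_ObI)
      have "mk (q i) (i1 i ** a i) (a i) \<in> K.arr (A i, a i) (Tm M i, q i)" "mk (q i) (i2 i ** b i) (b i) \<in> K.arr (B i, b i) (Tm M i, q i)"
        "mk (a i) (a i ** p1 i) (q i) \<in> K.arr (Tm M i, q i) (A i, a i)" "mk (b i) (b i ** p2 i) (q i) \<in> K.arr (Tm M i, q i) (B i, b i)"
        using ty qi[OF i] q(2,3)[OF i] by (auto intro!: mk_arr oA oB oM simp: cat_simps aa bb)
      moreover have "(a i ** p1 i) ** i1 i ** a i = a i" "(b i ** p2 i) ** i2 i ** b i = b i"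
        "(a i ** p1 i) ** i2 i ** b i = 0[B i,A i]" "(b i ** p2 i) ** i1 i ** a i = 0[A i,B i]"
        "(i1 i ** a i) ** a i ** p1 i +[Tm M i,Tm M i] (i2 i ** b i) ** b i ** p2 i = q i"
        using ty by (simp_all add: cat_simps bc aa bb q'[OF i] zero_left[OF a(1)[OF i]] zero_left[OF b(1)[OF i]])
      ultimately show "is_biproduct K (A i, a i) (B i, b i) (Tm (pack M q) i) (mk (q i) (i1 i ** a i) (a i))
         (mk (q i) (i2 i ** b i) (b i)) (mk (a i) (a i ** p1 i) (q i)) (mk (b i) (b i ** p2 i) (q i))"
        using oM by (simp add: is_biproduct_def mk_comp mk_Idn mk_zero mk_add K.arr_def)
    next
      fix i assume i: "i \<le> n"
      then have i': "i \<le> Suc n" "Suc i \<le> Suc n" by simp_all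
      have o: "(A i, a i) \<in> Ob K" "(B i, b i) \<in> Ob K" "(A (Suc i), a (Suc i)) \<in> Ob K" "(B (Suc i), b (Suc i)) \<in> Ob K"
        "(Tm M i, q i) \<in> Ob K" "(Tm M (Suc i), q (Suc i)) \<in> Ob K"
        using a b q(1) qi(3) i by (simp_all add: K_ObI)
      note ty = T(4-7)[OF i] T(12,13)[OF i'(1)] T(12,13)[OF i'(2)] a(1)[OF i'(1)] b(1)[OF i'(1)] q(1)[OF i'(1)]
        a(1)[OF i'(2)] b(1)[OF i'(2)] q(1)[OF i'(2)]
      note cut = cut_eq[OF comm(1)[OF i] a(2)[OF i'(2)] T(4)[OF i] a(1)[OF i'(2)]]
        cut_eq[OF comm(2)[OF i] b(2)[OF i'(2)] T(5)[OF i] b(1)[OF i'(2)]]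
        cut_eq[OF comm(3)[OF i] b(2)[OF i'(2)] T(6)[OF i] b(1)[OF i'(2)]]
        cut_eq[OF chain_map_comm[OF qc i] qi(3)[OF i'(2)] T(7)[OF i] q(1)[OF i'(2)]]
      show "mk (a (Suc i)) (\<alpha> i ** a i) (a i) \<in> K.arr (A i, a i) (A (Suc i), a (Suc i))"
        "mk (b (Suc i)) (\<beta> i ** b i) (b i) \<in> K.arr (B i, b i) (B (Suc i), b (Suc i))"
        "mk (b (Suc i)) (\<phi> i ** a i) (a i) \<in> K.arr (A i, a i) (B (Suc i), b (Suc i))"
        and "Df (pack M q) i \<in> K.arr (Tm (pack M q) i) (Tm (pack M q) (Suc i))"
        using mk_arr_cut[OF o(1,3) ty(1)] mk_arr_cut[OF o(2,4) ty(2)] mk_arr_cut[OF o(1,4) ty(3)] mk_arr_cut[OF o(5,6) ty(4)] cut by simp_all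
      note aq = q(2,3)[OF i'(1)] a(2)[OF i'(1)] b(2)[OF i'(1)]
      note aa = comp_eq_comp[OF a(2)[OF i'(1)] a(1)[OF i'(1)] a(1)[OF i'(1)]] and bb = comp_eq_comp[OF b(2)[OF i'(1)] b(1)[OF i'(1)] b(1)[OF i'(1)]]
      have c1: "a (Suc i) ** \<alpha> i ** a i ** p1 i = \<alpha> i ** a i ** p1 i" "b (Suc i) ** \<beta> i ** b i ** p2 i = \<beta> i ** b i ** p2 i"
        "b (Suc i) ** \<phi> i ** a i ** p1 i = \<phi> i ** a i ** p1 i"
        using comp_eq_comp[OF cut(1) _ _ intoI[OF ty(5)]] comp_eq_comp[OF cut(2) _ _ intoI[OF ty(6)]] comp_eq_comp[OF cut(3) _ _ intoI[OF ty(5)]] ty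
        by (simp_all add: cat_simps)
      have "p1 (Suc i) ** Df M i ** q i = -[Tm M i,A (Suc i)] (\<alpha> i ** a i ** p1 i)"
        using comp_eq_comp[OF T(8)[OF i] ty(7,4) intoI[OF ty(11)]] ty by (simp add: cat_simps aq)
      then have e1: "(a (Suc i) ** p1 (Suc i)) ** Df M i ** q i = -[Tm M i,A (Suc i)] ((\<alpha> i ** a i) ** a i ** p1 i)"
        using ty by (simp add: cat_simps aa c1)
      have "p2 (Suc i) ** Df M i ** q i = \<phi> i ** a i ** p1 i +[Tm M i,B (Suc i)] \<beta> i ** b i ** p2 i"
        using comp_eq_comp[OF T(9)[OF i] ty(8,4) intoI[OF ty(11)]] ty by (simp add: cat_simps aq)
      then have e2: "(b (Suc i) ** p2 (Suc i)) ** Df M i ** q i =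
          (\<phi> i ** a i) ** a i ** p1 i +[Tm M i,B (Suc i)] (\<beta> i ** b i) ** b i ** p2 i"
        using ty by (simp add: cat_simps aa bb c1)
      have s1: "(\<alpha> i ** a i) ** a i ** p1 i \<in> arr (Tm M i) (A (Suc i))" "((\<alpha> i ** a i) ** a i ** p1 i) ** q i = (\<alpha> i ** a i) ** a i ** p1 i"
        "a (Suc i) ** (\<alpha> i ** a i) ** a i ** p1 i = (\<alpha> i ** a i) ** a i ** p1 i"
        using ty by (simp_all add: cat_simps aa aq c1)
      show "mk (a (Suc i)) (a (Suc i) ** p1 (Suc i)) (q (Suc i)) \<cdot>\<^bsub>K\<^esub> Df (pack M q) i =
          inv\<^bsub>Hom K (Tm (pack M q) i) (A (Suc i), a (Suc i))\<^esub> (mk (a (Suc i)) (\<alpha> i ** a i) (a i) \<cdot>\<^bsub>K\<^esub> mk (a i) (a i ** p1 i) (q i))"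
        using mk_neg[OF o(5,3) s1] cut(4) e1 by (simp add: mk_comp)
      show "mk (b (Suc i)) (b (Suc i) ** p2 (Suc i)) (q (Suc i)) \<cdot>\<^bsub>K\<^esub> Df (pack M q) i =
          (mk (b (Suc i)) (\<phi> i ** a i) (a i) \<cdot>\<^bsub>K\<^esub> mk (a i) (a i ** p1 i) (q i)) \<otimes>\<^bsub>Hom K (Tm (pack M q) i) (B (Suc i), b (Suc i))\<^esub>
          (mk (b (Suc i)) (\<beta> i ** b i) (b i) \<cdot>\<^bsub>K\<^esub> mk (b i) (b i ** p2 i) (q i))"
        using cut(4) e2 by (simp add: mk_comp mk_add)
    qed
  qed
qed


end

section \<open>Exangles over zero extensions with a zero end term\<close>

context biadditive_functor begin

text \<open>Every (X, 0) is a zero object of the completion, so (R2) there covers more than the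
  packed trivial complexes of C and is derived from exactness instead: the identity of A kills the
  zero extension, hence extends over the first differential, which is therefore a split
  monomorphism.\<close>

lemma iso_class_left_trivial:
  assumes W: "n_exangle n C E W \<one>\<^bsub>Ext E Z A\<^esub>" and ends: "Tm W 0 = A" "Tm W (Suc n) = Z"
    and Z: "is_zero_object C Z" and n: "1 \<le> n"
  shows "iso_class n C W = iso_class n C (left_trivial_cpx C A Z)"
proof -
  let ?L = "left_trivial_cpx C A Z"
  note ex = n_exangleD(1)[OF W]
  note Ch = cexact_Ch[OF ex] and ZO = zero_object_Ob[OF Z] and z = zero_object_arr[OF Z]
  have AO: "A \<in> Ob C" using Ch_Ob[OF Ch, of 0] ends by simp
  have LC: "?L \<in> Ch n C" by (rule left_trivial_Ch[OF Z AO])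
  have L: "Tm ?L i = (if i \<le> 1 then A else Z)" "Df ?L i = (if i = 0 then Idn C A else if i = 1 then 0[A,Z] else 0[Z,Z])" for i
    by (simp_all add: left_trivial_cpx_def)
  have exL: "cexact n ?L"
    unfolding cexact_def
  proof (intro conjI LC allI impI ballI)
    fix i Y u assume i: "i < n" and u: "u \<in> arr (Tm ?L (Suc i)) Y" "u ** Df ?L i = 0[Tm ?L i,Y]"
    have YO: "Y \<in> Ob C" using arrD(2)[OF u(1)] .
    have "u = 0[Tm ?L (Suc i),Y]"
    proof (cases "i = 0")
      case True then show ?thesis using u id_right[of u A Y] by (simp add: L)
    next
      case False then show ?thesis using u(1) z(1) by (simp add: L)
    qed
    then show "\<exists>v\<in>arr (Tm ?L (Suc (Suc i))) Y. u = v ** Df ?L (Suc i)"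
      using ZO YO AO by (intro bexI[of _ "0[Z,Y]"]) (simp_all add: L zero_arr zero_right[OF zero_arr])
  qed
  have "push C E Z (Idn C A) \<one>\<^bsub>Ext E Z A\<^esub> = \<one>\<^bsub>Ext E Z A\<^esub>" by (rule push_Idn[OF zero_ext[OF ZO AO]])
  then obtain v where v: "v \<in> arr (Tm W (Suc 0)) A" "Idn C A = v ** Df W 0"
    using n_exangleD(7)[OF W, of "Idn C A" A] ends Idn_arr[OF AO] by auto
  have d0: "Df W 0 \<in> arr A (Tm W (Suc 0))" using Ch_arr[OF Ch, of 0] ends by simp
  define f where "f i = (if i = 0 then Idn C A else if i = 1 then Df W 0 else 0[Z,Tm W i])" for i
  define g where "g i = (if i = 0 then Idn C A else if i = 1 then v else 0[Tm W i,Z])" for i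
  have fc: "chain_map n C ?L W f"
  proof (rule chain_mapI)
    show "f i \<in> arr (Tm ?L i) (Tm W i)" if "i \<le> Suc n" for i
      using that Ch_Ob[OF Ch that] ZO d0 Idn_arr[OF AO] ends by (simp add: f_def L zero_arr)
    show "Df W i ** f i = f (Suc i) ** Df ?L i" if i: "i \<le> n" for i
    proof -
      consider "i = 0" | "i = 1" | "i > 1" by linarith
      then show ?thesis
      proof cases
        case 1 then show ?thesis by (simp add: f_def L)
      next
        case 2 then show ?thesis using i n Ch_zero[OF Ch, of 0] Ch_Ob[OF Ch, of "Suc (Suc 0)"] ends ZO AO
          by (simp add: f_def L zero_left[OF zero_arr])
      next
        case 3 then show ?thesis using zero_right[OF Ch_arr[OF Ch i] ZO] zero_left[OF zero_arr[OF ZO ZO], of "Tm W (Suc i)"] Ch_Ob[OF Ch, of "Suc i"] i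
          by (simp add: f_def L)
      qed
    qed
  qed
  have gc: "chain_map n C W ?L g"
  proof (rule chain_mapI)
    show "g i \<in> arr (Tm W i) (Tm ?L i)" if "i \<le> Suc n" for i
      using that Ch_Ob[OF Ch that] ZO v Idn_arr[OF AO] ends by (simp add: g_def L zero_arr)
    show "Df ?L i ** g i = g (Suc i) ** Df W i" if i: "i \<le> n" for i
    proof -
      consider "i = 0" | "i = 1" | "i > 1" by linarith
      then show ?thesis
      proof cases
        case 1 then show ?thesis by (simp add: g_def L v(2)[symmetric] id_left[OF intoI[OF Idn_arr[OF AO]]])
      next
        case 2 then show ?thesis using zero_left[OF v(1) ZO] zero_left[OF Ch_arr[OF Ch i] ZO]
          by (simp add: g_def L)
      next
        case 3 then show ?thesis using zero_left[OF Ch_arr[OF Ch i] ZO] zero_right[OF zero_arr[OF ZO ZO], of "Tm W i"] Ch_Ob[OF Ch, of i] i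
          by (simp add: g_def L)
      qed
    qed
  qed
  have "linked n W ?L"
    unfolding linked_def chain_map_fixing_ends_def using fc gc ends n zero_object_Idn[OF Z]
    by (intro conjI exI[of _ f] exI[of _ g]) (simp_all add: f_def g_def L)
  then show ?thesis using iso_class_eq_iff[OF ex exL] by simp
qed

text \<open>Dually, the identity of A lifts along the last differential, which is therefore a split
  epimorphism.\<close>

lemma iso_class_right_trivial:
  assumes W: "n_exangle n C E W \<one>\<^bsub>Ext E A Z\<^esub>" and ends: "Tm W 0 = Z" "Tm W (Suc n) = A"
    and Z: "is_zero_object C Z" and n: "1 \<le> n"
  shows "iso_class n C W = iso_class n C (right_trivial_cpx n C A Z)"
proof -
  let ?R = "right_trivial_cpx n C A Z"
  note ex = n_exangleD(1)[OF W]
  note Ch = cexact_Ch[OF ex] and ZO = zero_object_Ob[OF Z] and z = zero_object_arr[OF Z]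
  have AO: "A \<in> Ob C" using Ch_Ob[OF Ch, of "Suc n"] ends by simp
  have RC: "?R \<in> Ch n C" by (rule right_trivial_Ch[OF Z AO n])
  have R: "Tm ?R i = (if n \<le> i then A else Z)" "Df ?R i = (if i = n then Idn C A else if Suc i = n then 0[Z,A] else 0[Z,Z])" for i
    by (simp_all add: right_trivial_cpx_def)
  have exR: "cexact n ?R"
    unfolding cexact_def
  proof (intro conjI RC allI impI ballI)
    fix i Y u assume i: "i < n" and u: "u \<in> arr (Tm ?R (Suc i)) Y" "u ** Df ?R i = 0[Tm ?R i,Y]"
    have YO: "Y \<in> Ob C" using arrD(2)[OF u(1)] .
    show "\<exists>v\<in>arr (Tm ?R (Suc (Suc i))) Y. u = v ** Df ?R (Suc i)"
    proof (cases "Suc i = n")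
      case True
      then show ?thesis using u id_right[of u A Y] by (intro bexI[of _ u]) (simp_all add: R)
    next
      case False
      then have "u = 0[Z,Y]" using u(1) z(1) i by (simp add: R)
      moreover have "0[Tm ?R (Suc (Suc i)),Y] ** Df ?R (Suc i) = 0[Z,Y]"
        using z(1) comp_arr[OF zero_arr Ch_arr[OF RC], of "Suc i" Y] Ch_Ob[OF RC, of "Suc (Suc i)"] YO False i by (simp add: R)
      moreover have "0[Tm ?R (Suc (Suc i)),Y] \<in> arr (Tm ?R (Suc (Suc i))) Y"
        using Ch_Ob[OF RC, of "Suc (Suc i)"] i YO by (intro zero_arr) simp_all
      ultimately show ?thesis by metis
    qed
  qed
  have "pull C E Z (Idn C A) \<one>\<^bsub>Ext E A Z\<^esub> = \<one>\<^bsub>Ext E A Z\<^esub>" by (rule pull_Idn[OF zero_ext[OF AO ZO]])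
  then obtain v where v: "v \<in> arr A (Tm W n)" "Idn C A = Df W n ** v"
    using n_exangleD(6)[OF W, of "Idn C A" A] ends Idn_arr[OF AO] by auto
  have dn: "Df W n \<in> arr (Tm W n) A" using Ch_arr[OF Ch, of n] ends by simp
  define f where "f i = (if i = Suc n then Idn C A else if i = n then v else 0[Z,Tm W i])" for i
  define g where "g i = (if i = Suc n then Idn C A else if i = n then Df W n else 0[Tm W i,Z])" for i
  have farr: "f i \<in> arr (Tm ?R i) (Tm W i)" if "i \<le> Suc n" for i
    using that Ch_Ob[OF Ch that] ZO v Idn_arr[OF AO] ends by (auto simp: f_def R zero_arr)
  have "Df W i ** f i = f (Suc i) ** Df ?R i" if i: "i \<le> n" for i
  proof (cases "i = n")
    case True then show ?thesis by (simp add: f_def R v(2)[symmetric] id_left[OF intoI[OF Idn_arr[OF AO]]])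
  next
    case False
    then have "Tm ?R i = Z" using i by (simp add: R)
    then show ?thesis
      using comp_arr[OF Ch_arr[OF Ch i] farr[of i]] comp_arr[OF farr[of "Suc i"] Ch_arr[OF RC i]] z(1) i by (metis Suc_le_mono le_SucI)
  qed
  then have fc: "chain_map n C ?R W f" by (intro chain_mapI farr)
  have gc: "chain_map n C W ?R g"
  proof (rule chain_mapI)
    show "g i \<in> arr (Tm W i) (Tm ?R i)" if "i \<le> Suc n" for i
      using that Ch_Ob[OF Ch that] ZO dn Idn_arr[OF AO] ends by (auto simp: g_def R zero_arr)
    show "Df ?R i ** g i = g (Suc i) ** Df W i" if i: "i \<le> n" for i
    proof -
      consider "i = n" | "Suc i = n" | "Suc i < n" using i by linarith
      then show ?thesis
      proof cases
        case 1 then show ?thesis by (simp add: g_def R)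
      next
        case 2 then show ?thesis using Ch_zero[OF Ch, of i] ends zero_left[OF zero_arr[OF Ch_Ob[OF Ch, of i] ZO] AO] by (auto simp: g_def R)
      next
        case 3 then show ?thesis using zero_left[OF Ch_arr[OF Ch i] ZO] zero_right[OF zero_arr[OF ZO ZO], of "Tm W i"] Ch_Ob[OF Ch, of i] i
          by (simp add: g_def R)
      qed
    qed
  qed
  have "linked n W ?R"
    unfolding linked_def chain_map_fixing_ends_def using fc gc ends n zero_object_Idn[OF Z]
    by (intro conjI exI[of _ f] exI[of _ g]) (simp_all add: f_def g_def R)
  then show ?thesis using iso_class_eq_iff[OF ex exR] by simp
qed

end

section \<open>Exangles and realisations in the completion\<close>

context karoubi_additive begin

lemma push_mx:
  assumes "\<delta> \<in> ext Z A" "pull C E A z \<delta> = \<delta>" "r \<in> arr A B" "z \<in> arr Z Z"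
  shows "push K F (Z, z) (mk b r a) (mx a \<delta> z) = mx b (push C E Z r \<delta>) z"
  using push_pull(1)[OF assms(4,3,1)] assms(2) unfolding push_def[of K] mk_Idn mx_Act by simp

lemma pull_mx:
  assumes "\<delta> \<in> ext Z A" "push C E Z a \<delta> = \<delta>" "c \<in> arr Z' Z" "a \<in> arr A A"
  shows "pull K F (A, a) (mk z c z') (mx a \<delta> z) = mx a (pull C E A c \<delta>) z'"
  using push_pull(2)[OF assms(3,4,1)] assms(2) unfolding pull_def[of K] mk_Idn mx_Act by simp

text \<open>A factorisation found in C is turned into one in the completion by cutting the new
  factor with the idempotents on both sides.\<close>

lemma pack_n_exangle:
  assumes nx: "n_exangle n C E X \<delta>" and e: "chain_map n C X X e" "\<And>i. i \<le> Suc n \<Longrightarrow> e i ** e i = e i"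
    and p: "push C E (Tm X (Suc n)) (e 0) \<delta> = \<delta>" "pull C E (Tm X 0) (e (Suc n)) \<delta> = \<delta>"
  shows "n_exangle n K F (pack X e) (mx (e 0) \<delta> (e (Suc n)))"
proof -
  note N = n_exangleD[OF nx]
  note Ch = cexact_Ch[OF N(1)]
  note oX = pack_Ob[OF Ch e] and Df = pack_Df[OF Ch e]
  note [simp del] = pack_simps(2)
  note ea = chain_map_arr[OF e(1) Ch Ch]
  have e0: "e 0 \<in> arr (Tm X 0) (Tm X 0)" and en: "e (Suc n) \<in> arr (Tm X (Suc n)) (Tm X (Suc n))" using ea by simp_all
  have left: "\<exists>v'\<in>K.arr (Y, y) (Tm (pack X e) i). mk (e (Suc i)) w y = Df (pack X e) i \<cdot>\<^bsub>K\<^esub> v'"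
    if i: "i \<le> n" and w: "e (Suc i) ** w = w" "w ** y = w" and Y: "(Y, y) \<in> Ob K" and v: "v \<in> arr Y (Tm X i)" "w = Df X i ** v" for Y y w v i
  proof
    show "mk (e i) (e i ** v ** y) y \<in> K.arr (Y, y) (Tm (pack X e) i)"
      using mk_arr_cut[OF Y oX v(1)] i by simp
    have ty: "Df X i \<in> arr (Tm X i) (Tm X (Suc i))" "e i \<in> arr (Tm X i) (Tm X i)" "e (Suc i) \<in> arr (Tm X (Suc i)) (Tm X (Suc i))" "y \<in> arr Y Y"
      using i Ch_arr[OF Ch] ea K_ObD(1)[OF Y] by simp_all
    have "(Df X i ** e i) ** e i ** v ** y = (Df X i ** e i) ** v ** y"
      using ty v(1) comp_eq_comp[OF e(2)[of i] ty(2,2), of "v ** y"] i by (simp add: typing comp_assoc)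
    also have "\<dots> = (e (Suc i) ** w) ** y"
      unfolding chain_map_comm[OF e(1) i] v(2) using ty v(1) by (simp add: typing comp_assoc)
    also have "\<dots> = w" using w by simp
    finally show "mk (e (Suc i)) w y = Df (pack X e) i \<cdot>\<^bsub>K\<^esub> mk (e i) (e i ** v ** y) y"
      using i by (simp add: Df mk_comp)
  qed
  have right: "\<exists>v'\<in>K.arr (Tm (pack X e) (Suc i)) (Y, y). mk y w (e i) = v' \<cdot>\<^bsub>K\<^esub> Df (pack X e) i"
    if i: "i \<le> n" and w: "w ** e i = w" "y ** w = w" and Y: "(Y, y) \<in> Ob K" and v: "v \<in> arr (Tm X (Suc i)) Y" "w = v ** Df X i" for Y y w v i
  proof
    show "mk y (y ** v ** e (Suc i)) (e (Suc i)) \<in> K.arr (Tm (pack X e) (Suc i)) (Y, y)"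
      using mk_arr_cut[OF oX[of "Suc i"] Y v(1)] i by simp
    have ty: "Df X i \<in> arr (Tm X i) (Tm X (Suc i))" "e i \<in> arr (Tm X i) (Tm X i)" "e (Suc i) \<in> arr (Tm X (Suc i)) (Tm X (Suc i))" "y \<in> arr Y Y"
      using i Ch_arr[OF Ch] ea K_ObD(1)[OF Y] by simp_all
    have "(y ** v ** e (Suc i)) ** Df X i ** e i = y ** v ** e (Suc i) ** Df X i ** e i"
      using ty v(1) by (simp add: cat_simps)
    also have "e (Suc i) ** Df X i ** e i = Df X i ** e i"
      using cut_eq[OF chain_map_comm[OF e(1) i] e(2)[of "Suc i"] ty(1,3)] i by simp
    also have "y ** v ** Df X i ** e i = y ** (v ** Df X i) ** e i" using ty v(1) by (simp add: cat_simps)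
    also have "\<dots> = w" using w v(2) by simp
    finally show "mk y w (e i) = mk y (y ** v ** e (Suc i)) (e (Suc i)) \<cdot>\<^bsub>K\<^esub> Df (pack X e) i"
      using i by (simp add: Df mk_comp)
  qed
  have de: "Df X i ** e i \<in> arr (Tm X i) (Tm X (Suc i))" if "i \<le> n" for i
    using comp_arr[OF Ch_arr[OF Ch that] ea] that by simp
  have ext: "mx (e 0) \<delta> (e (Suc n)) \<in> K.ext (Tm X (Suc n), e (Suc n)) (Tm X 0, e 0)"
    using N(2) p oX by (intro mx_ext) simp_all
  have "K.cexact n (pack X e)"
    unfolding K.cexact_def
  proof (intro conjI pack_Ch[OF Ch e] allI impI ballI)
    fix i P u assume i: "i < n" and u: "u \<in> K.arr (Tm (pack X e) (Suc i)) P"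
      and z: "u \<cdot>\<^bsub>K\<^esub> Df (pack X e) i = \<one>\<^bsub>Hom K (Tm (pack X e) i) P\<^esub>"
    obtain Y y where P: "P = (Y, y)" by (cases P)
    obtain w where w: "u = mk y w (e (Suc i))" "w \<in> arr (Tm X (Suc i)) Y" "w ** e (Suc i) = w" "y ** w = w" "(Y, y) \<in> Ob K"
      using u unfolding P pack_simps by (rule K_arrE)
    have ty: "Df X i \<in> arr (Tm X i) (Tm X (Suc i))" "e (Suc i) \<in> arr (Tm X (Suc i)) (Tm X (Suc i))"
      using i Ch_arr[OF Ch] ea by simp_all
    have "w ** Df X i ** e i = 0[Tm X i,Y]"
      using z i by (simp add: P w(1) Df mk_comp mk_zero mk_inj)
    then have "w ** Df X i = 0[Tm X i,Y]"
      using chain_map_comm[OF e(1), of i] i comp_eq_comp[OF w(3,2) ty(2) intoI[OF ty(1)]] by simp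
    then obtain v where v: "v \<in> arr (Tm X (Suc (Suc i))) Y" "w = v ** Df X (Suc i)"
      using cexactE[OF N(1) i w(2)] by blast
    show "\<exists>v\<in>K.arr (Tm (pack X e) (Suc (Suc i))) P. u = v \<cdot>\<^bsub>K\<^esub> Df (pack X e) (Suc i)"
      unfolding P w(1) using right[OF _ w(3,4,5) v] i by simp
  qed
  moreover have "push K F (Tm (pack X e) (Suc n)) (Df (pack X e) 0) (mx (e 0) \<delta> (e (Suc n))) =
      \<one>\<^bsub>Ext F (Tm (pack X e) (Suc n)) (Tm (pack X e) (Suc 0))\<^esub>"
    using push_mx[OF N(2) p(2) de en] push_comp[OF Ch_arr[OF Ch le0] e0 N(2)] p(1) N(3) by (simp add: Df mx_zero)
  moreover have "pull K F (Tm (pack X e) 0) (Df (pack X e) n) (mx (e 0) \<delta> (e (Suc n))) =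
      \<one>\<^bsub>Ext F (Tm (pack X e) n) (Tm (pack X e) 0)\<^esub>"
    using pull_mx[OF N(2) p(1) de e0] pull_comp[OF Ch_arr[OF Ch le_refl] ea[OF le_SucI[OF le_refl]] N(2)] N(4) pull_of_zero[OF ea[of n] Ch_Ob[OF Ch, of 0]]
    by (simp add: Df mx_zero)
  moreover have "\<exists>v\<in>K.arr P (Tm (pack X e) i). u = Df (pack X e) i \<cdot>\<^bsub>K\<^esub> v"
    if i: "i < n" and u: "u \<in> K.arr P (Tm (pack X e) (Suc i))"
      and z: "Df (pack X e) (Suc i) \<cdot>\<^bsub>K\<^esub> u = \<one>\<^bsub>Hom K P (Tm (pack X e) (Suc (Suc i)))\<^esub>" for i P u
  proof -
    obtain Y y where P: "P = (Y, y)" by (cases P)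
    obtain w where w: "u = mk (e (Suc i)) w y" "w \<in> arr Y (Tm X (Suc i))" "w ** y = w" "e (Suc i) ** w = w" "(Y, y) \<in> Ob K"
      using u unfolding P pack_simps by (rule K_arrE)
    have ty: "Df X (Suc i) \<in> arr (Tm X (Suc i)) (Tm X (Suc (Suc i)))" "e (Suc i) \<in> arr (Tm X (Suc i)) (Tm X (Suc i))"
      using i Ch_arr[OF Ch] ea by simp_all
    have "(Df X (Suc i) ** e (Suc i)) ** w = 0[Y,Tm X (Suc (Suc i))]"
      using z i by (simp add: P w(1) Df mk_comp mk_zero mk_inj)
    then have "Df X (Suc i) ** w = 0[Y,Tm X (Suc (Suc i))]"
      using comp_assoc_arr[OF ty w(2)] w(4) by simp
    then obtain v where v: "v \<in> arr Y (Tm X i)" "w = Df X i ** v"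
      using N(5)[OF i w(2)] by blast
    show ?thesis unfolding P w(1) using left[OF _ w(4,3,5) v] i by simp
  qed
  moreover have "\<exists>v\<in>K.arr P (Tm (pack X e) n). u = Df (pack X e) n \<cdot>\<^bsub>K\<^esub> v"
    if u: "u \<in> K.arr P (Tm (pack X e) (Suc n))"
      and z: "pull K F (Tm (pack X e) 0) u (mx (e 0) \<delta> (e (Suc n))) = \<one>\<^bsub>Ext F P (Tm (pack X e) 0)\<^esub>" for P u
  proof -
    obtain Y y where P: "P = (Y, y)" by (cases P)
    obtain w where w: "u = mk (e (Suc n)) w y" "w \<in> arr Y (Tm X (Suc n))" "w ** y = w" "e (Suc n) ** w = w" "(Y, y) \<in> Ob K"
      using u unfolding P pack_simps by (rule K_arrE)
    have "pull C E (Tm X 0) w \<delta> = \<one>\<^bsub>Ext E Y (Tm X 0)\<^esub>"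
      using z unfolding P w(1) pack_simps pull_mx[OF N(2) p(1) w(2) e0] mx_zero mx_inj .
    then obtain v where v: "v \<in> arr Y (Tm X n)" "w = Df X n ** v"
      using N(6)[OF w(2)] by blast
    show ?thesis unfolding P w(1) using left[OF _ w(4,3,5) v] by simp
  qed
  moreover have "\<exists>v\<in>K.arr (Tm (pack X e) (Suc 0)) P. u = v \<cdot>\<^bsub>K\<^esub> Df (pack X e) 0"
    if u: "u \<in> K.arr (Tm (pack X e) 0) P"
      and z: "push K F (Tm (pack X e) (Suc n)) u (mx (e 0) \<delta> (e (Suc n))) = \<one>\<^bsub>Ext F (Tm (pack X e) (Suc n)) P\<^esub>" for P u
  proof -
    obtain Y y where P: "P = (Y, y)" by (cases P)
    obtain w where w: "u = mk y w (e 0)" "w \<in> arr (Tm X 0) Y" "w ** e 0 = w" "y ** w = w" "(Y, y) \<in> Ob K"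
      using u unfolding P pack_simps by (rule K_arrE)
    have "push C E (Tm X (Suc n)) w \<delta> = \<one>\<^bsub>Ext E (Tm X (Suc n)) Y\<^esub>"
      using z unfolding P w(1) pack_simps push_mx[OF N(2) p(2) w(2) en] mx_zero mx_inj .
    then obtain v where v: "v \<in> arr (Tm X (Suc 0)) Y" "w = v ** Df X 0"
      using N(7)[OF w(2)] by blast
    show ?thesis unfolding P w(1) using right[OF _ w(3,4,5) v] by simp
  qed
  ultimately show ?thesis unfolding K.n_exangle_iff using ext by (simp add: Ball_def)
qed

end

text \<open>As t is defined by a choice, it is only assumed to be the class of some packed complex
  for each extension. That the class contains every other packed realisation is proved in
  \<open>realises_pack\<close>.\<close>

locale karoubi_real = exact_realisation C E n s + karoubi_additive C E K F mk mx
  for C :: "('o, 'm) addcat" and E :: "('o, 'm, 'x) bifunctor" and n :: nat and s :: "('o, 'm, 'x) realisation"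
    and K :: "('o \<times> 'm, 'k) addcat" and F :: "('o \<times> 'm, 'k, 'y) bifunctor"
    and mk :: "'m \<Rightarrow> 'm \<Rightarrow> 'm \<Rightarrow> 'k" and mx :: "'m \<Rightarrow> 'x \<Rightarrow> 'm \<Rightarrow> 'y" +
  fixes t :: "('o \<times> 'm, 'k, 'y) realisation"
  assumes n_pos: "1 \<le> n"
    and real_class: "\<lbrakk>\<delta> \<in> ext Z A; push C E Z a \<delta> = \<delta>; pull C E A z \<delta> = \<delta>; (Z, z) \<in> Ob K; (A, a) \<in> Ob K\<rbrakk>
      \<Longrightarrow> \<exists>X e. realises n C s Z A \<delta> X \<and> chain_map n C X X e \<and> (\<forall>i\<le>Suc n. e i ** e i = e i) \<and>
        e 0 = a \<and> e (Suc n) = z \<and> t (Z, z) (A, a) (mx a \<delta> z) = iso_class n K (pack X e)"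
begin

lemma real_classE:
  assumes "\<rho> \<in> K.ext (Z, z) (A, a)"
  obtains \<delta> X e where "\<rho> = mx a \<delta> z" "\<delta> \<in> ext Z A" "push C E Z a \<delta> = \<delta>" "pull C E A z \<delta> = \<delta>" "(Z, z) \<in> Ob K" "(A, a) \<in> Ob K"
    "realises n C s Z A \<delta> X" "chain_map n C X X e" "\<And>i. i \<le> Suc n \<Longrightarrow> e i ** e i = e i" "e 0 = a" "e (Suc n) = z"
    "t (Z, z) (A, a) \<rho> = iso_class n K (pack X e)" "n_exangle n K F (pack X e) \<rho>"
proof -
  obtain \<delta> where \<delta>: "\<rho> = mx a \<delta> z" "\<delta> \<in> ext Z A" "push C E Z a \<delta> = \<delta>" "pull C E A z \<delta> = \<delta>" "(Z, z) \<in> Ob K" "(A, a) \<in> Ob K"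
    using assms by (rule K_extE)
  obtain X e where X: "realises n C s Z A \<delta> X" and e: "chain_map n C X X e" "\<forall>i\<le>Suc n. e i ** e i = e i" "e 0 = a" "e (Suc n) = z"
    and c: "t (Z, z) (A, a) (mx a \<delta> z) = iso_class n K (pack X e)"
    using real_class[OF \<delta>(2-6)] by blast
  have ee: "\<And>i. i \<le> Suc n \<Longrightarrow> e i ** e i = e i" using e(2) by blast
  have "n_exangle n K F (pack X e) (mx (e 0) \<delta> (e (Suc n)))"
    by (rule pack_n_exangle[OF realises_n_exangle[OF X \<delta>(2)] e(1) ee]) (use realises_ends[OF X] e \<delta> in simp_all)
  then show thesis by (intro that[OF \<delta> X e(1) ee e(3,4)]) (simp_all add: \<delta>(1) c e)
qed

lemma real_class_exangle:
  assumes "\<rho> \<in> K.ext P Q"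
  obtains W where "Tm W 0 = Q" "Tm W (Suc n) = P" "n_exangle n K F W \<rho>" "t P Q \<rho> = iso_class n K W"
proof -
  obtain Z z A a where PQ: "P = (Z, z)" "Q = (A, a)" by (cases P, cases Q)
  show thesis
  proof (rule real_classE[OF assms[unfolded PQ]])
    fix \<delta> X e
    assume "realises n C s Z A \<delta> X" "e 0 = a" "e (Suc n) = z" "t (Z, z) (A, a) \<rho> = iso_class n K (pack X e)"
      "n_exangle n K F (pack X e) \<rho>"
    then show thesis using that[of "pack X e"] realises_ends by (simp add: PQ)
  qed
qed

text \<open>Once the class is represented by an exangle, equality of classes can be replaced by
  membership.\<close>

lemma K_realises_iff:
  assumes "\<rho> \<in> K.ext P Q"
  shows "realises n K t P Q \<rho> W \<longleftrightarrow> Tm W 0 = Q \<and> Tm W (Suc n) = P \<and> n_exangle n K F W \<rho> \<and> W \<in> t P Q \<rho>"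
proof -
  obtain U where c: "t P Q \<rho> = iso_class n K U" and nx: "n_exangle n K F U \<rho>"
    using assms by (rule real_class_exangle)
  note ex = K.n_exangleD(1)[OF nx]
  show ?thesis
  proof
    assume W: "realises n K t P Q \<rho> W"
    then have "W \<in> Ch n K" "t P Q \<rho> = iso_class n K W" and e: "Tm W 0 = Q" "Tm W (Suc n) = P" by (simp_all add: realises_def)
    then have m: "W \<in> t P Q \<rho>" using K.iso_class_refl by simp
    then show "Tm W 0 = Q \<and> Tm W (Suc n) = P \<and> n_exangle n K F W \<rho> \<and> W \<in> t P Q \<rho>"
      using K.n_exangle_iso_class_iff[OF nx, of W] c e by simp
  next
    assume W: "Tm W 0 = Q \<and> Tm W (Suc n) = P \<and> n_exangle n K F W \<rho> \<and> W \<in> t P Q \<rho>"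
    have exW: "K.cexact n W" and "K.linked n (U) W"
      using W K.n_exangle_iso_class_iff[OF nx, of W] K.n_exangleD(1) c by auto
    then have "iso_class n K (U) = iso_class n K W" using K.iso_class_eq_iff[OF ex exW] by simp
    then show "realises n K t P Q \<rho> W" using W c K.cexact_Ch[OF exW] by (simp add: realises_def)
  qed
qed

lemma K_R0:
  assumes \<rho>: "\<rho> \<in> K.ext P Q" and \<sigma>: "\<sigma> \<in> K.ext P' Q'" and g: "g \<in> K.arr Q Q'" and h: "h \<in> K.arr P P'"
    and eq: "push K F P g \<rho> = pull K F Q' h \<sigma>"
    and V: "realises n K t P Q \<rho> V" and W: "realises n K t P' Q' \<sigma> W"
  shows "\<exists>f. is_lift n K V W g h f"
proof -
  obtain Z z A a where PQ: "P = (Z, z)" "Q = (A, a)" by (cases P, cases Q)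
  obtain Z' z' A' a' where PQ': "P' = (Z', z')" "Q' = (A', a')" by (cases P', cases Q')
  obtain \<delta> X e where \<delta>: "\<rho> = mx a \<delta> z" "\<delta> \<in> ext Z A" "push C E Z a \<delta> = \<delta>" "pull C E A z \<delta> = \<delta>" "(Z, z) \<in> Ob K" "(A, a) \<in> Ob K"
    and X: "realises n C s Z A \<delta> X" and e: "chain_map n C X X e" "\<And>i. i \<le> Suc n \<Longrightarrow> e i ** e i = e i" "e 0 = a" "e (Suc n) = z"
    and tX: "t P Q \<rho> = iso_class n K (pack X e)" and nX: "n_exangle n K F (pack X e) \<rho>"
    using \<rho> unfolding PQ by (rule real_classE) blast
  obtain \<delta>' Y r where \<delta>': "\<sigma> = mx a' \<delta>' z'" "\<delta>' \<in> ext Z' A'" "push C E Z' a' \<delta>' = \<delta>'" "pull C E A' z' \<delta>' = \<delta>'" "(Z', z') \<in> Ob K" "(A', a') \<in> Ob K"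
    and Y: "realises n C s Z' A' \<delta>' Y" and r: "chain_map n C Y Y r" "\<And>i. i \<le> Suc n \<Longrightarrow> r i ** r i = r i" "r 0 = a'" "r (Suc n) = z'"
    and tY: "t P' Q' \<sigma> = iso_class n K (pack Y r)" and nY: "n_exangle n K F (pack Y r) \<sigma>"
    using \<sigma> unfolding PQ' by (rule real_classE) blast
  have lX: "K.linked n V (pack X e)" and lY: "K.linked n (pack Y r) W" and ChV: "V \<in> Ch n K" and ChW: "W \<in> Ch n K"
    using V W K.linked_sym K.n_exangle_iso_class_iff[OF nX, of V] K.n_exangle_iso_class_iff[OF nY, of W]
    unfolding K_realises_iff[OF \<rho>] K_realises_iff[OF \<sigma>] tX tY by (auto dest: K.n_exangleD(1) K.cexact_Ch)
  obtain p where p: "chain_map_fixing_ends n K V (pack X e) p" using lX by (auto simp: K.linked_def)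
  obtain q where q: "chain_map_fixing_ends n K (pack Y r) W q" using lY by (auto simp: K.linked_def)
  obtain b where b: "g = mk a' b a" "b \<in> arr A A'" "b ** a = b" "a' ** b = b"
    using g unfolding PQ PQ' by (rule K_arrE)
  obtain c where c: "h = mk z' c z" "c \<in> arr Z Z'" "c ** z = c" "z' ** c = c"
    using h unfolding PQ PQ' by (rule K_arrE)
  note z = K_ObD[OF \<delta>(5)] and a' = K_ObD[OF \<delta>'(6)] and a = K_ObD[OF \<delta>(6)] and z' = K_ObD[OF \<delta>'(5)]
  have "push C E Z b \<delta> = pull C E A' c \<delta>'"
    using eq unfolding PQ PQ' \<delta>(1) \<delta>'(1) b(1) c(1) push_mx[OF \<delta>(2,4) b(2) z(1)] pull_mx[OF \<delta>'(2,3) c(2) a'(1)] mx_inj .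
  then obtain f where f: "chain_map n C X Y f" "f 0 = b" "f (Suc n) = c"
    using lift_exists[OF X Y \<delta>(2) \<delta>'(2) b(2) c(2)] by blast
  note ChX = realises_Ch[OF X] and ChY = realises_Ch[OF Y]
  note F = pack_lift[OF ChX ChY f(1) e(1,2) r(1,2)]
  \<comment> \<open>The lift is routed through the packed representatives, where a lift from C, cut
    by the idempotents, is available.\<close>
  have m: "chain_map n K V W (\<lambda>i. q i \<cdot>\<^bsub>K\<^esub> mk (r i) (r i ** f i ** e i) (e i) \<cdot>\<^bsub>K\<^esub> p i)"
    by (rule K.chain_map_comp[OF K.chain_map_comp[OF K.fixing_endsD(1)[OF p] F ChV pack_Ch[OF ChX e(1,2)] pack_Ch[OF ChY r(1,2)]]
      K.fixing_endsD(1)[OF q] ChV pack_Ch[OF ChY r(1,2)] ChW])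
  have ends: "Tm V 0 = (A, a)" "Tm V (Suc n) = (Z, z)" using V[unfolded K_realises_iff[OF \<rho>]] unfolding PQ by auto
  have endsY: "Tm (pack Y r) 0 = (A', a')" "Tm (pack Y r) (Suc n) = (Z', z')" using realises_ends[OF Y] r by simp_all
  have "is_lift n K V W g h (\<lambda>i. q i \<cdot>\<^bsub>K\<^esub> mk (r i) (r i ** f i ** e i) (e i) \<cdot>\<^bsub>K\<^esub> p i)"
    unfolding is_lift_def using m K.fixing_endsD(3,5)[OF p] K.fixing_endsD(3,5)[OF q]
    by (simp add: ends endsY mk_Idn mk_comp b(1) c(1) e(3,4) r(3,4) f(2,3) b(3,4) c(3,4) del: pack_simps)
  then show ?thesis by blast
qed

lemma K_exact_realisation: "exact_realisation K F n t"
proof (intro exact_realisation.intro exact_realisation_axioms.intro K.biadditive_functor_axioms)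
  fix P Q \<rho> assume "P \<in> Ob K" "Q \<in> Ob K" "\<rho> \<in> carrier (Ext F P Q)"
  then have \<rho>: "\<rho> \<in> K.ext P Q" by (rule K.extI)
  obtain W where W: "Tm W 0 = Q" "Tm W (Suc n) = P" "n_exangle n K F W \<rho>" "t P Q \<rho> = iso_class n K W"
    using \<rho> by (rule real_class_exangle)
  have "realises n K t P Q \<rho> W"
    unfolding K_realises_iff[OF \<rho>] using W K.iso_class_refl[OF K.cexact_Ch[OF K.n_exangleD(1)[OF W(3)]]] by simp
  then show "\<exists>X. realises n K t P Q \<rho> X" by blast
next
  fix Q Q' P P' \<rho> \<sigma> g h V W
  assume "Q \<in> Ob K" "Q' \<in> Ob K" "P \<in> Ob K" "P' \<in> Ob K" "\<rho> \<in> carrier (Ext F P Q)" "\<sigma> \<in> carrier (Ext F P' Q')"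
    "g \<in> carrier (Hom K Q Q')" "h \<in> carrier (Hom K P P')" "push K F P g \<rho> = pull K F Q' h \<sigma>"
    "realises n K t P Q \<rho> V" "realises n K t P' Q' \<sigma> W"
  then show "\<exists>f. is_lift n K V W g h f"
    by (intro K_R0[of \<rho> P Q \<sigma> P' Q' g h V W] K.extI K.arrI)
next
  fix Q P \<rho> W assume "Q \<in> Ob K" "P \<in> Ob K" "\<rho> \<in> carrier (Ext F P Q)" and W: "realises n K t P Q \<rho> W"
  then have "\<rho> \<in> K.ext P Q" by (simp add: K.extI)
  from W[unfolded K_realises_iff[OF this]] show "n_exangle n K F W \<rho>" by blast
next
  fix Q Z' assume Q: "Q \<in> Ob K" and Z': "is_zero_object K Z'"
  have \<rho>: "\<one>\<^bsub>Ext F Z' Q\<^esub> \<in> K.ext Z' Q" by (rule K.zero_ext[OF K.zero_object_Ob[OF Z'] Q])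
  obtain W where W: "Tm W 0 = Q" "Tm W (Suc n) = Z'" "n_exangle n K F W \<one>\<^bsub>Ext F Z' Q\<^esub>"
      "t Z' Q \<one>\<^bsub>Ext F Z' Q\<^esub> = iso_class n K W"
    using \<rho> by (rule real_class_exangle)
  show "t Z' Q \<one>\<^bsub>Ext F Z' Q\<^esub> = iso_class n K (left_trivial_cpx K Q Z')"
    unfolding W(4) by (rule K.iso_class_left_trivial[OF W(3,1,2) Z' n_pos])
next
  fix Q Z' assume Q: "Q \<in> Ob K" and Z': "is_zero_object K Z'"
  have \<rho>: "\<one>\<^bsub>Ext F Q Z'\<^esub> \<in> K.ext Q Z'" by (rule K.zero_ext[OF Q K.zero_object_Ob[OF Z']])
  obtain W where W: "Tm W 0 = Z'" "Tm W (Suc n) = Q" "n_exangle n K F W \<one>\<^bsub>Ext F Q Z'\<^esub>"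
      "t Q Z' \<one>\<^bsub>Ext F Q Z'\<^esub> = iso_class n K W"
    using \<rho> by (rule real_class_exangle)
  show "t Q Z' \<one>\<^bsub>Ext F Q Z'\<^esub> = iso_class n K (right_trivial_cpx n K Q Z')"
    unfolding W(4) by (rule K.iso_class_right_trivial[OF W(3,1,2) Z' n_pos])
qed

sublocale K: exact_realisation K F n t by (rule K_exact_realisation)

text \<open>At the ends the cut map r f e equals e, which is the identity of the packed end
  term.\<close>

lemma pack_fixing_ends:
  assumes Ch: "X \<in> Ch n C" "Y \<in> Ch n C" and f: "chain_map_fixing_ends n C X Y f"
    and e: "chain_map n C X X e" "\<And>i. i \<le> Suc n \<Longrightarrow> e i ** e i = e i"
    and r: "chain_map n C Y Y r" "\<And>i. i \<le> Suc n \<Longrightarrow> r i ** r i = r i"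
    and eq: "r 0 = e 0" "r (Suc n) = e (Suc n)"
  shows "\<exists>g. chain_map_fixing_ends n K (pack X e) (pack Y r) g"
proof -
  note F = fixing_endsD[OF f]
  have "r 0 ** f 0 ** e 0 = e 0" "r (Suc n) ** f (Suc n) ** e (Suc n) = e (Suc n)"
    using e(2)[of 0] e(2)[of "Suc n"] id_left[OF intoI[OF chain_map_arr[OF e(1) Ch(1,1)]]] by (simp_all add: F(3,5) eq)
  then have "chain_map_fixing_ends n K (pack X e) (pack Y r) (\<lambda>i. mk (r i) (r i ** f i ** e i) (e i))"
    using pack_lift[OF Ch F(1) e r] F(2,4) by (simp add: chain_map_fixing_ends_def mk_Idn eq)
  then show ?thesis by blast
qed

text \<open>Independence of the choices in t: linking maps between two realising complexes, cut by
  the respective idempotents, link the packed complexes.\<close>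

lemma realises_pack:
  assumes X: "realises n C s Z A \<delta> X" and \<delta>: "\<delta> \<in> ext Z A"
    and e: "chain_map n C X X e" "\<And>i. i \<le> Suc n \<Longrightarrow> e i ** e i = e i" "e 0 = a" "e (Suc n) = z"
    and p: "push C E Z a \<delta> = \<delta>" "pull C E A z \<delta> = \<delta>"
  shows "realises n K t (Z, z) (A, a) (mx a \<delta> z) (pack X e)"
proof -
  note Ch = realises_Ch[OF X] and ends = realises_ends[OF X]
  have oK: "(Z, z) \<in> Ob K" "(A, a) \<in> Ob K"
    using pack_Ob[OF Ch e(1,2), of 0] pack_Ob[OF Ch e(1,2), of "Suc n"] ends e(3,4) by simp_all
  have \<rho>: "mx a \<delta> z \<in> K.ext (Z, z) (A, a)" by (rule mx_ext[OF \<delta> p oK])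
  obtain \<delta>' Y r where \<delta>': "mx a \<delta> z = mx a \<delta>' z"
    and Y: "realises n C s Z A \<delta>' Y" and r: "chain_map n C Y Y r" "\<And>i. i \<le> Suc n \<Longrightarrow> r i ** r i = r i" "r 0 = a" "r (Suc n) = z"
    and tY: "t (Z, z) (A, a) (mx a \<delta> z) = iso_class n K (pack Y r)" and nY: "n_exangle n K F (pack Y r) (mx a \<delta> z)"
    using \<rho> by (rule real_classE) blast
  note Y = Y[folded \<delta>'[unfolded mx_inj]]
  note ChY = realises_Ch[OF Y] and endsY = realises_ends[OF Y]
  have nX: "n_exangle n K F (pack X e) (mx a \<delta> z)"
    using pack_n_exangle[OF realises_n_exangle[OF X \<delta>] e(1,2)] p ends e(3,4) by simp
  obtain f g where f: "chain_map_fixing_ends n C X Y f" and g: "chain_map_fixing_ends n C Y X g"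
    using realises_linked[OF X Y \<delta>] by (auto simp: linked_def)
  have "K.linked n (pack Y r) (pack X e)"
    unfolding K.linked_def
    using pack_fixing_ends[OF Ch ChY f e(1,2) r(1,2)] pack_fixing_ends[OF ChY Ch g r(1,2) e(1,2)] e(3,4) r(3,4) by simp
  then have "pack X e \<in> t (Z, z) (A, a) (mx a \<delta> z)"
    unfolding tY using K.n_exangle_iso_class_iff[OF nY] nX by simp
  then show ?thesis
    unfolding K_realises_iff[OF \<rho>] using nX ends e(3,4) by simp
qed

text \<open>Allows the underlying complex X to be prescribed; only the idempotents on it are
  chosen.\<close>

lemma realises_packE:
  assumes "\<delta> \<in> ext Z A" "push C E Z a \<delta> = \<delta>" "pull C E A z \<delta> = \<delta>" "(Z, z) \<in> Ob K" "(A, a) \<in> Ob K"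
    and X: "realises n C s Z A \<delta> X"
  obtains e where "chain_map n C X X e" "\<And>i. i \<le> Suc n \<Longrightarrow> e i ** e i = e i" "e 0 = a" "e (Suc n) = z"
    "realises n K t (Z, z) (A, a) (mx a \<delta> z) (pack X e)"
proof -
  note ends = realises_ends[OF X]
  have "\<exists>e. chain_map n C X X e \<and> (\<forall>i\<le>Suc n. e i ** e i = e i) \<and> e 0 = a \<and> e (Suc n) = z"
    using idempotent_lift[OF n_pos realises_n_exangle[OF X assms(1)], of a z] assms K_ObD[OF assms(4)] K_ObD[OF assms(5)]
    unfolding ends by metis
  then obtain e where e: "chain_map n C X X e" "\<And>i. i \<le> Suc n \<Longrightarrow> e i ** e i = e i" "e 0 = a" "e (Suc n) = z" by blast
  show thesis by (rule that[OF e realises_pack[OF X assms(1) e assms(2,3)]])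
qed


end

text \<open>The assumptions hold for C and for its opposite category: \<open>inflation_sum\<close>
  comes from (EA2)^op in the first case and from (EA2) in the second, and \<open>good_lift\<close>
  the other way round. Each instance then yields half of the axioms for the completion.\<close>

locale karoubi = karoubi_real C E n s K F mk mx t
  for C :: "('o, 'm) addcat" and E :: "('o, 'm, 'x) bifunctor" and n :: nat and s :: "('o, 'm, 'x) realisation"
    and K :: "('o \<times> 'm, 'k) addcat" and F :: "('o \<times> 'm, 'k, 'y) bifunctor"
    and mk :: "'m \<Rightarrow> 'm \<Rightarrow> 'm \<Rightarrow> 'k" and mx :: "'m \<Rightarrow> 'x \<Rightarrow> 'm \<Rightarrow> 'y"
    and t :: "('o \<times> 'm, 'k, 'y) realisation" +
  assumes inflation_comp: "\<lbrakk>is_inflation n C E s A B f; is_inflation n C E s B B' g\<rbrakk>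
      \<Longrightarrow> is_inflation n C E s A B' (g ** f)"
    and inflation_sum: "\<lbrakk>\<delta> \<in> ext Z A; realises n C s Z A \<delta> X; f \<in> arr A B\<rbrakk>
      \<Longrightarrow> \<exists>P i1 i2 p1 p2 y. is_biproduct C B (Tm X (Suc 0)) P i1 i2 p1 p2 \<and>
        is_inflation n C E s A P y \<and> p1 ** y = f \<and> p2 ** y = Df X 0"
    and good_lift: "\<lbrakk>\<delta> \<in> ext Z A; c \<in> arr Z' Z; realises n C s Z' A (pull C E A c \<delta>) Y; realises n C s Z A \<delta> X\<rbrakk>
      \<Longrightarrow> \<exists>f M. is_lift n C Y X (Idn C A) c f \<and> is_mapping_cone n C Y X f M \<and>
        realises n C s Z (Tm Y (Suc 0)) (push C E Z (Df Y 0) \<delta>) M"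
begin

text \<open>The idempotent on B does not occur: the condition is stated in C alone, and b enters
  only through f being a morphism of the completion.\<close>

definition splits_inflation where
  "splits_inflation A a B f \<longleftrightarrow>
     (\<exists>Z \<delta> X q u. \<delta> \<in> ext Z A \<and> realises n C s Z A \<delta> X \<and> q \<in> arr B (Tm X (Suc 0)) \<and> q ** f = Df X 0 ** a \<and>
       u \<in> arr (Tm X (Suc 0)) A \<and> u ** Df X 0 = Idn C A +[A,A] -[A,A] a)"

lemma inflation_E:
  assumes "is_inflation n C E s A B f"
  obtains Z \<delta> X where "\<delta> \<in> ext Z A" "realises n C s Z A \<delta> X" "Tm X (Suc 0) = B" "Df X 0 = f" "f \<in> arr A B"
proof -
  obtain Z \<delta> X where Z: "Z \<in> Ob C" "\<delta> \<in> carrier (Ext E Z A)" and X: "realises n C s Z A \<delta> X" and X1: "Tm X (Suc 0) = B" "Df X 0 = f"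
    using assms by (auto simp: is_inflation_def)
  note Ch = realises_Ch[OF X] and ends = realises_ends[OF X]
  have "\<delta> \<in> ext Z A" using Z Ch_Ob[OF Ch, of 0] ends by (simp add: extI)
  then show thesis using that X X1 Ch_arr[OF Ch, of 0] ends by auto
qed

text \<open>The given complex W is linked to a packed realisation X. The degree 1 component of the
  link provides q, and u exists because a fixes the extension.\<close>

lemma splits_inflation_of_inflation:
  assumes "is_inflation n K F t (A, a) (B, b) (mk b f a)" and f: "(A, a) \<in> Ob K"
  shows "splits_inflation A a B f"
proof -
  obtain Z z \<rho> W where \<rho>: "\<rho> \<in> carrier (Ext F (Z, z) (A, a))" "(Z, z) \<in> Ob K" and W: "realises n K t (Z, z) (A, a) \<rho> W"
    and W1: "Tm W (Suc 0) = (B, b)" "Df W 0 = mk b f a"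
    using assms by (auto simp: is_inflation_def)
  have \<rho>: "\<rho> \<in> K.ext (Z, z) (A, a)" using \<rho> f by (simp add: K.extI)
  obtain \<delta> where \<delta>: "\<rho> = mx a \<delta> z" "\<delta> \<in> ext Z A" "push C E Z a \<delta> = \<delta>" "pull C E A z \<delta> = \<delta>"
    "(Z, z) \<in> Ob K" "(A, a) \<in> Ob K"
    by (rule K_extE[OF \<rho>])
  obtain X where X: "realises n C s Z A \<delta> X" by (rule realises_exists[OF \<delta>(2)])
  obtain e where e: "chain_map n C X X e" "\<And>i. i \<le> Suc n \<Longrightarrow> e i ** e i = e i" "e 0 = a" "e (Suc n) = z"
    and P: "realises n K t (Z, z) (A, a) (mx a \<delta> z) (pack X e)"
    by (rule realises_packE[OF \<delta>(2-6) X]) blast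
  note ends = realises_ends[OF X] and endsW = K.realises_ends[OF W]
  obtain p where p: "chain_map_fixing_ends n K W (pack X e) p"
    using K.realises_linked[OF W P[folded \<delta>(1)] \<rho>] by (auto simp: K.linked_def)
  have pc: "chain_map n K W (pack X e) p" and p0: "p 0 = mk a a a"
    using K.fixing_endsD(1,3)[OF p] endsW by (simp_all add: mk_Idn)
  have "p (Suc 0) \<in> K.arr (B, b) (Tm X (Suc 0), e (Suc 0))"
    using K.chain_map_arr[OF pc K.realises_Ch[OF W] K.realises_Ch[OF P], of "Suc 0"] W1 by simp
  then obtain q where q: "p (Suc 0) = mk (e (Suc 0)) q b" "q \<in> arr B (Tm X (Suc 0))"
    by (rule K_arrE)
  note Ch = realises_Ch[OF X]
  have ty: "Df X 0 \<in> arr A (Tm X (Suc 0))" "a \<in> arr A A" "a ** a = a" "e (Suc 0) \<in> arr (Tm X (Suc 0)) (Tm X (Suc 0))"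
    using Ch_arr[OF Ch, of 0] ends K_ObD[OF f] chain_map_arr[OF e(1) Ch Ch, of "Suc 0"] by simp_all
  have "e (Suc 0) ** Df X 0 = Df X 0 ** a"
    using chain_map_comm[OF e(1), of 0] e(3) by simp
  then have "e (Suc 0) ** Df X 0 ** a = Df X 0 ** a"
    using ty comp_eq_comp[of "e (Suc 0)" "Df X 0" "Df X 0 ** a" _ _ _ a] by (simp add: cat_simps)
  moreover have "mk (e (Suc 0)) ((e (Suc 0) ** Df X 0 ** a) ** a) a = mk (e (Suc 0)) (q ** f) a"
    using K.chain_map_comm[OF pc, of 0] W1 by (simp add: p0 q mk_comp e(3))
  ultimately have qf: "q ** f = Df X 0 ** a"
    using ty by (simp add: mk_inj cat_simps)
  have "a \<in> arr (Tm X 0) (Tm X 0)" "push C E (Tm X (Suc n)) a \<delta> = \<delta>" using ends \<delta> ty by simp_all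
  from push_split[OF realises_n_exangle[OF X \<delta>(2)] this refl]
  obtain u where u: "u \<in> arr (Tm X (Suc 0)) A" "u ** Df X 0 = Idn C A +[A,A] -[A,A] a"
    unfolding ends by metis
  show ?thesis unfolding splits_inflation_def using \<delta>(2) X q(2) qf u by blast
qed

text \<open>Adding B to the degree 1 term makes f a component of an inflation (f, x). The
  automorphism that subtracts q from the summand B into the other one changes it to (f, x - q f) =
  (f, x - x a), and after composition with a only f is left.\<close>

lemma splits_inflation_core:
  assumes f: "splits_inflation A a B f" "f \<in> arr A B" "f ** a = f" and a: "a \<in> arr A A" "a ** a = a"
  obtains M y i p v where "is_inflation n C E s A M y" "y \<in> arr A M" "i \<in> arr B M" "p \<in> arr M B" "p ** i = Idn C B"
    "p ** y = f" "y ** a = i ** f" "v \<in> arr M A" "v ** y = Idn C A +[A,A] -[A,A] a"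
proof -
  obtain Z \<delta> X q u where \<delta>: "\<delta> \<in> ext Z A" and X: "realises n C s Z A \<delta> X" and q: "q \<in> arr B (Tm X (Suc 0))" "q ** f = Df X 0 ** a"
    and u: "u \<in> arr (Tm X (Suc 0)) A" "u ** Df X 0 = Idn C A +[A,A] -[A,A] a"
    using f(1) unfolding splits_inflation_def by blast
  obtain P i1 i2 p1 p2 y where b: "is_biproduct C B (Tm X (Suc 0)) P i1 i2 p1 p2"
    and y: "is_inflation n C E s A P y" "p1 ** y = f" "p2 ** y = Df X 0"
    using inflation_sum[OF \<delta> X f(2)] by blast
  note Ch = realises_Ch[OF X] and ends = realises_ends[OF X]
  have ob: "B \<in> Ob C" "Tm X (Suc 0) \<in> Ob C" using arrD(2)[OF f(2)] Ch_Ob[OF Ch, of "Suc 0"] by simp_all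
  have x: "Df X 0 \<in> arr A (Tm X (Suc 0))" using Ch_arr[OF Ch, of 0] ends by simp
  note bD = biproductD[OF b ob] and bc = biproduct_comp[OF b ob]
  have yt: "y \<in> arr A P" by (rule inflation_E[OF y(1)])
  have PO: "P \<in> Ob C" using yt by (rule arrD)
  let ?g = "Idn C P +[P,P] -[P,P] (i2 ** q ** p1)" and ?h = "Idn C P +[P,P] i2 ** q ** p1"
  note ty = bD(1-4) q(1) f(2) a(1) u(1) yt x PO Idn_arr[OF PO]
  have g: "?g \<in> arr P P" "?h \<in> arr P P" using ty by (simp_all add: cat_simps)
  have inv: "?h ** ?g = Idn C P" "?g ** ?h = Idn C P"
    using ty ob by (simp_all add: cat_ac bc zero_left[OF comp_arr[OF q(1) bD(3)] ob(1)])
  have infl: "is_inflation n C E s A P (?g ** y)"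
    by (rule inflation_comp_iso[OF n_pos y(1) g inv])
  have gy: "?g ** y = y +[A,P] -[A,P] (i2 ** Df X 0 ** a)"
    using ty by (simp add: cat_simps y(2) q(2))
  show thesis
  proof (rule that[OF infl _ bD(1,3,5)])
    show "?g ** y \<in> arr A P" using g(1) yt by (rule comp_arr)
    show "p1 ** ?g ** y = f" unfolding gy using ty ob arrD(1)[OF f(2)] by (simp add: cat_simps bc y(2) zero_left[OF comp_arr[OF x a(1)] ob(1)])
    show "(?g ** y) ** a = i1 ** f"
    proof (rule biproduct_into_eqI[OF b ob, where D=A])
      show "p1 ** (?g ** y) ** a = p1 ** i1 ** f"
        unfolding gy using ty a(2) comp_eq_comp[OF y(2) bD(3) yt intoI[OF a(1)]]
        arrD(1)[OF f(2)] ob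
        by (simp add: cat_simps bc f(3) zero_left[OF comp_arr[OF x a(1)] ob(1)])
      show "p2 ** (?g ** y) ** a = p2 ** i1 ** f"
        unfolding gy using ty a(2) comp_eq_comp[OF y(3) bD(4) yt intoI[OF a(1)]]
        ob by (simp add: cat_simps bc zero_left[OF f(2) ob(2)])
    qed (use comp_arr[OF comp_arr[OF g(1) yt] a(1)] comp_arr[OF bD(1) f(2)] in simp_all)
    \<comment> \<open>As (1 - a) a = 0, u takes x - x a to 1 - a just as it does x.\<close>
    show "u ** p2 \<in> arr P A" using ty by (simp add: typing)
    show "(u ** p2) ** ?g ** y = Idn C A +[A,A] -[A,A] a"
      unfolding gy using ty a(2) comp_eq_comp[OF u(2) u(1) x intoI[OF a(1)]] arrD(1)[OF a(1)]
      by (simp add: cat_simps bc y(3) u(2))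
  qed
qed

text \<open>The inflation attached to f ends in M, whereas the one attached to g starts in B.
  Pushing the extension of the latter along i gives an inflation starting in M, so that the two
  compose.\<close>

lemma splits_inflation_comp:
  assumes f: "splits_inflation A a B f" "f \<in> arr A B" "f ** a = f" "b ** f = f" and a: "a \<in> arr A A" "a ** a = a"
    and g: "splits_inflation B b B' g" "g \<in> arr B B'" and b: "b \<in> arr B B"
  shows "splits_inflation A a B' (g ** f)"
proof -
  obtain M y i p v where y: "is_inflation n C E s A M y" and ty: "y \<in> arr A M" "i \<in> arr B M" "p \<in> arr M B" "v \<in> arr M A"
    and r: "p ** i = Idn C B" "p ** y = f" "y ** a = i ** f" "v ** y = Idn C A +[A,A] -[A,A] a"
    by (rule splits_inflation_core[OF f(1-3) a]) blast
  obtain Z \<delta> X q u where \<delta>: "\<delta> \<in> ext Z B" and X: "realises n C s Z B \<delta> X" and q: "q \<in> arr B' (Tm X (Suc 0))" "q ** g = Df X 0 ** b"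
    using g(1) unfolding splits_inflation_def by blast
  have i\<delta>: "push C E Z i \<delta> \<in> ext Z M" using ty(2) \<delta> by (rule push_ext)
  obtain V where V: "realises n C s Z M (push C E Z i \<delta>) V" by (rule realises_exists[OF i\<delta>])
  note ChX = realises_Ch[OF X] and endsX = realises_ends[OF X] and ChV = realises_Ch[OF V] and endsV = realises_ends[OF V]
  have ZO: "Z \<in> Ob C" and MO: "M \<in> Ob C" and AO: "A \<in> Ob C" using extD(1)[OF i\<delta>] extD(2)[OF i\<delta>] arrD(1)[OF ty(1)] by auto
  have z0: "Df V 0 \<in> arr M (Tm V (Suc 0))" and x0: "Df X 0 \<in> arr B (Tm X (Suc 0))"
    using Ch_arr[OF ChV, of 0] Ch_arr[OF ChX, of 0] endsV endsX by simp_all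
  have "is_inflation n C E s M (Tm V (Suc 0)) (Df V 0)"
    unfolding is_inflation_def using V extD[OF i\<delta>] by (auto intro!: bexI exI)
  then have z: "is_inflation n C E s A (Tm V (Suc 0)) (Df V 0 ** y)" by (rule inflation_comp[OF y])
  then obtain Z' \<epsilon> W where \<epsilon>: "\<epsilon> \<in> ext Z' A" and W: "realises n C s Z' A \<epsilon> W" and W1: "Tm W (Suc 0) = Tm V (Suc 0)" "Df W 0 = Df V 0 ** y"
    by (rule inflation_E)
  have "push C E Z i \<delta> = pull C E M (Idn C Z) (push C E Z i \<delta>)" using pull_Idn[OF i\<delta>] by simp
  then obtain \<phi> where \<phi>: "chain_map n C X V \<phi>" "\<phi> 0 = i"
    using lift_exists[OF X V \<delta> i\<delta> ty(2) Idn_arr[OF ZO]] by blast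
  have \<phi>1: "\<phi> (Suc 0) \<in> arr (Tm X (Suc 0)) (Tm V (Suc 0))" and \<phi>c: "Df V 0 ** i = \<phi> (Suc 0) ** Df X 0"
    using chain_map_arr[OF \<phi>(1) ChX ChV, of "Suc 0"] chain_map_comm[OF \<phi>(1), of 0] \<phi>(2) by simp_all
  note ty' = ty \<phi>1 z0 x0 q(1) f(2) g(2) a(1) b
  have "(\<phi> (Suc 0) ** q) ** g ** f = \<phi> (Suc 0) ** Df X 0 ** b ** f"
    using ty' comp_eq_comp[OF q(2) q(1) g(2) intoI[OF f(2)]] by (simp add: cat_simps)
  also have "\<dots> = Df V 0 ** i ** f"
    using ty' comp_eq_comp[OF \<phi>c z0 ty(2) intoI[OF f(2)]] by (simp add: cat_simps f(4))
  also have "\<dots> = (Df V 0 ** y) ** a" using ty' by (simp add: cat_simps r(3))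
  finally have 1: "(\<phi> (Suc 0) ** q) ** g ** f = Df W 0 ** a" using W1 by simp
  \<comment> \<open>Subtracting the part of v on the summand B makes it vanish on i without changing
    its value on y. Then w kills the extension pushed along i, hence factors through
    \<open>Df V 0\<close>, and the factor is the required retraction.\<close>
  define w where "w = v +[M,A] -[M,A] (v ** i ** p)"
  have w: "w \<in> arr M A" "w ** i = 0[B,A]"
    unfolding w_def using ty by (simp_all add: cat_simps r(1))
  have "w ** y = v ** y +[A,A] -[A,A] (v ** y ** a)"
    unfolding w_def using ty' by (simp add: cat_simps r(2,3))
  also have "\<dots> = Idn C A +[A,A] -[A,A] a"
    using ty' comp_eq_comp[OF r(4) ty(4,1) intoI[OF a(1)]] a(2) AO Idn_arr[OF AO] by (simp add: cat_simps r(4))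
  finally have wy: "w ** y = Idn C A +[A,A] -[A,A] a" .
  have "push C E (Tm V (Suc n)) w (push C E Z i \<delta>) = push C E Z (w ** i) \<delta>"
    unfolding endsV using push_comp[OF w(1) ty(2) \<delta>] by simp
  also have "\<dots> = \<one>\<^bsub>Ext E (Tm V (Suc n)) A\<^esub>"
    unfolding w(2) endsV by (rule push_zero[OF AO \<delta>])
  finally obtain v' where v': "v' \<in> arr (Tm V (Suc 0)) A" "w = v' ** Df V 0"
    using n_exangleD(7)[OF realises_n_exangle[OF V i\<delta>], of w A] w(1) endsV by auto
  have "v' ** Df W 0 = Idn C A +[A,A] -[A,A] a"
    unfolding W1 wy[symmetric] v'(2) using v'(1) ty z0 by (simp add: cat_simps)
  moreover have "\<phi> (Suc 0) ** q \<in> arr B' (Tm W (Suc 0))" using ty' W1 by (simp add: typing)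
  ultimately show ?thesis
    unfolding splits_inflation_def using \<epsilon> W 1 v'(1) W1(1) by metis
qed


text \<open>(B, b) is isomorphic to (M, I P), where M is the degree 1 term of an exangle starting in
  A. It remains to extend the idempotents a and I P to an idempotent chain map, for which only
  degree 2 needs a further correction.\<close>

lemma inflation_of_splits:
  assumes sp: "splits_inflation A a B f" and oA: "(A, a) \<in> Ob K" and oB: "(B, b) \<in> Ob K"
    and f: "f \<in> arr A B" "f ** a = f" "b ** f = f"
  shows "is_inflation n K F t (A, a) (B, b) (mk b f a)"
proof -
  note a = K_ObD[OF oA] and b = K_ObD[OF oB]
  have AO: "A \<in> Ob C" using arrD(1)[OF a(1)] .
  define c where "c = Idn C A +[A,A] -[A,A] a"
  note c = complement_idempotent[OF a c_def]
  obtain M y i p v where y: "is_inflation n C E s A M y" and ty: "y \<in> arr A M" "i \<in> arr B M" "p \<in> arr M B" "v \<in> arr M A"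
    and r: "p ** i = Idn C B" "p ** y = f" "y ** a = i ** f" "v ** y = c"
    unfolding c_def by (rule splits_inflation_core[OF sp f(1,2) a]) blast
  obtain Z \<delta> X where \<delta>: "\<delta> \<in> ext Z A" and X: "realises n C s Z A \<delta> X" and X1: "Tm X (Suc 0) = M" "Df X 0 = y"
    using inflation_E[OF y] by metis
  note Ch = realises_Ch[OF X] and ends = realises_ends[OF X] and nx = realises_n_exangle[OF X \<delta>]
  have MO: "M \<in> Ob C" using arrD(2)[OF ty(1)] .
  define I where "I = i ** b"
  define P where "P = b ** p"
  have IP: "I \<in> arr B M" "P \<in> arr M B" using ty b by (simp_all add: I_def P_def typing)
  have PI: "P ** I = b" and Ib: "I ** b = I" and bP: "b ** P = P"
    using ty b comp_eq_comp[OF r(1) ty(3,2) intoI[OF b(1)]] comp_eq_comp[OF b(2) b(1,1) intoI[OF ty(3)]]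
    by (simp_all add: I_def P_def cat_simps)
  have Py: "P ** y = f" and If: "I ** f = y ** a"
    using ty b f r by (simp_all add: I_def P_def cat_simps)
  have PIx: "P ** I ** x = b ** x" if "x \<in> into B" for x using comp_eq_comp[OF PI IP(2,1) that] .
  \<comment> \<open>As in the composition of inflations, v is made to vanish on the summand, here on
    I, while its value on y is kept.\<close>
  define w where "w = v +[M,A] -[M,A] (v ** I ** P)"
  define u where "u = c ** w"
  have w: "w \<in> arr M A" and u: "u \<in> arr M A" using ty IP c(1) by (simp_all add: w_def u_def typing)
  have wI: "w ** I = 0[B,A]" unfolding w_def using ty IP b by (simp add: cat_simps PI Ib)
  have wy: "w ** y = c"
  proof -
    have "w ** y = v ** y +[A,A] -[A,A] (v ** y ** a)"
      unfolding w_def using ty IP f by (simp add: cat_simps Py If)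
    also have "\<dots> = c" using ty c(1,5) a comp_eq_comp[OF r(4) ty(4,1) intoI[OF a(1)]] AO
      by (simp add: cat_simps r(4))
    finally show ?thesis .
  qed
  have uI: "u ** I = 0[B,A]" and uy: "u ** y = c"
    using w c(1,3) IP ty arrD(1)[OF IP(1)] by (simp_all add: u_def cat_simps wI wy)
  \<comment> \<open>What remains of M after removing I P and the copy y u of the discarded part (A,
    1 - a). It kills both I and y, hence is idempotent, and it factors through the next
    differential.\<close>
  define k where "k = Idn C M +[M,M] -[M,M] (I ** P +[M,M] y ** u)"
  note ty' = ty IP w u a(1) b(1) f(1) c(1) AO MO Idn_arr[OF MO] Idn_arr[OF AO]
  have k: "k \<in> arr M M" unfolding k_def using ty' by (simp add: typing)
  have yc: "y ** c = y +[A,M] -[A,M] (y ** a)" unfolding c_def using ty' by (simp add: cat_simps)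
  have ky: "k ** y = 0[A,M]" unfolding k_def using ty' by (simp add: cat_ac Py If uy yc)
  have kI: "k ** I = 0[B,M]" unfolding k_def using ty' arrD(1)[OF IP(1)] by (simp add: cat_simps PI Ib uI)
  have "k ** k = k +[M,M] -[M,M] ((k ** I) ** P +[M,M] (k ** y) ** u)"
    using ty' k by (subst (2) k_def) (simp add: cat_simps)
  then have kk: "k ** k = k" unfolding ky kI using ty' k by (simp add: cat_simps)
  let ?d = "Df X (Suc 0)" and ?T = "Tm X (Suc (Suc 0))"
  have d: "?d \<in> arr M ?T" using Ch_arr[OF Ch, of "Suc 0"] n_pos X1 by simp
  have TO: "?T \<in> Ob C" using arrD(2)[OF d] .
  have dy: "?d ** y = 0[A,?T]" using Ch_zero[OF Ch, of 0] n_pos X1 ends by simp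
  obtain q where q: "q \<in> arr ?T M" "k = q ** ?d"
    using cexactE[OF n_exangleD(1)[OF nx], of 0 k M] n_pos k ky X1 ends by auto
  \<comment> \<open>Q transports k along the differential d, that is, Q d = d k. With 1 - Q in
    degree 2 the square between degrees 1 and 2 commutes, because d y = 0.\<close>
  define Q where "Q = ?d ** k ** q"
  have Qt: "Q \<in> arr ?T ?T" unfolding Q_def using d k q(1) by (simp add: typing)
  have Qd: "Q ** ?d = ?d ** k" unfolding Q_def using d k q(1) by (simp add: cat_simps q(2)[symmetric] kk)
  have QQ: "Q ** Q = Q"
  proof -
    have "Q ** Q = (Q ** ?d) ** k ** q" using d k q(1) Qt by (simp add: Q_def cat_simps)
    also have "\<dots> = Q" unfolding Qd using d k q(1) comp_eq_comp[OF kk k k intoI[OF q(1)]] by (simp add: Q_def cat_simps)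
    finally show ?thesis .
  qed
  define e2 where "e2 = Idn C ?T +[?T,?T] -[?T,?T] Q"
  note e2 = complement_idempotent[OF Qt QQ e2_def]
  define e where "e j = (if j = 0 then a else if j = Suc 0 then I ** P else if j = Suc (Suc 0) then e2 else Idn C (Tm X j))" for j
  have IPIP: "(I ** P) ** I ** P = I ** P"
    using IP b comp_eq_comp[OF Ib IP(1) b(1) intoI[OF IP(2)]] by (simp add: cat_simps PIx)
  have idem: "e j ** e j = e j" if "j \<le> Suc n" for j
    using a(2) IPIP e2(3) id_left[OF intoI[OF Idn_arr[OF Ch_Ob[OF Ch that]]]] by (simp add: e_def)
  have dk: "?d ** k = ?d +[M,?T] -[M,?T] (?d ** I ** P)"
    unfolding k_def using ty' d TO comp_eq_comp[OF dy d ty(1) intoI[OF u]] by (simp add: cat_simps)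
  have chain: "chain_map n C X X e"
  proof (rule chain_mapI)
    fix j assume j: "j \<le> Suc n"
    show "e j \<in> arr (Tm X j) (Tm X j)"
      using j a IP e2(1) X1 ends Idn_arr[OF Ch_Ob[OF Ch j]] by (simp add: e_def comp_arr)
  next
    fix j assume j: "j \<le> n"
    consider "j = 0" | "j = 1" | "j = 2" | "j > 2" by linarith
    then show "Df X j ** e j = e (Suc j) ** Df X j"
    proof cases
      case 1
      then show ?thesis using ty' by (simp add: e_def X1 cat_simps Py If)
    next
      case 2
      have "e2 ** ?d = ?d ** I ** P"
        unfolding e2_def using Qt d ty' TO Idn_arr[OF TO] by (simp add: cat_ac Qd dk)
      then show ?thesis using 2 by (simp add: e_def)
    next
      case 3
      let ?d2 = "Df X (Suc (Suc 0))"
      have d2: "?d2 \<in> arr ?T (Tm X (Suc (Suc (Suc 0))))" using Ch_arr[OF Ch, of "Suc (Suc 0)"] j 3 by simp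
      have "?d2 ** ?d = 0[M,Tm X (Suc (Suc (Suc 0)))]" using Ch_zero[OF Ch, of "Suc 0"] j 3 X1 by simp
      from comp_eq_comp[OF this d2 d, of "k ** q"] have "?d2 ** Q = 0[?T,Tm X (Suc (Suc (Suc 0)))]"
        unfolding Q_def using d2 k q(1) arrD(2)[OF d2] by (simp add: typing zero_left[OF comp_arr[OF k q(1)]])
      then have "?d2 ** e2 = ?d2" unfolding e2_def using d2 Qt TO Idn_arr[OF TO] arrD(2)[OF d2] by (simp add: cat_simps)
      then show ?thesis using 3 id_left[OF intoI[OF d2]] by (simp add: e_def numeral_2_eq_2)
    next
      case 4
      then show ?thesis using 4 id_left[OF intoI[OF Ch_arr[OF Ch j]]] id_right[OF Ch_arr[OF Ch j]] by (simp add: e_def)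
    qed
  qed
  have "push C E Z c \<delta> = push C E Z v (push C E Z y \<delta>)"
    unfolding r(4)[symmetric] by (rule push_comp[OF ty(4,1) \<delta>])
  also have "\<dots> = \<one>\<^bsub>Ext E Z A\<^esub>"
    using n_exangleD(3)[OF nx] push_of_zero[OF ty(4) extD(1)[OF \<delta>]] ends X1 by simp
  finally have pa: "push C E Z a \<delta> = \<delta>"
    using push_complement_zero[OF c(2) a(1) c(1) \<delta>] by simp
  \<comment> \<open>For n = 1 the degree 2 term is the end term, so 1 - Q has to fix \<delta>. It
    does, because Q factors through the last differential, which pulls \<delta> back to
    zero.\<close>
  have pz: "pull C E A (e (Suc n)) \<delta> = \<delta>"
  proof (cases "n = 1")
    case True
    then have Z: "?T = Z" using ends by simp
    have "pull C E A Q \<delta> = pull C E A (k ** q) (pull C E A ?d \<delta>)"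
      unfolding Q_def using pull_comp[OF d comp_arr[OF k q(1)], of \<delta> A] \<delta> Z by simp
    also have "\<dots> = \<one>\<^bsub>Ext E Z A\<^esub>"
      using n_exangleD(4)[OF nx] pull_of_zero[OF comp_arr[OF k q(1)] AO] ends X1 True Z by simp
    finally have "pull C E A e2 \<delta> = \<delta>"
      using pull_complement_zero[of Z e2 Q \<delta> A] e2(1,2) Qt \<delta> Z TO by (simp add: add_comm)
    then show ?thesis using True by (simp add: e_def)
  next
    case False
    then show ?thesis using n_pos pull_Idn[OF \<delta>] ends by (simp add: e_def)
  qed
  have oZ: "(Z, e (Suc n)) \<in> Ob K"
    using chain_map_arr[OF chain Ch Ch, of "Suc n"] idem[of "Suc n"] ends by (simp add: K_ObI)
  have "realises n K t (Z, e (Suc n)) (A, a) (mx a \<delta> (e (Suc n))) (pack X e)"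
    by (rule realises_pack[OF X \<delta> chain idem _ refl pa pz]) (simp_all add: e_def)
  moreover have "mx a \<delta> (e (Suc n)) \<in> K.ext (Z, e (Suc n)) (A, a)"
    by (rule mx_ext[OF \<delta> pa pz oZ oA])
  ultimately have infl: "is_inflation n K F t (A, a) (M, I ** P) (mk (I ** P) ((I ** P) ** y ** a) a)"
    unfolding is_inflation_def
    by (intro bexI[of _ "(Z, e (Suc n))"] bexI[of _ "mx a \<delta> (e (Suc n))"] exI[of _ "pack X e"])
      (simp_all add: K.ext_def e_def X1)
  have oM: "(M, I ** P) \<in> Ob K" using IP IPIP by (simp add: K_ObI comp_arr)
  \<comment> \<open>The packed inflation ends in (M, I P); composing it with the isomorphism P to
    (B, b) gives f.\<close>
  have "is_inflation n K F t (A, a) (B, b) (mk b P (I ** P) \<cdot>\<^bsub>K\<^esub> mk (I ** P) ((I ** P) ** y ** a) a)"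
  proof (rule K.inflation_comp_iso[OF n_pos infl])
    show "mk b P (I ** P) \<in> K.arr (M, I ** P) (B, b)"
      using IP bP PIx[OF intoI[OF IP(2)]] by (intro mk_arr oM oB) simp_all
    show "mk (I ** P) I b \<in> K.arr (B, b) (M, I ** P)"
      using IP Ib PI by (intro mk_arr oM oB) (simp_all add: cat_simps)
  qed (simp_all add: mk_comp mk_Idn PI)
  moreover have "P ** (I ** P) ** y ** a = f"
  proof -
    have "P ** y ** a = f" using comp_eq_comp[OF Py IP(2) ty(1) intoI[OF a(1)]] f(2) by simp
    moreover have "P ** (I ** P) ** y ** a = b ** P ** y ** a" using ty' by (simp add: typing comp_assoc PIx)
    ultimately show ?thesis using f(3) by simp
  qed
  ultimately show ?thesis by (simp add: mk_comp)
qed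

lemma K_inflation_comp:
  assumes f: "is_inflation n K F t P Q f" and g: "is_inflation n K F t Q R g"
  shows "is_inflation n K F t P R (g \<cdot>\<^bsub>K\<^esub> f)"
proof -
  obtain A a where P: "P = (A, a)" by (cases P)
  obtain B b where Q: "Q = (B, b)" by (cases Q)
  obtain B' b' where R: "R = (B', b')" by (cases R)
  have arr: "f' \<in> K.arr P' Q'" if infl: "is_inflation n K F t P' Q' f'" for f' P' Q'
  proof -
    obtain Z \<delta> X where "realises n K t Z P' \<delta> X" "Tm X (Suc 0) = Q'" "Df X 0 = f'"
      using infl unfolding is_inflation_def One_nat_def by blast
    then show ?thesis using K.Ch_arr[OF K.realises_Ch, of Z P' \<delta> X 0] K.realises_ends by auto
  qed
  obtain r where r: "f = mk b r a" "r \<in> arr A B" "r ** a = r" "b ** r = r" "(A, a) \<in> Ob K" "(B, b) \<in> Ob K"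
    using arr[OF f] unfolding P Q by (rule K_arrE)
  obtain q where q: "g = mk b' q b" "q \<in> arr B B'" "q ** b = q" "b' ** q = q" "(B', b') \<in> Ob K"
    using arr[OF g] unfolding R Q by (rule K_arrE)
  have 1: "splits_inflation A a B r" and 2: "splits_inflation B b B' q"
    using splits_inflation_of_inflation[OF _ r(5), of B b r] splits_inflation_of_inflation[OF _ r(6), of B' b' q]
      f g P Q R r(1) q(1) by simp_all
  note a = K_ObD[OF r(5)] and b = K_ObD[OF r(6)] and b' = K_ObD[OF q(5)]
  have "splits_inflation A a B' (q ** r)"
    by (rule splits_inflation_comp[OF 1 r(2-4) a 2 q(2) b(1)])
  then have "is_inflation n K F t (A, a) (B', b') (mk b' (q ** r) a)"
    by (rule inflation_of_splits[OF _ r(5) q(5)])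
      (use r q a b b' comp_eq_comp[OF q(4) b'(1) q(2) intoI[OF r(2)]] in \<open>simp_all add: cat_simps\<close>)
  then show ?thesis by (simp add: P R r(1) q(1) mk_comp)
qed


text \<open>As f commutes with the idempotents, \<open>e (Suc i)\<close> and \<open>r i\<close> form
  a diagonal idempotent on the cone. With the ends padded by a zero object,
  \<open>pack_twisted_sum\<close> applies in all degrees at once.\<close>

lemma pack_mapping_cone:
  assumes Ch: "X \<in> Ch n C" "Y \<in> Ch n C" and f: "chain_map n C X Y f" and M: "is_mapping_cone n C X Y f M"
    and e: "chain_map n C X X e" "\<And>i. i \<le> Suc n \<Longrightarrow> e i ** e i = e i"
    and r: "chain_map n C Y Y r" "\<And>i. i \<le> Suc n \<Longrightarrow> r i ** r i = r i"
    and fe: "\<And>i. i \<le> Suc n \<Longrightarrow> f i ** e i = r i ** f i"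
  obtains q where "chain_map n C M M q" "\<And>i. i \<le> Suc n \<Longrightarrow> q i ** q i = q i" "q 0 = e (Suc 0)" "q (Suc n) = r (Suc n)"
    "is_mapping_cone n K (pack X e) (pack Y r) (\<lambda>i. mk (r i) (f i ** e i) (e i)) (pack M q)"
proof -
  obtain Z where Z: "is_zero_object C Z" using ex_zero_object by blast
  note ZO = zero_object_Ob[OF Z]
  obtain i1 i2 p1 p2 where c: "cone_sum n Z X Y f M i1 i2 p1 p2"
    using cone_sum_of_is_mapping_cone[OF Z Ch f M n_pos] by blast
  then have tw: "twisted_sum n (tail_ob n Z X) (head_ob Z Y) (tail_df n Z X) (head_df Z Y) (\<lambda>i. f (Suc i)) M i1 i2 p1 p2"
    and ends: "Tm M 0 = Tm X (Suc 0)" "Tm M (Suc n) = Tm Y (Suc n)" "i1 0 = Idn C (Tm X (Suc 0))" "p1 0 = Idn C (Tm X (Suc 0))"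
      "i2 (Suc n) = Idn C (Tm Y (Suc n))" "p2 (Suc n) = Idn C (Tm Y (Suc n))"
    by (simp_all add: cone_sum_def)
  define a where "a i = (if i \<le> n then e (Suc i) else Idn C Z)" for i
  define b where "b i = (if i = 0 then Idn C Z else r i)" for i
  note T = twisted_sumD[OF tw]
  have a: "a i \<in> arr (tail_ob n Z X i) (tail_ob n Z X i)" "a i ** a i = a i" if "i \<le> Suc n" for i
    using that chain_map_arr[OF e(1) Ch(1,1), of "Suc i"] e(2)[of "Suc i"] ZO Idn_arr[OF ZO] id_left[OF intoI[OF Idn_arr[OF ZO]]]
    by (simp_all add: a_def tail_ob_def)
  have b: "b i \<in> arr (head_ob Z Y i) (head_ob Z Y i)" "b i ** b i = b i" if "i \<le> Suc n" for i
    using that chain_map_arr[OF r(1) Ch(2,2), of i] r(2)[of i] ZO Idn_arr[OF ZO] id_left[OF intoI[OF Idn_arr[OF ZO]]]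
    by (simp_all add: b_def head_ob_def)
  have comm: "tail_df n Z X i ** a i = a (Suc i) ** tail_df n Z X i" if i: "i \<le> n" for i
  proof (cases "i = n")
    case True
    then show ?thesis using chain_map_arr[OF e(1) Ch(1,1), of "Suc n"] Ch_Ob[OF Ch(1), of "Suc n"] ZO
      by (simp add: a_def tail_df_def zero_left id_left[OF intoI[OF zero_arr]])
  next
    case False
    then show ?thesis using i chain_map_comm[OF e(1), of "Suc i"] by (simp add: a_def tail_df_def)
  qed
  have comm': "head_df Z Y i ** b i = b (Suc i) ** head_df Z Y i" if i: "i \<le> n" for i
  proof (cases "i = 0")
    case True
    then show ?thesis using chain_map_arr[OF r(1) Ch(2,2), of "Suc 0"] Ch_Ob[OF Ch(2), of "Suc 0"] ZO
      by (simp add: b_def head_df_def zero_right id_right[OF zero_arr])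
  next
    case False
    then show ?thesis using i chain_map_comm[OF r(1), of i] by (simp add: b_def head_df_def)
  qed
  have comm'': "f (Suc i) ** a i = b (Suc i) ** f (Suc i)" if i: "i \<le> n" for i
    using i fe[of "Suc i"] by (simp add: a_def b_def)
  obtain q where q: "chain_map n C M M q" "\<And>i. i \<le> Suc n \<Longrightarrow> q i ** q i = q i"
    and q_eq: "\<And>i. i \<le> Suc n \<Longrightarrow> q i = i1 i ** a i ** p1 i +[Tm M i,Tm M i] i2 i ** b i ** p2 i"
    and twK: "K.twisted_sum n (\<lambda>i. (tail_ob n Z X i, a i)) (\<lambda>i. (head_ob Z Y i, b i)) (\<lambda>i. mk (a (Suc i)) (tail_df n Z X i ** a i) (a i))
      (\<lambda>i. mk (b (Suc i)) (head_df Z Y i ** b i) (b i)) (\<lambda>i. mk (b (Suc i)) (f (Suc i) ** a i) (a i)) (pack M q)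
      (\<lambda>i. mk (q i) (i1 i ** a i) (a i)) (\<lambda>i. mk (q i) (i2 i ** b i) (b i))
      (\<lambda>i. mk (a i) (a i ** p1 i) (q i)) (\<lambda>i. mk (b i) (b i ** p2 i) (q i))"
    by (rule pack_twisted_sum[OF tw a b comm comm' comm'']) blast+
  have e1: "e (Suc 0) \<in> arr (Tm X (Suc 0)) (Tm X (Suc 0))" and rn: "r (Suc n) \<in> arr (Tm Y (Suc n)) (Tm Y (Suc n))"
    using chain_map_arr[OF e(1) Ch(1,1)] chain_map_arr[OF r(1) Ch(2,2)] by simp_all
  have z0: "i2 0 = 0[Z,Tm X (Suc 0)]" "p1 (Suc n) = 0[Tm Y (Suc n),Z]" "i1 (Suc n) = 0[Z,Tm Y (Suc n)]" "p2 0 = 0[Tm X (Suc 0),Z]"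
    using zero_object_arr[OF Z] T(10-13)[of 0] T(10-13)[of "Suc n"] ends(1,2) by (simp_all add: head_ob_def tail_ob_def)
  have q0: "q 0 = e (Suc 0)"
    unfolding q_eq[OF le0] using e1 ZO arrD(1)[OF e1] by (simp add: ends a_def b_def z0 cat_simps id_right)
  have qn: "q (Suc n) = r (Suc n)"
    unfolding q_eq[OF le_refl] using rn ZO arrD(1)[OF rn] by (simp add: ends a_def b_def z0 cat_simps id_right)
  let ?Z = "(Z, Idn C Z)"
  note ZK = K_zero_object[OF Z]
  \<comment> \<open>Padding and packing commute when the completion is padded with the zero object
    (Z, 1).\<close>
  have obs: "(\<lambda>i. (tail_ob n Z X i, a i)) = K.tail_ob n ?Z (pack X e)" "(\<lambda>i. (head_ob Z Y i, b i)) = K.head_ob ?Z (pack Y r)"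
    by (auto simp: tail_ob_def K.tail_ob_def head_ob_def K.head_ob_def a_def b_def)
  have dfs: "mk (a (Suc i)) (tail_df n Z X i ** a i) (a i) = K.tail_df n ?Z (pack X e) i"
    "mk (b (Suc i)) (head_df Z Y i ** b i) (b i) = K.head_df ?Z (pack Y r) i"
    "mk (b (Suc i)) (f (Suc i) ** a i) (a i) = mk (r (Suc i)) (f (Suc i) ** e (Suc i)) (e (Suc i))" if i: "i \<le> n" for i
  proof -
    show "mk (a (Suc i)) (tail_df n Z X i ** a i) (a i) = K.tail_df n ?Z (pack X e) i"
      using i ZO pack_Df[OF Ch(1) e, of "Suc i"] chain_map_arr[OF e(1) Ch(1,1), of "Suc n"]
      by (auto simp: a_def tail_df_def K.tail_df_def mk_zero zero_left simp del: pack_simps(2))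
    show "mk (b (Suc i)) (head_df Z Y i ** b i) (b i) = K.head_df ?Z (pack Y r) i"
      using i ZO pack_Df[OF Ch(2) r, of i] Ch_Ob[OF Ch(2), of "Suc 0"]
      by (auto simp: b_def head_df_def K.head_df_def mk_zero id_right[OF zero_arr] simp del: pack_simps(2))
    show "mk (b (Suc i)) (f (Suc i) ** a i) (a i) = mk (r (Suc i)) (f (Suc i) ** e (Suc i)) (e (Suc i))"
      using i by (simp add: a_def b_def)
  qed
  have "K.cone_sum n ?Z (pack X e) (pack Y r) (\<lambda>i. mk (r i) (f i ** e i) (e i)) (pack M q)
      (\<lambda>i. mk (q i) (i1 i ** a i) (a i)) (\<lambda>i. mk (q i) (i2 i ** b i) (b i))
      (\<lambda>i. mk (a i) (a i ** p1 i) (q i)) (\<lambda>i. mk (b i) (b i ** p2 i) (q i))"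
    unfolding K.cone_sum_def
  proof (intro conjI)
    show "K.twisted_sum n (K.tail_ob n ?Z (pack X e)) (K.head_ob ?Z (pack Y r)) (K.tail_df n ?Z (pack X e)) (K.head_df ?Z (pack Y r))
      (\<lambda>i. mk (r (Suc i)) (f (Suc i) ** e (Suc i)) (e (Suc i))) (pack M q)
      (\<lambda>i. mk (q i) (i1 i ** a i) (a i)) (\<lambda>i. mk (q i) (i2 i ** b i) (b i))
      (\<lambda>i. mk (a i) (a i ** p1 i) (q i)) (\<lambda>i. mk (b i) (b i ** p2 i) (q i))"
      using twK dfs unfolding obs K.twisted_sum_def by simp
  qed (use id_left[OF intoI[OF e1]] id_right[OF e1] id_left[OF intoI[OF rn]] id_right[OF rn] in \<open>simp_all add: ends q0 qn a_def b_def mk_Idn\<close>)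
  from K.is_mapping_cone_of_cone_sum[OF ZK pack_Ch[OF Ch(1) e] pack_Ch[OF Ch(2) r] pack_chain_map[OF Ch f e r fe] this n_pos]
  have cone: "is_mapping_cone n K (pack X e) (pack Y r) (\<lambda>i. mk (r i) (f i ** e i) (e i)) (pack M q)" .
  show thesis by (rule that[OF q(1) q(2) q0 qn cone])
qed

lemma K_good_lift:
  assumes \<rho>: "\<rho> \<in> K.ext P Q" and g: "g \<in> K.arr P' P"
    and Y: "realises n K t P' Q (pull K F Q g \<rho>) Y" and X: "realises n K t P Q \<rho> X"
  shows "\<exists>f M. is_lift n K Y X (Idn K Q) g f \<and> is_mapping_cone n K Y X f M \<and>
    realises n K t P (Tm Y (Suc 0)) (push K F P (Df Y 0) \<rho>) M"
proof -
  obtain Z z where P: "P = (Z, z)" by (cases P)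
  obtain Z' z' where P': "P' = (Z', z')" by (cases P')
  obtain A a where Q: "Q = (A, a)" by (cases Q)
  obtain c where c: "g = mk z c z'" "c \<in> arr Z' Z" "c ** z' = c" "z ** c = c" "(Z', z') \<in> Ob K" "(Z, z) \<in> Ob K"
    using g unfolding P P' by (rule K_arrE)
  obtain \<delta> where \<delta>: "\<rho> = mx a \<delta> z" "\<delta> \<in> ext Z A" "push C E Z a \<delta> = \<delta>" "pull C E A z \<delta> = \<delta>" "(A, a) \<in> Ob K"
    using \<rho> unfolding P Q by (rule K_extE)
  note z = K_ObD[OF c(6)] and z' = K_ObD[OF c(5)] and a = K_ObD[OF \<delta>(5)]
  define \<sigma> where "\<sigma> = pull C E A c \<delta>"
  have \<sigma>: "\<sigma> \<in> ext Z' A" unfolding \<sigma>_def by (rule pull_ext[OF c(2) \<delta>(2)])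
  have \<sigma>a: "push C E Z' a \<sigma> = \<sigma>"
    unfolding \<sigma>_def push_pull(1)[OF c(2) a(1) \<delta>(2)] using push_pull(2)[OF c(2) a(1) \<delta>(2)] \<delta>(3) by simp
  have \<sigma>z: "pull C E A z' \<sigma> = \<sigma>"
    unfolding \<sigma>_def using pull_comp[OF c(2) z'(1) \<delta>(2)] c(3) by simp
  have "Act E c a \<delta> = \<sigma>" unfolding \<sigma>_def using push_pull(2)[OF c(2) a(1) \<delta>(2)] \<delta>(3) by simp
  then have pull_\<rho>: "pull K F Q g \<rho> = mx a \<sigma> z'" by (simp add: pull_def Q mk_Idn c(1) \<delta>(1) mx_Act)
  obtain V where V: "realises n C s Z' A \<sigma> V" by (rule realises_exists[OF \<sigma>])
  obtain W where W: "realises n C s Z A \<delta> W" by (rule realises_exists[OF \<delta>(2)])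
  note ChV = realises_Ch[OF V] and ChW = realises_Ch[OF W] and endsV = realises_ends[OF V] and endsW = realises_ends[OF W]
  obtain e where e: "chain_map n C V V e" "\<And>i. i \<le> Suc n \<Longrightarrow> e i ** e i = e i" "e 0 = a" "e (Suc n) = z'"
    and eV: "realises n K t (Z', z') (A, a) (mx a \<sigma> z') (pack V e)"
    by (rule realises_packE[OF \<sigma> \<sigma>a \<sigma>z c(5) \<delta>(5) V]) blast
  obtain r where r: "chain_map n C W W r" "\<And>i. i \<le> Suc n \<Longrightarrow> r i ** r i = r i" "r 0 = a" "r (Suc n) = z"
    and rW: "realises n K t (Z, z) (A, a) (mx a \<delta> z) (pack W r)"
    by (rule realises_packE[OF \<delta>(2-4) c(6) \<delta>(5) W]) blast
  obtain h N where hN: "is_lift n C V W (Idn C A) c h" "is_mapping_cone n C V W h N"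
    "realises n C s Z (Tm V (Suc 0)) (push C E Z (Df V 0) \<delta>) N"
    using good_lift[OF \<delta>(2) c(2) V[unfolded \<sigma>_def] W] by blast
  obtain f M where f: "is_lift n C V W (Idn C A) c f" and M: "is_mapping_cone n C V W f M"
    and M_real: "realises n C s Z (Tm V (Suc 0)) (push C E Z (Df V 0) \<delta>) M" and fe: "\<And>i. i \<le> Suc n \<Longrightarrow> f i ** e i = r i ** f i"
    using commuting_lift[OF n_pos \<delta>(2) c(2) V[unfolded \<sigma>_def] W hN e r c(3,4) \<delta>(4)] by blast
  have fc: "chain_map n C V W f" "f 0 = Idn C A" "f (Suc n) = c" using f by (simp_all add: is_lift_def)
  obtain q where q: "chain_map n C M M q" "\<And>i. i \<le> Suc n \<Longrightarrow> q i ** q i = q i" "q 0 = e (Suc 0)" "q (Suc n) = r (Suc n)"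
    and cone: "is_mapping_cone n K (pack V e) (pack W r) (\<lambda>i. mk (r i) (f i ** e i) (e i)) (pack M q)"
    by (rule pack_mapping_cone[OF ChV ChW fc(1) M e(1,2) r(1,2) fe]) blast+
  have v0: "Df V 0 \<in> arr A (Tm V (Suc 0))" "e (Suc 0) \<in> arr (Tm V (Suc 0)) (Tm V (Suc 0))"
    using Ch_arr[OF ChV, of 0] endsV chain_map_arr[OF e(1) ChV ChV] by simp_all
  have v1: "e (Suc 0) ** Df V 0 = Df V 0 ** a" using chain_map_comm[OF e(1), of 0] e(3) by simp
  \<comment> \<open>The pushed extension must be fixed by the idempotents at the two ends of the
    cone before the packed cone can realise it.\<close>
  have pe: "push C E Z (e (Suc 0)) (push C E Z (Df V 0) \<delta>) = push C E Z (Df V 0) \<delta>"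
    using push_comp[OF v0(2,1) \<delta>(2)] push_comp[OF v0(1) a(1) \<delta>(2)] \<delta>(3) v1 by simp
  have pz: "pull C E (Tm V (Suc 0)) z (push C E Z (Df V 0) \<delta>) = push C E Z (Df V 0) \<delta>"
    unfolding push_pull(2)[OF z(1) v0(1) \<delta>(2)] using push_pull(1)[OF z(1) v0(1) \<delta>(2)] \<delta>(4) by simp
  have real: "realises n K t (Z, z) (Tm V (Suc 0), e (Suc 0)) (mx (e (Suc 0)) (push C E Z (Df V 0) \<delta>) z) (pack M q)"
    by (rule realises_pack[OF M_real push_ext[OF v0(1) \<delta>(2)] q(1,2) q(3) _ pe pz]) (simp_all add: q(4) r(4))
  have "Act E z (e (Suc 0) ** Df V 0 ** a) \<delta> = push C E Z (Df V 0) \<delta>"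
  proof -
    have "e (Suc 0) ** Df V 0 ** a = Df V 0 ** a"
      using cut_eq[OF v1[symmetric] e(2)[of "Suc 0"] v0] n_pos by simp
    then have "Act E z (e (Suc 0) ** Df V 0 ** a) \<delta> = push C E Z (Df V 0 ** a) (pull C E A z \<delta>)"
      using push_pull(1)[OF z(1) comp_arr[OF v0(1) a(1)] \<delta>(2)] by simp
    then show ?thesis using push_comp[OF v0(1) a(1) \<delta>(2)] \<delta>(3,4) by simp
  qed
  then have push_\<rho>: "push K F P (Df (pack V e) 0) \<rho> = mx (e (Suc 0)) (push C E Z (Df V 0) \<delta>) z"
    by (simp add: push_def P mk_Idn \<delta>(1) e(3) mx_Act)
  have lift: "is_lift n K (pack V e) (pack W r) (Idn K Q) g (\<lambda>i. mk (r i) (f i ** e i) (e i))"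
    using pack_chain_map[OF ChV ChW fc(1) e(1,2) r(1,2) fe] fc(2,3) e(3,4) r(3,4) c(1,3) id_left[OF intoI[OF a(1)]]
    by (simp add: is_lift_def Q mk_Idn)
  have eV': "realises n K t P' Q (pull K F Q g \<rho>) (pack V e)" unfolding pull_\<rho> unfolding P' Q by (rule eV)
  have rW': "realises n K t P Q \<rho> (pack W r)" unfolding \<delta>(1) unfolding P Q by (rule rW)
  have real': "realises n K t P (Tm (pack V e) (Suc 0)) (push K F P (Df (pack V e) 0) \<rho>) (pack M q)"
    unfolding push_\<rho> unfolding P using real by simp
  show ?thesis
    by (rule K.EA2_transport[OF n_pos \<rho> g eV' Y rW' X lift cone real'])
qed

end

section \<open>The idempotent completion\<close>

text \<open>The Hom groups and the extension groups of the completion both arise in this way: a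
  subgroup of elements fixed by idempotents, with each element tagged by them.\<close>

lemma comm_group_relabel:
  assumes G: "comm_group G" and S: "subgroup S G"
  shows "comm_group \<lparr>carrier = {(a, x, b) |x. x \<in> S}, mult = (\<lambda>(_, x, _) (_, y, _). (a, x \<otimes>\<^bsub>G\<^esub> y, b)), one = (a, \<one>\<^bsub>G\<^esub>, b)\<rparr>"
proof -
  interpret G: comm_group G by (rule G)
  interpret S: subgroup S G by (rule S)
  show ?thesis
  proof (rule comm_groupI)
    fix x assume "x \<in> carrier \<lparr>carrier = {(a, x, b) |x. x \<in> S}, mult = (\<lambda>(_, x, _) (_, y, _). (a, x \<otimes>\<^bsub>G\<^esub> y, b)), one = (a, \<one>\<^bsub>G\<^esub>, b)\<rparr>"
    then obtain y where y: "x = (a, y, b)" "y \<in> S" by auto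
    then show "\<exists>z\<in>carrier \<lparr>carrier = {(a, x, b) |x. x \<in> S}, mult = (\<lambda>(_, x, _) (_, y, _). (a, x \<otimes>\<^bsub>G\<^esub> y, b)), one = (a, \<one>\<^bsub>G\<^esub>, b)\<rparr>.
        z \<otimes>\<^bsub>\<lparr>carrier = {(a, x, b) |x. x \<in> S}, mult = (\<lambda>(_, x, _) (_, y, _). (a, x \<otimes>\<^bsub>G\<^esub> y, b)), one = (a, \<one>\<^bsub>G\<^esub>, b)\<rparr>\<^esub> x =
        \<one>\<^bsub>\<lparr>carrier = {(a, x, b) |x. x \<in> S}, mult = (\<lambda>(_, x, _) (_, y, _). (a, x \<otimes>\<^bsub>G\<^esub> y, b)), one = (a, \<one>\<^bsub>G\<^esub>, b)\<rparr>\<^esub>"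
      by (intro bexI[of _ "(a, inv\<^bsub>G\<^esub> y, b)"]) (auto simp: G.l_inv S.mem_carrier)
  qed (auto simp: G.m_ac S.mem_carrier)
qed

section \<open>The completion as an additive category\<close>

context additive_category begin

lemma icompl_Ob: "(X, e) \<in> Ob (icompl C) \<longleftrightarrow> e \<in> arr X X \<and> e ** e = e"
  by (auto simp: icompl_def arr_def)

lemma icompl_Hom:
  assumes "(X, e) \<in> Ob (icompl C)" "(Y, e') \<in> Ob (icompl C)"
  shows "carrier (Hom (icompl C) (X, e) (Y, e')) = {(e', r, e) |r. r \<in> arr X Y \<and> r ** e = r \<and> e' ** r = r}"
  using assms by (auto simp: icompl_def arr_def)

lemma icompl_simps [simp]:
  "mult (Hom (icompl C) (X, e) (Y, e')) (a, r, b) (c, r', d) = (e', r +[X,Y] r', e)"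
  "\<one>\<^bsub>Hom (icompl C) (X, e) (Y, e')\<^esub> = (e', 0[X,Y], e)"
  "Idn (icompl C) (X, e) = (e, e, e)"
  "(e'', q, a) \<cdot>\<^bsub>icompl C\<^esub> (b, r, e) = (e'', q ** r, e)"
  by (simp_all add: icompl_def)

lemma icompl_Hom_comm_group:
  assumes e: "(X, e) \<in> Ob (icompl C)" and e': "(Y, e') \<in> Ob (icompl C)"
  shows "comm_group (Hom (icompl C) (X, e) (Y, e'))"
proof -
  let ?S = "{r \<in> arr X Y. r ** e = r \<and> e' ** r = r}"
  have ty: "e \<in> arr X X" "e' \<in> arr Y Y" "X \<in> Ob C" "Y \<in> Ob C" using e e' by (simp_all add: icompl_Ob arr_def)
  have G: "comm_group (H X Y)" using ty by (simp add: Hom_comm_group)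
  have "subgroup ?S (H X Y)"
  proof (rule group.subgroupI[OF comm_group.axioms(2)[OF G]])
    show "?S \<subseteq> carrier (H X Y)" by (auto simp: arr_def)
    have "0[X,Y] \<in> ?S" using ty by (simp add: cat_simps)
    then show "?S \<noteq> {}" by blast
    show "r +[X,Y] r' \<in> ?S" if "r \<in> ?S" "r' \<in> ?S" for r r'
      using that ty by (simp add: cat_simps)
    show "-[X,Y] r \<in> ?S" if "r \<in> ?S" for r
      using that ty by (simp add: cat_simps)
  qed
  from comm_group_relabel[OF G this, of e' e]
  show ?thesis using ty by (simp add: icompl_def arr_def conj_commute)
qed

lemma icompl_zero_object:
  assumes Z: "is_zero_object C Z"
  shows "is_zero_object (icompl C) (Z, Idn C Z)"
proof -
  note ZO = zero_object_Ob[OF Z]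
  have oZ: "(Z, Idn C Z) \<in> Ob (icompl C)" using ZO by (simp add: icompl_Ob Idn_arr id_left[OF intoI[OF Idn_arr]])
  have "(\<exists>!f. f \<in> carrier (Hom (icompl C) (A, a) (Z, Idn C Z))) \<and> (\<exists>!f. f \<in> carrier (Hom (icompl C) (Z, Idn C Z) (A, a)))"
    if A: "(A, a) \<in> Ob (icompl C)" for A a
  proof -
    have ty: "a \<in> arr A A" "A \<in> Ob C" using A by (simp_all add: icompl_Ob arr_def)
    have "f = (Idn C Z, 0[A,Z], a)" if "f \<in> carrier (Hom (icompl C) (A, a) (Z, Idn C Z))" for f
      using that zero_object_arr(2)[OF Z] unfolding icompl_Hom[OF A oZ] by blast
    moreover have "f = (a, 0[Z,A], Idn C Z)" if "f \<in> carrier (Hom (icompl C) (Z, Idn C Z) (A, a))" for f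
      using that zero_object_arr(1)[OF Z] unfolding icompl_Hom[OF oZ A] by blast
    moreover have "(Idn C Z, 0[A,Z], a) \<in> carrier (Hom (icompl C) (A, a) (Z, Idn C Z))" "(a, 0[Z,A], Idn C Z) \<in> carrier (Hom (icompl C) (Z, Idn C Z) (A, a))"
      unfolding icompl_Hom[OF oZ A] icompl_Hom[OF A oZ] using ty ZO Idn_arr[OF ZO] by (simp_all add: cat_simps)
    ultimately show ?thesis by blast
  qed
  then show ?thesis unfolding is_zero_object_def using oZ by (metis prod.exhaust)
qed

text \<open>The direct sum carries the diagonal idempotent q, and injections and projections are cut
  by a and b.\<close>

lemma icompl_biproduct:
  assumes A: "(A, a) \<in> Ob (icompl C)" and B: "(B, b) \<in> Ob (icompl C)" and P: "is_biproduct C A B P i1 i2 p1 p2"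
  defines "q \<equiv> i1 ** a ** p1 +[P,P] i2 ** b ** p2"
  shows "is_biproduct (icompl C) (A, a) (B, b) (P, q) (q, i1 ** a, a) (q, i2 ** b, b) (a, a ** p1, q) (b, b ** p2, q)"
proof -
  have ty: "a \<in> arr A A" "b \<in> arr B B" "A \<in> Ob C" "B \<in> Ob C" "a ** a = a" "b ** b = b" using A B by (simp_all add: icompl_Ob arr_def)
  note bp = biproductD[OF P ty(3,4)] and bc = biproduct_comp[OF P ty(3,4)]
  note aa = comp_eq_comp[OF ty(5) ty(1) ty(1)] and bb = comp_eq_comp[OF ty(6) ty(2) ty(2)]
  note t = bp(1-4) ty
  note zz = zero_left[OF ty(1)] zero_left[OF ty(2)] zero_left[OF comp_arr[OF ty(1) bp(3)]] zero_left[OF comp_arr[OF ty(2) bp(4)]]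
  have PO: "P \<in> Ob C" using arrD(2)[OF bp(1)] .
  have q: "q \<in> arr P P" unfolding q_def using t by (simp add: cat_simps)
  have qi: "q ** i1 ** a = i1 ** a" "q ** i2 ** b = i2 ** b" "(a ** p1) ** q = a ** p1" "(b ** p2) ** q = b ** p2"
    unfolding q_def using t PO by (simp_all add: cat_simps bc aa bb zz)
  have "q ** q = (q ** i1 ** a) ** p1 +[P,P] (q ** i2 ** b) ** p2"
    using t q by (subst (2) q_def) (simp add: cat_simps)
  then have qq: "q ** q = q" unfolding qi using t by (simp add: q_def cat_simps)
  have oP: "(P, q) \<in> Ob (icompl C)" using q qq by (simp add: icompl_Ob)
  have "(i1 ** a) ** a ** p1 +[P,P] (i2 ** b) ** b ** p2 = q"
    "(a ** p1) ** i1 ** a = a" "(b ** p2) ** i2 ** b = b" "(a ** p1) ** i2 ** b = 0[B,A]" "(b ** p2) ** i1 ** a = 0[A,B]"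
    using t by (simp_all add: q_def cat_simps bc aa bb zz)
  moreover have "i1 ** a \<in> arr A P" "i2 ** b \<in> arr B P" "a ** p1 \<in> arr P A" "b ** p2 \<in> arr P B"
    "(i1 ** a) ** a = i1 ** a" "(i2 ** b) ** b = i2 ** b" "a ** a ** p1 = a ** p1" "b ** b ** p2 = b ** p2"
    using t by (simp_all add: cat_simps aa bb)
  ultimately show ?thesis
    unfolding is_biproduct_def using oP qi by (simp add: icompl_Hom[OF A oP] icompl_Hom[OF B oP] icompl_Hom[OF oP A] icompl_Hom[OF oP B])
qed

lemma icompl_additive: "additive_category (icompl C)"
proof (rule additive_category.intro)
  fix P Q assume "P \<in> Ob (icompl C)" "Q \<in> Ob (icompl C)"
  then show "comm_group (Hom (icompl C) P Q)" by (cases P, cases Q) (simp add: icompl_Hom_comm_group)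
next
  show "\<exists>Z. is_zero_object (icompl C) Z" using ex_zero_object icompl_zero_object by blast
next
  fix P Q assume PQ: "P \<in> Ob (icompl C)" "Q \<in> Ob (icompl C)"
  obtain A a B b where e: "P = (A, a)" "Q = (B, b)" by (cases P, cases Q)
  have "A \<in> Ob C" "B \<in> Ob C" using PQ by (simp_all add: e icompl_Ob arr_def)
  then obtain R i1 i2 p1 p2 where "is_biproduct C A B R i1 i2 p1 p2" using ex_biproduct by blast
  from icompl_biproduct[OF PQ[unfolded e] this]
  show "\<exists>R i1 i2 p1 p2. is_biproduct (icompl C) P Q R i1 i2 p1 p2" unfolding e by blast
next
  fix P assume "P \<in> Ob (icompl C)"
  then show "Idn (icompl C) P \<in> carrier (Hom (icompl C) P P)"
    by (cases P) (simp add: icompl_Hom icompl_Ob)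
next
  fix P Q R f g assume o: "P \<in> Ob (icompl C)" "Q \<in> Ob (icompl C)" "R \<in> Ob (icompl C)"
    and fg: "f \<in> carrier (Hom (icompl C) P Q)" "g \<in> carrier (Hom (icompl C) Q R)"
  obtain A a B b D d where e: "P = (A, a)" "Q = (B, b)" "R = (D, d)" by (cases P, cases Q, cases R)
  note o = o[unfolded e]
  show "g \<cdot>\<^bsub>icompl C\<^esub> f \<in> carrier (Hom (icompl C) P R)"
    using fg unfolding e icompl_Hom[OF o(1,2)] icompl_Hom[OF o(2,3)] icompl_Hom[OF o(1,3)]
    using o unfolding icompl_Ob by (auto simp: cat_simps) (metis comp_assoc_arr)+
next
  fix P Q f assume o: "P \<in> Ob (icompl C)" "Q \<in> Ob (icompl C)" and f: "f \<in> carrier (Hom (icompl C) P Q)"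
  obtain A a B b where e: "P = (A, a)" "Q = (B, b)" by (cases P, cases Q)
  show "Idn (icompl C) Q \<cdot>\<^bsub>icompl C\<^esub> f = f" "f \<cdot>\<^bsub>icompl C\<^esub> Idn (icompl C) P = f"
    using f unfolding e icompl_Hom[OF o[unfolded e]] by auto
next
  fix P Q R S f g h assume o: "P \<in> Ob (icompl C)" "Q \<in> Ob (icompl C)" "R \<in> Ob (icompl C)" "S \<in> Ob (icompl C)"
    and fgh: "f \<in> carrier (Hom (icompl C) P Q)" "g \<in> carrier (Hom (icompl C) Q R)" "h \<in> carrier (Hom (icompl C) R S)"
  obtain A a B b D d F x where e: "P = (A, a)" "Q = (B, b)" "R = (D, d)" "S = (F, x)" by (cases P, cases Q, cases R, cases S)
  note o = o[unfolded e]
  show "(h \<cdot>\<^bsub>icompl C\<^esub> g) \<cdot>\<^bsub>icompl C\<^esub> f = h \<cdot>\<^bsub>icompl C\<^esub> (g \<cdot>\<^bsub>icompl C\<^esub> f)"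
    using fgh unfolding e icompl_Hom[OF o(1,2)] icompl_Hom[OF o(2,3)] icompl_Hom[OF o(3,4)]
    by (auto simp: comp_assoc_arr)
next
  fix P Q R f g g' assume o: "P \<in> Ob (icompl C)" "Q \<in> Ob (icompl C)" "R \<in> Ob (icompl C)"
    and fg: "f \<in> carrier (Hom (icompl C) P Q)" "g \<in> carrier (Hom (icompl C) Q R)" "g' \<in> carrier (Hom (icompl C) Q R)"
  obtain A a B b D d where e: "P = (A, a)" "Q = (B, b)" "R = (D, d)" by (cases P, cases Q, cases R)
  note o = o[unfolded e]
  show "(g \<otimes>\<^bsub>Hom (icompl C) Q R\<^esub> g') \<cdot>\<^bsub>icompl C\<^esub> f = (g \<cdot>\<^bsub>icompl C\<^esub> f) \<otimes>\<^bsub>Hom (icompl C) P R\<^esub> (g' \<cdot>\<^bsub>icompl C\<^esub> f)"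
    using fg unfolding e icompl_Hom[OF o(1,2)] icompl_Hom[OF o(2,3)] by (auto simp: distrib_right)
next
  fix P Q R f f' g assume o: "P \<in> Ob (icompl C)" "Q \<in> Ob (icompl C)" "R \<in> Ob (icompl C)"
    and fg: "f \<in> carrier (Hom (icompl C) P Q)" "f' \<in> carrier (Hom (icompl C) P Q)" "g \<in> carrier (Hom (icompl C) Q R)"
  obtain A a B b D d where e: "P = (A, a)" "Q = (B, b)" "R = (D, d)" by (cases P, cases Q, cases R)
  note o = o[unfolded e]
  show "g \<cdot>\<^bsub>icompl C\<^esub> (f \<otimes>\<^bsub>Hom (icompl C) P Q\<^esub> f') = (g \<cdot>\<^bsub>icompl C\<^esub> f) \<otimes>\<^bsub>Hom (icompl C) P R\<^esub> (g \<cdot>\<^bsub>icompl C\<^esub> f')"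
    using fg unfolding e icompl_Hom[OF o(1,2)] icompl_Hom[OF o(2,3)] by (auto simp: distrib_left)
qed

end

section \<open>The biadditive functor on the completion\<close>

context biadditive_functor begin

lemma icompl_Ext:
  assumes "(Z, z) \<in> Ob (icompl C)" "(A, a) \<in> Ob (icompl C)"
  shows "carrier (Ext (icompl_ext C E) (Z, z) (A, a)) = {(a, \<delta>, z) |\<delta>. \<delta> \<in> ext Z A \<and> push C E Z a \<delta> = \<delta> \<and> pull C E A z \<delta> = \<delta>}"
  using assms by (auto simp: icompl_ext_def ext_def icompl_Ob arr_def)

lemma icompl_ext_simps [simp]:
  "mult (Ext (icompl_ext C E) (Z, z) (A, a)) (u, \<delta>, v) (u', \<rho>, v') = (a, \<delta> \<otimes>\<^bsub>Ext E Z A\<^esub> \<rho>, z)"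
  "\<one>\<^bsub>Ext (icompl_ext C E) (Z, z) (A, a)\<^esub> = (a, \<one>\<^bsub>Ext E Z A\<^esub>, z)"
  "Act (icompl_ext C E) (u, c, z) (a, b, v) (w, \<delta>, x) = (a, Act E c b \<delta>, z)"
  by (simp_all add: icompl_ext_def)

lemma Act_mult:
  "c \<in> arr D' D \<Longrightarrow> a \<in> arr A A' \<Longrightarrow> \<delta> \<in> ext D A \<Longrightarrow> \<rho> \<in> ext D A \<Longrightarrow>
    Act E c a (\<delta> \<otimes>\<^bsub>Ext E D A\<^esub> \<rho>) = Act E c a \<delta> \<otimes>\<^bsub>Ext E D' A'\<^esub> Act E c a \<rho>"
  using Act_hom[of D D' A A' c a] by (auto simp: arr_def ext_def hom_def)

lemma icompl_Ext_comm_group: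
  assumes z: "(Z, z) \<in> Ob (icompl C)" and a: "(A, a) \<in> Ob (icompl C)"
  shows "comm_group (Ext (icompl_ext C E) (Z, z) (A, a))"
proof -
  have ty: "z \<in> arr Z Z" "a \<in> arr A A" "Z \<in> Ob C" "A \<in> Ob C" using z a by (simp_all add: icompl_Ob arr_def)
  let ?S = "{\<delta> \<in> carrier (Ext E Z A). push C E Z a \<delta> = \<delta> \<and> pull C E A z \<delta> = \<delta>}"
  have G: "comm_group (Ext E Z A)" using ty by (simp add: Ext_comm_group)
  note g = comm_group.axioms(2)[OF G]
  have hom: "Act E (Idn C Z) a \<in> hom (Ext E Z A) (Ext E Z A)" "Act E z (Idn C A) \<in> hom (Ext E Z A) (Ext E Z A)"
    using ty Idn_arr[of Z] Idn_arr[of A] by (auto intro!: Act_hom simp: arr_def)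
  note gh = group_hom.intro[OF g g group_hom_axioms.intro[OF hom(1)]] group_hom.intro[OF g g group_hom_axioms.intro[OF hom(2)]]
  have "subgroup ?S (Ext E Z A)"
  proof (rule group.subgroupI[OF g])
    show "?S \<subseteq> carrier (Ext E Z A)" by blast
    have "\<one>\<^bsub>Ext E Z A\<^esub> \<in> ?S"
      using zero_ext[OF ty(3,4)] push_of_zero[OF ty(2,3)] pull_of_zero[OF ty(1,4)] by (simp add: ext_def)
    then show "?S \<noteq> {}" by blast
    show "inv\<^bsub>Ext E Z A\<^esub> \<delta> \<in> ?S" if "\<delta> \<in> ?S" for \<delta>
      using that group_hom.hom_inv[OF gh(1), of \<delta>] group_hom.hom_inv[OF gh(2), of \<delta>] group.inv_closed[OF g]
      by (simp add: push_def pull_def)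
    show "\<delta> \<otimes>\<^bsub>Ext E Z A\<^esub> \<rho> \<in> ?S" if "\<delta> \<in> ?S" "\<rho> \<in> ?S" for \<delta> \<rho>
      using that hom_mult[OF hom(1), of \<delta> \<rho>] hom_mult[OF hom(2), of \<delta> \<rho>] monoid.m_closed[OF group.is_monoid[OF g]]
      by (simp add: push_def pull_def)
  qed
  from comm_group_relabel[OF G this, of a z]
  show ?thesis by (simp add: icompl_ext_def)
qed

lemma icompl_Act_ext:
  assumes c: "c \<in> arr D' D" "c ** d' = c" and a: "a \<in> arr A A'" "x' ** a = a" and \<delta>: "\<delta> \<in> ext D A" and x: "d' \<in> arr D' D'" "x' \<in> arr A' A'"
  shows "Act E c a \<delta> \<in> ext D' A'" "push C E D' x' (Act E c a \<delta>) = Act E c a \<delta>" "pull C E A' d' (Act E c a \<delta>) = Act E c a \<delta>"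
proof -
  have I: "Idn C D' \<in> arr D' D'" "Idn C A' \<in> arr A' A'" using x by (auto intro: Idn_arr arrD)
  show "Act E c a \<delta> \<in> ext D' A'" using c(1) a(1) \<delta> by (rule Act_ext)
  show "push C E D' x' (Act E c a \<delta>) = Act E c a \<delta>"
    unfolding push_def using Act_Act[OF c(1) I(1) a(1) x(2) \<delta>] a c by (simp add: id_right)
  show "pull C E A' d' (Act E c a \<delta>) = Act E c a \<delta>"
    unfolding pull_def using Act_Act[OF c(1) x(1) a(1) I(2) \<delta>] a c by (simp add: id_left[OF intoI])
qed

lemma icompl_biadditive: "biadditive_functor (icompl C) (icompl_ext C E)"
proof (intro biadditive_functor.intro biadditive_functor_axioms.intro icompl_additive)
  fix P Q assume PQ: "P \<in> Ob (icompl C)" "Q \<in> Ob (icompl C)"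
  then show "comm_group (Ext (icompl_ext C E) P Q)"
    by (cases P, cases Q) (simp add: icompl_Ext_comm_group)
  fix \<delta> assume \<delta>: "\<delta> \<in> carrier (Ext (icompl_ext C E) P Q)"
  obtain A a B b where e: "P = (A, a)" "Q = (B, b)" by (cases P, cases Q)
  have ty: "a \<in> arr A A" "b \<in> arr B B" using PQ by (simp_all add: e icompl_Ob)
  show "Act (icompl_ext C E) (Idn (icompl C) P) (Idn (icompl C) Q) \<delta> = \<delta>"
    using \<delta> push_pull(1)[OF ty, symmetric] unfolding e icompl_Ext[OF PQ[unfolded e]] by auto
next
  fix P P' Q Q' c a assume o: "P \<in> Ob (icompl C)" "P' \<in> Ob (icompl C)" "Q \<in> Ob (icompl C)" "Q' \<in> Ob (icompl C)"
    and c: "c \<in> carrier (Hom (icompl C) P' P)" and a: "a \<in> carrier (Hom (icompl C) Q Q')"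
  obtain D d D' d' A x A' x' where e: "P = (D, d)" "P' = (D', d')" "Q = (A, x)" "Q' = (A', x')" by (cases P, cases P', cases Q, cases Q')
  note o = o[unfolded e]
  obtain r where r: "c = (d, r, d')" "r \<in> arr D' D" "r ** d' = r" using c unfolding e icompl_Hom[OF o(2,1)] by blast
  obtain q where q: "a = (x', q, x)" "q \<in> arr A A'" "x' ** q = q" using a unfolding e icompl_Hom[OF o(3,4)] by blast
  have ty: "d' \<in> arr D' D'" "x' \<in> arr A' A'" using o by (simp_all add: icompl_Ob)
  show "Act (icompl_ext C E) c a \<in> hom (Ext (icompl_ext C E) P Q) (Ext (icompl_ext C E) P' Q')"
    unfolding e r(1) q(1) hom_def icompl_Ext[OF o(1,3)] icompl_Ext[OF o(2,4)]
    using icompl_Act_ext[OF r(2,3) q(2,3) _ ty] Act_mult[OF r(2) q(2)] by auto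
  {
    fix c' \<delta> assume c': "c' \<in> carrier (Hom (icompl C) P' P)" and \<delta>: "\<delta> \<in> carrier (Ext (icompl_ext C E) P Q)"
    obtain r' where r': "c' = (d, r', d')" "r' \<in> arr D' D" using c' unfolding e icompl_Hom[OF o(2,1)] by blast
    show "Act (icompl_ext C E) (c \<otimes>\<^bsub>Hom (icompl C) P' P\<^esub> c') a \<delta> =
        Act (icompl_ext C E) c a \<delta> \<otimes>\<^bsub>Ext (icompl_ext C E) P' Q'\<^esub> Act (icompl_ext C E) c' a \<delta>"
      using \<delta> Act_add_left[of D D' A A' r r' q] r(2) r'(2) q(2) unfolding e r(1) r'(1) q(1) icompl_Ext[OF o(1,3)] by (auto simp: arr_def ext_def)
  next
    fix a' \<delta> assume a': "a' \<in> carrier (Hom (icompl C) Q Q')" and \<delta>: "\<delta> \<in> carrier (Ext (icompl_ext C E) P Q)"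
    obtain q' where q': "a' = (x', q', x)" "q' \<in> arr A A'" using a' unfolding e icompl_Hom[OF o(3,4)] by blast
    show "Act (icompl_ext C E) c (a \<otimes>\<^bsub>Hom (icompl C) Q Q'\<^esub> a') \<delta> =
        Act (icompl_ext C E) c a \<delta> \<otimes>\<^bsub>Ext (icompl_ext C E) P' Q'\<^esub> Act (icompl_ext C E) c a' \<delta>"
      using \<delta> Act_add_right[of D D' A A' r q q'] r(2) q'(2) q(2) unfolding e r(1) q'(1) q(1) icompl_Ext[OF o(1,3)] by (auto simp: arr_def ext_def)
  }
next
  fix P P' P'' Q Q' Q'' c c' a a' \<delta>
  assume o: "P \<in> Ob (icompl C)" "P' \<in> Ob (icompl C)" "P'' \<in> Ob (icompl C)" "Q \<in> Ob (icompl C)" "Q' \<in> Ob (icompl C)" "Q'' \<in> Ob (icompl C)"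
    and c: "c \<in> carrier (Hom (icompl C) P' P)" "c' \<in> carrier (Hom (icompl C) P'' P')"
    and a: "a \<in> carrier (Hom (icompl C) Q Q')" "a' \<in> carrier (Hom (icompl C) Q' Q'')" and \<delta>: "\<delta> \<in> carrier (Ext (icompl_ext C E) P Q)"
  obtain D d D' d' D'' d'' where e: "P = (D, d)" "P' = (D', d')" "P'' = (D'', d'')" by (cases P, cases P', cases P'')
  obtain A x A' x' A'' x'' where e': "Q = (A, x)" "Q' = (A', x')" "Q'' = (A'', x'')" by (cases Q, cases Q', cases Q'')
  note o = o[unfolded e e']
  show "Act (icompl_ext C E) (c \<cdot>\<^bsub>icompl C\<^esub> c') (a' \<cdot>\<^bsub>icompl C\<^esub> a) \<delta> = Act (icompl_ext C E) c' a' (Act (icompl_ext C E) c a \<delta>)"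
    using c a \<delta> unfolding e e' icompl_Hom[OF o(2,1)] icompl_Hom[OF o(3,2)] icompl_Hom[OF o(4,5)] icompl_Hom[OF o(5,6)] icompl_Ext[OF o(1,4)]
    by (auto simp: Act_Act)
qed

end

lemma (in biadditive_functor) icompl_karoubi_additive:
  "karoubi_additive C E (icompl C) (icompl_ext C E) (\<lambda>b r a. (b, r, a)) (\<lambda>a \<delta> z. (a, \<delta>, z))"
proof (intro karoubi_additive.intro karoubi_additive_axioms.intro icompl_biadditive biadditive_functor_axioms)
  show "Ob (icompl C) = {(A, a). a \<in> arr A A \<and> a ** a = a}" by (auto simp: icompl_Ob)
qed (simp_all add: icompl_Hom icompl_Ext)

lemma (in additive_category) arr_op: "additive_category.arr (op_cat C) A B = arr B A"
  by (auto simp: additive_category.arr_def[OF op_additive] arr_def)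

lemma (in biadditive_functor) ext_op: "biadditive_functor.ext (op_cat C) (op_bifunctor E) D A = ext A D"
  by (auto simp: biadditive_functor.ext_def[OF op_biadditive] ext_def)

lemma (in biadditive_functor) icompl_karoubi_additive_op:
  "karoubi_additive (op_cat C) (op_bifunctor E) (op_cat (icompl C)) (op_bifunctor (icompl_ext C E))
    (\<lambda>b r a. (a, r, b)) (\<lambda>a \<delta> z. (z, \<delta>, a))"
proof (intro karoubi_additive.intro karoubi_additive_axioms.intro op_biadditive biadditive_functor.op_biadditive[OF icompl_biadditive])
  show "Ob (op_cat (icompl C)) = {(A, a). a \<in> additive_category.arr (op_cat C) A A \<and> a \<cdot>\<^bsub>op_cat C\<^esub> a = a}"
    by (auto simp: icompl_Ob arr_op)
qed (auto simp: icompl_Hom icompl_Ext arr_op ext_op)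

section \<open>The realisation of the completion and of its opposite\<close>

context exact_realisation begin

lemma icompl_karoubi_real:
  assumes n: "1 \<le> n"
  shows "karoubi_real C E n s (icompl C) (icompl_ext C E) (\<lambda>b r a. (b, r, a)) (\<lambda>a \<delta> z. (a, \<delta>, z)) (icompl_real n C s)"
proof (intro karoubi_real.intro karoubi_real_axioms.intro icompl_karoubi_additive exact_realisation_axioms n)
  interpret I: karoubi_additive C E "icompl C" "icompl_ext C E" "\<lambda>b r a. (b, r, a)" "\<lambda>a \<delta> z. (a, \<delta>, z)"
    by (rule icompl_karoubi_additive)
  fix \<delta> Z z A a
  assume \<delta>: "\<delta> \<in> ext Z A" "push C E Z a \<delta> = \<delta>" "pull C E A z \<delta> = \<delta>" and o: "(Z, z) \<in> Ob (icompl C)" "(A, a) \<in> Ob (icompl C)"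
  note ty = o[unfolded icompl_Ob]
  obtain X where X: "realises n C s Z A \<delta> X" by (rule realises_exists[OF \<delta>(1)])
  note ends = realises_ends[OF X]
  \<comment> \<open>This shows that the set from which the realisation of the completion chooses is
    not empty.\<close>
  have "\<exists>e. chain_map n C X X e \<and> (\<forall>i\<le>Suc n. e i ** e i = e i) \<and> e 0 = a \<and> e (Suc n) = z"
    using idempotent_lift[OF n realises_n_exangle[OF X \<delta>(1)], of a z] \<delta> ty unfolding ends by metis
  then obtain e where "idempotent_realiser n C s Z A (a, \<delta>, z) (X, e)"
    using X by (auto simp: idempotent_realiser_def)
  then have "idempotent_realiser n C s Z A (a, \<delta>, z) (SOME Xe. idempotent_realiser n C s Z A (a, \<delta>, z) Xe)"
    by (rule someI)
  moreover obtain Y r where Y: "(SOME Xe. idempotent_realiser n C s Z A (a, \<delta>, z) Xe) = (Y, r)" by (rule prod.exhaust)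
  ultimately have "realises n C s Z A \<delta> Y \<and> chain_map n C Y Y r \<and> (\<forall>i\<le>Suc n. r i ** r i = r i) \<and> r 0 = a \<and> r (Suc n) = z"
    by (simp add: idempotent_realiser_def)
  moreover have "icompl_real n C s (Z, z) (A, a) (a, \<delta>, z) = iso_class n (icompl C) (I.pack Y r)"
    by (simp add: icompl_real_def Y I.pack_def icompl_cpx_def)
  ultimately show "\<exists>X e. realises n C s Z A \<delta> X \<and> chain_map n C X X e \<and> (\<forall>i\<le>Suc n. e i ** e i = e i) \<and>
      e 0 = a \<and> e (Suc n) = z \<and> icompl_real n C s (Z, z) (A, a) (a, \<delta>, z) = iso_class n (icompl C) (I.pack X e)"
    by blast
qed

lemma icompl_karoubi_real_op:
  assumes n: "1 \<le> n"
  shows "karoubi_real (op_cat C) (op_bifunctor E) n (op_realisation n C s) (op_cat (icompl C)) (op_bifunctor (icompl_ext C E))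
    (\<lambda>b r a. (a, r, b)) (\<lambda>a \<delta> z. (z, \<delta>, a)) (op_realisation n (icompl C) (icompl_real n C s))"
proof (intro karoubi_real.intro karoubi_real_axioms.intro icompl_karoubi_additive_op op_exact_realisation n)
  interpret I: karoubi_real C E n s "icompl C" "icompl_ext C E" "\<lambda>b r a. (b, r, a)" "\<lambda>a \<delta> z. (a, \<delta>, z)" "icompl_real n C s"
    by (rule icompl_karoubi_real[OF n])
  interpret J: karoubi_additive "op_cat C" "op_bifunctor E" "op_cat (icompl C)" "op_bifunctor (icompl_ext C E)"
    "\<lambda>b r a. (a, r, b)" "\<lambda>a \<delta> z. (z, \<delta>, a)"
    by (rule icompl_karoubi_additive_op)
  fix \<delta> Z z A a
  assume "\<delta> \<in> biadditive_functor.ext (op_cat C) (op_bifunctor E) Z A"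
    "push (op_cat C) (op_bifunctor E) Z a \<delta> = \<delta>" "pull (op_cat C) (op_bifunctor E) A z \<delta> = \<delta>"
    and "(Z, z) \<in> Ob (op_cat (icompl C))" "(A, a) \<in> Ob (op_cat (icompl C))"
  then have \<delta>: "\<delta> \<in> ext A Z" "push C E A z \<delta> = \<delta>" "pull C E Z a \<delta> = \<delta>" and o: "(A, a) \<in> Ob (icompl C)" "(Z, z) \<in> Ob (icompl C)"
    by (simp_all add: ext_op)
  obtain X where X: "realises n C s A Z \<delta> X" by (rule realises_exists[OF \<delta>(1)])
  obtain e where e: "chain_map n C X X e" "\<And>i. i \<le> Suc n \<Longrightarrow> e i ** e i = e i" "e 0 = z" "e (Suc n) = a"
    and P: "realises n (icompl C) (icompl_real n C s) (A, a) (Z, z) (z, \<delta>, a) (I.pack X e)"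
    by (rule I.realises_packE[OF \<delta> o X]) blast
  let ?e = "\<lambda>i. e (Suc n - i)"
  have \<rho>: "(z, \<delta>, a) \<in> I.K.ext (A, a) (Z, z)" using I.mx_ext[OF \<delta> o] .
  have R: "realises n (op_cat C) (op_realisation n C s) Z A \<delta> (rev_cpx n X)"
    unfolding realises_op[OF \<delta>(1)] by (rule realises_rev_rev[OF X \<delta>(1)])
  have "chain_map n C (rev_cpx n (rev_cpx n X)) (rev_cpx n (rev_cpx n X)) e"
    using e(1) by (simp add: chain_map_def)
  then have c: "chain_map n (op_cat C) (rev_cpx n X) (rev_cpx n X) ?e" by (rule chain_map_of_op)
  have Ch: "X \<in> Ch n C" by (rule realises_Ch[OF X])
  \<comment> \<open>Packing and reversal commute up to the bracketing of e d e and up to values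
    outside the relevant degrees.\<close>
  have "cpx_agree n (I.pack X e) (rev_cpx n (J.pack (rev_cpx n X) ?e))"
    unfolding cpx_agree_def
  proof (intro conjI allI impI)
    fix i assume i: "i \<le> n"
    then have s: "Suc n - (n - i) = Suc i" "n - (n - i) = i" "Suc n - Suc (n - i) = i" by simp_all
    have "(e (Suc i) ** Df X i) ** e i = e (Suc i) ** Df X i ** e i"
      using chain_map_arr[OF e(1) Ch Ch, of i] chain_map_arr[OF e(1) Ch Ch, of "Suc i"] Ch_arr[OF Ch i] i by (simp add: cat_simps)
    then show "Df (I.pack X e) i = Df (rev_cpx n (J.pack (rev_cpx n X) ?e)) i"
      by (simp add: s)
  qed simp
  then have "realises n (icompl C) (icompl_real n C s) (A, a) (Z, z) (z, \<delta>, a) (rev_cpx n (J.pack (rev_cpx n X) ?e))"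
    by (rule I.K.realises_of_agree[OF P \<rho>])
  then have "op_realisation n (icompl C) (icompl_real n C s) (Z, z) (A, a) (z, \<delta>, a) = iso_class n (op_cat (icompl C)) (J.pack (rev_cpx n X) ?e)"
    unfolding I.K.realises_op[OF \<rho>, symmetric] by (simp add: realises_def)
  then show "\<exists>X e. realises n (op_cat C) (op_realisation n C s) Z A \<delta> X \<and> chain_map n (op_cat C) X X e \<and>
      (\<forall>i\<le>Suc n. e i \<cdot>\<^bsub>op_cat C\<^esub> e i = e i) \<and> e 0 = a \<and> e (Suc n) = z \<and>
      op_realisation n (icompl C) (icompl_real n C s) (Z, z) (A, a) (z, \<delta>, a) = iso_class n (op_cat (icompl C)) (J.pack X e)"
    using R c e by (intro exI[of _ "rev_cpx n X"] exI[of _ ?e]) simp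
qed

end

section \<open>The axioms for the completion\<close>

context n_exangulated_category begin

lemma icompl_karoubi:
  assumes n: "1 \<le> n"
  shows "karoubi C E n s (icompl C) (icompl_ext C E) (\<lambda>b r a. (b, r, a)) (\<lambda>a \<delta> z. (a, \<delta>, z)) (icompl_real n C s)"
proof (intro karoubi.intro karoubi_axioms.intro icompl_karoubi_real n)
  fix A B B' f g assume fg: "is_inflation n C E s A B f" "is_inflation n C E s B B' g"
  have "A \<in> Ob C \<and> B \<in> Ob C" if "is_inflation n C E s A B f" for A B f
    using that n unfolding is_inflation_def realises_def Ch_def by force
  then show "is_inflation n C E s A B' (g ** f)" using EA1_inflation fg by blast
next
  fix \<delta> Z A X f B assume \<delta>: "\<delta> \<in> ext Z A" and X: "realises n C s Z A \<delta> X" and f: "f \<in> arr A B"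
  have p\<delta>: "push C E Z f \<delta> \<in> ext Z B" by (rule push_ext[OF f \<delta>])
  obtain Y where Y: "realises n C s Z B (push C E Z f \<delta>) Y" by (rule realises_exists[OF p\<delta>])
  \<comment> \<open>The first differential of the cocone has the components f and
    \<open>Df X 0\<close>, so it is the required inflation into the direct sum.\<close>
  obtain g N where g: "is_lift n C X Y f (Idn C Z) g" and N: "is_mapping_cocone n C X Y g N"
    and R: "realises n C s (Tm Y n) A (pull C E A (Df Y n) \<delta>) N"
    using EA2_op[OF _ _ _ _ _ Y X] \<delta> f by (auto simp: ext_def arr_def)
  from N n obtain i1 i2 p1 p2 where b: "is_biproduct C (Tm Y 0) (Tm X (Suc 0)) (Tm N (Suc 0)) i1 i2 p1 p2"
    and d: "p1 ** Df N 0 = g 0" "p2 ** Df N 0 = Df X 0"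
    unfolding is_mapping_cocone_def by (metis One_nat_def atLeastAtMost_iff diff_self_eq_0 le_refl)
  have dn: "Df Y n \<in> arr (Tm Y n) Z" using Ch_arr[OF realises_Ch[OF Y], of n] realises_ends[OF Y] by simp
  have "pull C E A (Df Y n) \<delta> \<in> ext (Tm Y n) A" by (rule pull_ext[OF dn \<delta>])
  then have "is_inflation n C E s A (Tm N (Suc 0)) (Df N 0)"
    unfolding is_inflation_def ext_def using R by (intro bexI[of _ "Tm Y n"] bexI[of _ "pull C E A (Df Y n) \<delta>"] exI[of _ N]) simp_all
  moreover have "is_biproduct C B (Tm X (Suc 0)) (Tm N (Suc 0)) i1 i2 p1 p2" using b realises_ends[OF Y] by simp
  moreover have "g 0 = f" using g by (simp add: is_lift_def)
  ultimately show "\<exists>P i1 i2 p1 p2 y. is_biproduct C B (Tm X (Suc 0)) P i1 i2 p1 p2 \<and>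
        is_inflation n C E s A P y \<and> p1 ** y = f \<and> p2 ** y = Df X 0"
    using d by blast
next
  fix \<delta> Z A c Z' Y X
  assume "\<delta> \<in> ext Z A" "c \<in> arr Z' Z" "realises n C s Z' A (pull C E A c \<delta>) Y" "realises n C s Z A \<delta> X"
  then show "\<exists>f M. is_lift n C Y X (Idn C A) c f \<and> is_mapping_cone n C Y X f M \<and>
        realises n C s Z (Tm Y (Suc 0)) (push C E Z (Df Y 0) \<delta>) M"
    using EA2[of A Z Z' \<delta> c Y X] by (simp add: ext_def arr_def)
qed

lemma icompl_karoubi_op:
  assumes n: "1 \<le> n"
  shows "karoubi (op_cat C) (op_bifunctor E) n (op_realisation n C s) (op_cat (icompl C)) (op_bifunctor (icompl_ext C E))
    (\<lambda>b r a. (a, r, b)) (\<lambda>a \<delta> z. (z, \<delta>, a)) (op_realisation n (icompl C) (icompl_real n C s))"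
proof (intro karoubi.intro karoubi_axioms.intro icompl_karoubi_real_op n)
  fix A B B' f g
  assume fg: "is_inflation n (op_cat C) (op_bifunctor E) (op_realisation n C s) A B f"
    "is_inflation n (op_cat C) (op_bifunctor E) (op_realisation n C s) B B' g"
  have "B \<in> Ob C" if "is_deflation n C E s B A f" for A B f
    using that unfolding is_deflation_def realises_def Ch_def by force
  then show "is_inflation n (op_cat C) (op_bifunctor E) (op_realisation n C s) A B' (g \<cdot>\<^bsub>op_cat C\<^esub> f)"
    using fg EA1_deflation[of B' B A g f] unfolding is_inflation_op[OF n] op_cat_simps by blast
next
  fix \<delta> Z A X f B
  assume "\<delta> \<in> biadditive_functor.ext (op_cat C) (op_bifunctor E) Z A" and X: "realises n (op_cat C) (op_realisation n C s) Z A \<delta> X"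
    and "f \<in> additive_category.arr (op_cat C) A B"
  then have \<delta>: "\<delta> \<in> ext A Z" and f: "f \<in> arr B A" by (simp_all add: ext_op arr_op)
  note X = X[unfolded realises_op[OF \<delta>]]
  have p\<delta>: "pull C E Z f \<delta> \<in> ext B Z" by (rule pull_ext[OF f \<delta>])
  obtain Y where Y: "realises n C s B Z (pull C E Z f \<delta>) Y" by (rule realises_exists[OF p\<delta>])
  \<comment> \<open>Dually, the last differential of the cone restricts on the two summands to f and
    to the last differential of the reversed complex.\<close>
  obtain g M where g: "is_lift n C Y (rev_cpx n X) (Idn C Z) f g" and M: "is_mapping_cone n C Y (rev_cpx n X) g M"
    and R: "realises n C s A (Tm Y 1) (push C E A (Df Y 0) \<delta>) M"
    using EA2[OF _ _ _ _ _ Y X] \<delta> f by (auto simp: ext_def arr_def)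
  from M n obtain i1 i2 p1 p2 where b: "is_biproduct C (Tm Y (n + 1)) (Tm (rev_cpx n X) n) (Tm M n) i1 i2 p1 p2"
    and d: "Df M n ** i1 = g (n + 1)" "Df M n ** i2 = Df (rev_cpx n X) n"
    unfolding is_mapping_cone_def by (metis atLeastAtMost_iff le_refl)
  have d0: "Df Y 0 \<in> arr Z (Tm Y 1)" using Ch_arr[OF realises_Ch[OF Y], of 0] realises_ends[OF Y] by simp
  have "push C E A (Df Y 0) \<delta> \<in> ext A (Tm Y 1)" by (rule push_ext[OF d0 \<delta>])
  then have "is_inflation n (op_cat C) (op_bifunctor E) (op_realisation n C s) A (Tm M n) (Df M n)"
    unfolding is_inflation_op[OF n] is_deflation_def ext_def using R
    by (intro conjI bexI[of _ "Tm Y 1"] bexI[of _ "push C E A (Df Y 0) \<delta>"] exI[of _ M]) simp_all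
  moreover have "is_biproduct (op_cat C) B (Tm X (Suc 0)) (Tm M n) p1 p2 i1 i2" using b realises_ends[OF Y] by simp
  moreover have "g (n + 1) = f" using g by (simp add: is_lift_def)
  ultimately have "is_biproduct (op_cat C) B (Tm X (Suc 0)) (Tm M n) p1 p2 i1 i2 \<and>
        is_inflation n (op_cat C) (op_bifunctor E) (op_realisation n C s) A (Tm M n) (Df M n) \<and>
        i1 \<cdot>\<^bsub>op_cat C\<^esub> Df M n = f \<and> i2 \<cdot>\<^bsub>op_cat C\<^esub> Df M n = Df X 0"
    using d by simp
  then show "\<exists>P i1 i2 p1 p2 y. is_biproduct (op_cat C) B (Tm X (Suc 0)) P i1 i2 p1 p2 \<and>
        is_inflation n (op_cat C) (op_bifunctor E) (op_realisation n C s) A P y \<and> p1 \<cdot>\<^bsub>op_cat C\<^esub> y = f \<and> p2 \<cdot>\<^bsub>op_cat C\<^esub> y = Df X 0"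
    by blast
next
  fix \<delta> Z A c Z' Y X
  assume "\<delta> \<in> biadditive_functor.ext (op_cat C) (op_bifunctor E) Z A" and "c \<in> additive_category.arr (op_cat C) Z' Z"
    and Y: "realises n (op_cat C) (op_realisation n C s) Z' A (pull (op_cat C) (op_bifunctor E) A c \<delta>) Y"
    and X: "realises n (op_cat C) (op_realisation n C s) Z A \<delta> X"
  then have \<delta>: "\<delta> \<in> ext A Z" and c: "c \<in> arr Z Z'" by (simp_all add: ext_op arr_op)
  note X = X[unfolded realises_op[OF \<delta>]]
  note Y = Y[unfolded push_pull_op realises_op[OF push_ext[OF c \<delta>]]]
  obtain g N where g: "is_lift n C (rev_cpx n X) (rev_cpx n Y) c (Idn C A) g" and N: "is_mapping_cocone n C (rev_cpx n X) (rev_cpx n Y) g N"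
    and R: "realises n C s (Tm (rev_cpx n Y) n) Z (pull C E Z (Df (rev_cpx n Y) n) \<delta>) N"
    using EA2_op[OF _ _ _ _ _ Y X] \<delta> c unfolding ext_def arr_def by blast
  note cone = mapping_cone_op_of_cocone[OF N n realises_Ch[OF X] realises_Ch[OF Y]]
  have lift: "is_lift n (op_cat C) Y X (Idn (op_cat C) A) c (\<lambda>i. g (Suc n - i))"
    using g chain_map_of_op[of n C X Y g] unfolding is_lift_def by simp
  have "Df (rev_cpx n Y) n \<in> arr (Tm (rev_cpx n Y) n) A" using Ch_arr[OF realises_Ch[OF Y], of n] realises_ends[OF Y] by simp
  then have \<epsilon>: "pull C E Z (Df (rev_cpx n Y) n) \<delta> \<in> ext (Tm (rev_cpx n Y) n) Z" by (rule pull_ext[OF _ \<delta>])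
  have "realises n (op_cat C) (op_realisation n C s) Z (Tm (rev_cpx n Y) n) (pull C E Z (Df (rev_cpx n Y) n) \<delta>) (rev_cpx n N)"
    unfolding realises_op[OF \<epsilon>] by (rule realises_rev_rev[OF R \<epsilon>])
  then have "realises n (op_cat C) (op_realisation n C s) Z (Tm Y (Suc 0)) (push (op_cat C) (op_bifunctor E) Z (Df Y 0) \<delta>) (rev_cpx n N)"
    by simp
  then show "\<exists>f M. is_lift n (op_cat C) Y X (Idn (op_cat C) A) c f \<and> is_mapping_cone n (op_cat C) Y X f M \<and>
        realises n (op_cat C) (op_realisation n C s) Z (Tm Y (Suc 0)) (push (op_cat C) (op_bifunctor E) Z (Df Y 0) \<delta>) M"
    using lift cone by blast
qed

text \<open>The instance for C gives the composition of inflations and (EA2); the one for the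
  opposite category gives the composition of deflations and (EA2)^op.\<close>

lemma icompl_n_exangulated:
  assumes n: "1 \<le> n"
  shows "n_exangulated_category n (icompl C) (icompl_ext C E) (icompl_real n C s)"
proof -
  interpret I: karoubi C E n s "icompl C" "icompl_ext C E" "\<lambda>b r a. (b, r, a)" "\<lambda>a \<delta> z. (a, \<delta>, z)" "icompl_real n C s"
    by (rule icompl_karoubi[OF n])
  interpret J: karoubi "op_cat C" "op_bifunctor E" n "op_realisation n C s" "op_cat (icompl C)" "op_bifunctor (icompl_ext C E)"
    "\<lambda>b r a. (a, r, b)" "\<lambda>a \<delta> z. (z, \<delta>, a)" "op_realisation n (icompl C) (icompl_real n C s)"
    by (rule icompl_karoubi_op[OF n])
  show ?thesis
  proof (intro n_exangulated_category.intro n_exangulated_category_axioms.intro I.K_exact_realisation)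
    fix P Q R f g
    assume "is_inflation n (icompl C) (icompl_ext C E) (icompl_real n C s) P Q f"
      "is_inflation n (icompl C) (icompl_ext C E) (icompl_real n C s) Q R g"
    then show "is_inflation n (icompl C) (icompl_ext C E) (icompl_real n C s) P R (g \<cdot>\<^bsub>icompl C\<^esub> f)"
      by (rule I.K_inflation_comp)
  next
    fix P Q R f g
    assume "Q \<in> Ob (icompl C)" "R \<in> Ob (icompl C)" "is_deflation n (icompl C) (icompl_ext C E) (icompl_real n C s) P Q f"
      "is_deflation n (icompl C) (icompl_ext C E) (icompl_real n C s) Q R g"
    then show "is_deflation n (icompl C) (icompl_ext C E) (icompl_real n C s) P R (g \<cdot>\<^bsub>icompl C\<^esub> f)"
      using J.K_inflation_comp[of R Q g P f] unfolding I.K.is_inflation_op[OF n] op_cat_simps by blast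
  next
    fix Q P P' \<delta> c Y X
    assume "Q \<in> Ob (icompl C)" "P \<in> Ob (icompl C)" "P' \<in> Ob (icompl C)" "\<delta> \<in> carrier (Ext (icompl_ext C E) P Q)"
      "c \<in> carrier (Hom (icompl C) P' P)"
      and "realises n (icompl C) (icompl_real n C s) P' Q (pull (icompl C) (icompl_ext C E) Q c \<delta>) Y"
      "realises n (icompl C) (icompl_real n C s) P Q \<delta> X"
    then show "\<exists>f M. is_lift n (icompl C) Y X (Idn (icompl C) Q) c f \<and> is_mapping_cone n (icompl C) Y X f M \<and>
        realises n (icompl C) (icompl_real n C s) P (Tm Y 1) (push (icompl C) (icompl_ext C E) P (Df Y 0) \<delta>) M"
      using I.K_good_lift[of \<delta> P Q c P' Y X] by (simp add: I.K.ext_def I.K.arr_def)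
  next
    fix A A' D \<delta> a Y X
    assume o: "A \<in> Ob (icompl C)" "A' \<in> Ob (icompl C)" "D \<in> Ob (icompl C)" "\<delta> \<in> carrier (Ext (icompl_ext C E) D A)"
      "a \<in> carrier (Hom (icompl C) A A')"
      and Y: "realises n (icompl C) (icompl_real n C s) D A' (push (icompl C) (icompl_ext C E) D a \<delta>) Y"
      and X: "realises n (icompl C) (icompl_real n C s) D A \<delta> X"
    have \<delta>: "\<delta> \<in> I.K.ext D A" and a: "a \<in> I.K.arr A A'" using o by (simp_all add: I.K.ext_def I.K.arr_def)
    have a\<delta>: "push (icompl C) (icompl_ext C E) D a \<delta> \<in> I.K.ext D A'" by (rule I.K.push_ext[OF a \<delta>])
    have Yop: "realises n (op_cat (icompl C)) (op_realisation n (icompl C) (icompl_real n C s)) A' D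
        (pull (op_cat (icompl C)) (op_bifunctor (icompl_ext C E)) D a \<delta>) (rev_cpx n Y)"
      unfolding push_pull_op I.K.realises_op[OF a\<delta>] by (rule I.K.realises_rev_rev[OF Y a\<delta>])
    have Xop: "realises n (op_cat (icompl C)) (op_realisation n (icompl C) (icompl_real n C s)) A D \<delta> (rev_cpx n X)"
      unfolding I.K.realises_op[OF \<delta>] by (rule I.K.realises_rev_rev[OF X \<delta>])
    obtain f M where f: "is_lift n (op_cat (icompl C)) (rev_cpx n Y) (rev_cpx n X) (Idn (op_cat (icompl C)) D) a f"
      and M: "is_mapping_cone n (op_cat (icompl C)) (rev_cpx n Y) (rev_cpx n X) f M"
      and R: "realises n (op_cat (icompl C)) (op_realisation n (icompl C) (icompl_real n C s)) A (Tm (rev_cpx n Y) (Suc 0))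
        (push (op_cat (icompl C)) (op_bifunctor (icompl_ext C E)) A (Df (rev_cpx n Y) 0) \<delta>) M"
      using J.K_good_lift[OF \<delta>[folded I.K.ext_op] a[folded I.K.arr_op] Yop Xop] by blast
    have "chain_map n (icompl C) (rev_cpx n (rev_cpx n X)) (rev_cpx n (rev_cpx n Y)) (\<lambda>i. f (Suc n - i))"
      using f unfolding is_lift_def chain_map_op by blast
    \<comment> \<open>Chain maps see only the degrees in which reversing twice is the
      identity.\<close>
    then have "chain_map n (icompl C) X Y (\<lambda>i. f (Suc n - i))" by (simp add: chain_map_def)
    then have lift: "is_lift n (icompl C) X Y a (Idn (icompl C) D) (\<lambda>i. f (Suc n - i))"
      using f by (simp add: is_lift_def)
    note cocone = I.K.mapping_cocone_of_cone_op[OF M n I.K.realises_Ch[OF X] I.K.realises_Ch[OF Y]]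
    have "Df Y n \<in> I.K.arr (Tm Y n) D" using I.K.Ch_arr[OF I.K.realises_Ch[OF Y], of n] I.K.realises_ends[OF Y] by simp
    then have "pull (icompl C) (icompl_ext C E) A (Df Y n) \<delta> \<in> I.K.ext (Tm Y n) A" by (rule I.K.pull_ext[OF _ \<delta>])
    then have "realises n (icompl C) (icompl_real n C s) (Tm Y n) A (pull (icompl C) (icompl_ext C E) A (Df Y n) \<delta>) (rev_cpx n M)"
      using R I.K.realises_op[of "pull (icompl C) (icompl_ext C E) A (Df Y n) \<delta>" "Tm Y n" A M] by simp
    then show "\<exists>g N. is_lift n (icompl C) X Y a (Idn (icompl C) D) g \<and> is_mapping_cocone n (icompl C) X Y g N \<and>
        realises n (icompl C) (icompl_real n C s) (Tm Y n) A (pull (icompl C) (icompl_ext C E) A (Df Y n) \<delta>) N"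
      using lift cocone by blast
  qed
qed

end

section \<open>Corner rings of semi-perfect rings\<close>

context ring begin

text \<open>Closure under negation follows from multiplication by -1.\<close>

lemma left_ideal_iff:
  "left_ideal I R \<longleftrightarrow> I \<subseteq> carrier R \<and> \<zero> \<in> I \<and> (\<forall>x\<in>I. \<forall>y\<in>I. x \<oplus> y \<in> I) \<and> (\<forall>r\<in>carrier R. \<forall>x\<in>I. r \<otimes> x \<in> I)"
proof
  assume I: "left_ideal I R"
  then interpret additive_subgroup I R by (simp add: left_ideal_def)
  show "I \<subseteq> carrier R \<and> \<zero> \<in> I \<and> (\<forall>x\<in>I. \<forall>y\<in>I. x \<oplus> y \<in> I) \<and> (\<forall>r\<in>carrier R. \<forall>x\<in>I. r \<otimes> x \<in> I)"
    using I a_subset by (auto simp: left_ideal_def)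
next
  assume I: "I \<subseteq> carrier R \<and> \<zero> \<in> I \<and> (\<forall>x\<in>I. \<forall>y\<in>I. x \<oplus> y \<in> I) \<and> (\<forall>r\<in>carrier R. \<forall>x\<in>I. r \<otimes> x \<in> I)"
  have "\<ominus> x \<in> I" if "x \<in> I" for x
  proof -
    have "(\<ominus> \<one>) \<otimes> x \<in> I" using that I by blast
    moreover have "x \<in> carrier R" using that I by blast
    ultimately show ?thesis by (simp add: l_minus)
  qed
  then have "additive_subgroup I R"
    using I by (auto intro!: additive_subgroup.intro add.subgroupI simp: a_inv_def)
  then show "left_ideal I R" using I by (simp add: left_ideal_def)
qed

lemma left_idealD:
  assumes "left_ideal I R"
  shows "x \<in> I \<Longrightarrow> x \<in> carrier R" "\<zero> \<in> I" "x \<in> I \<Longrightarrow> y \<in> I \<Longrightarrow> x \<oplus> y \<in> I" "r \<in> carrier R \<Longrightarrow> x \<in> I \<Longrightarrow> r \<otimes> x \<in> I"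
    "x \<in> I \<Longrightarrow> \<ominus> x \<in> I" "x \<in> I \<Longrightarrow> y \<in> I \<Longrightarrow> x \<ominus> y \<in> I"
proof -
  note I = assms[unfolded left_ideal_iff]
  show "x \<in> I \<Longrightarrow> x \<in> carrier R" "\<zero> \<in> I" "x \<in> I \<Longrightarrow> y \<in> I \<Longrightarrow> x \<oplus> y \<in> I" "r \<in> carrier R \<Longrightarrow> x \<in> I \<Longrightarrow> r \<otimes> x \<in> I"
    using I by blast+
  show m: "\<ominus> x \<in> I" if "x \<in> I" for x
    using assms that by (simp add: left_ideal_def additive_subgroup.a_inv_closed)
  show "x \<in> I \<Longrightarrow> y \<in> I \<Longrightarrow> x \<ominus> y \<in> I" using I m by (simp add: minus_eq)
qed

text \<open>Properness is expressed by 1 not lying in the ideal, a condition that survives unions of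
  chains.\<close>

lemma maximal_left_ideal_exists:
  assumes L: "left_ideal L R" and one: "\<one> \<notin> L"
  obtains M where "maximal_left_ideal M R" "L \<subseteq> M" "\<one> \<notin> M"
proof -
  let ?A = "{I. left_ideal I R \<and> L \<subseteq> I \<and> \<one> \<notin> I}"
  have "\<exists>M\<in>?A. \<forall>X\<in>?A. M \<subseteq> X \<longrightarrow> X = M"
  proof (rule subset_Zorn_nonempty)
    show "?A \<noteq> {}" using L one by blast
    fix \<C> assume ne: "\<C> \<noteq> {}" and chain: "subset.chain ?A \<C>"
    then have \<C>: "\<And>I. I \<in> \<C> \<Longrightarrow> left_ideal I R \<and> L \<subseteq> I \<and> \<one> \<notin> I" and total: "\<And>I J. I \<in> \<C> \<Longrightarrow> J \<in> \<C> \<Longrightarrow> I \<subseteq> J \<or> J \<subseteq> I"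
      by (auto simp: subset.chain_def subset_chain_def)
    have "left_ideal (\<Union>\<C>) R"
      unfolding left_ideal_iff
    proof (intro conjI ballI)
      show "\<Union>\<C> \<subseteq> carrier R" using \<C> left_idealD(1) by blast
      show "\<zero> \<in> \<Union>\<C>" using \<C> ne left_idealD(2) by blast
      show "r \<otimes> x \<in> \<Union>\<C>" if "r \<in> carrier R" "x \<in> \<Union>\<C>" for r x using that \<C> left_idealD(4) by blast
      fix x y assume "x \<in> \<Union>\<C>" "y \<in> \<Union>\<C>"
      then obtain I J where "I \<in> \<C>" "x \<in> I" "J \<in> \<C>" "y \<in> J" by blast
      then obtain K where "K \<in> \<C>" "x \<in> K" "y \<in> K" using total by blast
      then show "x \<oplus> y \<in> \<Union>\<C>" using \<C> left_idealD(3) by blast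
    qed
    then show "\<Union>\<C> \<in> ?A" using \<C> ne by blast
  qed
  then obtain M where "M \<in> ?A" and max: "\<forall>X\<in>?A. M \<subseteq> X \<longrightarrow> X = M" by (rule bexE)
  then have M: "left_ideal M R" "L \<subseteq> M" "\<one> \<notin> M" by simp_all
  have "maximal_left_ideal M R"
    unfolding maximal_left_ideal_def
  proof (intro conjI allI impI)
    show "left_ideal M R" by (rule M(1))
    show "M \<noteq> carrier R" using M(3) by blast
    fix I assume I: "left_ideal I R" "M \<subseteq> I"
    show "I = M \<or> I = carrier R"
    proof (cases "\<one> \<in> I")
      case True
      then have "x \<in> I" if "x \<in> carrier R" for x using left_idealD(4)[OF I(1) that True] that by simp
      then show ?thesis using left_idealD(1)[OF I(1)] by blast
    next
      case False
      then have "I \<in> ?A" using I M(2) by simp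
      then show ?thesis using max I(2) by blast
    qed
  qed
  then show thesis using M by (intro that)
qed

text \<open>This description refers to elements only. It allows radicals to be compared between a
  ring and its corner, and it gives that the radical is two-sided.\<close>

lemma jacobson_radical_iff:
  "x \<in> jacobson_radical R \<longleftrightarrow> x \<in> carrier R \<and> (\<forall>r\<in>carrier R. \<exists>v\<in>carrier R. v \<otimes> (\<one> \<ominus> r \<otimes> x) = \<one>)"
proof
  assume x: "x \<in> jacobson_radical R"
  then have xc: "x \<in> carrier R" by (simp add: jacobson_radical_def)
  have "\<exists>v\<in>carrier R. v \<otimes> (\<one> \<ominus> r \<otimes> x) = \<one>" if r: "r \<in> carrier R" for r
  proof (rule ccontr)
    assume no: "\<not> (\<exists>v\<in>carrier R. v \<otimes> (\<one> \<ominus> r \<otimes> x) = \<one>)"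
    define w where "w = \<one> \<ominus> r \<otimes> x"
    have w: "w \<in> carrier R" using r xc by (simp add: w_def)
    \<comment> \<open>If w has no left inverse, R w is proper and lies in a maximal left ideal. That
      ideal contains r x as well, hence also 1.\<close>
    let ?L = "{v \<otimes> w |v. v \<in> carrier R}"
    have "left_ideal ?L R"
      unfolding left_ideal_iff
    proof (intro conjI ballI)
      have "\<zero> = \<zero> \<otimes> w" using w by simp
      then show "\<zero> \<in> ?L" by blast
      fix p q assume q: "q \<in> ?L"
      then obtain a where a: "a \<in> carrier R" "q = a \<otimes> w" by blast
      show "p \<oplus> q \<in> ?L" if "p \<in> ?L"
      proof -
        from that obtain b where b: "b \<in> carrier R" "p = b \<otimes> w" by blast
        have "p \<oplus> q = (b \<oplus> a) \<otimes> w" using a b w by (simp add: l_distr)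
        then show ?thesis using a(1) b(1) by blast
      qed
      show "p \<otimes> q \<in> ?L" if p: "p \<in> carrier R"
      proof -
        have "p \<otimes> q = (p \<otimes> a) \<otimes> w" using a p w by (simp add: m_assoc)
        then show ?thesis using a(1) p by blast
      qed
    qed (use w in auto)
    moreover have "\<one> \<notin> ?L" using no w_def by auto
    ultimately obtain M where M: "maximal_left_ideal M R" "?L \<subseteq> M" "\<one> \<notin> M" by (rule maximal_left_ideal_exists)
    then have li: "left_ideal M R" by (simp add: maximal_left_ideal_def)
    have "w = \<one> \<otimes> w" using w by simp
    then have "w \<in> M" using M(2) by blast
    moreover have "r \<otimes> x \<in> M" using x M(1) r left_idealD(4)[OF li] by (simp add: jacobson_radical_def)
    ultimately have "w \<oplus> r \<otimes> x \<in> M" using left_idealD(3)[OF li] by blast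
    moreover have "w \<oplus> r \<otimes> x = \<one>" using r xc by (simp add: w_def minus_eq a_assoc l_neg)
    ultimately show False using M(3) by simp
  qed
  then show "x \<in> carrier R \<and> (\<forall>r\<in>carrier R. \<exists>v\<in>carrier R. v \<otimes> (\<one> \<ominus> r \<otimes> x) = \<one>)" using xc by blast
next
  assume x: "x \<in> carrier R \<and> (\<forall>r\<in>carrier R. \<exists>v\<in>carrier R. v \<otimes> (\<one> \<ominus> r \<otimes> x) = \<one>)"
  have "x \<in> M" if M: "maximal_left_ideal M R" for M
  proof (rule ccontr)
    assume xM: "x \<notin> M"
    have li: "left_ideal M R" and ne: "M \<noteq> carrier R" and max: "\<And>I. left_ideal I R \<Longrightarrow> M \<subseteq> I \<Longrightarrow> I = M \<or> I = carrier R"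
      using M by (simp_all add: maximal_left_ideal_def)
    \<comment> \<open>By maximality M + R x is the whole ring, so some 1 - r x lies in M although it
      has a left inverse.\<close>
    let ?I = "{m \<oplus> r \<otimes> x |m r. m \<in> M \<and> r \<in> carrier R}"
    note MD = left_idealD[OF li]
    have "left_ideal ?I R"
      unfolding left_ideal_iff
    proof (intro conjI ballI)
      have "\<zero> = \<zero> \<oplus> \<zero> \<otimes> x" using x by simp
      then show "\<zero> \<in> ?I" using MD(2) zero_closed by blast
      show "p \<oplus> q \<in> ?I" if "p \<in> ?I" "q \<in> ?I" for p q
      proof -
        from that obtain m r m' r' where e: "p = m \<oplus> r \<otimes> x" "q = m' \<oplus> r' \<otimes> x" "m \<in> M" "m' \<in> M" "r \<in> carrier R" "r' \<in> carrier R" by blast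
        have "p \<oplus> q = (m \<oplus> m') \<oplus> (r \<oplus> r') \<otimes> x"
          using e x MD(1)[OF e(3)] MD(1)[OF e(4)] by (simp add: l_distr a_ac)
        moreover have "m \<oplus> m' \<in> M" "r \<oplus> r' \<in> carrier R" using e MD(3) by simp_all
        ultimately show ?thesis by blast
      qed
      show "p \<otimes> q \<in> ?I" if p: "p \<in> carrier R" and q: "q \<in> ?I" for p q
      proof -
        from q obtain m r where e: "q = m \<oplus> r \<otimes> x" "m \<in> M" "r \<in> carrier R" by blast
        have "p \<otimes> q = p \<otimes> m \<oplus> (p \<otimes> r) \<otimes> x" using e x p MD(1)[OF e(2)] by (simp add: r_distr m_assoc)
        moreover have "p \<otimes> m \<in> M" "p \<otimes> r \<in> carrier R" using e p MD(4) by simp_all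
        ultimately show ?thesis by blast
      qed
    qed (use x MD(1) in auto)
    moreover have "M \<subseteq> ?I"
    proof
      fix m assume m: "m \<in> M"
      then have "m = m \<oplus> \<zero> \<otimes> x" using x MD(1) by simp
      then show "m \<in> ?I" using m by blast
    qed
    moreover have "x \<in> ?I"
    proof -
      have "x = \<zero> \<oplus> \<one> \<otimes> x" using x by simp
      then show ?thesis using MD(2) by blast
    qed
    ultimately have "?I = carrier R" using max xM by blast
    then obtain m r where mr: "\<one> = m \<oplus> r \<otimes> x" "m \<in> M" "r \<in> carrier R" using one_closed by blast
    obtain v where v: "v \<in> carrier R" "v \<otimes> (\<one> \<ominus> r \<otimes> x) = \<one>" using x mr(3) by blast
    have "\<one> \<ominus> r \<otimes> x = m" using mr x MD(1)[OF mr(2)] by (simp add: minus_eq a_assoc r_neg)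
    then have "\<one> \<in> M" using v MD(4)[OF v(1) mr(2)] by simp
    then have "p \<in> M" if "p \<in> carrier R" for p using MD(4)[of p \<one>] that by simp
    then show False using ne MD(1) by blast
  qed
  then show "x \<in> jacobson_radical R" using x by (simp add: jacobson_radical_def)
qed

lemma jacobson_radical_left_ideal: "left_ideal (jacobson_radical R) R"
  unfolding left_ideal_iff jacobson_radical_def maximal_left_ideal_def
  using left_idealD by auto

text \<open>If u is a left inverse of 1 - r y, then 1 + y u r is one of 1 - y r. Here y = s
  x.\<close>

lemma jacobson_radical_right:
  assumes x: "x \<in> jacobson_radical R" and r: "r \<in> carrier R"
  shows "x \<otimes> r \<in> jacobson_radical R"
proof -
  have xc: "x \<in> carrier R" and inv: "\<And>s. s \<in> carrier R \<Longrightarrow> \<exists>v\<in>carrier R. v \<otimes> (\<one> \<ominus> s \<otimes> x) = \<one>"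
    using x by (simp_all add: jacobson_radical_iff)
  have "\<exists>v\<in>carrier R. v \<otimes> (\<one> \<ominus> s \<otimes> (x \<otimes> r)) = \<one>" if s: "s \<in> carrier R" for s
  proof -
    obtain u where u: "u \<in> carrier R" "u \<otimes> (\<one> \<ominus> (r \<otimes> s) \<otimes> x) = \<one>" using inv[of "r \<otimes> s"] r s by auto
    let ?y = "s \<otimes> x"
    have y: "?y \<in> carrier R" using s xc by simp
    have "(\<one> \<oplus> ?y \<otimes> u \<otimes> r) \<otimes> (\<one> \<ominus> s \<otimes> (x \<otimes> r)) = \<one> \<ominus> ?y \<otimes> r \<oplus> ?y \<otimes> (u \<otimes> (\<one> \<ominus> (r \<otimes> s) \<otimes> x)) \<otimes> r"
      using y s r xc u(1) by (simp add: minus_eq l_distr r_distr m_assoc l_minus r_minus minus_add a_ac)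
    also have "\<dots> = \<one>" unfolding u(2) using y r by (simp add: minus_eq a_assoc l_neg)
    finally show ?thesis using y u(1) r by blast
  qed
  then show ?thesis using xc r by (simp add: jacobson_radical_iff)
qed

lemma jacobson_radical_ideal: "ideal (jacobson_radical R) R"
  using jacobson_radical_left_ideal jacobson_radical_right left_idealD(4)[OF jacobson_radical_left_ideal]
  by (intro idealI ring_axioms) (auto simp: left_ideal_def additive_subgroup_def)

text \<open>The left inverse v satisfies 1 - v = -(v j), so v is congruent to 1 as well and has
  itself a left inverse. Hence v is a two-sided inverse.\<close>

lemma one_minus_jacobson_unit:
  assumes j: "j \<in> jacobson_radical R"
  obtains v where "v \<in> carrier R" "v \<otimes> (\<one> \<ominus> j) = \<one>" "(\<one> \<ominus> j) \<otimes> v = \<one>" "\<one> \<ominus> v \<in> jacobson_radical R"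
proof -
  note li = left_idealD[OF jacobson_radical_left_ideal]
  have jc: "j \<in> carrier R" using li(1)[OF j] .
  have left: "\<exists>v\<in>carrier R. v \<otimes> (\<one> \<ominus> i) = \<one>" if "i \<in> jacobson_radical R" for i
    using that one_closed l_one unfolding jacobson_radical_iff by metis
  obtain v where v: "v \<in> carrier R" "v \<otimes> (\<one> \<ominus> j) = \<one>" using left[OF j] by blast
  have vj: "v \<ominus> v \<otimes> j = \<one>" using v jc by (simp add: minus_eq r_distr r_minus)
  then have "\<one> \<ominus> v = \<ominus> (v \<otimes> j)" using v(1) jc
    by (metis (no_types) a_minus_def add.inv_closed add.inv_solve_right' add.m_closed a_comm m_closed one_closed minus_eq)
  then have 1: "\<one> \<ominus> v \<in> jacobson_radical R" using li(4,5) v(1) j by simp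
  have "\<one> \<ominus> (\<one> \<ominus> v) = v" using v(1) by (simp add: minus_eq minus_add a_assoc[symmetric] r_neg)
  then obtain w where w: "w \<in> carrier R" "w \<otimes> v = \<one>" using left[OF 1] by auto
  have "w = w \<otimes> (v \<otimes> (\<one> \<ominus> j))" using w v by simp
  also have "\<dots> = (w \<otimes> v) \<otimes> (\<one> \<ominus> j)" using w(1) v(1) jc by (simp add: m_assoc)
  also have "\<dots> = \<one> \<ominus> j" using w(2) jc by simp
  finally have "(\<one> \<ominus> j) \<otimes> v = \<one>" using w(2) by metis
  then show thesis by (rule that[OF v _ 1])
qed

end

text \<open>Left ideals of Q correspond to left ideals of R that contain the kernel. This removes
  cosets from the semisimplicity of the quotient by the radical.\<close>

lemma semisimple_ring_iff_lifted:
  assumes R: "ring R" and Q: "ring Q" and h: "h \<in> ring_hom R Q" and surj: "h ` carrier R = carrier Q"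
  shows "semisimple_ring Q \<longleftrightarrow> (\<forall>I. left_ideal I R \<longrightarrow> a_kernel R Q h \<subseteq> I \<longrightarrow>
    (\<exists>K. left_ideal K R \<and> a_kernel R Q h \<subseteq> K \<and> I \<inter> K = a_kernel R Q h \<and> I <+>\<^bsub>R\<^esub> K = carrier R))"
proof -
  interpret R: ring R by (rule R)
  interpret Q: ring Q by (rule Q)
  note h_closed = ring_hom_closed[OF h] and h_add = ring_hom_add[OF h] and h_mult = ring_hom_mult[OF h]
  have h_zero: "h \<zero>\<^bsub>R\<^esub> = \<zero>\<^bsub>Q\<^esub>" using ring_hom_zero[OF h R Q] .
  let ?k = "a_kernel R Q h"
  have ker: "x \<in> ?k \<longleftrightarrow> x \<in> carrier R \<and> h x = \<zero>\<^bsub>Q\<^esub>" for x unfolding a_kernel_def' by blast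
  have img: "left_ideal (h ` I) Q" if I: "left_ideal I R" for I
    unfolding Q.left_ideal_iff
  proof (intro conjI ballI)
    show "h ` I \<subseteq> carrier Q" using R.left_idealD(1)[OF I] h_closed by blast
    show "\<zero>\<^bsub>Q\<^esub> \<in> h ` I" using R.left_idealD(2)[OF I] h_zero by (metis imageI)
    show "p \<oplus>\<^bsub>Q\<^esub> q \<in> h ` I" if "p \<in> h ` I" "q \<in> h ` I" for p q
    proof -
      from that obtain x y where "p = h x" "q = h y" "x \<in> I" "y \<in> I" by blast
      then show ?thesis using R.left_idealD(1,3)[OF I] h_add by (metis imageI)
    qed
    show "p \<otimes>\<^bsub>Q\<^esub> q \<in> h ` I" if "p \<in> carrier Q" "q \<in> h ` I" for p q
    proof -
      from that surj obtain x y where "p = h x" "q = h y" "x \<in> carrier R" "y \<in> I" by blast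
      then show ?thesis using R.left_idealD(1,4)[OF I] h_mult by (metis imageI)
    qed
  qed
  have pre: "left_ideal {x \<in> carrier R. h x \<in> I} R" "?k \<subseteq> {x \<in> carrier R. h x \<in> I}" if I: "left_ideal I Q" for I
    unfolding R.left_ideal_iff using Q.left_idealD[OF I] by (auto simp: ker h_zero h_add h_mult h_closed)
  show ?thesis
  proof (intro iffI allI impI)
    fix I assume ss: "semisimple_ring Q" and I: "left_ideal I R" "?k \<subseteq> I"
    obtain L where L: "left_ideal L Q" "h ` I \<inter> L = {\<zero>\<^bsub>Q\<^esub>}" "h ` I <+>\<^bsub>Q\<^esub> L = carrier Q"
      using ss img[OF I(1)] unfolding semisimple_ring_def by blast
    let ?K = "{x \<in> carrier R. h x \<in> L}"
    note ID = R.left_idealD[OF I(1)]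
    have "I \<inter> ?K = ?k" using L(2) I(2) pre(2)[OF L(1)] by (auto simp: ker)
    moreover have "r \<in> I <+>\<^bsub>R\<^esub> ?K" if r: "r \<in> carrier R" for r
    proof -
      have "h r \<in> h ` I <+>\<^bsub>Q\<^esub> L" using L(3) h_closed[OF r] by simp
      then obtain i l where il: "i \<in> I" "l \<in> L" "h r = h i \<oplus>\<^bsub>Q\<^esub> l" by (auto simp: set_add_def')
      have lc: "l \<in> carrier Q" using Q.left_idealD(1)[OF L(1)] il(2) by blast
      have ic: "i \<in> carrier R" using ID(1) il(1) by blast
      have "h (r \<ominus>\<^bsub>R\<^esub> i) = l"
      proof -
        have "h (r \<ominus>\<^bsub>R\<^esub> i) \<oplus>\<^bsub>Q\<^esub> h i = h r"
          using ic r h_add[of "r \<ominus>\<^bsub>R\<^esub> i" i] by (simp add: R.minus_eq R.a_assoc R.l_neg)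
        also have "\<dots> = l \<oplus>\<^bsub>Q\<^esub> h i" using il(3) lc h_closed[OF ic] by (simp add: Q.a_comm)
        finally show ?thesis using lc ic r h_closed by simp
      qed
      then have "r \<ominus>\<^bsub>R\<^esub> i \<in> ?K" using il(2) r ic by simp
      moreover have "r = i \<oplus>\<^bsub>R\<^esub> (r \<ominus>\<^bsub>R\<^esub> i)" using r ic R.a_comm[of i "r \<ominus>\<^bsub>R\<^esub> i"] by (simp add: R.minus_eq R.a_assoc R.l_neg)
      ultimately show ?thesis using il(1) by (auto simp: set_add_def')
    qed
    moreover have "I <+>\<^bsub>R\<^esub> ?K \<subseteq> carrier R" using ID(1) by (auto simp: set_add_def')
    ultimately show "\<exists>K. left_ideal K R \<and> ?k \<subseteq> K \<and> I \<inter> K = ?k \<and> I <+>\<^bsub>R\<^esub> K = carrier R"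
      using pre[OF L(1)] by blast
  next
    assume lift: "\<forall>I. left_ideal I R \<longrightarrow> ?k \<subseteq> I \<longrightarrow>
      (\<exists>K. left_ideal K R \<and> ?k \<subseteq> K \<and> I \<inter> K = ?k \<and> I <+>\<^bsub>R\<^esub> K = carrier R)"
    have "\<exists>J. left_ideal J Q \<and> I \<inter> J = {\<zero>\<^bsub>Q\<^esub>} \<and> I <+>\<^bsub>Q\<^esub> J = carrier Q" if I: "left_ideal I Q" for I
    proof -
      let ?I = "{x \<in> carrier R. h x \<in> I}"
      obtain K where K: "left_ideal K R" "?I \<inter> K = ?k" "?I <+>\<^bsub>R\<^esub> K = carrier R" using lift pre[OF I] by blast
      note KD = R.left_idealD[OF K(1)] and ID = Q.left_idealD[OF I]
      have "I \<inter> h ` K \<subseteq> {\<zero>\<^bsub>Q\<^esub>}"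
      proof
        fix y assume "y \<in> I \<inter> h ` K"
        then obtain k where k: "k \<in> K" "y = h k" "h k \<in> I" by blast
        then have "k \<in> ?I \<inter> K" using KD(1) by blast
        then show "y \<in> {\<zero>\<^bsub>Q\<^esub>}" using K(2) k(2) ker by blast
      qed
      then have "I \<inter> h ` K = {\<zero>\<^bsub>Q\<^esub>}" using ID(2) Q.left_idealD(2)[OF img[OF K(1)]] by blast
      moreover have "q \<in> I <+>\<^bsub>Q\<^esub> h ` K" if q: "q \<in> carrier Q" for q
      proof -
        obtain r where r: "r \<in> carrier R" "q = h r" using q surj by blast
        have "r \<in> ?I <+>\<^bsub>R\<^esub> K" using K(3) r(1) by simp
        then obtain i k where "i \<in> ?I" "k \<in> K" "r = i \<oplus>\<^bsub>R\<^esub> k" by (auto simp: set_add_def')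
        then have "q = h i \<oplus>\<^bsub>Q\<^esub> h k" "h i \<in> I" using r KD(1) h_add by simp_all
        then show ?thesis using \<open>k \<in> K\<close> by (auto simp: set_add_def')
      qed
      moreover have "I <+>\<^bsub>Q\<^esub> h ` K \<subseteq> carrier Q" using ID(1) KD(1) h_closed by (auto simp: set_add_def')
      ultimately show ?thesis using img[OF K(1)] by blast
    qed
    then show "semisimple_ring Q" by (simp add: semisimple_ring_def Q)
  qed
qed

context ring begin

lemma quotient_jacobson_hom:
  "ring (R Quot jacobson_radical R)" "(+>) (jacobson_radical R) \<in> ring_hom R (R Quot jacobson_radical R)"
  "(+>) (jacobson_radical R) ` carrier R = carrier (R Quot jacobson_radical R)"
  "a_kernel R (R Quot jacobson_radical R) ((+>) (jacobson_radical R)) = jacobson_radical R"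
proof -
  interpret J: ideal "jacobson_radical R" R by (rule jacobson_radical_ideal)
  show "ring (R Quot jacobson_radical R)" by (rule J.quotient_is_ring)
  show "(+>) (jacobson_radical R) \<in> ring_hom R (R Quot jacobson_radical R)" by (rule J.rcos_ring_hom)
  show "(+>) (jacobson_radical R) ` carrier R = carrier (R Quot jacobson_radical R)"
    by (auto simp: FactRing_def A_RCOSETS_def')
  show "a_kernel R (R Quot jacobson_radical R) ((+>) (jacobson_radical R)) = jacobson_radical R"
  proof -
    have "jacobson_radical R +> x = jacobson_radical R \<longleftrightarrow> x \<in> jacobson_radical R" if "x \<in> carrier R" for x
      using J.a_rcos_const[of x] J.a_rcos_self[OF that] by metis
    then show ?thesis using J.a_subset by (auto simp: a_kernel_def' FactRing_def)
  qed
qed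

lemma semisimple_quotient_jacobson_iff:
  "semisimple_ring (R Quot jacobson_radical R) \<longleftrightarrow> (\<forall>I. left_ideal I R \<longrightarrow> jacobson_radical R \<subseteq> I \<longrightarrow>
    (\<exists>K. left_ideal K R \<and> jacobson_radical R \<subseteq> K \<and> I \<inter> K = jacobson_radical R \<and> I <+> K = carrier R))"
  using semisimple_ring_iff_lifted[OF ring_axioms quotient_jacobson_hom(1-3)] unfolding quotient_jacobson_hom(4) .

end

text \<open>The corner e R e is described by an injection \<iota>, because its elements are of a
  different type: endomorphisms in the completion carry the idempotent with them.\<close>

locale corner_ring = R: ring R + S: ring S
  for R :: "('a, 'b) ring_scheme" (structure) and S :: "('c, 'd) ring_scheme" +
  fixes \<iota> :: "'c \<Rightarrow> 'a" and e :: 'a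
  assumes e: "e \<in> carrier R" "e \<otimes> e = e"
    and inj: "inj_on \<iota> (carrier S)"
    and image: "\<iota> ` carrier S = {x \<in> carrier R. e \<otimes> x = x \<and> x \<otimes> e = x}"
    and mult: "\<And>x y. x \<in> carrier S \<Longrightarrow> y \<in> carrier S \<Longrightarrow> \<iota> (x \<otimes>\<^bsub>S\<^esub> y) = \<iota> x \<otimes> \<iota> y"
    and add: "\<And>x y. x \<in> carrier S \<Longrightarrow> y \<in> carrier S \<Longrightarrow> \<iota> (x \<oplus>\<^bsub>S\<^esub> y) = \<iota> x \<oplus> \<iota> y"
    and one: "\<iota> \<one>\<^bsub>S\<^esub> = e"
begin

lemma \<iota>D: "x \<in> carrier S \<Longrightarrow> \<iota> x \<in> carrier R" "x \<in> carrier S \<Longrightarrow> e \<otimes> \<iota> x = \<iota> x" "x \<in> carrier S \<Longrightarrow> \<iota> x \<otimes> e = \<iota> x"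
  using image by blast+

lemma \<iota>E:
  assumes "x \<in> carrier R" "e \<otimes> x = x" "x \<otimes> e = x"
  obtains s where "s \<in> carrier S" "\<iota> s = x"
  using assms image by (metis (mono_tags, lifting) image_iff mem_Collect_eq)

lemma cut: "x \<in> carrier R \<Longrightarrow> e \<otimes> (e \<otimes> x) = e \<otimes> x" "x \<in> carrier R \<Longrightarrow> x \<otimes> e \<otimes> e = x \<otimes> e"
  using e R.m_assoc[of e e x] R.m_assoc[of x e e] by simp_all

lemma \<iota>E_cut:
  assumes "x \<in> carrier R"
  obtains s where "s \<in> carrier S" "\<iota> s = e \<otimes> x \<otimes> e"
proof -
  have "e \<otimes> x \<otimes> e \<in> carrier R" "e \<otimes> (e \<otimes> x \<otimes> e) = e \<otimes> x \<otimes> e" "e \<otimes> x \<otimes> e \<otimes> e = e \<otimes> x \<otimes> e"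
    using assms e by (simp_all add: R.m_assoc cut)
  then show thesis by (rule \<iota>E) (rule that)
qed

lemma \<iota>_eq: "x \<in> carrier S \<Longrightarrow> y \<in> carrier S \<Longrightarrow> \<iota> x = \<iota> y \<longleftrightarrow> x = y"
  using inj by (auto dest: inj_onD)

lemma \<iota>_zero: "\<iota> \<zero>\<^bsub>S\<^esub> = \<zero>"
  using add[of "\<zero>\<^bsub>S\<^esub>" "\<zero>\<^bsub>S\<^esub>"] \<iota>D(1)[OF S.zero_closed] by (simp add: R.add.l_cancel_one)

lemma \<iota>_minus:
  assumes "x \<in> carrier S" "y \<in> carrier S"
  shows "\<iota> (x \<ominus>\<^bsub>S\<^esub> y) = \<iota> x \<ominus> \<iota> y"
proof -
  have "\<iota> (x \<ominus>\<^bsub>S\<^esub> y) \<oplus> \<iota> y = \<iota> x"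
    using assms add[of "x \<ominus>\<^bsub>S\<^esub> y" y] by (simp add: S.minus_eq S.a_assoc S.l_neg)
  moreover have "\<iota> x \<ominus> \<iota> y \<oplus> \<iota> y = \<iota> x"
    using \<iota>D(1) assms by (simp add: R.minus_eq R.a_assoc R.l_neg)
  ultimately show ?thesis
    using \<iota>D(1) assms R.add.right_cancel[of "\<iota> y"] by (metis R.minus_closed S.minus_closed)
qed

text \<open>A left inverse in R is cut down to the corner by e on both sides. Conversely, a left
  inverse \<tau> from the corner satisfies only \<tau> (1 - y) = e; since y e = y, the element 1 + y
  \<tau> is then a left inverse of 1 - y in R.\<close>

lemma jacobson_radical_corner: "x \<in> jacobson_radical S \<longleftrightarrow> x \<in> carrier S \<and> \<iota> x \<in> jacobson_radical R"
proof
  assume x: "x \<in> jacobson_radical S"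
  then have xS: "x \<in> carrier S" and inv: "\<And>s. s \<in> carrier S \<Longrightarrow> \<exists>v\<in>carrier S. v \<otimes>\<^bsub>S\<^esub> (\<one>\<^bsub>S\<^esub> \<ominus>\<^bsub>S\<^esub> s \<otimes>\<^bsub>S\<^esub> x) = \<one>\<^bsub>S\<^esub>"
    by (simp_all add: S.jacobson_radical_iff)
  note xi = \<iota>D[OF xS]
  have "\<exists>v\<in>carrier R. v \<otimes> (\<one> \<ominus> r \<otimes> \<iota> x) = \<one>" if r: "r \<in> carrier R" for r
  proof -
    obtain s where s: "s \<in> carrier S" "\<iota> s = e \<otimes> r \<otimes> e" by (rule \<iota>E_cut[OF r])
    obtain v where v: "v \<in> carrier S" "v \<otimes>\<^bsub>S\<^esub> (\<one>\<^bsub>S\<^esub> \<ominus>\<^bsub>S\<^esub> s \<otimes>\<^bsub>S\<^esub> x) = \<one>\<^bsub>S\<^esub>" using inv[OF s(1)] by blast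
    define \<tau> where "\<tau> = \<iota> v"
    define y where "y = r \<otimes> \<iota> x"
    have t: "\<tau> \<in> carrier R" "\<tau> \<otimes> e = \<tau>" using \<iota>D[OF v(1)] by (simp_all add: \<tau>_def)
    have y: "y \<in> carrier R" "y \<otimes> e = y" using r xi e by (simp_all add: y_def R.m_assoc)
    have "\<iota> s \<otimes> \<iota> x = e \<otimes> y" using s(2) r e xi by (simp add: y_def R.m_assoc)
    then have "\<iota> (\<one>\<^bsub>S\<^esub> \<ominus>\<^bsub>S\<^esub> s \<otimes>\<^bsub>S\<^esub> x) = e \<ominus> e \<otimes> y"
      using s(1) xS by (simp add: \<iota>_minus mult one)
    then have "\<tau> \<otimes> (e \<ominus> e \<otimes> y) = e"
      using mult[OF v(1), of "\<one>\<^bsub>S\<^esub> \<ominus>\<^bsub>S\<^esub> s \<otimes>\<^bsub>S\<^esub> x"] v(2) s(1) xS by (simp add: one \<tau>_def)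
    moreover have "e \<ominus> e \<otimes> y = e \<otimes> (\<one> \<ominus> y)" using e y by (simp add: R.minus_eq R.r_distr R.r_minus)
    ultimately have ty: "\<tau> \<otimes> (\<one> \<ominus> y) = e" using t e y by (simp add: R.m_assoc[symmetric])
    have "(\<one> \<oplus> y \<otimes> \<tau>) \<otimes> (\<one> \<ominus> y) = (\<one> \<ominus> y) \<oplus> y \<otimes> (\<tau> \<otimes> (\<one> \<ominus> y))"
      using y(1) t(1) by (simp add: R.l_distr R.m_assoc)
    also have "\<dots> = \<one>" unfolding ty y(2) using y(1) by (simp add: R.minus_eq R.a_assoc R.l_neg)
    finally show ?thesis unfolding y_def[symmetric] using y(1) t(1) by blast
  qed
  then show "x \<in> carrier S \<and> \<iota> x \<in> jacobson_radical R" using xS xi by (simp add: R.jacobson_radical_iff)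
next
  assume "x \<in> carrier S \<and> \<iota> x \<in> jacobson_radical R"
  then have xS: "x \<in> carrier S" and inv: "\<And>r. r \<in> carrier R \<Longrightarrow> \<exists>v\<in>carrier R. v \<otimes> (\<one> \<ominus> r \<otimes> \<iota> x) = \<one>"
    by (simp_all add: R.jacobson_radical_iff)
  note xi = \<iota>D[OF xS]
  have "\<exists>t\<in>carrier S. t \<otimes>\<^bsub>S\<^esub> (\<one>\<^bsub>S\<^esub> \<ominus>\<^bsub>S\<^esub> s \<otimes>\<^bsub>S\<^esub> x) = \<one>\<^bsub>S\<^esub>" if s: "s \<in> carrier S" for s
  proof -
    define y where "y = \<iota> s \<otimes> \<iota> x"
    have y: "y \<in> carrier R" "y \<otimes> e = y" "e \<otimes> y = y"
      using \<iota>D[OF s] xi e by (simp_all add: y_def R.m_assoc) (simp add: R.m_assoc[symmetric])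
    obtain v where v: "v \<in> carrier R" "v \<otimes> (\<one> \<ominus> y) = \<one>" using inv[of "\<iota> s"] \<iota>D[OF s] by (auto simp: y_def)
    obtain t where t: "t \<in> carrier S" "\<iota> t = e \<otimes> v \<otimes> e" by (rule \<iota>E_cut[OF v(1)])
    have ey: "e \<otimes> (e \<ominus> y) = (\<one> \<ominus> y) \<otimes> e" using e y by (simp add: R.minus_eq R.r_distr R.l_distr R.r_minus R.l_minus)
    have "\<iota> (t \<otimes>\<^bsub>S\<^esub> (\<one>\<^bsub>S\<^esub> \<ominus>\<^bsub>S\<^esub> s \<otimes>\<^bsub>S\<^esub> x)) = (e \<otimes> v \<otimes> e) \<otimes> (e \<ominus> y)"
      using t s xS by (simp add: mult \<iota>_minus one y_def)
    also have "\<dots> = e \<otimes> (v \<otimes> (e \<otimes> (e \<ominus> y)))" using e v(1) y(1) by (simp add: R.m_assoc)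
    also have "\<dots> = e \<otimes> ((v \<otimes> (\<one> \<ominus> y)) \<otimes> e)" unfolding ey using e v(1) y(1) by (simp add: R.m_assoc)
    also have "\<dots> = e" unfolding v(2) using e by simp
    finally have "\<iota> (t \<otimes>\<^bsub>S\<^esub> (\<one>\<^bsub>S\<^esub> \<ominus>\<^bsub>S\<^esub> s \<otimes>\<^bsub>S\<^esub> x)) = \<iota> \<one>\<^bsub>S\<^esub>" by (simp add: one)
    then have "t \<otimes>\<^bsub>S\<^esub> (\<one>\<^bsub>S\<^esub> \<ominus>\<^bsub>S\<^esub> s \<otimes>\<^bsub>S\<^esub> x) = \<one>\<^bsub>S\<^esub>" using t(1) s xS by (simp add: \<iota>_eq)
    then show ?thesis using t(1) by blast
  qed
  then show "x \<in> jacobson_radical S" using xS by (simp add: S.jacobson_radical_iff)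
qed

lemma corner_semisimple_quotient:
  assumes ss: "semisimple_ring (R Quot jacobson_radical R)"
  shows "semisimple_ring (S Quot jacobson_radical S)"
  unfolding S.semisimple_quotient_jacobson_iff
proof (intro allI impI)
  let ?J = "jacobson_radical R"
  note JD = R.left_idealD[OF R.jacobson_radical_left_ideal] and Jr = R.jacobson_radical_right
  fix I assume I: "left_ideal I S" "jacobson_radical S \<subseteq> I"
  note ID = S.left_idealD[OF I(1)]
  \<comment> \<open>\<open>L\<close> contains \<open>R (1 - e)\<close>; this is why \<open>e K e\<close> complements \<open>I\<close> when \<open>K\<close> complements \<open>L\<close>.\<close>
  define L where "L = {y \<in> carrier R. \<forall>r\<in>carrier R. e \<otimes> (r \<otimes> y) \<otimes> e \<in> \<iota> ` I}"
  have L: "left_ideal L R"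
    unfolding R.left_ideal_iff
  proof (intro conjI ballI)
    have "\<zero> \<in> \<iota> ` I" using ID(2) \<iota>_zero by (metis imageI)
    then show "\<zero> \<in> L" using e by (simp add: L_def)
    fix x y assume y: "y \<in> L"
    show "x \<oplus> y \<in> L" if x: "x \<in> L"
    proof -
      have "e \<otimes> (r \<otimes> (x \<oplus> y)) \<otimes> e \<in> \<iota> ` I" if r: "r \<in> carrier R" for r
      proof -
        obtain i j where ij: "i \<in> I" "j \<in> I" "e \<otimes> (r \<otimes> x) \<otimes> e = \<iota> i" "e \<otimes> (r \<otimes> y) \<otimes> e = \<iota> j"
          using x y r unfolding L_def by blast
        have "e \<otimes> (r \<otimes> (x \<oplus> y)) \<otimes> e = e \<otimes> (r \<otimes> x) \<otimes> e \<oplus> e \<otimes> (r \<otimes> y) \<otimes> e"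
          using x y r e by (simp add: L_def R.r_distr R.l_distr)
        also have "\<dots> = \<iota> (i \<oplus>\<^bsub>S\<^esub> j)" using ij ID(1) by (simp add: add)
        finally show ?thesis using ID(3) ij(1,2) by blast
      qed
      then show ?thesis using x y by (simp add: L_def)
    qed
    show "x \<otimes> y \<in> L" if x: "x \<in> carrier R"
      using x y by (simp add: L_def R.m_assoc[symmetric])
  qed (auto simp: L_def)
  have JL: "?J \<subseteq> L"
  proof
    fix y assume y: "y \<in> ?J"
    have yc: "y \<in> carrier R" using JD(1)[OF y] .
    have "e \<otimes> (r \<otimes> y) \<otimes> e \<in> \<iota> ` I" if r: "r \<in> carrier R" for r
    proof -
      obtain s where s: "s \<in> carrier S" "\<iota> s = e \<otimes> (r \<otimes> y) \<otimes> e" using \<iota>E_cut[of "r \<otimes> y"] r yc by auto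
      have "e \<otimes> (r \<otimes> y) \<otimes> e \<in> ?J" using JD(4) Jr e r y by simp
      then have "s \<in> I" using I(2) s jacobson_radical_corner by auto
      then show ?thesis unfolding s(2)[symmetric] by blast
    qed
    then show "y \<in> L" using yc by (simp add: L_def)
  qed
  have IL: "\<iota> i \<in> L" if i: "i \<in> I" for i
  proof -
    note ii = \<iota>D[OF ID(1)[OF i]]
    have "e \<otimes> (r \<otimes> \<iota> i) \<otimes> e \<in> \<iota> ` I" if r: "r \<in> carrier R" for r
    proof -
      obtain s where s: "s \<in> carrier S" "\<iota> s = e \<otimes> r \<otimes> e" by (rule \<iota>E_cut[OF r])
      have "\<iota> (s \<otimes>\<^bsub>S\<^esub> i) = e \<otimes> r \<otimes> e \<otimes> \<iota> i" using mult[OF s(1) ID(1)[OF i]] s(2) by simp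
      also have "\<dots> = e \<otimes> (r \<otimes> \<iota> i) \<otimes> e" using ii e r by (simp add: R.m_assoc)
      finally show ?thesis using ID(4)[OF s(1) i] by (metis imageI)
    qed
    then show ?thesis using ii by (simp add: L_def)
  qed
  obtain K where K: "left_ideal K R" "?J \<subseteq> K" "L \<inter> K = ?J" "L <+> K = carrier R"
    using ss L JL unfolding R.semisimple_quotient_jacobson_iff by blast
  note KD = R.left_idealD[OF K(1)]
  define M where "M = {x \<in> carrier S. \<exists>k\<in>K. \<iota> x = e \<otimes> k \<otimes> e}"
  have M: "left_ideal M S"
    unfolding S.left_ideal_iff
  proof (intro conjI ballI)
    have "\<iota> \<zero>\<^bsub>S\<^esub> = e \<otimes> \<zero> \<otimes> e" using e by (simp add: \<iota>_zero)
    then show "\<zero>\<^bsub>S\<^esub> \<in> M" using KD(2) by (auto simp: M_def)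
    fix x y assume "y \<in> M"
    then obtain k where y: "y \<in> carrier S" "k \<in> K" "\<iota> y = e \<otimes> k \<otimes> e" by (auto simp: M_def)
    note kc = KD(1)[OF y(2)]
    show "x \<oplus>\<^bsub>S\<^esub> y \<in> M" if xM: "x \<in> M"
    proof -
      from xM obtain k' where x: "x \<in> carrier S" "k' \<in> K" "\<iota> x = e \<otimes> k' \<otimes> e" by (auto simp: M_def)
      have "\<iota> (x \<oplus>\<^bsub>S\<^esub> y) = e \<otimes> (k' \<oplus> k) \<otimes> e"
        using x y e kc KD(1)[OF x(2)] by (simp add: add R.r_distr R.l_distr)
      then show ?thesis using x(1) y(1) KD(3)[OF x(2) y(2)] by (auto simp: M_def)
    qed
    show "x \<otimes>\<^bsub>S\<^esub> y \<in> M" if x: "x \<in> carrier S"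
    proof -
      have "\<iota> (x \<otimes>\<^bsub>S\<^esub> y) = e \<otimes> (\<iota> x \<otimes> e \<otimes> k) \<otimes> e"
        using x y e kc \<iota>D[OF x] by (simp add: mult R.m_assoc[symmetric])
      moreover have "\<iota> x \<otimes> e \<otimes> k \<in> K" using KD(4)[OF _ y(2)] \<iota>D(1)[OF x] e(1) by simp
      ultimately show ?thesis using x y(1) by (auto simp: M_def)
    qed
  qed (auto simp: M_def)
  have JM: "jacobson_radical S \<subseteq> M"
  proof
    fix x assume "x \<in> jacobson_radical S"
    then have x: "x \<in> carrier S" "\<iota> x \<in> K" using jacobson_radical_corner K(2) by auto
    then have "\<iota> x = e \<otimes> \<iota> x \<otimes> e" using \<iota>D by simp
    then show "x \<in> M" using x by (auto simp: M_def)
  qed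
  moreover have "I \<inter> M \<subseteq> jacobson_radical S"
  proof
    fix x assume x: "x \<in> I \<inter> M"
    then obtain k where k: "k \<in> K" "\<iota> x = e \<otimes> k \<otimes> e" by (auto simp: M_def)
    have kc: "k \<in> carrier R" and xS: "x \<in> carrier S" using KD(1) k(1) ID(1) x by auto
    \<comment> \<open>Since d e = 0, d lies in L. Adding it to \<iota> x shows that e k, which is in
      K, is in L too.\<close>
    define d where "d = e \<otimes> k \<ominus> e \<otimes> k \<otimes> e"
    have d: "d \<in> carrier R" "d \<otimes> e = \<zero>"
      using e kc by (simp_all add: d_def R.minus_eq R.l_distr R.l_minus R.m_assoc R.r_neg)
    have "\<zero> \<in> \<iota> ` I" using ID(2) \<iota>_zero by (metis imageI)
    then have "d \<in> L" using d e by (simp add: L_def R.m_assoc)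
    then have "d \<oplus> \<iota> x \<in> L" using R.left_idealD(3)[OF L] IL x by blast
    moreover have "d \<oplus> \<iota> x = e \<otimes> k" unfolding d_def k(2) using e kc by (simp add: R.minus_eq R.a_assoc R.l_neg)
    ultimately have "e \<otimes> k \<in> ?J" using KD(4)[OF e(1) k(1)] K(3) by auto
    then have "\<iota> x \<in> ?J" unfolding k(2) by (rule Jr[OF _ e(1)])
    then show "x \<in> jacobson_radical S" using xS jacobson_radical_corner by blast
  qed
  moreover have "x \<in> I <+>\<^bsub>S\<^esub> M" if x: "x \<in> carrier S" for x
  proof -
    note xi = \<iota>D[OF x]
    have "\<iota> x \<in> L <+> K" using xi(1) K(4) by simp
    then obtain l k where lk: "l \<in> L" "k \<in> K" "\<iota> x = l \<oplus> k" by (auto simp: set_add_def')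
    have lc: "l \<in> carrier R" and kc: "k \<in> carrier R" using lk KD(1) by (simp_all add: L_def)
    have "e \<otimes> (\<one> \<otimes> l) \<otimes> e \<in> \<iota> ` I" using lk(1) R.one_closed unfolding L_def by blast
    then obtain i where i: "i \<in> I" "\<iota> i = e \<otimes> l \<otimes> e" using lc by auto
    obtain m where m: "m \<in> carrier S" "\<iota> m = e \<otimes> k \<otimes> e" by (rule \<iota>E_cut[OF kc])
    have "\<iota> x = e \<otimes> (l \<oplus> k) \<otimes> e" using xi lk(3) by simp
    also have "\<dots> = \<iota> (i \<oplus>\<^bsub>S\<^esub> m)"
      using add[OF ID(1)[OF i(1)] m(1)] i(2) m(2) e lc kc by (simp add: R.r_distr R.l_distr)
    finally have "x = i \<oplus>\<^bsub>S\<^esub> m" using x m(1) ID(1)[OF i(1)] by (simp add: \<iota>_eq)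
    moreover have "m \<in> M" using m lk(2) by (auto simp: M_def)
    ultimately show ?thesis using i(1) by (auto simp: set_add_def')
  qed
  moreover have "I <+>\<^bsub>S\<^esub> M \<subseteq> carrier S" using ID(1) by (auto simp: set_add_def' M_def)
  ultimately show "\<exists>K. left_ideal K S \<and> jacobson_radical S \<subseteq> K \<and> I \<inter> K = jacobson_radical S \<and> I <+>\<^bsub>S\<^esub> K = carrier S"
    using M I(2) by blast
qed

lemma corner_idempotents_lift:
  assumes lift: "idempotents_lift_modulo R (jacobson_radical R)"
  shows "idempotents_lift_modulo S (jacobson_radical S)"
  unfolding idempotents_lift_modulo_def
proof (intro ballI impI)
  let ?J = "jacobson_radical R"
  note JD = R.left_idealD[OF R.jacobson_radical_left_ideal] and Jr = R.jacobson_radical_right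
  fix x assume x: "x \<in> carrier S" and xJ: "(x \<otimes>\<^bsub>S\<^esub> x) \<ominus>\<^bsub>S\<^esub> x \<in> jacobson_radical S"
  define a where "a = \<iota> x"
  have a: "a \<in> carrier R" "e \<otimes> a = a" "a \<otimes> e = a" using \<iota>D[OF x] by (simp_all add: a_def)
  have "a \<otimes> a \<ominus> a \<in> ?J" using xJ x unfolding jacobson_radical_corner by (simp add: \<iota>_minus mult a_def)
  then obtain g where g: "g \<in> carrier R" "g \<otimes> g = g" "g \<ominus> a \<in> ?J"
    using lift a(1) unfolding idempotents_lift_modulo_def by blast
  have ga: "(g \<ominus> a) \<otimes> e = g \<otimes> e \<ominus> a" using g(1) a e by (simp add: R.minus_eq R.l_distr R.l_minus)
  have geJ: "g \<otimes> e \<ominus> a \<in> ?J" using Jr[OF g(3) e(1)] ga by simp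
  \<comment> \<open>Conjugating \<open>g\<close> by the unit \<open>1 - j\<close>, which is \<open>1\<close> modulo the radical, gives an idempotent \<open>h\<close> with \<open>h e = h\<close>;
    then \<open>e h\<close> is an idempotent of the corner.\<close>
  define j where "j = g \<ominus> g \<otimes> e"
  have jc: "j \<in> carrier R" using g e by (simp add: j_def)
  have "(g \<ominus> a) \<ominus> (g \<otimes> e \<ominus> a) = j"
    using g(1) a(1) e(1) R.a_comm[of "\<ominus> (g \<otimes> e)" a] R.add.m_assoc[of "\<ominus> a" a "\<ominus> (g \<otimes> e)"]
    by (simp add: j_def R.minus_eq R.minus_add R.a_assoc R.l_neg)
  then have jJ: "j \<in> ?J" using JD(6)[OF g(3) geJ] by simp
  obtain v where v: "v \<in> carrier R" "v \<otimes> (\<one> \<ominus> j) = \<one>" "(\<one> \<ominus> j) \<otimes> v = \<one>" "\<one> \<ominus> v \<in> ?J"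
    by (rule R.one_minus_jacobson_unit[OF jJ])
  define u where "u = \<one> \<ominus> j"
  have u: "u \<in> carrier R" using jc by (simp add: u_def)
  have vu: "u \<otimes> v = \<one>" using v by (simp add: u_def)
  have "g \<otimes> j = g \<ominus> g \<otimes> e" using g e R.m_assoc[of g g e] by (simp add: j_def R.minus_eq R.r_distr R.r_minus)
  then have gu: "g \<otimes> u = g \<otimes> e"
    using g(1) e(1) jc by (simp add: u_def R.minus_eq R.r_distr R.r_minus R.minus_add R.a_assoc[symmetric] R.r_neg)
  \<comment> \<open>Since g u = g e, this is v g u, the conjugate of g by u.\<close>
  define h where "h = v \<otimes> (g \<otimes> e)"
  have h: "h \<in> carrier R" "h \<otimes> e = h" using v g e by (simp_all add: h_def R.m_assoc)
  have "h \<otimes> h = v \<otimes> (g \<otimes> ((u \<otimes> v) \<otimes> (g \<otimes> u)))"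
    unfolding h_def gu[symmetric] using v(1) g(1) u by (simp add: R.m_assoc)
  also have "\<dots> = v \<otimes> ((g \<otimes> g) \<otimes> u)" unfolding vu using g(1) u by (simp add: R.m_assoc)
  also have "\<dots> = h" by (simp add: g(2) gu h_def)
  finally have hh: "h \<otimes> h = h" .
  obtain s where s: "s \<in> carrier S" "\<iota> s = e \<otimes> h"
    by (rule \<iota>E[of "e \<otimes> h"]) (use e h cut in \<open>simp_all add: R.m_assoc\<close>)
  have "(e \<otimes> h) \<otimes> (e \<otimes> h) = e \<otimes> ((h \<otimes> e) \<otimes> h)" using e h(1) by (simp add: R.m_assoc)
  then have "\<iota> (s \<otimes>\<^bsub>S\<^esub> s) = \<iota> s" using s by (simp add: mult h(2) hh)
  then have ss: "s \<otimes>\<^bsub>S\<^esub> s = s" using s(1) by (simp add: \<iota>_eq)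
  have ge: "g \<otimes> e \<in> carrier R" using g(1) e(1) by simp
  \<comment> \<open>h differs from g e by w, which lies in the radical because 1 - v does.\<close>
  define w where "w = (\<one> \<ominus> v) \<otimes> (g \<otimes> e)"
  have w: "w \<in> carrier R" using v(1) ge by (simp add: w_def)
  have "v \<oplus> (\<one> \<ominus> v) = \<one>" using v(1) R.a_comm[of v "\<one> \<ominus> v"] by (simp add: R.minus_eq R.a_assoc R.l_neg)
  then have "h \<oplus> w = g \<otimes> e"
    using v(1) ge R.l_distr[of v "\<one> \<ominus> v" "g \<otimes> e"] by (simp add: h_def w_def)
  then have "h \<ominus> a = (g \<otimes> e \<ominus> a) \<ominus> w"
    using h(1) w a(1) R.a_comm[of "\<ominus> a" "\<ominus> w"] R.r_neg2[of w "\<ominus> a"] by (simp add: R.minus_eq R.a_assoc flip: \<open>h \<oplus> w = g \<otimes> e\<close>)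
  then have "h \<ominus> a \<in> ?J" using JD(6)[OF geJ Jr[OF v(4) ge, folded w_def]] by simp
  then have "e \<otimes> (h \<ominus> a) \<in> ?J" using JD(4)[OF e(1)] by blast
  moreover have "\<iota> (s \<ominus>\<^bsub>S\<^esub> x) = e \<otimes> (h \<ominus> a)"
    using s x h(1) a e by (simp add: \<iota>_minus a_def[symmetric] R.minus_eq R.r_distr R.r_minus)
  ultimately have "s \<ominus>\<^bsub>S\<^esub> x \<in> jacobson_radical S" using s(1) x by (simp add: jacobson_radical_corner)
  then show "\<exists>e\<in>carrier S. e \<otimes>\<^bsub>S\<^esub> e = e \<and> e \<ominus>\<^bsub>S\<^esub> x \<in> jacobson_radical S" using s(1) ss by blast
qed

lemma corner_semiperfect: "semiperfect_ring R \<Longrightarrow> semiperfect_ring S"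
  using corner_semisimple_quotient corner_idempotents_lift S.ring_axioms by (simp add: semiperfect_ring_def)

end

section \<open>Endomorphism rings and split idempotents in the completion\<close>

context additive_category begin

lemma End_ring_ring:
  assumes X: "X \<in> Ob C"
  shows "ring (End_ring C X)"
proof -
  have c: "f \<in> carrier (H X X) \<longleftrightarrow> f \<in> arr X X" for f using X by (simp add: arr_def)
  show ?thesis
  proof (rule ringI)
    show "abelian_group (End_ring C X)"
    proof (rule abelian_groupI)
      fix f assume "f \<in> carrier (End_ring C X)"
      then have f: "f \<in> arr X X" by (simp add: End_ring_def c)
      show "\<exists>g\<in>carrier (End_ring C X). g \<oplus>\<^bsub>End_ring C X\<^esub> f = \<zero>\<^bsub>End_ring C X\<^esub>"
        using f neg_arr[OF f] add_neg(2)[OF f] by (intro bexI[of _ "-[X,X] f"]) (simp_all add: End_ring_def c)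
    qed (use X in \<open>simp_all add: End_ring_def c add_assoc add_comm add_lcomm add_zero add_arr zero_arr\<close>)
    show "monoid (End_ring C X)"
      by (rule monoidI) (use X in \<open>simp_all add: End_ring_def c comp_arr Idn_arr comp_assoc_arr id_left[OF intoI] id_right\<close>)
  qed (use X in \<open>simp_all add: End_ring_def c distrib_left distrib_right\<close>)
qed

text \<open>The middle entries of the packed endomorphisms of (X, e) range over e R e, where R is
  the endomorphism ring of X.\<close>

lemma End_ring_icompl_corner:
  assumes P: "(X, e) \<in> Ob (icompl C)"
  shows "corner_ring (End_ring C X) (End_ring (icompl C) (X, e)) (\<lambda>f. fst (snd f)) e"
proof -
  have e: "e \<in> arr X X" "e ** e = e" "X \<in> Ob C" using P by (simp_all add: icompl_Ob arr_def)
  have c: "carrier (H X X) = arr X X" using e(3) by (auto simp: arr_def)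
  have S: "carrier (End_ring (icompl C) (X, e)) = {(e, r, e) |r. r \<in> arr X X \<and> r ** e = r \<and> e ** r = r}"
    by (simp add: End_ring_def icompl_Hom[OF P P])
  have R: "ring (End_ring C X)" by (rule End_ring_ring[OF e(3)])
  have S': "ring (End_ring (icompl C) (X, e))" by (rule additive_category.End_ring_ring[OF icompl_additive P])
  have "inj_on (\<lambda>f. fst (snd f)) (carrier (End_ring (icompl C) (X, e)))"
    unfolding S by (auto simp: inj_on_def)
  moreover have "(\<lambda>f. fst (snd f)) ` carrier (End_ring (icompl C) (X, e)) =
      {x \<in> carrier (End_ring C X). e \<otimes>\<^bsub>End_ring C X\<^esub> x = x \<and> x \<otimes>\<^bsub>End_ring C X\<^esub> e = x}"
    unfolding S by (force simp: End_ring_def c)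
  ultimately show ?thesis
    using R S' e by (intro corner_ring.intro corner_ring_axioms.intro) (auto simp: S, auto simp: End_ring_def c)
qed

text \<open>An idempotent r on (X, e) splits through the object (X, r).\<close>

lemma icompl_idempotent_complete: "idempotent_complete (icompl C)"
  unfolding idempotent_complete_def
proof (intro ballI impI)
  fix P f assume P: "P \<in> Ob (icompl C)" and f: "f \<in> carrier (Hom (icompl C) P P)" "f \<cdot>\<^bsub>icompl C\<^esub> f = f"
  obtain X e where Xe: "P = (X, e)" by (cases P)
  note P = P[unfolded Xe]
  obtain r where r: "f = (e, r, e)" "r \<in> arr X X" "r ** e = r" "e ** r = r"
    using f(1) unfolding Xe icompl_Hom[OF P P] by blast
  have rr: "r ** r = r" using f(2) by (simp add: r(1))
  have Q: "(X, r) \<in> Ob (icompl C)" using r(2) rr by (simp add: icompl_Ob)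
  have "(e, r, r) \<in> carrier (Hom (icompl C) (X, r) P)" "(r, r, e) \<in> carrier (Hom (icompl C) P (X, r))"
    unfolding Xe icompl_Hom[OF P Q] icompl_Hom[OF Q P] using r rr by simp_all
  moreover have "(e, r, r) \<cdot>\<^bsub>icompl C\<^esub> (r, r, e) = f \<and> (r, r, e) \<cdot>\<^bsub>icompl C\<^esub> (e, r, r) = Idn (icompl C) (X, r)"
    by (simp add: r(1) rr)
  ultimately show "\<exists>Y\<in>Ob (icompl C). \<exists>p\<in>carrier (Hom (icompl C) P Y). \<exists>i\<in>carrier (Hom (icompl C) Y P).
      i \<cdot>\<^bsub>icompl C\<^esub> p = f \<and> p \<cdot>\<^bsub>icompl C\<^esub> i = Idn (icompl C) Y"
    using Q by blast
qed

lemma krull_schmidt_icompl: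
  assumes "\<forall>X\<in>Ob C. semiperfect_ring (End_ring C X)"
  shows "krull_schmidt (icompl C)"
proof -
  have "semiperfect_ring (End_ring (icompl C) (X, e))" if P: "(X, e) \<in> Ob (icompl C)" for X e
  proof -
    have "X \<in> Ob C" using P by (simp add: icompl_Ob arr_def)
    then show ?thesis
      using corner_ring.corner_semiperfect[OF End_ring_icompl_corner[OF P]] assms by blast
  qed
  then show ?thesis
    unfolding krull_schmidt_def using icompl_additive icompl_idempotent_complete by auto
qed

end

theorem corollaryC:
  fixes n :: nat
    and C :: "('o, 'm) addcat"
    and E :: "('o, 'm, 'x) bifunctor"
    and s :: "('o, 'm, 'x) realisation"
  assumes "n \<ge> 1"
    and "n_exangulated_category n C E s"
    and "\<forall>X\<in>Ob C. semiperfect_ring (End_ring C X)"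
  shows "n_exangulated_category n (icompl C) (icompl_ext C E) (icompl_real n C s) \<and>
         krull_schmidt (icompl C)"
proof -
  interpret n_exangulated_category n C E s by (rule assms(2))
  show ?thesis using icompl_n_exangulated[OF assms(1)] krull_schmidt_icompl[OF assms(3)] by blast
qed

end
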